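(* Consider equations $f(x)u_t=(A(u)u_x)_x+h(x)B(u)u_x$ with $f\neq0$, $A\neq0$. A complete list of $\hat G^{\sim}_1$-inequivalent equations of this form having nontrivial conservation laws is exhausted by the following ones. (Each item gives the constraints on the parameter-functions $A,B,f,h$, together with conserved vectors $(F,G)$ of the basis elements of the corresponding space of conservation laws, each followed by its characteristic.) 1. $h=1$: $(fu,\,-Au_x-\int B)$, $\ 1$. 2. $A=1$, $B_u\neq0$, $f=-h(h^{-1})_{xx}$: $(e^t(h^{-1})_{xx}u,\ e^t(h^{-1}u_x-(h^{-1})_xu+\int B))$, $\ -e^th^{-1}$. 3. $B=1$, $f=h_x$: $(e^tfu,\ -e^t(Au_x+hu))$, $\ e^t$. 4. $B=1$, $f=h_x+hx^{-1}$: $(e^txfu,\ -e^t(xAu_x+xhu-\int A))$, $\ e^tx$. 5a. $B=0$: $(fu,\,-Au_x)$, $\ 1$; and $(xfu,\,-xAu_x+\int A)$, $\ x$. 5b. $B=1$, $f=1$, $h=1$: $(u,\,-Au_x-u)$, $\ 1$; and $((x+t)u,\ -(x+t)(Au_x+u)+\int A)$, $\ x+t$. 5c. $B=1$, $f=e^x$, $h=e^x$: $(e^{x+t}u,\ -e^t(Au_x+e^xu))$, $\ e^t$; and $(e^{x+t}(x+t)u,\ -e^t(x+t)(Au_x+e^xu)+e^t\int A)$, $\ e^t(x+t)$. 5d. $B=1$, $f=x^{\mu-1}$, $h=x^\mu$: $(e^{\mu t}x^{\mu-1}u,\ -e^{\mu t}(Au_x+x^\mu u))$, $\ e^{\mu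 t}$; and $(e^{(\mu+1)t}x^\mu u,\ e^{(\mu+1)t}(-xAu_x-x^{\mu+1}u+\int A))$, $\ e^{(\mu+1)t}x$. 6. $B=1$, $f=e^{-\mu/x}x^{-3}$, $h=e^{-\mu/x}x^{-1}$, $\mu\in\{0,1\}$: $(e^{\mu t}xfu,\ -e^{\mu t}x(Au_x+hu)+e^{\mu t}\int A)$, $\ e^{\mu t}x$; and $(e^{\mu t}(tx-1)fu,\ -e^{\mu t}(tx-1)(Au_x+hu)+te^{\mu t}\int A)$, $\ e^{\mu t}(tx-1)$. 7. $B=1$, $f=|x-1|^{\mu-3/2}|x+1|^{-\mu-3/2}$, $h=|x-1|^{\mu-1/2}|x+1|^{-\mu-1/2}$: $(e^{(2\mu+1)t}(x-1)fu,\ -e^{(2\mu+1)t}(x-1)(Au_x+hu)+e^{(2\mu+1)t}\int A)$, $\ e^{(2\mu+1)t}(x-1)$; and $(e^{(2\mu-1)t}(x+1)fu,\ -e^{(2\mu-1)t}(x+1)(Au_x+hu)+e^{(2\mu-1)t}\int A)$, $\ e^{(2\mu-1)t}(x+1)$. 8. $B=1$, $f=e^{\mu\arctan x}(x^2+1)^{-3/2}$, $h=e^{\mu\arctan x}(x^2+1)^{-1/2}$: $(e^{\mu t}(x\cos t+\sin t)fu,\ -e^{\mu t}(x\cos t+\sin t)(Au_x+hu)+e^{\mu t}\cos t\int A)$, $\ e^{\mu t}(x\cos t+\sin t)$; and $(e^{\mu t}(x\sin t-\cos t)fu,\ -e^{\mu t}(x\sin t-\cos t)(Au_x+hu)+e^{\mu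 t}\sin t\int A)$, $\ e^{\mu t}(x\sin t-\cos t)$. 9. $A=1$, $B=0$: $(\alpha fu,\ -\alpha u_x+\alpha_xu)$, $\ \alpha$. Here $\mu=\mathrm{const}$, and $\alpha=\alpha(t,x)$ is an arbitrary solution of the linear equation $f\alpha_t+\alpha_{xx}=0$.
   Context: The functions $f=f(x)$, $h=h(x)$, $A=A(u)$, $B=B(u)$ are smooth; those not mentioned in an item are arbitrary. $\int A=\int A(u)\,du$, $\int B=\int B(u)\,du$, $\int h=\int h(x)\,dx$. Conservation laws. For an equation with independent variables $t,x$ and unknown $u$, a conserved vector is a pair $(F,G)$ of smooth functions of $t,x,u$ and finitely many derivatives of $u$ such that $D_tF+D_xG=0$ on all solutions ($D_t,D_x$ are total derivatives). It is trivial if $F=\hat F+D_xH$, $G=\hat G-D_tH$ with $\hat F,\hat G$ vanishing on solutions and $H$ a function of $t,x$ and derivatives of $u$. The space of (local) conservation laws is the quotient of the linear space of conserved vectors by the subspace of trivial ones; a conservation law is nontrivial if it is a nonzero element of this space. A characteristic of a conservation law is a function $\lambda$ of $t,x$ and derivatives of $u$ such that, for some conserved vector $(F,G)$ of it, $D_tF+D_xG=\lambda\,\bigl(fu_t-(Au_x)_x-hBu_x\bigr)$ identically. The group $\hat G^{\sim}_1$ (extended equivalence group of the class). It consists of the transformations $$\tilde t=\delta_1t+\delta_2,\quad \tilde x=\delta_5\int e^{\delta_8\int h}dx+\delta_6,\quad \tilde u=\delta_3u+\delta_4,$$ $$\tilde f=\delta_1\delta_5^{-1}\delta_9fe^{-2\delta_8\int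 h},\quad \tilde h=\delta_9\delta_7^{-1}he^{-\delta_8\int h},\quad \tilde A=\delta_5\delta_9A,\quad \tilde B=\delta_7(B+\delta_8A),$$ where $\delta_1,\dots,\delta_9$ are arbitrary constants with $\delta_1\delta_3\delta_5\delta_7\delta_9\neq0$. Such a transformation maps the equation with $(f,h,A,B)$ to the equation of the same form with $(\tilde f,\tilde h,\tilde A,\tilde B)$; two equations are $\hat G^{\sim}_1$-equivalent if one is mapped to the other in this way.
   Formalization: In item 7, h gets the factor sgn(x^2-1): for |x|<1 the printed vectors are not conserved; μ and -μ in items 7, 8 are one entry; bases and inequivalence are claimed for equations not equivalent to one in an item with more conservation laws; equations with equal hB are identified. *)

theory Defs
  imports "HOL-Analysis.Analysis"
begin

section \<open>Jet space and differential functions\<close>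

text \<open>\<open>U i j\<close> is the jet coordinate of the derivative of \<open>u\<close> taken \<open>i\<close> times with respect
  to \<open>t\<close> and \<open>j\<close> times with respect to \<open>x\<close>; in particular \<open>U 0 0\<close> is \<open>u\<close> itself.\<close>

datatype coord = Time | Space | U nat nat

type_synonym jet = "coord \<Rightarrow> real"

definition partial :: "coord \<Rightarrow> (jet \<Rightarrow> real) \<Rightarrow> jet \<Rightarrow> real" where
  "partial c F p = deriv (\<lambda>s. F (p(c := s))) (p c)"

primrec partials :: "coord list \<Rightarrow> (jet \<Rightarrow> real) \<Rightarrow> jet \<Rightarrow> real" where
  "partials [] F = F"
| "partials (c # cs) F = partial c (partials cs F)"

text \<open>Smoothness: all iterated partial derivatives exist and are continuous. Continuity refers to
  the product topology on \<open>jet\<close>, which for functions of finitely many coordinates is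
  ordinary joint continuity in these coordinates. The set \<open>D\<close> is meant to be open.\<close>

definition smooth_on_jets :: "jet set \<Rightarrow> (jet \<Rightarrow> real) \<Rightarrow> bool" where
  "smooth_on_jets D F \<longleftrightarrow>
     (\<forall>cs. continuous_on D (partials cs F) \<and>
        (\<forall>c. \<forall>p\<in>D. (\<lambda>s. partials cs F (p(c := s))) differentiable at (p c)))"

definition differential_function :: "jet set \<Rightarrow> (jet \<Rightarrow> real) \<Rightarrow> bool" where
  "differential_function D F \<longleftrightarrow>
     smooth_on_jets D F \<and>
     (\<exists>S. finite S \<and> (\<forall>p\<in>D. \<forall>q\<in>D. (\<forall>c\<in>S. p c = q c) \<longrightarrow> F p = F q))"

text \<open>The sums are finite because a differential function depends on finitely many coordinates.\<close>

definition total_t :: "(jet \<Rightarrow> real) \<Rightarrow> jet \<Rightarrow> real" where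
  "total_t F p = partial Time F p +
     (\<Sum>(i, j) | partial (U i j) F p \<noteq> 0. p (U (Suc i) j) * partial (U i j) F p)"

definition total_x :: "(jet \<Rightarrow> real) \<Rightarrow> jet \<Rightarrow> real" where
  "total_x F p = partial Space F p +
     (\<Sum>(i, j) | partial (U i j) F p \<noteq> 0. p (U i (Suc j)) * partial (U i j) F p)"

definition on_jet :: "(real \<Rightarrow> real \<Rightarrow> real \<Rightarrow> real \<Rightarrow> real) \<Rightarrow> jet \<Rightarrow> real" where
  "on_jet g p = g (p Time) (p Space) (p (U 0 0)) (p (U 0 1))"


section \<open>The class of equations\<close>

text \<open>The parameter-functions are total functions of which only the values on the respective domain
  matter: \<open>cf\<close> and \<open>ch\<close> on \<open>xdom\<close>, \<open>cA\<close> and \<open>cB\<close> on \<open>udom\<close>.\<close>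

record equation =
  tdom :: "real set"
  xdom :: "real set"
  udom :: "real set"
  cf :: "real \<Rightarrow> real"
  ch :: "real \<Rightarrow> real"
  cA :: "real \<Rightarrow> real"
  cB :: "real \<Rightarrow> real"

definition open_interval :: "real set \<Rightarrow> bool" where
  "open_interval S \<longleftrightarrow> open S \<and> is_interval S \<and> S \<noteq> {}"

definition smooth_on_line :: "real set \<Rightarrow> (real \<Rightarrow> real) \<Rightarrow> bool" where
  "smooth_on_line S g \<longleftrightarrow> (\<forall>n. \<forall>x\<in>S. (deriv ^^ n) g differentiable at x)"

definition is_equation :: "equation \<Rightarrow> bool" where
  "is_equation E \<longleftrightarrow>
     open_interval (tdom E) \<and> open_interval (xdom E) \<and> open_interval (udom E) \<and>
     smooth_on_line (xdom E) (cf E) \<and> smooth_on_line (xdom E) (ch E) \<and>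
     smooth_on_line (udom E) (cA E) \<and> smooth_on_line (udom E) (cB E) \<and>
     (\<forall>x\<in>xdom E. cf E x \<noteq> 0) \<and> (\<forall>u\<in>udom E. cA E u \<noteq> 0)"

definition antiderivative :: "real set \<Rightarrow> (real \<Rightarrow> real) \<Rightarrow> (real \<Rightarrow> real) \<Rightarrow> bool" where
  "antiderivative S g I \<longleftrightarrow> (\<forall>y\<in>S. (I has_real_derivative g y) (at y))"

definition jet_domain :: "equation \<Rightarrow> jet set" where
  "jet_domain E = {p. p Time \<in> tdom E \<and> p Space \<in> xdom E \<and> p (U 0 0) \<in> udom E}"

definition pde :: "equation \<Rightarrow> jet \<Rightarrow> real" where
  "pde E p = cf E (p Space) * p (U 1 0)
     - total_x (\<lambda>q. cA E (q (U 0 0)) * q (U 0 1)) p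
     - ch E (p Space) * cB E (p (U 0 0)) * p (U 0 1)"

text \<open>\<open>On solutions\<close> is understood as usual in jet space: on the set defined by the equation
  together with all its differential consequences.\<close>

definition solution_jets :: "equation \<Rightarrow> jet set" where
  "solution_jets E =
     {p \<in> jet_domain E. \<forall>i j. (total_t ^^ i) ((total_x ^^ j) (pde E)) p = 0}"


section \<open>Conservation laws\<close>

type_synonym vec = "(jet \<Rightarrow> real) \<times> (jet \<Rightarrow> real)"

abbreviation differential_function_of :: "equation \<Rightarrow> (jet \<Rightarrow> real) \<Rightarrow> bool" where
  "differential_function_of E \<equiv> differential_function (jet_domain E)"

definition conserved_vector :: "equation \<Rightarrow> vec \<Rightarrow> bool" where
  "conserved_vector E V \<longleftrightarrow>
     differential_function_of E (fst V) \<and> differential_function_of E (snd V) \<and>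
     (\<forall>p\<in>solution_jets E. total_t (fst V) p + total_x (snd V) p = 0)"

definition trivial_vector :: "equation \<Rightarrow> vec \<Rightarrow> bool" where
  "trivial_vector E V \<longleftrightarrow>
     (\<exists>F' G' H.
        differential_function_of E F' \<and> differential_function_of E G' \<and>
        differential_function_of E H \<and>
        (\<forall>p\<in>solution_jets E. F' p = 0 \<and> G' p = 0) \<and>
        (\<forall>p\<in>jet_domain E. fst V p = F' p + total_x H p \<and> snd V p = G' p - total_t H p))"

definition vec_diff :: "vec \<Rightarrow> vec \<Rightarrow> vec" where
  "vec_diff V W = ((\<lambda>p. fst V p - fst W p), (\<lambda>p. snd V p - snd W p))"

definition lin_comb :: "(nat \<Rightarrow> real) \<Rightarrow> vec list \<Rightarrow> vec" where
  "lin_comb c Vs = ((\<lambda>p. \<Sum>k<length Vs. c k * fst (Vs ! k) p),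
                    (\<lambda>p. \<Sum>k<length Vs. c k * snd (Vs ! k) p))"

definition has_nontrivial_cl :: "equation \<Rightarrow> bool" where
  "has_nontrivial_cl E \<longleftrightarrow> (\<exists>V. conserved_vector E V \<and> \<not> trivial_vector E V)"

text \<open>Linear independence and spanning of the classes in the quotient of the space of conserved
  vectors by the subspace of trivial ones.\<close>

definition cl_independent :: "equation \<Rightarrow> vec list \<Rightarrow> bool" where
  "cl_independent E Vs \<longleftrightarrow>
     (\<forall>V\<in>set Vs. conserved_vector E V) \<and>
     (\<forall>c. trivial_vector E (lin_comb c Vs) \<longrightarrow> (\<forall>k<length Vs. c k = 0))"

definition cl_basis :: "equation \<Rightarrow> vec list \<Rightarrow> bool" where
  "cl_basis E Vs \<longleftrightarrow>
     cl_independent E Vs \<and>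
     (\<forall>V. conserved_vector E V \<longrightarrow> (\<exists>c. trivial_vector E (vec_diff V (lin_comb c Vs))))"

definition characteristic :: "equation \<Rightarrow> vec \<Rightarrow> (jet \<Rightarrow> real) \<Rightarrow> bool" where
  "characteristic E V l \<longleftrightarrow>
     conserved_vector E V \<and> differential_function_of E l \<and>
     (\<exists>W. conserved_vector E W \<and> trivial_vector E (vec_diff V W) \<and>
        (\<forall>p\<in>jet_domain E. total_t (fst W) p + total_x (snd W) p = l p * pde E p))"


section \<open>The extended equivalence group\<close>

text \<open>\<open>H\<close> is an antiderivative of \<open>h\<close> and \<open>K\<close> one of \<open>exp (d8 * H)\<close>; other choices
  of the integration constants only change the constants \<open>d1, \<dots>, d9\<close>.\<close>

definition maps_to :: "equation \<Rightarrow> equation \<Rightarrow> bool" where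
  "maps_to E E' \<longleftrightarrow>
     (\<exists>d1 d2 d3 d4 d5 d6 d7 d8 d9 :: real. \<exists>H K.
        d1 * d3 * d5 * d7 * d9 \<noteq> 0 \<and>
        antiderivative (xdom E) (ch E) H \<and>
        antiderivative (xdom E) (\<lambda>x. exp (d8 * H x)) K \<and>
        tdom E' = (\<lambda>t. d1 * t + d2) ` tdom E \<and>
        xdom E' = (\<lambda>x. d5 * K x + d6) ` xdom E \<and>
        udom E' = (\<lambda>u. d3 * u + d4) ` udom E \<and>
        (\<forall>x\<in>xdom E.
           cf E' (d5 * K x + d6) = d1 / d5 * d9 * cf E x * exp (- 2 * d8 * H x) \<and>
           ch E' (d5 * K x + d6) = d9 / d7 * ch E x * exp (- d8 * H x)) \<and>
        (\<forall>u\<in>udom E.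
           cA E' (d3 * u + d4) = d5 * d9 * cA E u \<and>
           cB E' (d3 * u + d4) = d7 * (cB E u + d8 * cA E u)))"

text \<open>The functions \<open>h\<close> and \<open>B\<close> enter the equation only through their product, so distinct
  parameter tuples may represent one equation (for example, if \<open>h\<close> vanishes identically, \<open>B\<close> is
  irrelevant). Equivalence is a relation between equations, not between parameter tuples.\<close>

definition same_equation :: "equation \<Rightarrow> equation \<Rightarrow> bool" where
  "same_equation E E' \<longleftrightarrow>
     tdom E' = tdom E \<and> xdom E' = xdom E \<and> udom E' = udom E \<and>
     (\<forall>x\<in>xdom E. cf E' x = cf E x) \<and> (\<forall>u\<in>udom E. cA E' u = cA E u) \<and>
     (\<forall>x\<in>xdom E. \<forall>u\<in>udom E. ch E' x * cB E' u = ch E x * cB E u)"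

definition equivalent :: "equation \<Rightarrow> equation \<Rightarrow> bool" where
  "equivalent E E' \<longleftrightarrow>
     (\<exists>E1 E2. is_equation E1 \<and> is_equation E2 \<and>
        same_equation E E1 \<and> maps_to E1 E2 \<and> same_equation E2 E')"


section \<open>The list\<close>

text \<open>Real power that agrees with the integer power for integer exponents; thus \<open>rpow x 0 = 1\<close> and
  \<open>rpow x 1 = x\<close> for all \<open>x\<close>, including \<open>x \<le> 0\<close>.\<close>

definition rpow :: "real \<Rightarrow> real \<Rightarrow> real" where
  "rpow x a = (if a \<in> \<int> then x powi \<lfloor>a\<rfloor> else x powr a)"

datatype item =
    Item1 | Item2 | Item3 | Item4
  | Item5a | Item5b | Item5c | Item5d real
  | Item6 real | Item7 real | Item8 real
  | Item9

text \<open>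
  \<^item> \<open>Item4\<close>: \<open>f = h_x + h/x\<close> is required where its right-hand side is defined; if
    \<open>0\<close> is in the domain, then \<open>f 0\<close> is determined by continuity.
  \<^item> \<open>Item5d\<close>: negative \<open>x\<close> are admitted for integer \<open>m\<close> only. The point \<open>0\<close> is excluded, unless
    \<open>m = 1\<close>, by \<open>f \<noteq> 0\<close> and \<open>h\<close> being smooth.
  \<^item> \<open>Item7\<close>: the factor \<open>sgn (x\<^sup>2 - 1)\<close> is \<open>1\<close> for \<open>\<bar>x\<bar> > 1\<close>. Without it the vectors given in
    \<open>listed_cls\<close> would not be conserved for \<open>\<bar>x\<bar> < 1\<close>. There, the equations with and without the
    factor are equivalent: take \<open>d1 = d9 = -1\<close>, \<open>d3 = d5 = d7 = 1\<close> and \<open>d2 = d4 = d6 = d8 = 0\<close>.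
    With the factor, \<open>h = (x\<^sup>2 - 1) f\<close>, and
    \<open>m = 3/2\<close> (\<open>m = -3/2\<close>) admits domains containing \<open>1\<close> (\<open>-1\<close>).\<close>

fun in_item :: "item \<Rightarrow> equation \<Rightarrow> bool" where
  "in_item Item1 E \<longleftrightarrow> (\<forall>x\<in>xdom E. ch E x = 1)"
| "in_item Item2 E \<longleftrightarrow>
     (\<forall>u\<in>udom E. cA E u = 1) \<and> (\<exists>u\<in>udom E. deriv (cB E) u \<noteq> 0) \<and>
     (\<forall>x\<in>xdom E. ch E x \<noteq> 0 \<and>
        cf E x = - ch E x * deriv (deriv (\<lambda>y. inverse (ch E y))) x)"
| "in_item Item3 E \<longleftrightarrow>
     (\<forall>u\<in>udom E. cB E u = 1) \<and> (\<forall>x\<in>xdom E. cf E x = deriv (ch E) x)"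
| "in_item Item4 E \<longleftrightarrow>
     (\<forall>u\<in>udom E. cB E u = 1) \<and>
     (\<forall>x\<in>xdom E. x \<noteq> 0 \<longrightarrow> cf E x = deriv (ch E) x + ch E x / x)"
| "in_item Item5a E \<longleftrightarrow> (\<forall>u\<in>udom E. cB E u = 0)"
| "in_item Item5b E \<longleftrightarrow>
     (\<forall>u\<in>udom E. cB E u = 1) \<and> (\<forall>x\<in>xdom E. cf E x = 1 \<and> ch E x = 1)"
| "in_item Item5c E \<longleftrightarrow>
     (\<forall>u\<in>udom E. cB E u = 1) \<and> (\<forall>x\<in>xdom E. cf E x = exp x \<and> ch E x = exp x)"
| "in_item (Item5d m) E \<longleftrightarrow>
     (\<forall>u\<in>udom E. cB E u = 1) \<and>
     (xdom E \<subseteq> {0<..} \<or> m \<in> \<int>) \<and>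
     (\<forall>x\<in>xdom E. cf E x = rpow x (m - 1) \<and> ch E x = rpow x m)"
| "in_item (Item6 m) E \<longleftrightarrow>
     (\<forall>u\<in>udom E. cB E u = 1) \<and> m \<in> {0, 1} \<and> 0 \<notin> xdom E \<and>
     (\<forall>x\<in>xdom E. cf E x = exp (- m / x) * x powi (- 3) \<and>
        ch E x = exp (- m / x) * x powi (- 1))"
| "in_item (Item7 m) E \<longleftrightarrow>
     (\<forall>u\<in>udom E. cB E u = 1) \<and>
     (\<forall>x\<in>xdom E.
        cf E x = rpow \<bar>x - 1\<bar> (m - 3/2) * rpow \<bar>x + 1\<bar> (- m - 3/2) \<and>
        ch E x = sgn (x\<^sup>2 - 1) * rpow \<bar>x - 1\<bar> (m - 1/2) * rpow \<bar>x + 1\<bar> (- m - 1/2))"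
| "in_item (Item8 m) E \<longleftrightarrow>
     (\<forall>u\<in>udom E. cB E u = 1) \<and>
     (\<forall>x\<in>xdom E.
        cf E x = exp (m * arctan x) * (x\<^sup>2 + 1) powr (- 3/2) \<and>
        ch E x = exp (m * arctan x) * (x\<^sup>2 + 1) powr (- 1/2))"
| "in_item Item9 E \<longleftrightarrow> (\<forall>u\<in>udom E. cA E u = 1 \<and> cB E u = 0)"

definition cl ::
  "(real \<Rightarrow> real \<Rightarrow> real \<Rightarrow> real \<Rightarrow> real) \<Rightarrow> (real \<Rightarrow> real \<Rightarrow> real \<Rightarrow> real \<Rightarrow> real) \<Rightarrow>
   (real \<Rightarrow> real \<Rightarrow> real) \<Rightarrow> vec \<times> (jet \<Rightarrow> real)" where
  "cl F G l = ((on_jet F, on_jet G), on_jet (\<lambda>t x u v. l t x))"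

text \<open>Conserved vectors paired with their characteristics; \<open>v\<close> stands for \<open>u_x\<close>, and \<open>IA\<close>, \<open>IB\<close>
  for antiderivatives of \<open>A\<close>, \<open>B\<close>. \<open>Item9\<close> has infinitely many conservation
  laws and is treated separately by \<open>linear_cl\<close>.\<close>

fun listed_cls ::
  "item \<Rightarrow> equation \<Rightarrow> (real \<Rightarrow> real) \<Rightarrow> (real \<Rightarrow> real) \<Rightarrow> (vec \<times> (jet \<Rightarrow> real)) list" where
  "listed_cls Item1 E IA IB =
     [cl (\<lambda>t x u v. cf E x * u)
         (\<lambda>t x u v. - cA E u * v - IB u)
         (\<lambda>t x. 1)]"
| "listed_cls Item2 E IA IB =
     (let k = (\<lambda>x. inverse (ch E x)) in
     [cl (\<lambda>t x u v. exp t * deriv (deriv k) x * u)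
         (\<lambda>t x u v. exp t * (k x * v - deriv k x * u + IB u))
         (\<lambda>t x. - exp t * k x)])"
| "listed_cls Item3 E IA IB =
     [cl (\<lambda>t x u v. exp t * cf E x * u)
         (\<lambda>t x u v. - exp t * (cA E u * v + ch E x * u))
         (\<lambda>t x. exp t)]"
| "listed_cls Item4 E IA IB =
     [cl (\<lambda>t x u v. exp t * x * cf E x * u)
         (\<lambda>t x u v. - exp t * (x * cA E u * v + x * ch E x * u - IA u))
         (\<lambda>t x. exp t * x)]"
| "listed_cls Item5a E IA IB =
     [cl (\<lambda>t x u v. cf E x * u)
         (\<lambda>t x u v. - cA E u * v)
         (\<lambda>t x. 1),
      cl (\<lambda>t x u v. x * cf E x * u)
         (\<lambda>t x u v. - x * cA E u * v + IA u)
         (\<lambda>t x. x)]"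
| "listed_cls Item5b E IA IB =
     [cl (\<lambda>t x u v. u)
         (\<lambda>t x u v. - cA E u * v - u)
         (\<lambda>t x. 1),
      cl (\<lambda>t x u v. (x + t) * u)
         (\<lambda>t x u v. - (x + t) * (cA E u * v + u) + IA u)
         (\<lambda>t x. x + t)]"
| "listed_cls Item5c E IA IB =
     [cl (\<lambda>t x u v. exp (x + t) * u)
         (\<lambda>t x u v. - exp t * (cA E u * v + exp x * u))
         (\<lambda>t x. exp t),
      cl (\<lambda>t x u v. exp (x + t) * (x + t) * u)
         (\<lambda>t x u v. - exp t * (x + t) * (cA E u * v + exp x * u) + exp t * IA u)
         (\<lambda>t x. exp t * (x + t))]"
| "listed_cls (Item5d m) E IA IB =
     [cl (\<lambda>t x u v. exp (m * t) * rpow x (m - 1) * u)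
         (\<lambda>t x u v. - exp (m * t) * (cA E u * v + rpow x m * u))
         (\<lambda>t x. exp (m * t)),
      cl (\<lambda>t x u v. exp ((m + 1) * t) * rpow x m * u)
         (\<lambda>t x u v. exp ((m + 1) * t) * (- x * cA E u * v - rpow x (m + 1) * u + IA u))
         (\<lambda>t x. exp ((m + 1) * t) * x)]"
| "listed_cls (Item6 m) E IA IB =
     [cl (\<lambda>t x u v. exp (m * t) * x * cf E x * u)
         (\<lambda>t x u v. - exp (m * t) * x * (cA E u * v + ch E x * u) + exp (m * t) * IA u)
         (\<lambda>t x. exp (m * t) * x),
      cl (\<lambda>t x u v. exp (m * t) * (t * x - 1) * cf E x * u)
         (\<lambda>t x u v. - exp (m * t) * (t * x - 1) * (cA E u * v + ch E x * u)
                    + t * exp (m * t) * IA u)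
         (\<lambda>t x. exp (m * t) * (t * x - 1))]"
| "listed_cls (Item7 m) E IA IB =
     [cl (\<lambda>t x u v. exp ((2 * m + 1) * t) * (x - 1) * cf E x * u)
         (\<lambda>t x u v. - exp ((2 * m + 1) * t) * (x - 1) * (cA E u * v + ch E x * u)
                    + exp ((2 * m + 1) * t) * IA u)
         (\<lambda>t x. exp ((2 * m + 1) * t) * (x - 1)),
      cl (\<lambda>t x u v. exp ((2 * m - 1) * t) * (x + 1) * cf E x * u)
         (\<lambda>t x u v. - exp ((2 * m - 1) * t) * (x + 1) * (cA E u * v + ch E x * u)
                    + exp ((2 * m - 1) * t) * IA u)
         (\<lambda>t x. exp ((2 * m - 1) * t) * (x + 1))]"
| "listed_cls (Item8 m) E IA IB =
     [cl (\<lambda>t x u v. exp (m * t) * (x * cos t + sin t) * cf E x * u)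
         (\<lambda>t x u v. - exp (m * t) * (x * cos t + sin t) * (cA E u * v + ch E x * u)
                    + exp (m * t) * cos t * IA u)
         (\<lambda>t x. exp (m * t) * (x * cos t + sin t)),
      cl (\<lambda>t x u v. exp (m * t) * (x * sin t - cos t) * cf E x * u)
         (\<lambda>t x u v. - exp (m * t) * (x * sin t - cos t) * (cA E u * v + ch E x * u)
                    + exp (m * t) * sin t * IA u)
         (\<lambda>t x. exp (m * t) * (x * sin t - cos t))]"
| "listed_cls Item9 E IA IB = []"

text \<open>The solutions \<open>a\<close> of \<open>f a_t + a_xx = 0\<close> and the corresponding conservation laws.\<close>

definition adjoint_solution :: "equation \<Rightarrow> (real \<Rightarrow> real \<Rightarrow> real) \<Rightarrow> bool" where
  "adjoint_solution E a \<longleftrightarrow>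
     differential_function_of E (on_jet (\<lambda>t x u v. a t x)) \<and>
     (\<forall>t\<in>tdom E. \<forall>x\<in>xdom E.
        cf E x * deriv (\<lambda>s. a s x) t + deriv (deriv (\<lambda>y. a t y)) x = 0)"

definition linear_cl :: "equation \<Rightarrow> (real \<Rightarrow> real \<Rightarrow> real) \<Rightarrow> vec \<times> (jet \<Rightarrow> real)" where
  "linear_cl E a =
     cl (\<lambda>t x u v. a t x * cf E x * u)
        (\<lambda>t x u v. - a t x * v + deriv (\<lambda>y. a t y) x * u)
        a"

definition listed_equation :: "item \<Rightarrow> equation \<Rightarrow> bool" where
  "listed_equation i E \<longleftrightarrow> is_equation E \<and> in_item i E"

text \<open>The items overlap literally: for instance, \<open>h = 1\<close>, \<open>B = 0\<close> satisfies the constraints of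
  \<open>Item1\<close> and of \<open>Item5a\<close>. As usual in such classifications, an item with arbitrary
  parameter-functions stands for the equations that are not equivalent to one of
  the items with a larger space of conservation laws; the items are graded by the dimension
  of that space (one, two, infinite).\<close>

fun grade :: "item \<Rightarrow> nat" where
  "grade Item1 = 1" | "grade Item2 = 1" | "grade Item3 = 1" | "grade Item4 = 1"
| "grade Item5a = 2" | "grade Item5b = 2" | "grade Item5c = 2" | "grade (Item5d m) = 2"
| "grade (Item6 m) = 2" | "grade (Item7 m) = 2" | "grade (Item8 m) = 2"
| "grade Item9 = 3"

definition properly_listed :: "item \<Rightarrow> equation \<Rightarrow> bool" where
  "properly_listed i E \<longleftrightarrow>
     listed_equation i E \<and>
     \<not> (\<exists>j E'. grade j > grade i \<and> listed_equation j E' \<and> equivalent E E')"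

text \<open>The entries for \<open>m\<close> and \<open>- m\<close> of \<open>Item7\<close>, and likewise of \<open>Item8\<close>, are interchanged by
  \<open>x \<mapsto> - x\<close>, \<open>t \<mapsto> - t\<close>.\<close>

definition same_entry :: "item \<Rightarrow> item \<Rightarrow> bool" where
  "same_entry i j \<longleftrightarrow>
     i = j \<or> (\<exists>m. i = Item7 m \<and> j = Item7 (- m)) \<or> (\<exists>m. i = Item8 m \<and> j = Item8 (- m))"

end

(* On solutions, the order of a conserved vector can be reduced until it is equivalent to one whose
   density is l f u, where l(t,x) solves f l_t + A l_xx - B (h l)_x = 0 for all values of u; the vector
   is trivial iff l = 0. So conservation laws correspond to such l. If A is constant and h B does not
   depend on u up to equivalence, the equation is linear. Otherwise the equation for l splits:
   if 1 is not a combination of A and B, or if A is constant, h l depends on t only (the case h l = 0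
   is excluded by unique continuation), and there is one l at most up to factors. If 1 is a combination
   of A and B, a transformation makes B = 0 (l = 1, x) or B = 1; in the latter case l = p(t) x + q(t)
   with (p,q) solving a linear system with constant coefficients. Two independent l exist iff h and h_x
   are f times a quadratic and a linear polynomial in x, and the normal forms of the quadratic under
   affine changes of x are the items 5b-8. *)
theory Submission
  imports Defs
begin

section \<open>Differential functions on a box\<close>

text \<open>The coefficients are merely smooth and \<open>h\<close> may vanish on parts of its
  domain, so \<open>h l = 0\<close> does not by itself give \<open>l = 0\<close>. This is the main
  obstacle: the parabolic equation \<open>f l_t + a l_xx = 0\<close> has to be followed sideways, in
  \<open>x\<close>, from Cauchy data on a line \<open>x = x0\<close>. As \<open>f\<close> does not
  depend on \<open>t\<close>, pairing with functions of \<open>t\<close> turns it into ordinary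
  differential equations in \<open>x\<close>, and polynomial test functions have derivatives small
  enough to close the estimate. Jets of solutions are parametrised by
  \<open>t, x, u, u_x, ...\<close>, all \<open>t\<close>-derivatives being expressed by the
  equation. There \<open>D_t\<close> becomes a field \<open>\<tau>\<close> that commutes with
  \<open>D_x\<close>, so conserved vectors containing arbitrary \<open>t\<close>-derivatives reduce
  to identities in \<open>x\<close>-derivatives alone. Inequivalence rests on what every ingredient
  of an equivalence preserves: the existence of two independent characteristics, constancy of
  \<open>A\<close>, \<open>h B\<close> being a multiple of \<open>A\<close>, and for
  \<open>B = 1\<close> the quadratic up to affine changes.\<close>

lemma differentiable_imp_DERIV_deriv:
  fixes f :: "real => real"
  assumes "f differentiable at x"
  shows "(f has_real_derivative deriv f x) (at x)"
  using assms by (simp add: DERIV_deriv_iff_real_differentiable)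

text \<open>Mixing the coordinates of two points of a product stays inside it, so the coordinate
  sets on which a function depends can be intersected; intervals as factors make a vanishing partial
  derivative remove a coordinate. The jet domain of an equation is an instance.\<close>

locale box =
  fixes sec :: "coord => real set"
  assumes sec: "open_interval (sec c)"
begin

definition D :: "jet set" where "D = {p. \<forall>c. p c \<in> sec c}"

lemma open_sec: "open (sec c)" and convex_sec: "convex (sec c)" and sec_nonempty: "sec c \<noteq> {}"
  using sec[of c] by (auto simp: open_interval_def is_interval_convex)

lemma D_sec: "p \<in> D ==> p c \<in> sec c"
  by (simp add: D_def)

lemma upd_D: "p \<in> D ==> s \<in> sec c ==> p(c := s) \<in> D"
  by (simp add: D_def)

lemma mix_D: "p \<in> D ==> q \<in> D ==> (\<lambda>c. if c \<in> A then p c else q c) \<in> D"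
  by (simp add: D_def)

text \<open>A relation instead of a value of \<open>partial\<close>: it asserts existence and value
  at once, since \<open>deriv\<close> says nothing about differentiability, and it sees the
  functions on \<open>D\<close> only.\<close>

definition has_partial :: "coord => (jet => real) => (jet => real) => bool" where
  "has_partial c F G \<longleftrightarrow> (\<forall>p\<in>D. ((\<lambda>s. F (p(c := s))) has_real_derivative G p) (at (p c)))"

lemma eventually_sec:
  assumes "p \<in> D" shows "\<forall>\<^sub>F s in nhds (p c). s \<in> sec c"
  using assms by (intro eventually_nhds_in_open open_sec D_sec)

lemma has_partial_imp_partial: "has_partial c F G ==> p \<in> D ==> partial c F p = G p"
  unfolding has_partial_def partial_def by (blast intro: DERIV_imp_deriv)

lemma has_partial_cong:
  assumes "\<And>p. p \<in> D ==> F p = F' p" "\<And>p. p \<in> D ==> G p = G' p" "has_partial c F G"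
  shows "has_partial c F' G'"
  unfolding has_partial_def
proof
  fix p assume p: "p \<in> D"
  have "\<forall>\<^sub>F s in nhds (p c). F (p(c := s)) = F' (p(c := s))"
    using eventually_sec[OF p] by eventually_elim (simp add: assms(1) p upd_D)
  moreover have "((\<lambda>s. F (p(c := s))) has_real_derivative G p) (at (p c))"
    using assms(3) p by (simp add: has_partial_def)
  ultimately show "((\<lambda>s. F' (p(c := s))) has_real_derivative G' p) (at (p c))"
    by (rule DERIV_cong_ev[THEN iffD1, OF refl _ assms(2)[OF p]])
qed

lemma partial_cong:
  assumes "\<And>p. p \<in> D ==> F p = G p" "p \<in> D"
  shows "partial c F p = partial c G p"
  unfolding partial_def
proof (rule deriv_cong_ev)
  show "\<forall>\<^sub>F s in nhds (p c). F (p(c := s)) = G (p(c := s))"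
    using eventually_sec[OF assms(2)] by eventually_elim (simp add: assms upd_D)
qed simp

abbreviation smooth :: "(jet => real) => bool" where "smooth \<equiv> smooth_on_jets D"

text \<open>By induction on the list, each iterated partial derivative agrees on \<open>D\<close>
  with some member of \<open>C\<close>. Smoothness thus follows from one derivative at a time,
  without formulas for iterated ones.\<close>

lemma smooth_coinduct:
  assumes "F \<in> C" and cont: "\<And>G. G \<in> C ==> continuous_on D G"
    and step: "\<And>G c. G \<in> C ==> \<exists>G'\<in>C. has_partial c G G'"
  shows "smooth F"
proof -
  have *: "\<exists>G\<in>C. \<forall>p\<in>D. partials cs F p = G p" for cs
  proof (induction cs)
    case Nil then show ?case using assms(1) by auto
  next
    case (Cons c cs)
    then obtain G where G: "G \<in> C" "\<forall>p\<in>D. partials cs F p = G p" by blast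
    obtain G' where G': "G' \<in> C" "has_partial c G G'" using step G(1) by blast
    then have "\<forall>p\<in>D. partials (c # cs) F p = G' p"
      using partial_cong[of "partials cs F" G] G(2) has_partial_imp_partial by simp
    then show ?case using G' by blast
  qed
  show ?thesis
    unfolding smooth_on_jets_def
  proof (intro allI conjI ballI)
    fix cs
    obtain G where G: "G \<in> C" "\<forall>p\<in>D. partials cs F p = G p" using * by blast
    show "continuous_on D (partials cs F)"
      using cont[OF G(1)] G(2) by (simp cong: continuous_on_cong)
    fix c p assume p: "p \<in> D"
    obtain G' where G': "G' \<in> C" "has_partial c G G'" using step G(1) by blast
    then have "has_partial c (partials cs F) G'"
      using has_partial_cong[of G "partials cs F" G' G'] G(2) by auto
    then show "(\<lambda>s. partials cs F (p(c := s))) differentiable at (p c)"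
      using p unfolding has_partial_def by (auto intro: differentiableI simp: has_field_derivative_def)
  qed
qed

lemma smooth_continuous: "smooth F ==> continuous_on D F"
  unfolding smooth_on_jets_def by (metis partials.simps(1))

lemma smooth_has_partial: "smooth F ==> has_partial c F (partial c F)"
  unfolding has_partial_def partial_def
proof
  fix p assume F: "smooth F" and p: "p \<in> D"
  have "(\<lambda>s. partials [] F (p(c := s))) differentiable at (p c)"
    using F p unfolding smooth_on_jets_def by blast
  then show "((\<lambda>s. F (p(c := s))) has_real_derivative deriv (\<lambda>s. F (p(c := s))) (p c)) (at (p c))"
    by (simp add: differentiable_imp_DERIV_deriv)
qed

lemma smooth_DERIV:
  assumes "smooth F" "p \<in> D"
  shows "((\<lambda>s. F (p(c := s))) has_real_derivative partial c F p) (at (p c))"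
  using smooth_has_partial[OF assms(1)] assms(2) unfolding has_partial_def by blast

lemma smooth_DERIV_upd:
  assumes "smooth F" "p \<in> D" "s \<in> sec c"
  shows "((\<lambda>r. F (p(c := r))) has_real_derivative partial c F (p(c := s))) (at s)"
  using smooth_DERIV[OF assms(1) upd_D[OF assms(2,3)], of c] by simp

lemma partials_append: "partials (cs @ ds) F = partials cs (partials ds F)"
  by (induction cs) auto

lemma smooth_partial:
  assumes "smooth F" shows "smooth (partial c F)"
proof -
  have "partials cs (partial c F) = partials (cs @ [c]) F" for cs
    by (simp add: partials_append)
  then show ?thesis using assms unfolding smooth_on_jets_def by presburger
qed

lemma smooth_cong:
  assumes "\<And>p. p \<in> D ==> F p = G p" "smooth F"
  shows "smooth G"
proof (rule smooth_coinduct[where C="{G. \<exists>F. smooth F \<and> (\<forall>p\<in>D. F p = G p)}"])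
  show "G \<in> {G. \<exists>F. smooth F \<and> (\<forall>p\<in>D. F p = G p)}" using assms by auto
  show "continuous_on D G'" if G': "G' \<in> {G. \<exists>F. smooth F \<and> (\<forall>p\<in>D. F p = G p)}" for G'
  proof -
    obtain F where "smooth F" "\<forall>p\<in>D. F p = G' p" using G' by blast
    then show ?thesis using smooth_continuous continuous_on_cong[OF refl, of D F G'] by blast
  qed
  show "\<exists>H\<in>{G. \<exists>F. smooth F \<and> (\<forall>p\<in>D. F p = G p)}. has_partial c G' H"
    if G': "G' \<in> {G. \<exists>F. smooth F \<and> (\<forall>p\<in>D. F p = G p)}" for G' c
  proof -
    obtain F where F: "smooth F" "\<forall>p\<in>D. F p = G' p" using G' by blast
    then have "has_partial c G' (partial c F)"
      using has_partial_cong[of F G' "partial c F"] smooth_has_partial by blast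
    then show ?thesis using smooth_partial[OF F(1)] by blast
  qed
qed

definition dep :: "coord set => (jet => real) => bool" where
  "dep S F \<longleftrightarrow> (\<forall>p\<in>D. \<forall>q\<in>D. (\<forall>c\<in>S. p c = q c) \<longrightarrow> F p = F q)"

abbreviation dfun :: "(jet => real) => bool" where "dfun \<equiv> differential_function D"

lemma dfun_iff: "dfun F \<longleftrightarrow> smooth F \<and> (\<exists>S. finite S \<and> dep S F)"
  by (simp add: differential_function_def dep_def)

lemma dfunI: "smooth F ==> finite S ==> dep S F ==> dfun F"
  by (auto simp: dfun_iff)

lemma dfun_smooth: "dfun F ==> smooth F"
  by (simp add: dfun_iff)

lemma dep_mono: "dep S F ==> S \<subseteq> T ==> dep T F"
  unfolding dep_def by blast

lemma dep_eq: "dep S F ==> p \<in> D ==> q \<in> D ==> (\<And>c. c \<in> S ==> p c = q c) ==> F p = F q"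
  unfolding dep_def by blast

lemma dep_Int:
  assumes "dep A F" "dep B F" shows "dep (A \<inter> B) F"
  unfolding dep_def
proof (intro ballI impI)
  fix p q assume p: "p \<in> D" and q: "q \<in> D" and eq: "\<forall>c\<in>A \<inter> B. p c = q c"
  \<comment> \<open>This point agrees with \<open>p\<close> on \<open>A\<close> and with
    \<open>q\<close> on \<open>B\<close>.\<close>
  let ?r = "\<lambda>c. if c \<in> A then p c else q c"
  have "F p = F ?r" by (rule dep_eq[OF assms(1) p mix_D[OF p q]]) simp
  also have "\<dots> = F q" by (rule dep_eq[OF assms(2) mix_D[OF p q] q]) (use eq in auto)
  finally show "F p = F q" .
qed

lemma dep_cong: "(\<And>p. p \<in> D ==> F p = G p) ==> dep S F ==> dep S G"
  unfolding dep_def by metis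

lemma dep_partial:
  assumes "dep S F" shows "dep S (partial c F)"
  unfolding dep_def
proof (intro ballI impI)
  fix p q assume p: "p \<in> D" and q: "q \<in> D" and eq: "\<forall>c\<in>S. p c = q c"
  show "partial c F p = partial c F q"
  proof (cases "c \<in> S")
    case True
    then have "p c = q c" using eq by auto
    have "\<forall>\<^sub>F s in nhds (p c). F (p(c := s)) = F (q(c := s))"
      using eventually_sec[OF p]
      by eventually_elim (use assms p q eq in \<open>auto intro!: dep_eq[of S F] upd_D\<close>)
    then show ?thesis unfolding partial_def \<open>p c = q c\<close>
      by (intro deriv_cong_ev) (simp_all add: \<open>p c = q c\<close>)
  next
    case False
    have "partial c F r = 0" if "r \<in> D" for r
    proof -
      have "\<forall>\<^sub>F s in nhds (r c). F (r(c := s)) = F r"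
        using eventually_sec[OF that]
        by eventually_elim (use assms that False in \<open>auto intro!: dep_eq[of S F] upd_D\<close>)
      then have "partial c F r = deriv (\<lambda>s. F r) (r c)"
        unfolding partial_def by (intro deriv_cong_ev) auto
      then show ?thesis by simp
    qed
    then show ?thesis using p q by simp
  qed
qed

lemma partial_eq_0:
  assumes "dep S F" "c \<notin> S" "p \<in> D" shows "partial c F p = 0"
proof -
  have "\<forall>\<^sub>F s in nhds (p c). F (p(c := s)) = F p"
    using eventually_sec[OF assms(3)]
    by eventually_elim (use assms in \<open>auto intro!: dep_eq[of S F] upd_D\<close>)
  then have "partial c F p = deriv (\<lambda>s. F p) (p c)"
    unfolding partial_def by (intro deriv_cong_ev) auto
  then show ?thesis by simp
qed

lemma dfun_partial: "dfun F ==> dfun (partial c F)"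
  unfolding dfun_iff using smooth_partial dep_partial by blast

lemma dfun_cong: "(\<And>p. p \<in> D ==> F p = G p) ==> dfun F ==> dfun G"
  unfolding dfun_iff using smooth_cong dep_cong by metis

text \<open>On the convex slice through \<open>p\<close> in direction \<open>c\<close> the function
  is constant, so the \<open>c\<close>-coordinate of \<open>p\<close> may first be replaced by that
  of \<open>q\<close>.\<close>

lemma dep_diff:
  assumes F: "smooth F" "dep S F" and z: "\<And>p. p \<in> D ==> partial c F p = 0"
  shows "dep (S - {c}) F"
  unfolding dep_def
proof (intro ballI impI)
  fix p q assume p: "p \<in> D" and q: "q \<in> D" and eq: "\<forall>d\<in>S - {c}. p d = q d"
  have "((\<lambda>s. F (p(c := s))) has_real_derivative 0) (at s within sec c)" if "s \<in> sec c" for s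
  proof -
    have "p(c := s) \<in> D" using p that upd_D by blast
    then show ?thesis
      using z smooth_DERIV_upd[OF F(1) p that] by (simp add: has_field_derivative_at_within)
  qed
  then obtain k where "\<forall>s\<in>sec c. F (p(c := s)) = k"
    using has_field_derivative_zero_constant[OF convex_sec, of c "\<lambda>s. F (p(c := s))"] by auto
  then have "F (p(c := p c)) = F (p(c := q c))" using p q D_sec by metis
  also have "\<dots> = F q"
    using eq q p by (intro dep_eq[OF F(2)]) (auto intro: upd_D D_sec)
  finally show "F p = F q" by simp
qed

text \<open>The chain rule is obtained by moving one coordinate after the other.\<close>

lemma chain_rule:
  assumes F: "smooth F" "dep S F" "finite S"
    and I: "open I" "s0 \<in> I"
    and g: "\<And>s. s \<in> I ==> g s \<in> D"
    and cont: "\<And>c. c \<in> S ==> continuous_on I (\<lambda>s. g s c)"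
    and deriv: "\<And>c. c \<in> S ==> ((\<lambda>s. g s c) has_real_derivative g' c) (at s0)"
  shows "((\<lambda>s. F (g s)) has_real_derivative (\<Sum>c\<in>S. partial c F (g s0) * g' c)) (at s0)"
proof -
  define ov where "ov A s = (\<lambda>c. if c \<in> A then g s c else g s0 c)" for A s
  have ov_D: "ov A s \<in> D" if "s \<in> I" for A s
    unfolding ov_def using mix_D[OF g g] that I by auto
  have "((\<lambda>s. F (ov A s)) has_real_derivative (\<Sum>c\<in>A. partial c F (g s0) * g' c)) (at s0)"
    if "finite A" "A \<subseteq> S" for A
    using that
  proof (induction A)
    case empty
    then show ?case by (simp add: ov_def)
  next
    case (insert d A)
    have cov: "continuous_on (I \<times> sec d) (\<lambda>x. (ov A (fst x))(d := snd x))"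
    proof (rule continuous_on_coordinatewise_then_product)
      fix i
      show "continuous_on (I \<times> sec d) (\<lambda>x. ((ov A (fst x))(d := snd x)) i)"
      proof (cases "i = d")
        case True then show ?thesis by (simp add: continuous_on_snd)
      next
        case False
        have "continuous_on (I \<times> sec d) (\<lambda>x. g (fst x) i)" if "i \<in> A"
          using cont[of i] insert.prems that
          by (intro continuous_on_compose2[of I "\<lambda>s. g s i" _ fst]) (auto intro: continuous_on_fst)
        then show ?thesis using False unfolding ov_def by (cases "i \<in> A") auto
      qed
    qed
    have cpart: "continuous_on (I \<times> sec d) (\<lambda>x. partial d F ((ov A (fst x))(d := snd x)))"
      by (rule continuous_on_compose2[OF smooth_continuous[OF smooth_partial[OF F(1)]] cov])
        (use upd_D ov_D in auto)
    let ?fy = "\<lambda>s y. blinfun_mult_right (partial d F ((ov A s)(d := y)))"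
    \<comment> \<open>Joint differentiability at a point of the \<open>(s, y)\<close> plane follows
      from the derivative in \<open>s\<close> at that point, which the induction provides, and a
      derivative in \<open>y\<close> that is jointly continuous.\<close>
    have ev: "((\<lambda>(s, y). F ((ov A s)(d := y))) has_derivative
        (\<lambda>(ts, ty). (\<Sum>c\<in>A. partial c F (g s0) * g' c) * ts + ?fy s0 (g s0 d) ty))
        (at (s0, g s0 d) within I \<times> sec d)"
    proof (rule has_derivative_partialsI)
      have "(\<lambda>s. F ((ov A s)(d := g s0 d))) = (\<lambda>s. F (ov A s))"
        using insert.hyps by (intro ext arg_cong[of _ _ F]) (auto simp: ov_def)
      then show "((\<lambda>s. F ((ov A s)(d := g s0 d))) has_derivative
          (*) (\<Sum>c\<in>A. partial c F (g s0) * g' c)) (at s0 within I)"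
        using insert.IH insert.prems
        by (simp add: has_derivative_at_withinI has_field_derivative_def)
      show "((\<lambda>y. F ((ov A s)(d := y))) has_derivative blinfun_apply (?fy s y)) (at y within sec d)"
        if "s \<in> I" "y \<in> sec d" for s y
      proof -
        have "((\<lambda>r. F ((ov A s)(d := r))) has_real_derivative partial d F ((ov A s)(d := y))) (at y)"
          using smooth_DERIV_upd[OF F(1) ov_D[OF that(1)] that(2)] .
        then show ?thesis
          by (simp add: has_field_derivative_def has_derivative_at_withinI)
      qed
      have "continuous_on (I \<times> sec d) (\<lambda>(s, y). ?fy s y)"
        using cpart by (auto simp: case_prod_beta intro!: continuous_intros)
      then show "continuous (at (s0, g s0 d) within I \<times> sec d) (\<lambda>(s, y). ?fy s y)"
        using I g D_sec by (auto simp: continuous_on_eq_continuous_within)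
      show "g s0 d \<in> sec d" using I g D_sec by blast
    qed (rule convex_sec)
    have op: "open (I \<times> sec d)" using I open_sec open_Times by blast
    have "g s0 d \<in> sec d" using I g D_sec by blast
    have ev2: "((\<lambda>(s, y). F ((ov A s)(d := y))) has_derivative
        (\<lambda>(ts, ty). (\<Sum>c\<in>A. partial c F (g s0) * g' c) * ts + ?fy s0 (g s0 d) ty))
        (at (s0, g s0 d))"
      using ev I(2) \<open>g s0 d \<in> sec d\<close> by (simp add: at_within_open[OF _ op])
    have pair: "((\<lambda>s. (s, g s d)) has_derivative (\<lambda>h. (h, g' d * h))) (at s0)"
      using deriv[of d] insert.prems
      by (auto intro!: derivative_eq_intros simp: has_field_derivative_def)
    have "(ov A s)(d := g s d) = ov (insert d A) s" for s
      by (auto simp: ov_def)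
    moreover have s0: "(ov A s0)(d := g s0 d) = g s0"
      by (auto simp: ov_def)
    ultimately have "((\<lambda>s. F (ov (insert d A) s)) has_derivative
        (\<lambda>h. (\<Sum>c\<in>A. partial c F (g s0) * g' c) * h + ?fy s0 (g s0 d) (g' d * h))) (at s0)"
      using has_derivative_compose[OF pair ev2] by simp
    also have "(\<lambda>h. (\<Sum>c\<in>A. partial c F (g s0) * g' c) * h + ?fy s0 (g s0 d) (g' d * h)) =
        (*) (\<Sum>c\<in>insert d A. partial c F (g s0) * g' c)"
      using insert.hyps by (simp add: fun_eq_iff algebra_simps s0)
    finally show ?case by (simp add: has_field_derivative_def)
  qed
  from this[OF F(3) order_refl]
  have *: "((\<lambda>s. F (ov S s)) has_real_derivative (\<Sum>c\<in>S. partial c F (g s0) * g' c)) (at s0)" .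
  have "\<forall>\<^sub>F s in nhds s0. s \<in> I" by (intro eventually_nhds_in_open I)
  then have "\<forall>\<^sub>F s in nhds s0. F (ov S s) = F (g s)"
    by eventually_elim (rule dep_eq[OF F(2)], simp_all add: ov_D g, simp add: ov_def)
  then show ?thesis by (rule DERIV_cong_ev[THEN iffD1, OF refl _ refl *])
qed

end

lemma open_interval_antiderivative:
  assumes "open_interval S" and cont: "continuous_on S (f :: real => real)"
  shows "\<exists>F. antiderivative S f F"
proof -
  have S: "open S" "is_interval S" using assms by (auto simp: open_interval_def)
  obtain a where a: "a \<in> S" using assms by (auto simp: open_interval_def)
  have "((\<lambda>u. LBINT y=a..u. f y) has_real_derivative f x) (at x)" if x: "x \<in> S" for x
  proof -
    have "min a x \<in> S" "max a x \<in> S" using a x by (auto simp: min_def max_def)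
    then obtain e1 e2 where e: "e1 > 0" "cball (min a x) e1 \<subseteq> S" "e2 > 0" "cball (max a x) e2 \<subseteq> S"
      using open_contains_cball_eq[OF S(1)] by metis
    let ?l = "min a x - e1" and ?u = "max a x + e2"
    have "?l \<in> cball (min a x) e1" "?u \<in> cball (max a x) e2" using e(1,3) by (auto simp: dist_real_def)
    then have "?l \<in> S" "?u \<in> S" using e(2,4) by blast+
    then have sub: "{?l..?u} \<subseteq> S"
      using mem_is_interval_1_I[OF S(2)] by (meson atLeastAtMost_iff subsetI)
    have "((\<lambda>u. LBINT y=a..u. f y) has_vector_derivative f x) (at x within {?l..?u})"
      by (rule interval_integral_FTC2)
        (use e(1,3) continuous_on_subset[OF cont sub] in auto)
    moreover have "at x within {?l..?u} = at x"
      using e by (intro at_within_interior) (auto simp: min_def max_def)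
    ultimately show ?thesis by (simp add: has_real_derivative_iff_has_vector_derivative)
  qed
  then show ?thesis unfolding antiderivative_def by blast
qed

section \<open>Smoothness of sums, products and compositions\<close>

context box
begin

lemma continuous_on_upd: "continuous_on A (\<lambda>s. p(c := s))" for p :: jet
proof (rule continuous_on_coordinatewise_then_product)
  show "continuous_on A (\<lambda>s. (p(c := s)) i)" for i
    by (cases "i = c") (auto intro: continuous_intros)
qed

lemma continuous_on_upd2: "continuous_on A (\<lambda>x. p(c := fst x, d := snd x))" for p :: jet
proof (rule continuous_on_coordinatewise_then_product)
  show "continuous_on A (\<lambda>x. (p(c := fst x, d := snd x)) i)" for i
    by (cases "i = c"; cases "i = d") (auto intro: continuous_intros)
qed

lemma continuous_on_coord: "continuous_on A (\<lambda>p. p c)" for A :: "jet set"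
  by (rule continuous_on_subset[OF continuous_on_product_coordinates]) simp

lemma has_partial_const: "has_partial c (\<lambda>p. k) (\<lambda>p. 0)"
  by (simp add: has_partial_def)

lemma has_partial_coord: "has_partial c (\<lambda>p. p d) (\<lambda>p. if c = d then 1 else 0)"
  by (auto simp: has_partial_def intro!: derivative_eq_intros)

lemma has_partial_add:
  "has_partial c F F' ==> has_partial c G G' ==> has_partial c (\<lambda>p. F p + G p) (\<lambda>p. F' p + G' p)"
  unfolding has_partial_def using DERIV_add by fastforce

lemma has_partial_mult:
  "has_partial c F F' ==> has_partial c G G' ==>
    has_partial c (\<lambda>p. F p * G p) (\<lambda>p. F' p * G p + F p * G' p)"
  unfolding has_partial_def
proof
  fix p assume "\<forall>p\<in>D. ((\<lambda>s. F (p(c := s))) has_real_derivative F' p) (at (p c))"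
    "\<forall>p\<in>D. ((\<lambda>s. G (p(c := s))) has_real_derivative G' p) (at (p c))" "p \<in> D"
  then have "((\<lambda>s. F (p(c := s)) * G (p(c := s))) has_real_derivative
      F (p(c := p c)) * G' p + F' p * G (p(c := p c))) (at (p c))"
    by (intro DERIV_mult') auto
  then show "((\<lambda>s. F (p(c := s)) * G (p(c := s))) has_real_derivative
      F' p * G p + F p * G' p) (at (p c))" by (simp add: add.commute)
qed

lemma has_partial_comp:
  assumes F: "smooth F" "dep S F" "finite S"
    and \<sigma>: "\<And>c. continuous_on D (\<sigma> c)" "\<And>c. has_partial d (\<sigma> c) (\<sigma>' c)"
    and \<sigma>_D: "\<And>p. p \<in> D ==> (\<lambda>c. \<sigma> c p) \<in> D"
  shows "has_partial d (\<lambda>p. F (\<lambda>c. \<sigma> c p)) (\<lambda>p. \<Sum>c\<in>S. partial c F (\<lambda>c. \<sigma> c p) * \<sigma>' c p)"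
  unfolding has_partial_def
proof
  fix p assume p: "p \<in> D"
  have "((\<lambda>s. F (\<lambda>c. \<sigma> c (p(d := s)))) has_real_derivative
      (\<Sum>c\<in>S. partial c F (\<lambda>c. \<sigma> c (p(d := p d))) * \<sigma>' c p)) (at (p d))"
  proof (rule chain_rule[OF F])
    show "open (sec d)" by (rule open_sec)
    show "p d \<in> sec d" by (rule D_sec[OF p])
    show "(\<lambda>c. \<sigma> c (p(d := s))) \<in> D" if "s \<in> sec d" for s
      using \<sigma>_D upd_D[OF p that] by blast
    show "continuous_on (sec d) (\<lambda>s. \<sigma> c (p(d := s)))" for c
      by (rule continuous_on_compose2[OF \<sigma>(1) continuous_on_upd]) (use upd_D[OF p] in auto)
    show "((\<lambda>s. \<sigma> c (p(d := s))) has_real_derivative \<sigma>' c p) (at (p d))" for c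
      using \<sigma>(2)[of c] p by (simp add: has_partial_def)
  qed
  then show "((\<lambda>s. F (\<lambda>c. \<sigma> c (p(d := s)))) has_real_derivative
      (\<Sum>c\<in>S. partial c F (\<lambda>c. \<sigma> c p) * \<sigma>' c p)) (at (p d))" by simp
qed

lemma smooth_const: "smooth (\<lambda>p. k)"
  by (rule smooth_coinduct[where C="range (\<lambda>k p. k)"]) (use has_partial_const in \<open>auto\<close>)

lemma smooth_coord: "smooth (\<lambda>p. p c)"
proof (rule smooth_coinduct[where C="insert (\<lambda>p. p c) {F. smooth F}"])
  fix G d assume G: "G \<in> insert (\<lambda>p. p c) {F. smooth F}"
  show "continuous_on D G" using G continuous_on_coord smooth_continuous by auto
  show "\<exists>G'\<in>insert (\<lambda>p. p c) {F. smooth F}. has_partial d G G'"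
  proof (cases "smooth G")
    case True then show ?thesis using smooth_has_partial smooth_partial by blast
  next
    case False
    then have "has_partial d G (\<lambda>p. if d = c then 1 else 0)" using G has_partial_coord by auto
    then show ?thesis using smooth_const by auto
  qed
qed simp

text \<open>The derivative of a product or a composition is a sum of products of the same kind, so
  the class to which \<open>smooth_coinduct\<close> is applied is taken to be closed under all three
  operations at once.\<close>

inductive_set smooth_hull :: "(jet => real) set" where
  base: "smooth F ==> F \<in> smooth_hull"
| add: "F \<in> smooth_hull ==> G \<in> smooth_hull ==> (\<lambda>p. F p + G p) \<in> smooth_hull"
| mult: "F \<in> smooth_hull ==> G \<in> smooth_hull ==> (\<lambda>p. F p * G p) \<in> smooth_hull"
| comp: "smooth F ==> finite S ==> dep S F ==> (\<And>c. \<sigma> c \<in> smooth_hull) ==>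
    (\<And>p. p \<in> D ==> (\<lambda>c. \<sigma> c p) \<in> D) ==> (\<lambda>p. F (\<lambda>c. \<sigma> c p)) \<in> smooth_hull"

lemma smooth_hull_sum:
  "finite S ==> (\<And>c. c \<in> S ==> F c \<in> smooth_hull) ==> (\<lambda>p. \<Sum>c\<in>S. F c p) \<in> smooth_hull"
  by (induction S rule: finite_induct)
    (auto intro: smooth_hull.add smooth_hull.base smooth_const)

lemma smooth_hull_step:
  "F \<in> smooth_hull ==> continuous_on D F \<and> (\<forall>c. \<exists>G\<in>smooth_hull. has_partial c F G)"
proof (induction rule: smooth_hull.induct)
  case (base F)
  have "\<exists>G\<in>smooth_hull. has_partial c F G" for c
    using smooth_has_partial[OF base, of c] smooth_hull.base[OF smooth_partial[OF base, of c]] by blast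
  then show ?case using smooth_continuous[OF base] by blast
next
  case (add F G)
  have "\<exists>H\<in>smooth_hull. has_partial c (\<lambda>p. F p + G p) H" for c
  proof -
    obtain F' G' where "F' \<in> smooth_hull" "has_partial c F F'" "G' \<in> smooth_hull" "has_partial c G G'"
      using add.IH by blast
    then show ?thesis using has_partial_add[of c F F' G G'] smooth_hull.add[of F' G'] by blast
  qed
  then show ?case using add.IH by (auto intro: continuous_on_add)
next
  case (mult F G)
  have "\<exists>H\<in>smooth_hull. has_partial c (\<lambda>p. F p * G p) H" for c
  proof -
    obtain F' G' where "F' \<in> smooth_hull" "has_partial c F F'" "G' \<in> smooth_hull" "has_partial c G G'"
      using mult.IH by blast
    moreover from this have "(\<lambda>p. F' p * G p + F p * G' p) \<in> smooth_hull"
      by (intro smooth_hull.add smooth_hull.mult mult.hyps)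
    ultimately show ?thesis using has_partial_mult[of c F F' G G'] by blast
  qed
  then show ?case using mult.IH by (auto intro: continuous_on_mult)
next
  case (comp F S \<sigma>)
  have cont: "continuous_on D (\<lambda>p c. \<sigma> c p)"
    using comp.IH by (intro continuous_on_coordinatewise_then_product) auto
  have "continuous_on D (\<lambda>p. F (\<lambda>c. \<sigma> c p))"
    by (rule continuous_on_compose2[OF smooth_continuous[OF comp.hyps(1)] cont])
      (use comp.hyps in auto)
  moreover have "\<exists>H\<in>smooth_hull. has_partial d (\<lambda>p. F (\<lambda>c. \<sigma> c p)) H" for d
  proof -
    have "\<forall>c. \<exists>G. G \<in> smooth_hull \<and> has_partial d (\<sigma> c) G" using comp.IH by blast
    then obtain \<sigma>' where \<sigma>': "\<And>c. \<sigma>' c \<in> smooth_hull" "\<And>c. has_partial d (\<sigma> c) (\<sigma>' c)"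
      by metis
    have "has_partial d (\<lambda>p. F (\<lambda>c. \<sigma> c p)) (\<lambda>p. \<Sum>c\<in>S. partial c F (\<lambda>c. \<sigma> c p) * \<sigma>' c p)"
      by (rule has_partial_comp[OF comp.hyps(1,3,2) _ \<sigma>'(2)]) (use comp in auto)
    moreover have *: "(\<lambda>p. partial c F (\<lambda>c. \<sigma> c p)) \<in> smooth_hull" for c
      by (rule smooth_hull.comp[of "partial c F" S \<sigma>])
        (simp_all add: comp.hyps smooth_partial dep_partial)
    have "(\<lambda>p. \<Sum>c\<in>S. partial c F (\<lambda>c. \<sigma> c p) * \<sigma>' c p) \<in> smooth_hull"
      by (rule smooth_hull_sum[OF comp.hyps(2)], rule smooth_hull.mult[OF * \<sigma>'(1)])
    ultimately show ?thesis by blast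
  qed
  ultimately show ?case by blast
qed

lemma smooth_hull_smooth: "F \<in> smooth_hull ==> smooth F"
  by (rule smooth_coinduct[where C=smooth_hull]) (use smooth_hull_step in blast)+

lemma smooth_add: "smooth F ==> smooth G ==> smooth (\<lambda>p. F p + G p)"
  by (rule smooth_hull_smooth[OF smooth_hull.add[OF smooth_hull.base smooth_hull.base]])

lemma smooth_mult: "smooth F ==> smooth G ==> smooth (\<lambda>p. F p * G p)"
  by (rule smooth_hull_smooth[OF smooth_hull.mult[OF smooth_hull.base smooth_hull.base]])

lemma smooth_comp:
  assumes "smooth F" "finite S" "dep S F" "\<And>c. smooth (\<sigma> c)" "\<And>p. p \<in> D ==> (\<lambda>c. \<sigma> c p) \<in> D"
  shows "smooth (\<lambda>p. F (\<lambda>c. \<sigma> c p))"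
  by (rule smooth_hull_smooth, rule smooth_hull.comp[of F S \<sigma>])
    (simp_all add: assms smooth_hull.base)

lemma dep_const: "dep S (\<lambda>p. k)"
  by (simp add: dep_def)

lemma dep_coord: "c \<in> S ==> dep S (\<lambda>p. p c)"
  by (simp add: dep_def)

lemma dep_add: "dep S F ==> dep S G ==> dep S (\<lambda>p. F p + G p)"
  unfolding dep_def by metis

lemma dep_mult: "dep S F ==> dep S G ==> dep S (\<lambda>p. F p * G p)"
  unfolding dep_def by metis

lemma dep_sum: "(\<And>c. c \<in> A ==> dep S (F c)) ==> dep S (\<lambda>p. \<Sum>c\<in>A. F c p)"
  unfolding dep_def by (intro ballI impI sum.cong refl) metis

lemma dep_comp:
  assumes "dep S F" "\<And>c. c \<in> S ==> dep T (\<sigma> c)" "\<And>p. p \<in> D ==> (\<lambda>c. \<sigma> c p) \<in> D"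
  shows "dep T (\<lambda>p. F (\<lambda>c. \<sigma> c p))"
  unfolding dep_def
  by (intro ballI impI dep_eq[OF assms(1)] assms(3)) (auto intro: dep_eq[OF assms(2)])

lemma dfun_const: "dfun (\<lambda>p. k)"
  by (rule dfunI[of _ "{}"]) (auto intro: smooth_const dep_const)

lemma dfun_coord: "dfun (\<lambda>p. p c)"
  by (rule dfunI[of _ "{c}"]) (auto intro: smooth_coord dep_coord)

lemma dfun_add: assumes "dfun F" "dfun G" shows "dfun (\<lambda>p. F p + G p)"
proof -
  obtain S T where "finite S" "dep S F" "finite T" "dep T G" using assms by (auto simp: dfun_iff)
  then show ?thesis
    using assms by (intro dfunI[of _ "S \<union> T"] smooth_add dep_add)
      (auto intro: dep_mono dfun_smooth)
qed

lemma dfun_mult: assumes "dfun F" "dfun G" shows "dfun (\<lambda>p. F p * G p)"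
proof -
  obtain S T where "finite S" "dep S F" "finite T" "dep T G" using assms by (auto simp: dfun_iff)
  then show ?thesis
    using assms by (intro dfunI[of _ "S \<union> T"] smooth_mult dep_mult)
      (auto intro: dep_mono dfun_smooth)
qed

lemma dfun_uminus: "dfun F ==> dfun (\<lambda>p. - F p)"
  using dfun_mult[OF dfun_const[of "-1"], of F] by simp

lemma dfun_diff: "dfun F ==> dfun G ==> dfun (\<lambda>p. F p - G p)"
  using dfun_add[OF _ dfun_uminus, of F G] by simp

lemma dfun_sum: "finite S ==> (\<And>c. c \<in> S ==> dfun (F c)) ==> dfun (\<lambda>p. \<Sum>c\<in>S. F c p)"
  by (induction S rule: finite_induct) (auto intro: dfun_const dfun_add)

lemma dfun_comp:
  assumes F: "dfun F" and \<sigma>: "\<And>c. dfun (\<sigma> c)" "\<And>p. p \<in> D ==> (\<lambda>c. \<sigma> c p) \<in> D"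
  shows "dfun (\<lambda>p. F (\<lambda>c. \<sigma> c p))"
proof -
  obtain S where S: "finite S" "dep S F" using F by (auto simp: dfun_iff)
  have "\<forall>c. \<exists>T. finite T \<and> dep T (\<sigma> c)" using \<sigma>(1) by (auto simp: dfun_iff)
  then obtain T where T: "\<And>c. finite (T c)" "\<And>c. dep (T c) (\<sigma> c)" by metis
  show ?thesis
  proof (rule dfunI)
    show "smooth (\<lambda>p. F (\<lambda>c. \<sigma> c p))"
      by (rule smooth_comp[OF dfun_smooth[OF F] S dfun_smooth[OF \<sigma>(1)] \<sigma>(2)])
    show "finite (\<Union>c\<in>S. T c)" using S T by auto
    show "dep (\<Union>c\<in>S. T c) (\<lambda>p. F (\<lambda>c. \<sigma> c p))"
      by (rule dep_comp[OF S(2) _ \<sigma>(2)]) (auto intro: dep_mono[OF T(2)])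
  qed
qed

lemma dfun_line:
  assumes "smooth_on_line (sec c) g" shows "dfun (\<lambda>p. g (p c))"
proof (rule dfunI[of _ "{c}"])
  have d: "((deriv ^^ n) g has_real_derivative (deriv ^^ Suc n) g x) (at x)" if "x \<in> sec c" for n x
    using assms that differentiable_imp_DERIV_deriv unfolding smooth_on_line_def by simp
  let ?C = "insert (\<lambda>p. 0) (range (\<lambda>n p. (deriv ^^ n) g (p c)))"
  show "smooth (\<lambda>p. g (p c))"
  proof (rule smooth_coinduct[where C="?C"])
    show "(\<lambda>p. g (p c)) \<in> ?C" by (auto intro!: image_eqI[of _ _ 0])
    fix G assume G: "G \<in> ?C"
    have "continuous_on (sec c) ((deriv ^^ n) g)" for n
      by (rule DERIV_continuous_on) (use d[of _ n] in \<open>auto intro: has_field_derivative_at_within\<close>)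
    then have "continuous_on D (\<lambda>p. (deriv ^^ n) g (p c))" for n
      by (rule continuous_on_compose2[OF _ continuous_on_coord]) (auto intro: D_sec)
    then show "continuous_on D G" using G by auto
    have *: "has_partial e (\<lambda>p. (deriv ^^ n) g (p c))
        (if e = c then (\<lambda>p. (deriv ^^ Suc n) g (p c)) else (\<lambda>p. 0))" for n e
      unfolding has_partial_def using d[of _ n] D_sec by auto
    then show "\<exists>G'\<in>?C. has_partial e G G'" for e
    proof (cases "G = (\<lambda>p. 0)")
      case True
      then show ?thesis using has_partial_const[of e 0] by blast
    next
      case False
      then obtain n where "G = (\<lambda>p. (deriv ^^ n) g (p c))" using G by blast
      then have "has_partial e G (if e = c then (\<lambda>p. (deriv ^^ Suc n) g (p c)) else (\<lambda>p. 0))"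
        using * by metis
      moreover have "(if e = c then (\<lambda>p. (deriv ^^ Suc n) g (p c)) else (\<lambda>p. 0)) \<in> ?C"
        by (simp del: funpow.simps)
      ultimately show ?thesis by blast
    qed
  qed
qed (auto simp: dep_def)

section \<open>Integration with respect to one coordinate\<close>

definition coord_integral :: "coord => real => (jet => real) => jet => real" where
  "coord_integral c a F p = (p c - a) * integral {0..1} (\<lambda>\<theta>. F (p(c := a + \<theta> * (p c - a))))"

lemma segment_sec: "p \<in> D ==> a \<in> sec c ==> 0 \<le> \<theta> ==> \<theta> \<le> 1 ==> a + \<theta> * (p c - a) \<in> sec c"
  using convexD_alt[OF convex_sec, of a c "p c" \<theta>] D_sec[of p c] by (simp add: algebra_simps)

lemma continuous_coord_integrand:
  assumes F: "smooth F" and a: "a \<in> sec c"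
  shows "continuous_on (D \<times> {0..1}) (\<lambda>x. F ((fst x)(c := a + snd x * (fst x c - a))))"
proof (rule continuous_on_compose2[OF smooth_continuous[OF F]])
  show "continuous_on (D \<times> {0..1}) (\<lambda>x. (fst x)(c := a + snd x * (fst x c - a)))"
  proof (rule continuous_on_coordinatewise_then_product)
    fix i
    have "continuous_on (D \<times> {0..1}) (\<lambda>x. fst x i)" for i
      by (rule continuous_on_compose2[OF continuous_on_coord[of UNIV]])
        (auto intro: continuous_on_fst)
    then show "continuous_on (D \<times> {0..1}) (\<lambda>x. ((fst x)(c := a + snd x * (fst x c - a))) i)"
      by (cases "i = c") (auto intro!: continuous_intros)
  qed
  show "(\<lambda>x. (fst x)(c := a + snd x * (fst x c - a))) ` (D \<times> {0..1}) \<subseteq> D"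
    using segment_sec[OF _ a] upd_D by auto
qed

lemma coord_integrand_integrable:
  assumes F: "smooth F" and a: "a \<in> sec c" and p: "p \<in> D"
  shows "(\<lambda>\<theta>. F (p(c := a + \<theta> * (p c - a)))) integrable_on {0..1}"
proof -
  have "continuous_on {0..1} (\<lambda>\<theta>. F (p(c := a + \<theta> * (p c - a))))"
    using continuous_on_compose2[OF continuous_coord_integrand[OF F a]
        continuous_on_Pair[OF continuous_on_const[of _ p] continuous_on_id], of "{0..1}"] p
    by auto
  then show ?thesis by (rule integrable_continuous_real)
qed

lemma coord_integral_continuous:
  assumes F: "smooth F" and a: "a \<in> sec c"
  shows "continuous_on D (coord_integral c a F)"
proof -
  have "continuous_on D (\<lambda>p. integral (cbox 0 1) (\<lambda>\<theta>. F (p(c := a + \<theta> * (p c - a)))))"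
    using continuous_coord_integrand[OF F a]
    by (intro integral_continuous_on_param) (simp add: case_prod_beta)
  then show ?thesis unfolding coord_integral_def
    by (auto intro!: continuous_intros continuous_on_coord)
qed

lemma has_partial_coord_integral_same:
  assumes F: "smooth F" and a: "a \<in> sec c"
  shows "has_partial c (coord_integral c a F) F"
  unfolding has_partial_def
proof
  fix p assume p: "p \<in> D"
  have "continuous_on (sec c) (\<lambda>s. F (p(c := s)))"
    by (rule continuous_on_compose2[OF smooth_continuous[OF F] continuous_on_upd])
      (use upd_D[OF p] in auto)
  then obtain \<Phi> where \<Phi>: "\<And>s. s \<in> sec c ==> (\<Phi> has_real_derivative F (p(c := s))) (at s)"
    using open_interval_antiderivative[OF sec] unfolding antiderivative_def by blast
  have eq: "coord_integral c a F (p(c := s)) = \<Phi> s - \<Phi> a" if s: "s \<in> sec c" for s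
  proof -
    have "((\<lambda>\<theta>. (s - a) * F (p(c := a + \<theta> * (s - a)))) has_integral
        \<Phi> (a + 1 * (s - a)) - \<Phi> (a + 0 * (s - a))) {0..1}"
    proof (rule fundamental_theorem_of_calculus)
      fix \<theta> :: real assume "\<theta> \<in> {0..1}"
      then have "a + \<theta> * (s - a) \<in> sec c" using segment_sec[OF upd_D[OF p s] a, of \<theta>] by simp
      from \<Phi>[OF this] have "((\<lambda>\<theta>. \<Phi> (a + \<theta> * (s - a))) has_real_derivative
          F (p(c := a + \<theta> * (s - a))) * (s - a)) (at \<theta> within {0..1})"
        by (rule DERIV_chain2[where g="\<lambda>\<theta>. a + \<theta> * (s - a)"])
          (auto intro!: derivative_eq_intros)
      then show "((\<lambda>\<theta>. \<Phi> (a + \<theta> * (s - a))) has_vector_derivative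
          (s - a) * F (p(c := a + \<theta> * (s - a)))) (at \<theta> within {0..1})"
        by (simp add: has_real_derivative_iff_has_vector_derivative[symmetric] mult.commute)
    qed simp
    then have "integral {0..1} (\<lambda>\<theta>. (s - a) * F (p(c := a + \<theta> * (s - a)))) =
        \<Phi> (a + 1 * (s - a)) - \<Phi> (a + 0 * (s - a))"
      by (rule integral_unique)
    then show ?thesis unfolding coord_integral_def by simp
  qed
  have "\<forall>\<^sub>F s in nhds (p c). coord_integral c a F (p(c := s)) = \<Phi> s - \<Phi> a"
    using eventually_sec[OF p, of c] by eventually_elim (rule eq)
  moreover have "((\<lambda>s. \<Phi> s - \<Phi> a) has_real_derivative F p) (at (p c))"
    using \<Phi>[OF D_sec[OF p]] by (auto intro!: derivative_eq_intros)
  ultimately show "((\<lambda>s. coord_integral c a F (p(c := s))) has_real_derivative F p) (at (p c))"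
    using DERIV_cong_ev[OF refl _ refl, of "\<lambda>s. coord_integral c a F (p(c := s))"] by simp
qed

text \<open>The substitution in \<open>coord_integral\<close> fixes the interval of integration to
  \<open>[0, 1]\<close>, so the coordinate \<open>d\<close> occurs in the integrand only and
  differentiation under the integral sign applies.\<close>

lemma has_partial_coord_integral_other:
  assumes F: "smooth F" and a: "a \<in> sec c" and d: "d \<noteq> c"
  shows "has_partial d (coord_integral c a F) (coord_integral c a (partial d F))"
  unfolding has_partial_def
proof
  fix p assume p: "p \<in> D"
  have "((\<lambda>s. integral (cbox 0 1) (\<lambda>\<theta>. F ((p(d := s))(c := a + \<theta> * (p c - a))))) has_real_derivative
      integral (cbox 0 1) (\<lambda>\<theta>. partial d F ((p(d := p d))(c := a + \<theta> * (p c - a))))) (at (p d) within sec d)"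
  proof (rule leibniz_rule_field_derivative)
    fix s \<theta> :: real assume s: "s \<in> sec d" and \<theta>: "\<theta> \<in> cbox 0 1"
    have "p(c := a + \<theta> * (p c - a)) \<in> D" using segment_sec[OF p a] upd_D[OF p] \<theta> by simp
    from smooth_DERIV_upd[OF F this s]
    show "((\<lambda>s. F ((p(d := s))(c := a + \<theta> * (p c - a)))) has_real_derivative
        partial d F ((p(d := s))(c := a + \<theta> * (p c - a)))) (at s within sec d)"
      using d by (simp add: fun_upd_twist has_field_derivative_at_within)
  next
    show "(\<lambda>\<theta>. F ((p(d := s))(c := a + \<theta> * (p c - a)))) integrable_on cbox 0 1" if "s \<in> sec d" for s
      using coord_integrand_integrable[OF F a upd_D[OF p that]] d by simp
    have "continuous_on (sec d \<times> {0..1}) (\<lambda>x. (p(d := fst x), snd x))"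
      by (intro continuous_on_Pair continuous_on_snd continuous_on_id
          continuous_on_compose2[OF continuous_on_upd[of UNIV] continuous_on_fst]) auto
    then have "continuous_on (sec d \<times> {0..1})
        (\<lambda>x. partial d F ((p(d := fst x))(c := a + snd x * ((p(d := fst x)) c - a))))"
      using continuous_on_compose2[OF continuous_coord_integrand[OF smooth_partial[OF F, of d] a],
          of "sec d \<times> {0..1}" "\<lambda>x. (p(d := fst x), snd x)"] upd_D[OF p] by force
    then show "continuous_on (sec d \<times> cbox 0 1)
        (\<lambda>(s, \<theta>). partial d F ((p(d := s))(c := a + \<theta> * (p c - a))))"
      using d by (simp add: case_prod_beta)
  qed (use D_sec[OF p] convex_sec in auto)
  then have "((\<lambda>s. integral {0..1} (\<lambda>\<theta>. F ((p(d := s))(c := a + \<theta> * (p c - a))))) has_real_derivative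
      integral {0..1} (\<lambda>\<theta>. partial d F (p(c := a + \<theta> * (p c - a))))) (at (p d))"
    using at_within_open[OF D_sec[OF p] open_sec] by simp
  from DERIV_cmult[OF this, of "p c - a"]
  show "((\<lambda>s. coord_integral c a F (p(d := s))) has_real_derivative
      coord_integral c a (partial d F) p) (at (p d))"
    using d unfolding coord_integral_def by simp
qed

text \<open>A derivative in direction \<open>c\<close> gives back the smooth integrand and any other
  one is again such an integral, so smooth functions and these integrals together are closed under
  differentiation.\<close>

lemma smooth_coord_integral:
  assumes F: "smooth F" and a: "a \<in> sec c"
  shows "smooth (coord_integral c a F)"
proof (rule smooth_coinduct[where C="{F. smooth F} \<union> coord_integral c a ` {F. smooth F}"])
  fix G d assume G: "G \<in> {F. smooth F} \<union> coord_integral c a ` {F. smooth F}"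
  show "continuous_on D G" using G coord_integral_continuous[OF _ a] smooth_continuous by auto
  show "\<exists>G'\<in>{F. smooth F} \<union> coord_integral c a ` {F. smooth F}. has_partial d G G'"
  proof (cases "smooth G")
    case True then show ?thesis using smooth_has_partial smooth_partial by blast
  next
    case False
    then obtain F where "smooth F" "G = coord_integral c a F" using G by blast
    then show ?thesis
      using has_partial_coord_integral_same[OF _ a] has_partial_coord_integral_other[OF _ a]
        smooth_partial by (cases "d = c") blast+
  qed
qed (use F in auto)

lemma dep_coord_integral:
  assumes "dep S F" "a \<in> sec c" shows "dep (insert c S) (coord_integral c a F)"
  unfolding dep_def coord_integral_def
proof (intro ballI impI)
  fix p q assume p: "p \<in> D" and q: "q \<in> D" and eq: "\<forall>d\<in>insert c S. p d = q d"
  have "integral {0..1} (\<lambda>\<theta>. F (p(c := a + \<theta> * (p c - a)))) =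
      integral {0..1} (\<lambda>\<theta>. F (q(c := a + \<theta> * (q c - a))))"
    using eq segment_sec[OF p assms(2)] segment_sec[OF q assms(2)] p q
    by (intro integral_cong dep_eq[OF assms(1)] upd_D) auto
  then show "(p c - a) * integral {0..1} (\<lambda>\<theta>. F (p(c := a + \<theta> * (p c - a)))) =
      (q c - a) * integral {0..1} (\<lambda>\<theta>. F (q(c := a + \<theta> * (q c - a))))" using eq by simp
qed

lemma dfun_coord_integral:
  assumes "dfun F" "a \<in> sec c" shows "dfun (coord_integral c a F)"
  using assms unfolding dfun_iff
  by (meson dep_coord_integral finite_insert smooth_coord_integral)

section \<open>Symmetry of second partial derivatives\<close>

lemma second_difference_mvt:
  assumes F: "smooth F" and p: "p \<in> D" and cd: "c \<noteq> d" and h: "h > 0"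
    and hs: "{p c..p c + h} \<subseteq> sec c" "{p d..p d + h} \<subseteq> sec d"
  shows "\<exists>s\<in>{p c..p c + h}. \<exists>r\<in>{p d..p d + h}.
    F (p(c := p c + h, d := p d + h)) - F (p(c := p c + h)) - F (p(d := p d + h)) + F p
      = h * (h * partial d (partial c F) (p(c := s, d := r)))"
proof -
  let ?\<phi> = "\<lambda>s. F (p(d := p d + h, c := s)) - F (p(c := s))"
  have "\<exists>s. p c < s \<and> s < p c + h \<and> ?\<phi> (p c + h) - ?\<phi> (p c) =
      (p c + h - p c) * (partial c F (p(d := p d + h, c := s)) - partial c F (p(c := s)))"
  proof (rule MVT2)
    fix s assume "p c \<le> s" "s \<le> p c + h"
    then have "s \<in> sec c" "p d + h \<in> sec d" using hs h by auto
    then show "(?\<phi> has_real_derivative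
        partial c F (p(d := p d + h, c := s)) - partial c F (p(c := s))) (at s)"
      using smooth_DERIV_upd[OF F] p upd_D[OF p] by (auto intro!: derivative_eq_intros)
  qed (use h in auto)
  then obtain s where s: "p c < s" "s < p c + h" and eq1: "?\<phi> (p c + h) - ?\<phi> (p c) =
      h * (partial c F (p(d := p d + h, c := s)) - partial c F (p(c := s)))" by auto
  then have "s \<in> sec c" using hs by auto
  then have ps: "p(c := s) \<in> D" using upd_D[OF p] by blast
  have "\<exists>r. p d < r \<and> r < p d + h \<and>
      partial c F (p(c := s, d := p d + h)) - partial c F (p(c := s, d := p d)) =
      (p d + h - p d) * partial d (partial c F) (p(c := s, d := r))"
  proof (rule MVT2)
    fix r assume "p d \<le> r" "r \<le> p d + h"
    then show "((\<lambda>r. partial c F (p(c := s, d := r))) has_real_derivative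
        partial d (partial c F) (p(c := s, d := r))) (at r)"
      using hs by (intro smooth_DERIV_upd[OF smooth_partial[OF F] ps]) auto
  qed (use h in auto)
  then obtain r where r: "p d < r" "r < p d + h" and eq2:
    "partial c F (p(c := s, d := p d + h)) - partial c F (p(c := s, d := p d)) =
      h * partial d (partial c F) (p(c := s, d := r))" by auto
  have "p(c := s, d := p d) = p(c := s)" using cd by auto
  then show ?thesis
    using eq1 eq2 s r cd by (intro bexI[of _ s] bexI[of _ r]) (simp_all add: fun_upd_twist)
qed

text \<open>The second difference over a small square is \<open>h * h\<close> times either mixed
  derivative, each taken at some point of the square. If the two values at \<open>p\<close>
  differed, continuity would keep them apart on the whole square.\<close>

lemma partial_commute:
  assumes F: "smooth F" and p: "p \<in> D"
  shows "partial d (partial c F) p = partial c (partial d F) p"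
proof (cases "c = d")
  case False
  let ?P = "\<lambda>x. partial d (partial c F) (p(c := fst x, d := snd x))"
  let ?Q = "\<lambda>x. partial c (partial d F) (p(c := fst x, d := snd x))"
  have cont: "continuous_on (sec c \<times> sec d) ?P" "continuous_on (sec c \<times> sec d) ?Q"
    by (auto intro!: continuous_on_compose2[OF smooth_continuous continuous_on_upd2]
        smooth_partial F upd_D p)
  have op: "open (sec c \<times> sec d)" "(p c, p d) \<in> sec c \<times> sec d"
    using open_Times[OF open_sec open_sec] D_sec[OF p] by auto
  have "isCont ?P (p c, p d)" "isCont ?Q (p c, p d)"
    using cont op by (auto simp: continuous_on_eq_continuous_at)
  \<comment> \<open>The two mean value points are different, hence a function of a pair of
    points.\<close>
  then have c: "isCont (\<lambda>y. ?P (fst y) - ?Q (snd y)) ((p c, p d), (p c, p d))"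
    by (intro isCont_diff isCont_o2[where f=fst and g="?P"] isCont_o2[where f=snd and g="?Q"]
        isCont_fst isCont_snd continuous_ident) auto
  have "?P (p c, p d) - ?Q (p c, p d) = 0"
  proof (rule ccontr)
    assume ne: "?P (p c, p d) - ?Q (p c, p d) \<noteq> 0"
    from c ne have "\<forall>\<^sub>F y in nhds ((p c, p d), (p c, p d)). ?P (fst y) - ?Q (snd y) \<noteq> 0"
      using tendsto_imp_eventually_ne[of "\<lambda>y. ?P (fst y) - ?Q (snd y)" _ _ 0]
      unfolding isCont_def eventually_nhds_conv_at by simp
    then obtain e where e: "e > 0"
      "\<And>y. dist y ((p c, p d), (p c, p d)) < e ==> ?P (fst y) - ?Q (snd y) \<noteq> 0"
      unfolding eventually_nhds_metric by blast
    obtain e1 where e1: "e1 > 0" "cball (p c) e1 \<subseteq> sec c"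
      using open_contains_cball_eq[OF open_sec] D_sec[OF p] by metis
    obtain e2 where e2: "e2 > 0" "cball (p d) e2 \<subseteq> sec d"
      using open_contains_cball_eq[OF open_sec] D_sec[OF p] by metis
    \<comment> \<open>Each point lies within \<open>2 * h\<close> of the corner and so the pair
      within \<open>4 * h\<close>, which is less than \<open>e\<close>.\<close>
    define h where "h = min (e / 5) (min e1 e2)"
    have h: "h > 0" "h \<le> e / 5" "h \<le> e1" "h \<le> e2" using e e1 e2 by (auto simp: h_def)
    have sub: "{p c..p c + h} \<subseteq> sec c" "{p d..p d + h} \<subseteq> sec d"
      using e1 e2 h by (auto simp: subset_eq dist_real_def)
    obtain s r where sr: "s \<in> {p c..p c + h}" "r \<in> {p d..p d + h}"
      "F (p(c := p c + h, d := p d + h)) - F (p(c := p c + h)) - F (p(d := p d + h)) + F p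
        = h * (h * ?P (s, r))"
      using second_difference_mvt[OF F p False h(1) sub] by auto
    obtain s' r' where sr': "s' \<in> {p c..p c + h}" "r' \<in> {p d..p d + h}"
      "F (p(d := p d + h, c := p c + h)) - F (p(d := p d + h)) - F (p(c := p c + h)) + F p
        = h * (h * partial c (partial d F) (p(d := r', c := s')))"
      using second_difference_mvt[OF F p False[symmetric] h(1) sub(2,1)] by blast
    then have "h * (h * ?P (s, r)) = h * (h * ?Q (s', r'))"
      using sr(3) sr'(3)[unfolded fun_upd_twist[OF False[symmetric]]] unfolding fst_conv snd_conv by linarith
    then have "?P (s, r) - ?Q (s', r') = 0" using h by simp
    moreover have "dist ((s, r), (s', r')) ((p c, p d), (p c, p d)) < e"
    proof -
      have "dist (s, r) (p c, p d) \<le> \<bar>s - p c\<bar> + \<bar>r - p d\<bar>" for s r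
        unfolding dist_Pair_Pair dist_real_def using sqrt_sum_squares_le_sum_abs by auto
      then have "dist (s, r) (p c, p d) \<le> 2 * h" "dist (s', r') (p c, p d) \<le> 2 * h"
        using sr(1,2) sr'(1,2) by (smt (verit) atLeastAtMost_iff)+
      moreover have "dist ((s, r), (s', r')) ((p c, p d), (p c, p d)) \<le>
          \<bar>dist (s, r) (p c, p d)\<bar> + \<bar>dist (s', r') (p c, p d)\<bar>"
        unfolding dist_Pair_Pair[of "(s, r)"] by (rule sqrt_sum_squares_le_sum_abs)
      ultimately show ?thesis using h by simp
    qed
    ultimately show False using e(2)[of "((s, r), (s', r'))"] by simp
  qed
  then show ?thesis by simp
qed simp

end

section \<open>Total derivatives as vector fields on jets\<close>

fun shift_t :: "coord => jet => real" where
  "shift_t Time p = 1" | "shift_t Space p = 0" | "shift_t (U i j) p = p (U (Suc i) j)"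

fun shift_x :: "coord => jet => real" where
  "shift_x Time p = 0" | "shift_x Space p = 1" | "shift_x (U i j) p = p (U i (Suc j))"

context box
begin

lemma partial_add:
  "smooth F ==> smooth G ==> p \<in> D ==> partial c (\<lambda>p. F p + G p) p = partial c F p + partial c G p"
  by (rule has_partial_imp_partial[OF has_partial_add[OF smooth_has_partial smooth_has_partial]])

lemma partial_mult:
  "smooth F ==> smooth G ==> p \<in> D ==>
    partial c (\<lambda>p. F p * G p) p = partial c F p * G p + F p * partial c G p"
  by (rule has_partial_imp_partial[OF has_partial_mult[OF smooth_has_partial smooth_has_partial]])

lemma partial_const: "p \<in> D ==> partial c (\<lambda>p. k) p = 0"
  by (rule has_partial_imp_partial[OF has_partial_const])

lemma partial_coord: "p \<in> D ==> partial c (\<lambda>p. p d) p = (if c = d then 1 else 0)"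
  by (rule has_partial_imp_partial[OF has_partial_coord])

lemma dfun_common_dep:
  assumes "dfun F" "dfun G" shows "\<exists>S. finite S \<and> dep S F \<and> dep S G"
proof -
  obtain S T where "finite S" "dep S F" "finite T" "dep T G" using assms by (auto simp: dfun_iff)
  then show ?thesis by (intro exI[of _ "S \<union> T"]) (auto intro: dep_mono)
qed

text \<open>The derivation along the field with components \<open>\<xi>\<close>. The index set
  follows \<open>total_t\<close> and \<open>total_x\<close>, which are the fields
  \<open>shift_t\<close> and \<open>shift_x\<close> on differential functions
  (\<open>total_as_der\<close>); the evolution along solutions will be a third field.\<close>

definition der :: "(coord => jet => real) => (jet => real) => jet => real" where
  "der \<xi> F p = (\<Sum>c | partial c F p \<noteq> 0. \<xi> c p * partial c F p)"

lemma der_eq: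
  assumes "finite S" "dep S F" "p \<in> D"
  shows "der \<xi> F p = (\<Sum>c\<in>S. \<xi> c p * partial c F p)"
  unfolding der_def
  by (rule sum.mono_neutral_left) (use assms partial_eq_0 in auto)

lemma der_cong:
  assumes "\<And>p. p \<in> D ==> F p = G p" "p \<in> D" shows "der \<xi> F p = der \<xi> G p"
  unfolding der_def using partial_cong[OF assms] by simp

lemma der_const: "p \<in> D ==> der \<xi> (\<lambda>p. k) p = 0"
  by (subst der_eq[of "{}"]) (auto intro: dep_const)

lemma der_coord: "p \<in> D ==> der \<xi> (\<lambda>p. p c) p = \<xi> c p"
  by (subst der_eq[of "{c}"]) (auto intro: dep_coord simp: partial_coord)

lemma der_add:
  assumes "dfun F" "dfun G" "p \<in> D" shows "der \<xi> (\<lambda>p. F p + G p) p = der \<xi> F p + der \<xi> G p"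
proof -
  obtain S where S: "finite S" "dep S F" "dep S G" using dfun_common_dep assms by blast
  show ?thesis
    by (simp add: der_eq[OF S(1) dep_add[OF S(2,3)] assms(3)] der_eq[OF S(1,2) assms(3)]
        der_eq[OF S(1,3) assms(3)] partial_add assms dfun_smooth sum.distrib distrib_left)
qed

lemma der_mult:
  assumes "dfun F" "dfun G" "p \<in> D"
  shows "der \<xi> (\<lambda>p. F p * G p) p = der \<xi> F p * G p + F p * der \<xi> G p"
proof -
  obtain S where S: "finite S" "dep S F" "dep S G" using dfun_common_dep assms by blast
  show ?thesis
    by (simp add: der_eq[OF S(1) dep_mult[OF S(2,3)] assms(3)] der_eq[OF S(1,2) assms(3)]
        der_eq[OF S(1,3) assms(3)] partial_mult assms dfun_smooth sum.distrib distrib_left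
        sum_distrib_left sum_distrib_right mult.assoc mult.left_commute)
qed

lemma der_cmult: "dfun F ==> p \<in> D ==> der \<xi> (\<lambda>p. k * F p) p = k * der \<xi> F p"
  by (simp add: der_mult dfun_const der_const)

lemma der_uminus: "dfun F ==> p \<in> D ==> der \<xi> (\<lambda>p. - F p) p = - der \<xi> F p"
  using der_cmult[of F p \<xi> "-1"] by simp

lemma der_diff:
  assumes "dfun F" "dfun G" "p \<in> D" shows "der \<xi> (\<lambda>p. F p - G p) p = der \<xi> F p - der \<xi> G p"
  using der_add[OF assms(1) dfun_uminus[OF assms(2)] assms(3), of \<xi>]
    der_uminus[OF assms(2,3), of \<xi>] by simp

lemma der_sum:
  assumes "finite A" "\<And>a. a \<in> A ==> dfun (F a)" "p \<in> D"
  shows "der \<xi> (\<lambda>p. \<Sum>a\<in>A. F a p) p = (\<Sum>a\<in>A. der \<xi> (F a) p)"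
  using assms(1,2)
  by (induction A rule: finite_induct) (simp_all add: der_const der_add assms(3) dfun_sum)

lemma dfun_der:
  assumes "dfun F" "\<And>c. dfun (\<xi> c)" shows "dfun (der \<xi> F)"
proof -
  obtain S where S: "finite S" "dep S F" using assms(1) by (auto simp: dfun_iff)
  have "dfun (\<lambda>p. \<Sum>c\<in>S. \<xi> c p * partial c F p)"
    by (intro dfun_sum S dfun_mult assms dfun_partial)
  then show ?thesis by (rule dfun_cong[rotated]) (simp add: der_eq[OF S])
qed

lemma dep_der:
  assumes "dfun F" "dep S F" "S \<subseteq> T" "\<And>c. c \<in> S ==> dep T (\<xi> c)" shows "dep T (der \<xi> F)"
proof -
  obtain S0 where "finite S0" "dep S0 F" using assms(1) by (auto simp: dfun_iff)
  then have S: "finite (S0 \<inter> S)" "dep (S0 \<inter> S) F" using dep_Int assms(2) by auto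
  have "dep T (\<lambda>p. \<Sum>c\<in>S0 \<inter> S. \<xi> c p * partial c F p)"
    using assms by (intro dep_sum dep_mult dep_partial dep_mono[OF assms(2)]) auto
  then show ?thesis by (rule dep_cong[rotated]) (simp add: der_eq[OF S])
qed

lemma der_comp:
  assumes F: "dfun F" "finite S" "dep S F"
    and \<sigma>: "\<And>c. dfun (\<sigma> c)" "\<And>p. p \<in> D ==> (\<lambda>c. \<sigma> c p) \<in> D" and p: "p \<in> D"
  shows "der \<xi> (\<lambda>p. F (\<lambda>c. \<sigma> c p)) p = (\<Sum>c\<in>S. der \<xi> (\<sigma> c) p * partial c F (\<lambda>c. \<sigma> c p))"
proof -
  have "\<forall>c. \<exists>T. finite T \<and> dep T (\<sigma> c)" using \<sigma>(1) by (auto simp: dfun_iff)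
  then obtain T where T: "\<And>c. finite (T c)" "\<And>c. dep (T c) (\<sigma> c)" by metis
  define V where "V = (\<Union>c\<in>S. T c)"
  have V: "finite V" using F(2) T(1) by (simp add: V_def)
  have dV: "dep V (\<sigma> c)" if "c \<in> S" for c
    using dep_mono[OF T(2)] that unfolding V_def by blast
  have dF: "dep V (\<lambda>p. F (\<lambda>c. \<sigma> c p))" by (rule dep_comp[OF F(3) dV \<sigma>(2)])
  have "partial d (\<lambda>p. F (\<lambda>c. \<sigma> c p)) p = (\<Sum>c\<in>S. partial c F (\<lambda>c. \<sigma> c p) * partial d (\<sigma> c) p)"
    for d
    by (rule has_partial_imp_partial[OF has_partial_comp[OF dfun_smooth[OF F(1)] F(3,2)] p])
      (use \<sigma> dfun_smooth smooth_continuous smooth_has_partial in auto)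
  then have "der \<xi> (\<lambda>p. F (\<lambda>c. \<sigma> c p)) p =
      (\<Sum>d\<in>V. \<Sum>c\<in>S. (\<xi> d p * partial d (\<sigma> c) p) * partial c F (\<lambda>c. \<sigma> c p))"
    by (simp add: der_eq[OF V dF p] sum_distrib_left mult_ac)
  also have "\<dots> = (\<Sum>c\<in>S. (\<Sum>d\<in>V. \<xi> d p * partial d (\<sigma> c) p) * partial c F (\<lambda>c. \<sigma> c p))"
    by (subst sum.swap) (simp add: sum_distrib_right)
  also have "\<dots> = (\<Sum>c\<in>S. der \<xi> (\<sigma> c) p * partial c F (\<lambda>c. \<sigma> c p))"
    by (intro sum.cong refl) (simp add: der_eq[OF V dV p])
  finally show ?thesis .
qed

text \<open>The condition on \<open>\<eta>\<close> says that the map \<open>\<sigma>\<close> carries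
  the field \<open>\<xi>\<close> at \<open>p\<close> to \<open>\<eta>\<close> at the image point;
  related fields are compatible with pullback.\<close>

lemma der_comp_transfer:
  assumes F: "dfun F" and \<sigma>: "\<And>c. dfun (\<sigma> c)" "\<And>p. p \<in> D ==> (\<lambda>c. \<sigma> c p) \<in> D"
    and p: "p \<in> D" and \<eta>: "\<And>c. \<eta> c (\<lambda>c. \<sigma> c p) = der \<xi> (\<sigma> c) p"
  shows "der \<eta> F (\<lambda>c. \<sigma> c p) = der \<xi> (\<lambda>p. F (\<lambda>c. \<sigma> c p)) p"
proof -
  obtain S where S: "finite S" "dep S F" using F by (auto simp: dfun_iff)
  show ?thesis
    by (simp add: der_comp[OF F S \<sigma> p] der_eq[OF S \<sigma>(2)[OF p]] \<eta>)
qed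

lemma der_der:
  assumes F: "dfun F" "finite S" "dep S F" and \<xi>: "\<And>c. dfun (\<xi> c)" and p: "p \<in> D"
  shows "der \<eta> (der \<xi> F) p = (\<Sum>c\<in>S. der \<eta> (\<xi> c) p * partial c F p) +
    (\<Sum>c\<in>S. \<Sum>d\<in>S. \<xi> c p * (\<eta> d p * partial d (partial c F) p))"
proof -
  have "der \<eta> (der \<xi> F) p = der \<eta> (\<lambda>p. \<Sum>c\<in>S. \<xi> c p * partial c F p) p"
    by (rule der_cong) (simp_all add: der_eq F p)
  also have "\<dots> = (\<Sum>c\<in>S. der \<eta> (\<xi> c) p * partial c F p + \<xi> c p * der \<eta> (partial c F) p)"
    by (simp add: der_sum der_mult F \<xi> p dfun_mult dfun_partial)
  also have "\<dots> = (\<Sum>c\<in>S. der \<eta> (\<xi> c) p * partial c F p) +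
      (\<Sum>c\<in>S. \<Sum>d\<in>S. \<xi> c p * (\<eta> d p * partial d (partial c F) p))"
    by (simp add: sum.distrib der_eq[OF F(2) dep_partial[OF F(3)] p] sum_distrib_left)
  finally show ?thesis .
qed

text \<open>Second derivatives of \<open>F\<close> enter symmetrically in both orders and cancel.
  Only the commutators of the components remain, and only at coordinates on which \<open>F\<close>
  depends.\<close>

lemma der_commute:
  assumes F: "dfun F" "dep S F" and \<xi>: "\<And>c. dfun (\<xi> c)" and \<eta>: "\<And>c. dfun (\<eta> c)" and p: "p \<in> D"
    and comm: "\<And>c. c \<in> S ==> der \<eta> (\<xi> c) p = der \<xi> (\<eta> c) p"
  shows "der \<eta> (der \<xi> F) p = der \<xi> (der \<eta> F) p"
proof -
  obtain S0 where "finite S0" "dep S0 F" using F(1) by (auto simp: dfun_iff)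
  then have S: "finite (S0 \<inter> S)" "dep (S0 \<inter> S) F" using dep_Int F(2) by auto
  have "(\<Sum>c\<in>S0 \<inter> S. \<Sum>d\<in>S0 \<inter> S. \<xi> c p * (\<eta> d p * partial d (partial c F) p)) =
      (\<Sum>c\<in>S0 \<inter> S. \<Sum>d\<in>S0 \<inter> S. \<eta> c p * (\<xi> d p * partial d (partial c F) p))"
    by (subst sum.swap)
      (simp add: partial_commute[OF dfun_smooth[OF F(1)] p] mult.left_commute)
  then show ?thesis
    using comm by (simp add: der_der[OF F(1) S \<xi> p] der_der[OF F(1) S \<eta> p])
qed

lemma total_as_der:
  assumes F: "dfun F" and p: "p \<in> D"
  shows "total_t F p = der shift_t F p" "total_x F p = der shift_x F p"
proof -
  obtain S where S: "finite S" "dep S F" using F by (auto simp: dfun_iff)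
  define I where "I = {(i, j). U i j \<in> S}"
  have inj: "inj (case_prod U)" by (auto simp: inj_def)
  have "finite (case_prod U -` S)" by (rule finite_vimageI[OF S(1) inj])
  moreover have "case_prod U -` S = I" by (auto simp: I_def)
  ultimately have I: "finite I" by simp
  let ?S = "insert Time (insert Space (case_prod U ` I))"
  have "S \<subseteq> ?S"
  proof
    fix c assume "c \<in> S" then show "c \<in> ?S" by (cases c) (auto simp: I_def image_iff)
  qed
  then have dS: "finite ?S" "dep ?S F" using I dep_mono[OF S(2)] by auto
  have sub: "{(i, j). partial (U i j) F p \<noteq> 0} \<subseteq> I"
    using partial_eq_0[OF S(2) _ p] by (auto simp: I_def)
  have *: "der \<xi> F p = \<xi> Time p * partial Time F p + \<xi> Space p * partial Space F p +
      (\<Sum>(i, j) | partial (U i j) F p \<noteq> 0. \<xi> (U i j) p * partial (U i j) F p)" for \<xi>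
  proof -
    have "der \<xi> F p = (\<Sum>c\<in>?S. \<xi> c p * partial c F p)" by (rule der_eq[OF dS p])
    also have "\<dots> = \<xi> Time p * partial Time F p + (\<xi> Space p * partial Space F p +
        (\<Sum>c\<in>case_prod U ` I. \<xi> c p * partial c F p))"
      using I by (subst sum.insert; auto)+
    also have "(\<Sum>c\<in>case_prod U ` I. \<xi> c p * partial c F p) =
        (\<Sum>(i, j)\<in>I. \<xi> (U i j) p * partial (U i j) F p)"
      by (subst sum.reindex[OF inj_on_subset[OF inj]]) (auto simp: case_prod_beta o_def)
    also have "\<dots> = (\<Sum>(i, j) | partial (U i j) F p \<noteq> 0. \<xi> (U i j) p * partial (U i j) F p)"
      by (rule sum.mono_neutral_right[OF I sub]) auto
    finally show ?thesis by simp
  qed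
  show "total_t F p = der shift_t F p" "total_x F p = der shift_x F p"
    unfolding total_t_def total_x_def * by simp_all
qed

end

section \<open>Smooth functions on the line\<close>

lemma DERIV_unique_open:
  fixes f g :: "real => real"
  assumes "open S" "x \<in> S" "\<And>y. y \<in> S ==> f y = g y"
    "(f has_real_derivative a) (at x)" "(g has_real_derivative b) (at x)"
  shows "a = b"
  using has_field_derivative_transform_within_open[OF assms(4,1,2,3)] assms(5) by (rule DERIV_unique)

lemma deriv_deriv_open:
  fixes g :: "real => real"
  assumes "open S" "\<And>x. x \<in> S ==> (g has_real_derivative g' x) (at x)"
    "(g' has_real_derivative g'') (at x)" "x \<in> S"
  shows "deriv (deriv g) x = g''"
  by (rule DERIV_imp_deriv[OF has_field_derivative_transform_within_open[OF assms(3,1,4)]])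
    (rule DERIV_imp_deriv[OF assms(2), symmetric])

text \<open>The analogue of \<open>smooth_coinduct\<close> in one variable, where continuity is
  automatic.\<close>

lemma smooth_on_line_coinduct:
  assumes "g \<in> C" and step: "\<And>g. g \<in> C ==> \<exists>g'\<in>C. \<forall>x\<in>S. (g has_real_derivative g' x) (at x)"
    and S: "open S"
  shows "smooth_on_line S g"
proof -
  have *: "\<exists>h\<in>C. \<forall>x\<in>S. (deriv ^^ n) g x = h x" for n
  proof (induction n)
    case 0 then show ?case using assms(1) by auto
  next
    case (Suc n)
    then obtain h where h: "h \<in> C" "\<forall>x\<in>S. (deriv ^^ n) g x = h x" by blast
    obtain h' where h': "h' \<in> C" "\<forall>x\<in>S. (h has_real_derivative h' x) (at x)" using step h(1) by blast
    have "deriv ((deriv ^^ n) g) x = h' x" if x: "x \<in> S" for x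
    proof -
      have "\<forall>\<^sub>F y in nhds x. (deriv ^^ n) g y = h y"
        using eventually_nhds_in_open[OF S x] by eventually_elim (use h in auto)
      then have "deriv ((deriv ^^ n) g) x = deriv h x" by (intro deriv_cong_ev) auto
      then show ?thesis using h' x DERIV_imp_deriv by force
    qed
    then show ?case using h' by auto
  qed
  show ?thesis unfolding smooth_on_line_def
  proof (intro allI ballI)
    fix n x assume x: "x \<in> S"
    obtain h where h: "h \<in> C" "\<forall>x\<in>S. (deriv ^^ n) g x = h x" using * by blast
    obtain h' where h': "(h has_real_derivative h' x) (at x)" using step h(1) x by blast
    have "\<forall>\<^sub>F y in nhds x. (deriv ^^ n) g y = h y"
      using eventually_nhds_in_open[OF S x] by eventually_elim (use h in auto)
    then have "((deriv ^^ n) g has_real_derivative h' x) (at x)"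
      by (rule DERIV_cong_ev[THEN iffD2, OF refl _ refl h'])
    then show "(deriv ^^ n) g differentiable at x" by (auto simp: real_differentiable_def)
  qed
qed

lemma smooth_on_line_DERIV:
  "smooth_on_line S g ==> x \<in> S ==> (g has_real_derivative deriv g x) (at x)"
  unfolding smooth_on_line_def using differentiable_imp_DERIV_deriv by (metis funpow_0)

lemma smooth_on_line_deriv: "smooth_on_line S g ==> smooth_on_line S (deriv g)"
  unfolding smooth_on_line_def by (metis funpow_Suc_right comp_apply)

lemma smooth_on_line_continuous: "smooth_on_line S g ==> continuous_on S g"
  by (rule DERIV_continuous_on[where D="deriv g"])
    (auto intro: has_field_derivative_at_within smooth_on_line_DERIV)

inductive_set line_hull :: "real set => (real => real) set" for S where
  base: "smooth_on_line S g ==> g \<in> line_hull S"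
| add: "g \<in> line_hull S ==> h \<in> line_hull S ==> (\<lambda>x. g x + h x) \<in> line_hull S"
| mult: "g \<in> line_hull S ==> h \<in> line_hull S ==> (\<lambda>x. g x * h x) \<in> line_hull S"
| comp: "smooth_on_line T g ==> h \<in> line_hull S ==> (\<And>x. x \<in> S ==> h x \<in> T) ==>
    (\<lambda>x. g (h x)) \<in> line_hull S"

lemma line_hull_step:
  "g \<in> line_hull S ==> \<exists>g'\<in>line_hull S. \<forall>x\<in>S. (g has_real_derivative g' x) (at x)"
proof (induction rule: line_hull.induct)
  case (base g)
  then show ?case using smooth_on_line_DERIV line_hull.base[OF smooth_on_line_deriv[OF base]] by blast
next
  case (add g h)
  then obtain g' h' where "g' \<in> line_hull S" "h' \<in> line_hull S"
    "\<forall>x\<in>S. (g has_real_derivative g' x) (at x)" "\<forall>x\<in>S. (h has_real_derivative h' x) (at x)" by blast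
  then show ?case
    by (intro bexI[of _ "\<lambda>x. g' x + h' x"] line_hull.add) (auto intro: DERIV_add)
next
  case (mult g h)
  then obtain g' h' where *: "g' \<in> line_hull S" "h' \<in> line_hull S"
    "\<forall>x\<in>S. (g has_real_derivative g' x) (at x)" "\<forall>x\<in>S. (h has_real_derivative h' x) (at x)" by blast
  have "(\<lambda>x. g x * h' x + g' x * h x) \<in> line_hull S"
    by (rule line_hull.add[OF line_hull.mult line_hull.mult]) (use * mult in auto)
  moreover have "((\<lambda>x. g x * h x) has_real_derivative g x * h' x + g' x * h x) (at x)" if "x \<in> S" for x
    by (rule DERIV_mult') (use * that in auto)
  ultimately show ?case by (intro bexI[of _ "\<lambda>x. g x * h' x + g' x * h x"]) auto
next
  case (comp T g h)
  then obtain h' where *: "h' \<in> line_hull S" "\<forall>x\<in>S. (h has_real_derivative h' x) (at x)" by blast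
  have "(\<lambda>x. deriv g (h x) * h' x) \<in> line_hull S"
    by (rule line_hull.mult[OF line_hull.comp[OF smooth_on_line_deriv[OF comp.hyps(1)]]])
      (use comp * in auto)
  moreover have "((\<lambda>x. g (h x)) has_real_derivative deriv g (h x) * h' x) (at x)" if "x \<in> S" for x
    using DERIV_chain2[OF smooth_on_line_DERIV[OF comp.hyps(1)], of h x "h' x" UNIV] comp * that
    by blast
  ultimately show ?case by (intro bexI[of _ "\<lambda>x. deriv g (h x) * h' x"]) auto
qed

lemma line_hull_smooth: "g \<in> line_hull S ==> open S ==> smooth_on_line S g"
  by (rule smooth_on_line_coinduct[where C="line_hull S"]) (use line_hull_step in blast)+

lemma smooth_on_line_add:
  "smooth_on_line S g ==> smooth_on_line S h ==> open S ==> smooth_on_line S (\<lambda>x. g x + h x)"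
  by (rule line_hull_smooth[OF line_hull.add[OF line_hull.base line_hull.base]])

lemma smooth_on_line_mult:
  "smooth_on_line S g ==> smooth_on_line S h ==> open S ==> smooth_on_line S (\<lambda>x. g x * h x)"
  by (rule line_hull_smooth[OF line_hull.mult[OF line_hull.base line_hull.base]])

lemma smooth_on_line_comp:
  assumes "smooth_on_line T g" "smooth_on_line S h" "\<And>x. x \<in> S ==> h x \<in> T" "open S"
  shows "smooth_on_line S (\<lambda>x. g (h x))"
  by (rule line_hull_smooth[OF line_hull.comp[OF assms(1) line_hull.base[OF assms(2)]]])
    (use assms in auto)

lemma smooth_on_line_const: "open S ==> smooth_on_line S (\<lambda>x. k)"
  by (rule smooth_on_line_coinduct[where C="range (\<lambda>k x. k)"]) (auto intro: exI[of _ 0])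

lemma smooth_on_line_antiderivative:
  assumes "antiderivative S g G" "smooth_on_line S g" "open S"
  shows "smooth_on_line S G"
proof (rule smooth_on_line_coinduct[where C="insert G {g. smooth_on_line S g}"])
  fix h assume h: "h \<in> insert G {g. smooth_on_line S g}"
  show "\<exists>h'\<in>insert G {g. smooth_on_line S g}. \<forall>x\<in>S. (h has_real_derivative h' x) (at x)"
  proof (cases "smooth_on_line S h")
    case True
    then show ?thesis using smooth_on_line_DERIV smooth_on_line_deriv by blast
  next
    case False
    then show ?thesis using h assms unfolding antiderivative_def by auto
  qed
qed (use assms in auto)

lemma smooth_on_line_ident: "open S ==> smooth_on_line S (\<lambda>x. x)"
  by (rule smooth_on_line_antiderivative[of _ "\<lambda>x. 1"])
    (auto simp: antiderivative_def smooth_on_line_const)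

lemma smooth_on_line_exp: "smooth_on_line UNIV exp"
  by (rule smooth_on_line_coinduct[where C="{exp}"]) (auto intro: DERIV_exp)

lemma smooth_on_line_inverse_self: "smooth_on_line (- {0 :: real}) inverse"
proof (rule smooth_on_line_coinduct[where C="{h. \<exists>k n. h = (\<lambda>x. k * inverse x ^ Suc n)}"])
  have "inverse = (\<lambda>x. 1 * inverse x ^ Suc 0 :: real)" by auto
  then show "inverse \<in> {h. \<exists>k n. h = (\<lambda>x :: real. k * inverse x ^ Suc n)}" by blast
  fix h :: "real => real" assume "h \<in> {h. \<exists>k n. h = (\<lambda>x. k * inverse x ^ Suc n)}"
  then obtain k n where h: "h = (\<lambda>x. k * inverse x ^ Suc n)" by blast
  define h' where "h' = (\<lambda>x :: real. (- real (Suc n) * k) * inverse x ^ Suc (Suc n))"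
  have "(h has_real_derivative h' x) (at x)" if "x \<noteq> 0" for x
    unfolding h h'_def
    by (rule DERIV_cong[OF DERIV_cmult[OF DERIV_power[OF DERIV_inverse[OF that]]]])
      (simp add: algebra_simps)
  moreover have "h' \<in> {h. \<exists>k n. h = (\<lambda>x. k * inverse x ^ Suc n)}" unfolding h'_def by blast
  ultimately show "\<exists>h'\<in>{h. \<exists>k n. h = (\<lambda>x. k * inverse x ^ Suc n)}.
      \<forall>x\<in>- {0}. (h has_real_derivative h' x) (at x)" by (intro bexI[of _ h']) auto
qed auto

lemma smooth_on_line_inverse:
  assumes "smooth_on_line S g" "open S" "\<And>x. x \<in> S ==> g x \<noteq> 0"
  shows "smooth_on_line S (\<lambda>x. inverse (g x))"
  by (rule smooth_on_line_comp[OF smooth_on_line_inverse_self assms(1)]) (use assms in auto)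

section \<open>Restriction to the solution manifold\<close>

fun jet_sec :: "equation => coord => real set" where
  "jet_sec E Time = tdom E" | "jet_sec E Space = xdom E"
| "jet_sec E (U i j) = (if i = 0 \<and> j = 0 then udom E else UNIV)"

text \<open>The coordinates without \<open>t\<close>-derivatives; they serve as coordinates on the
  set of solution jets.\<close>

definition K_jet :: "coord set" where "K_jet = {Time, Space} \<union> range (U 0)"

locale eqn =
  fixes E :: equation
  assumes is_eq: "is_equation E"
begin

lemma domains: "open_interval (tdom E)" "open_interval (xdom E)" "open_interval (udom E)"
  and smooth_coeffs: "smooth_on_line (xdom E) (cf E)" "smooth_on_line (xdom E) (ch E)"
    "smooth_on_line (udom E) (cA E)" "smooth_on_line (udom E) (cB E)"
  and f_nz: "x \<in> xdom E ==> cf E x \<noteq> 0" and A_nz: "u \<in> udom E ==> cA E u \<noteq> 0"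
  using is_eq by (auto simp: is_equation_def)

lemma open_domains: "open (tdom E)" "open (xdom E)" "open (udom E)"
  using domains by (auto simp: open_interval_def)

end

sublocale eqn \<subseteq> box "jet_sec E"
proof
  show "open_interval (jet_sec E c)" for c
    using domains by (cases c) (auto simp: open_interval_def)
qed

context eqn
begin

lemma D_eq: "D = jet_domain E"
proof -
  have "(\<forall>c. p c \<in> jet_sec E c) \<longleftrightarrow> p Time \<in> tdom E \<and> p Space \<in> xdom E \<and> p (U 0 0) \<in> udom E" for p
  proof
    assume "\<forall>c. p c \<in> jet_sec E c"
    then have "p Time \<in> jet_sec E Time" "p Space \<in> jet_sec E Space" "p (U 0 0) \<in> jet_sec E (U 0 0)"
      by blast+
    then show "p Time \<in> tdom E \<and> p Space \<in> xdom E \<and> p (U 0 0) \<in> udom E" by simp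
  next
    assume *: "p Time \<in> tdom E \<and> p Space \<in> xdom E \<and> p (U 0 0) \<in> udom E"
    show "\<forall>c. p c \<in> jet_sec E c"
    proof
      fix c show "p c \<in> jet_sec E c" using * by (cases c) auto
    qed
  qed
  then show ?thesis by (auto simp: D_def jet_domain_def)
qed

lemma D_iff: "p \<in> D \<longleftrightarrow> p Time \<in> tdom E \<and> p Space \<in> xdom E \<and> p (U 0 0) \<in> udom E"
  by (simp add: D_eq jet_domain_def)

lemma dfun_x: "smooth_on_line (xdom E) g ==> dfun (\<lambda>p. g (p Space))"
  and dfun_u: "smooth_on_line (udom E) g ==> dfun (\<lambda>p. g (p (U 0 0)))"
  and dfun_t: "smooth_on_line (tdom E) g ==> dfun (\<lambda>p. g (p Time))"
  by (auto intro!: dfun_line)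

lemma dfun_coeffs: "dfun (\<lambda>p. cf E (p Space))" "dfun (\<lambda>p. ch E (p Space))"
  "dfun (\<lambda>p. cA E (p (U 0 0)))" "dfun (\<lambda>p. cB E (p (U 0 0)))"
  using dfun_x dfun_u smooth_coeffs by auto

lemma der_line:
  assumes "smooth_on_line (jet_sec E c) g" "p \<in> D"
  shows "der \<xi> (\<lambda>p. g (p c)) p = \<xi> c p * deriv g (p c)"
proof -
  have "partial c (\<lambda>p. g (p c)) p = deriv g (p c)"
    unfolding partial_def by simp
  then show ?thesis
    using der_eq[of "{c}" "\<lambda>p. g (p c)" p \<xi>] assms(2) by (simp add: dep_def)
qed

abbreviation "Dx \<equiv> der shift_x"
abbreviation "Dt \<equiv> der shift_t"

lemma dfun_shift: "dfun (shift_x c)" "dfun (shift_t c)"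
  by (cases c; auto simp: fun_eq_iff[of "shift_x _"] intro: dfun_const dfun_coord
      dfun_cong[of "\<lambda>p. 0"] dfun_cong[of "\<lambda>p. 1"] dfun_cong[of "\<lambda>p. p (U _ _)"])+

lemma dfun_Dx: "dfun F ==> dfun (Dx F)" and dfun_Dt: "dfun F ==> dfun (Dt F)"
  by (simp_all add: dfun_der dfun_shift)

lemma dfun_Dx_pow: "dfun F ==> dfun ((Dx ^^ j) F)" and dfun_Dt_pow: "dfun F ==> dfun ((Dt ^^ j) F)"
  by (induction j) (auto intro: dfun_Dx dfun_Dt)

lemma dep_Dx: "dfun F ==> dep K_jet F ==> dep K_jet (Dx F)"
proof (rule dep_der[where S=K_jet])
  show "dep K_jet (shift_x c)" if "c \<in> K_jet" for c
    using that by (cases c) (auto simp: K_jet_def dep_def)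
qed auto

lemma dep_Dx_pow: "dfun F ==> dep K_jet F ==> dep K_jet ((Dx ^^ j) F)"
  by (induction j) (auto intro: dep_Dx dfun_Dx_pow)

text \<open>The value of \<open>u_t\<close> prescribed by the equation.\<close>

definition rhs :: "jet => real" where
  "rhs p = (cA E (p (U 0 0)) * p (U 0 2) + deriv (cA E) (p (U 0 0)) * p (U 0 1) * p (U 0 1)
    + ch E (p Space) * cB E (p (U 0 0)) * p (U 0 1)) * inverse (cf E (p Space))"

lemma dfun_inverse_f: "dfun (\<lambda>p. inverse (cf E (p Space)))"
  using dfun_x[OF smooth_on_line_inverse[OF smooth_coeffs(1) open_domains(2) f_nz]] .

lemma dfun_rhs: "dfun rhs"
  unfolding rhs_def[abs_def]
  by (intro dfun_mult dfun_add dfun_coeffs dfun_coord dfun_inverse_f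
      dfun_u[OF smooth_on_line_deriv[OF smooth_coeffs(3)]])

lemma dep_rhs: "dep ({Time, Space} \<union> U 0 ` {..2}) rhs"
  unfolding dep_def rhs_def by auto

lemma dep_rhs_K: "dep K_jet rhs"
  by (rule dep_mono[OF dep_rhs]) (auto simp: K_jet_def)

lemma pde_eq: assumes p: "p \<in> D" shows "pde E p = cf E (p Space) * (p (U 1 0) - rhs p)"
proof -
  have "total_x (\<lambda>q. cA E (q (U 0 0)) * q (U 0 1)) p = Dx (\<lambda>q. cA E (q (U 0 0)) * q (U 0 1)) p"
    by (rule total_as_der) (use p in \<open>auto intro: dfun_mult dfun_coeffs dfun_coord\<close>)
  also have "\<dots> = p (U 0 1) * deriv (cA E) (p (U 0 0)) * p (U 0 1) + cA E (p (U 0 0)) * p (U 0 2)"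
    using der_line[of "U 0 0" "cA E" p shift_x] smooth_coeffs(3)
    by (simp add: der_mult dfun_coeffs dfun_coord p der_coord numeral_2_eq_2)
  finally show ?thesis
    using f_nz[of "p Space"] p by (simp add: pde_def rhs_def D_iff field_simps)
qed

text \<open>The total \<open>t\<close>-derivative on solutions, written in the coordinates
  \<open>K_jet\<close>: \<open>u_j\<close> moves with velocity \<open>D_x^j u_t\<close>. The value 0
  at the remaining coordinates keeps every component a function on \<open>K_jet\<close>.\<close>

definition evol :: "coord => jet => real" where
  "evol c = (case c of Time => \<lambda>p. 1 | Space => \<lambda>p. 0
    | U i j => if i = 0 then (Dx ^^ j) rhs else (\<lambda>p. 0))"

abbreviation "\<tau> \<equiv> der evol"

lemma dfun_evol: "dfun (evol c)" and dep_evol: "dep K_jet (evol c)"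
  by (cases c; simp add: evol_def dfun_const dep_const dfun_Dx_pow dfun_rhs dep_Dx_pow dep_rhs_K)+

lemma dfun_\<tau>: "dfun F ==> dfun (\<tau> F)"
  by (simp add: dfun_der dfun_evol)

lemma dep_\<tau>: "dfun F ==> dep K_jet F ==> dep K_jet (\<tau> F)"
  by (rule dep_der[where S=K_jet]) (auto intro: dep_evol)

lemma dfun_\<tau>_pow: "dfun F ==> dfun ((\<tau> ^^ j) F)"
  by (induction j) (auto intro: dfun_\<tau>)

lemma dep_\<tau>_pow: "dfun F ==> dep K_jet F ==> dep K_jet ((\<tau> ^^ j) F)"
  by (induction j) (auto intro: dep_\<tau> dfun_\<tau>_pow)

text \<open>By definition the velocity of \<open>u_(j+1)\<close> is the \<open>x\<close>-derivative
  of the velocity of \<open>u_j\<close>, which is the commutation of components that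
  \<open>der_commute\<close> asks for.\<close>

lemma \<tau>_Dx_commute:
  assumes "dfun F" "dep K_jet F" "p \<in> D" shows "\<tau> (Dx F) p = Dx (\<tau> F) p"
proof (rule der_commute[OF assms(1,2) dfun_shift(1) dfun_evol assms(3)])
  fix c assume "c \<in> K_jet"
  then consider "c = Time" | "c = Space" | j where "c = U 0 j" by (auto simp: K_jet_def)
  then show "\<tau> (shift_x c) p = Dx (evol c) p"
  proof cases
    case 1
    have "shift_x Time = (\<lambda>p. 0)" by auto
    then show ?thesis using 1 assms(3) by (simp add: evol_def der_const)
  next
    case 2
    have "shift_x Space = (\<lambda>p. 1)" by auto
    then show ?thesis using 2 assms(3) by (simp add: evol_def der_const)
  next
    case 3
    have "shift_x (U 0 j) = (\<lambda>p. p (U 0 (Suc j)))" by auto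
    then show ?thesis using 3 assms(3) by (simp add: evol_def der_coord)
  qed
qed

lemma \<tau>_Dx_pow:
  assumes "dfun F" "dep K_jet F" "p \<in> D" shows "\<tau> ((Dx ^^ j) F) p = (Dx ^^ j) (\<tau> F) p"
  using assms(3)
proof (induction j arbitrary: p)
  case (Suc j)
  have "\<tau> (Dx ((Dx ^^ j) F)) p = Dx (\<tau> ((Dx ^^ j) F)) p"
    by (intro \<tau>_Dx_commute dfun_Dx_pow dep_Dx_pow assms Suc.prems)
  also have "\<dots> = Dx ((Dx ^^ j) (\<tau> F)) p"
    by (rule der_cong[OF Suc.IH Suc.prems])
  finally show ?case by simp
qed simp

text \<open>Components of a retraction of the jet domain onto the solution jets. Coordinates in
  \<open>K_jet\<close> are kept; of \<open>Suc i\<close> time derivatives one is spent on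
  \<open>u_t = rhs\<close>, and the other \<open>i\<close> become applications of
  \<open>\<tau>\<close>.\<close>

definition sol_coord :: "coord => jet => real" where
  "sol_coord c = (case c of Time => \<lambda>p. p Time | Space => \<lambda>p. p Space
    | U i j => (case i of 0 => \<lambda>p. p (U 0 j) | Suc i => (Dx ^^ j) ((\<tau> ^^ i) rhs)))"

definition sol :: "jet => jet" where "sol p = (\<lambda>c. sol_coord c p)"

lemma sol_simps [simp]:
  "sol p Time = p Time" "sol p Space = p Space" "sol p (U 0 j) = p (U 0 j)"
  "sol p (U (Suc i) j) = (Dx ^^ j) ((\<tau> ^^ i) rhs) p"
  by (simp_all add: sol_def sol_coord_def)

lemma sol_D: "p \<in> D ==> sol p \<in> D"
  by (simp add: D_iff)

lemma dfun_sol_coord: "dfun (sol_coord c)"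
  by (auto simp: sol_coord_def dfun_coord intro!: dfun_Dx_pow dfun_\<tau>_pow dfun_rhs split: coord.split nat.split)

lemma dfun_sol: "dfun F ==> dfun (\<lambda>p. F (sol p))"
  unfolding sol_def by (rule dfun_comp) (use sol_D in \<open>auto simp: sol_def dfun_sol_coord\<close>)

lemma sol_dep: "dep K_jet F ==> p \<in> D ==> F (sol p) = F p"
  by (rule dep_eq[OF _ sol_D]) (auto simp: K_jet_def)

lemma dep_sol: assumes "dfun F" shows "dep K_jet (\<lambda>p. F (sol p))"
proof -
  have *: "dep K_jet (sol_coord c)" for c
  proof (cases c)
    case (U i j)
    then show ?thesis
      by (cases i) (auto simp: sol_coord_def K_jet_def[symmetric] dfun_\<tau>_pow dfun_rhs dep_rhs_K
          dep_\<tau>_pow intro!: dep_Dx_pow dep_coord, auto simp: K_jet_def)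
  qed (auto simp: sol_coord_def K_jet_def intro!: dep_coord)
  obtain S where S: "dep S F" using assms by (auto simp: dfun_iff)
  show ?thesis unfolding sol_def
    by (rule dep_comp[OF S *]) (use sol_D in \<open>auto simp: sol_def\<close>)
qed

text \<open>The map \<open>sol\<close> carries \<open>D_x\<close> to itself, because its component
  at \<open>U i (Suc j)\<close> is the \<open>x\<close>-derivative of the one at
  \<open>U i j\<close>.\<close>

lemma Dx_sol: assumes "dfun F" "p \<in> D" shows "Dx F (sol p) = Dx (\<lambda>p. F (sol p)) p"
  unfolding sol_def
proof (rule der_comp_transfer[OF assms(1) dfun_sol_coord _ assms(2)])
  show "(\<lambda>c. sol_coord c p) \<in> D" if "p \<in> D" for p using sol_D[OF that] by (simp add: sol_def)
  show "shift_x c (\<lambda>c. sol_coord c p) = Dx (sol_coord c) p" for c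
  proof (cases c)
    case (U i j)
    then show ?thesis using assms(2) by (cases i) (auto simp: sol_coord_def der_coord)
  qed (use assms(2) in \<open>auto simp: sol_coord_def der_coord\<close>)
qed

text \<open>Raising the \<open>t\<close>-index of a component of \<open>sol\<close> has to amount to
  applying \<open>\<tau>\<close>, although in its definition the \<open>x\<close>-derivatives are
  taken last; this is where \<open>\<tau>\<close> and \<open>D_x\<close> must commute.\<close>

lemma Dt_sol: assumes "dfun F" "p \<in> D" shows "Dt F (sol p) = \<tau> (\<lambda>p. F (sol p)) p"
  unfolding sol_def
proof (rule der_comp_transfer[OF assms(1) dfun_sol_coord _ assms(2)])
  show "(\<lambda>c. sol_coord c p) \<in> D" if "p \<in> D" for p using sol_D[OF that] by (simp add: sol_def)
  show "shift_t c (\<lambda>c. sol_coord c p) = \<tau> (sol_coord c) p" for c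
  proof (cases c)
    case (U i j)
    show ?thesis
    proof (cases i)
      case 0
      then show ?thesis using assms(2) U by (simp add: sol_coord_def der_coord evol_def)
    next
      case (Suc k)
      have "\<tau> ((Dx ^^ j) ((\<tau> ^^ k) rhs)) p = (Dx ^^ j) (\<tau> ((\<tau> ^^ k) rhs)) p"
        by (rule \<tau>_Dx_pow) (auto intro: dfun_\<tau>_pow dep_\<tau>_pow dfun_rhs dep_rhs_K assms(2))
      then show ?thesis using U Suc by (simp add: sol_coord_def)
    qed
  qed (use assms(2) in \<open>auto simp: sol_coord_def der_coord evol_def\<close>)
qed

lemma Dx_pow_sol: "dfun F ==> p \<in> D ==> (Dx ^^ j) F (sol p) = (Dx ^^ j) (\<lambda>p. F (sol p)) p"
proof (induction j arbitrary: p)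
  case (Suc j)
  have "Dx ((Dx ^^ j) F) (sol p) = Dx (\<lambda>p. (Dx ^^ j) F (sol p)) p"
    by (rule Dx_sol) (use Suc dfun_Dx_pow in auto)
  also have "\<dots> = Dx ((Dx ^^ j) (\<lambda>p. F (sol p))) p"
    by (rule der_cong) (use Suc in auto)
  finally show ?case by simp
qed simp

lemma Dt_pow_sol: "dfun F ==> p \<in> D ==> (Dt ^^ j) F (sol p) = (\<tau> ^^ j) (\<lambda>p. F (sol p)) p"
proof (induction j arbitrary: p)
  case (Suc j)
  have "Dt ((Dt ^^ j) F) (sol p) = \<tau> (\<lambda>p. (Dt ^^ j) F (sol p)) p"
    by (rule Dt_sol) (use Suc dfun_Dt_pow in auto)
  also have "\<dots> = \<tau> ((\<tau> ^^ j) (\<lambda>p. F (sol p))) p"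
    by (rule der_cong) (use Suc in auto)
  finally show ?case by simp
qed simp

lemma der_pow_cong:
  "(\<And>p. p \<in> D ==> F p = G p) ==> p \<in> D ==> (der \<xi> ^^ j) F p = (der \<xi> ^^ j) G p"
  by (induction j arbitrary: p) (auto intro: der_cong)

lemma der_pow_zero: "p \<in> D ==> (der \<xi> ^^ j) (\<lambda>p. 0) p = 0"
proof (induction j arbitrary: p)
  case (Suc j)
  then have "der \<xi> ((der \<xi> ^^ j) (\<lambda>p. 0)) p = der \<xi> (\<lambda>p. 0) p" by (intro der_cong) auto
  then show ?case using Suc.prems by (simp add: der_const)
qed simp

lemma dfun_pde: "dfun (pde E)"
proof -
  have "dfun (\<lambda>p. cf E (p Space) * (p (U 1 0) - rhs p))"
    by (intro dfun_mult dfun_diff dfun_coeffs dfun_coord dfun_rhs)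
  then show ?thesis by (rule dfun_cong[rotated]) (simp add: pde_eq)
qed

lemma total_x_pow: "dfun F ==> p \<in> D ==> (total_x ^^ j) F p = (Dx ^^ j) F p"
proof (induction j arbitrary: p)
  case (Suc j)
  have "dfun ((total_x ^^ j) F)"
    by (rule dfun_cong[of "(Dx ^^ j) F"]) (use Suc dfun_Dx_pow in auto)
  then have "total_x ((total_x ^^ j) F) p = Dx ((total_x ^^ j) F) p"
    using total_as_der Suc.prems by blast
  also have "\<dots> = Dx ((Dx ^^ j) F) p" by (rule der_cong) (use Suc in auto)
  finally show ?case by simp
qed simp

lemma total_t_pow: "dfun F ==> p \<in> D ==> (total_t ^^ j) F p = (Dt ^^ j) F p"
proof (induction j arbitrary: p)
  case (Suc j)
  have "dfun ((total_t ^^ j) F)"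
    by (rule dfun_cong[of "(Dt ^^ j) F"]) (use Suc dfun_Dt_pow in auto)
  then have "total_t ((total_t ^^ j) F) p = Dt ((total_t ^^ j) F) p"
    using total_as_der Suc.prems by blast
  also have "\<dots> = Dt ((Dt ^^ j) F) p" by (rule der_cong) (use Suc in auto)
  finally show ?case by simp
qed simp

lemma solution_jets_iff:
  "p \<in> solution_jets E \<longleftrightarrow> p \<in> D \<and> (\<forall>i j. (Dt ^^ i) ((Dx ^^ j) (pde E)) p = 0)"
proof -
  have "(total_t ^^ i) ((total_x ^^ j) (pde E)) p = (Dt ^^ i) ((Dx ^^ j) (pde E)) p"
    if p: "p \<in> D" for i j
  proof -
    have *: "\<And>p. p \<in> D ==> (Dx ^^ j) (pde E) p = (total_x ^^ j) (pde E) p"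
      using total_x_pow dfun_pde by simp
    have "dfun ((total_x ^^ j) (pde E))" by (rule dfun_cong[OF * dfun_Dx_pow[OF dfun_pde]])
    then show ?thesis using total_t_pow p der_pow_cong[OF *] by simp
  qed
  then show ?thesis by (auto simp: solution_jets_def D_eq[symmetric])
qed

text \<open>The pullback of the equation under \<open>sol\<close> vanishes identically, and its
  derivatives pull back to derivatives of zero along \<open>D_x\<close> and
  \<open>\<tau>\<close>.\<close>

lemma sol_in_solution_jets: assumes p: "p \<in> D" shows "sol p \<in> solution_jets E"
proof -
  have "(Dt ^^ i) ((Dx ^^ j) (pde E)) (sol p) = 0" for i j
  proof -
    have z: "pde E (sol q) = 0" if q: "q \<in> D" for q
      using pde_eq[OF sol_D[OF q]] sol_dep[OF dep_rhs_K q] by simp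
    have "(Dt ^^ i) ((Dx ^^ j) (pde E)) (sol p) = (\<tau> ^^ i) (\<lambda>p. (Dx ^^ j) (pde E) (sol p)) p"
      by (rule Dt_pow_sol) (auto intro: dfun_Dx_pow dfun_pde p)
    also have "\<dots> = (\<tau> ^^ i) (\<lambda>p. 0) p"
    proof (rule der_pow_cong[OF _ p])
      fix q assume q: "q \<in> D"
      have "(Dx ^^ j) (pde E) (sol q) = (Dx ^^ j) (\<lambda>p. pde E (sol p)) q"
        by (rule Dx_pow_sol[OF dfun_pde q])
      also have "\<dots> = (Dx ^^ j) (\<lambda>p. 0) q" by (rule der_pow_cong[OF z q])
      finally show "(Dx ^^ j) (pde E) (sol q) = 0" using der_pow_zero q by simp
    qed
    finally show ?thesis using der_pow_zero p by simp
  qed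
  then show ?thesis using sol_D[OF p] by (simp add: solution_jets_iff)
qed

end

section \<open>Solution jets are fixed by the parametrisation\<close>

context eqn
begin

lemma der_pow_add:
  assumes "\<And>c. dfun (\<xi> c)" "dfun F" "dfun G" "p \<in> D"
  shows "(der \<xi> ^^ j) (\<lambda>p. F p + G p) p = (der \<xi> ^^ j) F p + (der \<xi> ^^ j) G p"
  using assms(4)
proof (induction j arbitrary: p)
  case (Suc j)
  have d: "dfun ((der \<xi> ^^ i) F)" "dfun ((der \<xi> ^^ i) G)" for i
    by (induction i) (auto intro: dfun_der assms)
  have "der \<xi> ((der \<xi> ^^ j) (\<lambda>p. F p + G p)) p = der \<xi> (\<lambda>p. (der \<xi> ^^ j) F p + (der \<xi> ^^ j) G p) p"
    by (rule der_cong[OF Suc.IH Suc.prems])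
  then show ?case using d Suc.prems by (simp add: der_add)
qed simp

lemma Dt_pow_mult_x:
  assumes "smooth_on_line (xdom E) a" "dfun F" "p \<in> D"
  shows "(Dt ^^ i) (\<lambda>p. a (p Space) * F p) p = a (p Space) * (Dt ^^ i) F p"
  using assms(3)
proof (induction i arbitrary: p)
  case (Suc i)
  have "Dt ((Dt ^^ i) (\<lambda>p. a (p Space) * F p)) p = Dt (\<lambda>p. a (p Space) * (Dt ^^ i) F p) p"
    by (rule der_cong[OF Suc.IH Suc.prems])
  also have "\<dots> = a (p Space) * Dt ((Dt ^^ i) F) p"
    using der_line[of Space a p shift_t] assms(1,2) Suc.prems
    by (simp add: der_mult dfun_x dfun_Dt_pow)
  finally show ?case by simp
qed simp

text \<open>By the Leibniz rule. It allows the equation to be divided by \<open>f\<close>, so that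
  \<open>u_t - rhs\<close> vanishes together with all its differential consequences.\<close>

lemma solution_jets_ideal:
  assumes q: "q \<in> solution_jets E"
    and a: "smooth_on_line (xdom E) a" and F: "dfun F" "\<And>i j. (Dt ^^ i) ((Dx ^^ j) F) q = 0"
  shows "(Dt ^^ i) ((Dx ^^ j) (\<lambda>p. a (p Space) * F p)) q = 0"
  using a F
proof (induction j arbitrary: a F)
  case 0
  then show ?case using Dt_pow_mult_x[of a F q i] q "0.prems"(3)[of i 0] by (simp add: solution_jets_iff)
next
  case (Suc j)
  have qD: "q \<in> D" using q by (simp add: solution_jets_iff)
  let ?G1 = "\<lambda>p. deriv a (p Space) * F p" and ?G2 = "\<lambda>p. a (p Space) * Dx F p"
  have da: "smooth_on_line (xdom E) (deriv a)" using Suc.prems(1) by (rule smooth_on_line_deriv)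
  have G: "dfun ?G1" "dfun ?G2"
    using Suc.prems da by (auto intro!: dfun_mult dfun_x dfun_Dx)
  have "(Dt ^^ i) ((Dx ^^ Suc j) (\<lambda>p. a (p Space) * F p)) q =
      (Dt ^^ i) ((Dx ^^ j) (Dx (\<lambda>p. a (p Space) * F p))) q"
    by (simp add: funpow_swap1)
  also have "\<dots> = (Dt ^^ i) ((Dx ^^ j) (\<lambda>p. ?G1 p + ?G2 p)) q"
  proof (intro der_pow_cong qD)
    fix p assume p: "p \<in> D"
    show "Dx (\<lambda>p. a (p Space) * F p) p = ?G1 p + ?G2 p"
      using der_line[of Space a p shift_x] Suc.prems(1,2) p by (simp add: der_mult dfun_x)
  qed
  also have "\<dots> = (Dt ^^ i) (\<lambda>p. (Dx ^^ j) ?G1 p + (Dx ^^ j) ?G2 p) q"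
    by (intro der_pow_cong[OF der_pow_add] qD dfun_shift G)
  also have "\<dots> = (Dt ^^ i) ((Dx ^^ j) ?G1) q + (Dt ^^ i) ((Dx ^^ j) ?G2) q"
    by (intro der_pow_add dfun_shift dfun_Dx_pow G qD)
  also have "(Dt ^^ i) ((Dx ^^ j) ?G1) q = 0"
    by (rule Suc.IH[OF da Suc.prems(2,3)])
  also have "(Dt ^^ i) ((Dx ^^ j) ?G2) q = 0"
  proof (rule Suc.IH[OF Suc.prems(1) dfun_Dx[OF Suc.prems(2)]])
    show "(Dt ^^ i) ((Dx ^^ j) (Dx F)) q = 0" for i j
      using Suc.prems(3)[of i "Suc j"] by (simp add: funpow_swap1)
  qed
  finally show ?case by simp
qed

lemma \<tau>_pow_Dx_pow:
  assumes "dfun F" "dep K_jet F" "p \<in> D"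
  shows "(\<tau> ^^ i) ((Dx ^^ j) F) p = (Dx ^^ j) ((\<tau> ^^ i) F) p"
  using assms(3)
proof (induction i arbitrary: p)
  case (Suc i)
  have "\<tau> ((\<tau> ^^ i) ((Dx ^^ j) F)) p = \<tau> ((Dx ^^ j) ((\<tau> ^^ i) F)) p"
    by (rule der_cong[OF Suc.IH Suc.prems])
  also have "\<dots> = (Dx ^^ j) (\<tau> ((\<tau> ^^ i) F)) p"
    by (intro \<tau>_Dx_pow dfun_\<tau>_pow dep_\<tau>_pow assms Suc.prems)
  finally show ?case by simp
qed simp

definition L_jet :: "nat => coord set" where
  "L_jet n = {Time, Space} \<union> {U i j | i j. i \<le> n}"

lemma dep_Dt_pow: "dfun F ==> dep K_jet F ==> dep (L_jet i) ((Dt ^^ i) F)"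
proof (induction i)
  case 0
  then show ?case by (auto intro: dep_mono simp: K_jet_def L_jet_def)
next
  case (Suc i)
  have "dep (L_jet (Suc i)) (Dt ((Dt ^^ i) F))"
  proof (rule dep_der[OF dfun_Dt_pow[OF Suc.prems(1)] Suc.IH[OF Suc.prems]])
    show "L_jet i \<subseteq> L_jet (Suc i)" by (auto simp: L_jet_def)
    show "dep (L_jet (Suc i)) (shift_t c)" if "c \<in> L_jet i" for c
      using that by (cases c) (auto simp: L_jet_def dep_def)
  qed
  then show ?case by simp
qed

text \<open>Induction on the \<open>t\<close>-order: the consequences of the equation express a
  derivative of \<open>t\<close>-order \<open>Suc n\<close> by \<open>D_t^n D_x^j rhs\<close>, which
  involves \<open>t\<close>-orders up to \<open>n\<close> only, where \<open>q\<close> and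
  \<open>sol q\<close> already agree.\<close>

lemma solution_jets_sol:
  assumes q: "q \<in> solution_jets E" shows "sol q = q"
proof -
  have qD: "q \<in> D" using q by (simp add: solution_jets_iff)
  let ?g = "\<lambda>p. p (U 1 0) - rhs p"
  have g: "dfun ?g" by (intro dfun_diff dfun_coord dfun_rhs)
  have "(Dt ^^ i) ((Dx ^^ j) (\<lambda>p. inverse (cf E (p Space)) * pde E p)) q = 0" for i j
    using q by (intro solution_jets_ideal[OF q] smooth_on_line_inverse smooth_coeffs f_nz
        open_domains dfun_pde) (auto simp: solution_jets_iff)
  moreover have "(Dt ^^ i) ((Dx ^^ j) (\<lambda>p. inverse (cf E (p Space)) * pde E p)) q =
      (Dt ^^ i) ((Dx ^^ j) ?g) q" for i j
    by (intro der_pow_cong qD) (simp add: pde_eq f_nz D_iff)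
  ultimately have g0: "(Dt ^^ i) ((Dx ^^ j) ?g) q = 0" for i j by simp
  have u: "(Dx ^^ j) (\<lambda>p. p (U k l)) p = p (U k (l + j))" if "p \<in> D" for j k l p
    using that
  proof (induction j arbitrary: p)
    case (Suc j)
    have "Dx ((Dx ^^ j) (\<lambda>p. p (U k l))) p = Dx (\<lambda>p. p (U k (l + j))) p"
      by (rule der_cong[OF Suc.IH Suc.prems])
    then show ?case using Suc.prems by (simp add: der_coord)
  qed simp
  have ut: "(Dt ^^ j) (\<lambda>p. p (U k l)) p = p (U (k + j) l)" if "p \<in> D" for j k l p
    using that
  proof (induction j arbitrary: p)
    case (Suc j)
    have "Dt ((Dt ^^ j) (\<lambda>p. p (U k l))) p = Dt (\<lambda>p. p (U (k + j) l)) p"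
      by (rule der_cong[OF Suc.IH Suc.prems])
    then show ?case using Suc.prems by (simp add: der_coord)
  qed simp
  have key: "q (U (Suc i) j) = (Dt ^^ i) ((Dx ^^ j) rhs) q" for i j
  proof -
    have "(Dt ^^ i) ((Dx ^^ j) (\<lambda>p. p (U 1 0))) q = (Dt ^^ i) ((Dx ^^ j) (\<lambda>p. ?g p + rhs p)) q"
      by simp
    also have "\<dots> = (Dt ^^ i) (\<lambda>p. (Dx ^^ j) ?g p + (Dx ^^ j) rhs p) q"
      by (intro der_pow_cong[OF der_pow_add] qD dfun_shift g dfun_rhs)
    also have "\<dots> = (Dt ^^ i) ((Dx ^^ j) ?g) q + (Dt ^^ i) ((Dx ^^ j) rhs) q"
      by (intro der_pow_add dfun_shift dfun_Dx_pow g dfun_rhs qD)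
    also have "(Dt ^^ i) ((Dx ^^ j) (\<lambda>p. p (U 1 0))) q = (Dt ^^ i) (\<lambda>p. p (U 1 j)) q"
      using u[of _ j 1 0] by (intro der_pow_cong qD) simp
    finally show ?thesis using ut[OF qD] g0 by simp
  qed
  have "\<forall>i\<le>n. \<forall>j. sol q (U i j) = q (U i j)" for n
  proof (induction n)
    case (Suc n)
    have "sol q (U (Suc n) j) = q (U (Suc n) j)" for j
    proof -
      have "q (U (Suc n) j) = (Dt ^^ n) ((Dx ^^ j) rhs) (sol q)"
        unfolding key
        by (rule dep_eq[OF dep_Dt_pow[OF dfun_Dx_pow[OF dfun_rhs] dep_Dx_pow[OF dfun_rhs dep_rhs_K]]
              qD sol_D[OF qD]]) (use Suc.IH in \<open>auto simp: L_jet_def\<close>)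
      also have "\<dots> = (\<tau> ^^ n) (\<lambda>p. (Dx ^^ j) rhs (sol p)) q"
        by (intro Dt_pow_sol dfun_Dx_pow dfun_rhs qD)
      also have "\<dots> = (\<tau> ^^ n) ((Dx ^^ j) rhs) q"
        by (intro der_pow_cong sol_dep dep_Dx_pow dfun_rhs dep_rhs_K qD)
      also have "\<dots> = sol q (U (Suc n) j)"
        by (simp add: \<tau>_pow_Dx_pow dfun_rhs dep_rhs_K qD)
      finally show ?thesis by simp
    qed
    then show ?case using Suc.IH by (auto simp: le_Suc_eq)
  qed simp
  then have "sol q c = q c" for c by (cases c) auto
  then show ?thesis by blast
qed

section \<open>Order reduction of conserved vectors\<close>

definition K :: "nat => coord set" where "K n = {Time, Space} \<union> U 0 ` {..n}"

lemma K_mono: "m \<le> n ==> K m \<subseteq> K n" and K_subset: "K n \<subseteq> K_jet" and finite_K: "finite (K n)"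
  and K_Suc: "K (Suc n) - {U 0 (Suc n)} = K n"
  by (auto simp: K_def K_jet_def)

lemma K_mem: "Time \<in> K n" "Space \<in> K n" "U 0 k \<in> K n \<longleftrightarrow> k \<le> n"
  by (auto simp: K_def)

lemma sum_K: "(\<Sum>c\<in>K n. g c) = g Time + g Space + (\<Sum>k\<le>n. g (U 0 k) :: real)"
proof -
  have "inj_on (U 0) {..n}" by (auto simp: inj_on_def)
  then have "(\<Sum>c\<in>U 0 ` {..n}. g c) = (\<Sum>k\<le>n. g (U 0 k))" by (simp add: sum.reindex o_def)
  moreover have "K n = insert Time (insert Space (U 0 ` {..n}))" by (auto simp: K_def)
  ultimately show ?thesis by (subst \<open>K n = _\<close>, subst sum.insert; (subst sum.insert)?; auto)
qed

lemma dep_K_mono: "dep (K m) F ==> m \<le> n ==> dep (K n) F"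
  by (rule dep_mono[OF _ K_mono])

lemma dep_K_exists: assumes "dfun F" "dep K_jet F" shows "\<exists>n. dep (K n) F"
proof -
  obtain S where S: "finite S" "dep S F" using assms(1) by (auto simp: dfun_iff)
  have "finite (U 0 -` S)" by (rule finite_vimageI[OF S(1)]) (auto simp: inj_def)
  then obtain n where n: "\<forall>k\<in>U 0 -` S. k \<le> n" using finite_nat_set_iff_bounded_le by auto
  have "S \<inter> K_jet \<subseteq> K n" using n by (auto simp: K_def K_jet_def)
  then show ?thesis using dep_mono[OF dep_Int[OF S(2) assms(2)]] by blast
qed

text \<open>The highest derivative in \<open>D_x F\<close> stems from the highest one in
  \<open>F\<close> and enters linearly. The order reduction consists of comparing coefficients of
  such top derivatives.\<close>

lemma Dx_top:
  assumes "dfun F" "dep (K n) F"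
  shows "\<exists>B. dep (K n) B \<and> (\<forall>p\<in>D. Dx F p = B p + p (U 0 (Suc n)) * partial (U 0 n) F p)"
proof (intro exI conjI ballI)
  let ?B = "\<lambda>p. partial Space F p + (\<Sum>k<n. p (U 0 (Suc k)) * partial (U 0 k) F p)"
  show "dep (K n) ?B"
    by (intro dep_add dep_sum dep_mult dep_partial[OF assms(2)] dep_coord) (auto simp: K_def)
  fix p assume "p \<in> D"
  then show "Dx F p = ?B p + p (U 0 (Suc n)) * partial (U 0 n) F p"
    by (simp add: der_eq[OF finite_K assms(2)] sum_K lessThan_Suc_atMost[symmetric])
qed

lemma dep_Dx_K: assumes "dfun F" "dep (K n) F" shows "dep (K (Suc n)) (Dx F)"
proof (rule dep_der[OF assms K_mono])
  show "dep (K (Suc n)) (shift_x c)" if "c \<in> K n" for c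
    using that by (auto simp: K_def dep_def)
qed simp

abbreviation W :: "nat => jet => real" where "W j \<equiv> (Dx ^^ j) rhs"

lemma dfun_W: "dfun (W j)"
  by (rule dfun_Dx_pow[OF dfun_rhs])

text \<open>The diffusion coefficient \<open>A / f\<close>, which multiplies the highest derivative
  in every \<open>D_x^j u_t\<close>.\<close>

definition aJ :: "jet => real" where
  "aJ p = cA E (p (U 0 0)) * inverse (cf E (p Space))"

lemma dfun_aJ: "dfun aJ"
  unfolding aJ_def[abs_def] by (intro dfun_mult dfun_coeffs dfun_inverse_f)

lemma dep_aJ: "dep (K n) aJ"
  by (auto simp: dep_def aJ_def K_def)

lemma aJ_nz: "p \<in> D ==> aJ p \<noteq> 0"
  using A_nz f_nz by (simp add: aJ_def D_iff)

text \<open>While \<open>u_t\<close> itself is quadratic in \<open>u_x\<close>, after a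
  differentiation also the second highest derivative enters linearly with a coefficient of lower
  order. This is the second statement, and the reason why densities of order zero are treated apart
  in \<open>reduce_base\<close>.\<close>

lemma W_top:
  "\<exists>R. dfun R \<and> dep (K (Suc j)) R \<and> (\<forall>p\<in>D. W j p = aJ p * p (U 0 (Suc (Suc j))) + R p)"
  "\<exists>P Q. dep (K (Suc j)) P \<and> dep (K (Suc j)) Q \<and> (\<forall>p\<in>D. W (Suc j) p =
      aJ p * p (U 0 (Suc (Suc (Suc j)))) + P p * p (U 0 (Suc (Suc j))) + Q p)"
proof -
  have step: "\<exists>P Q. dep (K (Suc j)) P \<and> dep (K (Suc j)) Q \<and> (\<forall>p\<in>D. W (Suc j) p =
      aJ p * p (U 0 (Suc (Suc (Suc j)))) + P p * p (U 0 (Suc (Suc j))) + Q p)"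
    if R: "dfun R" "dep (K (Suc j)) R" "\<forall>p\<in>D. W j p = aJ p * p (U 0 (Suc (Suc j))) + R p" for j R
  proof -
    obtain B where B: "dep (K (Suc j)) B"
      "\<forall>p\<in>D. Dx R p = B p + p (U 0 (Suc (Suc j))) * partial (U 0 (Suc j)) R p"
      using Dx_top[OF R(1,2)] by blast
    have "W (Suc j) p = aJ p * p (U 0 (Suc (Suc (Suc j)))) +
        (Dx aJ p + partial (U 0 (Suc j)) R p) * p (U 0 (Suc (Suc j))) + B p" if p: "p \<in> D" for p
    proof -
      have "W (Suc j) p = Dx (W j) p" by simp
      also have "\<dots> = Dx (\<lambda>p. aJ p * p (U 0 (Suc (Suc j))) + R p) p"
        by (rule der_cong[OF _ p]) (use R(3) in auto)
      also have "\<dots> = Dx aJ p * p (U 0 (Suc (Suc j))) + aJ p * p (U 0 (Suc (Suc (Suc j)))) + Dx R p"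
        using p R(1) by (simp add: der_add der_mult dfun_mult dfun_aJ dfun_coord der_coord)
      finally show ?thesis using B(2) p by (simp add: algebra_simps)
    qed
    moreover have "dep (K (Suc j)) (\<lambda>p. Dx aJ p + partial (U 0 (Suc j)) R p)"
      by (intro dep_add dep_partial R dep_K_mono[OF dep_Dx_K[OF dfun_aJ dep_aJ[of 0]]]) simp
    ultimately show ?thesis using B(1) by blast
  qed
  show R: "\<exists>R. dfun R \<and> dep (K (Suc j)) R \<and> (\<forall>p\<in>D. W j p = aJ p * p (U 0 (Suc (Suc j))) + R p)" for j
  proof (induction j)
    case 0
    let ?R = "\<lambda>p. rhs p - aJ p * p (U 0 2)"
    have "dfun ?R" by (intro dfun_diff dfun_mult dfun_rhs dfun_aJ dfun_coord)
    moreover have "dep (K (Suc 0)) ?R"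
      by (auto simp: dep_def rhs_def aJ_def K_def algebra_simps)
    ultimately show ?case by (intro exI[of _ ?R]) (auto simp: numeral_2_eq_2)
  next
    case (Suc j)
    then obtain R where R: "dfun R" "dep (K (Suc j)) R"
      "\<forall>p\<in>D. W j p = aJ p * p (U 0 (Suc (Suc j))) + R p" by blast
    obtain P Q where PQ: "dep (K (Suc j)) P" "dep (K (Suc j)) Q" "\<forall>p\<in>D. W (Suc j) p =
      aJ p * p (U 0 (Suc (Suc (Suc j)))) + P p * p (U 0 (Suc (Suc j))) + Q p"
      using step[OF R] by blast
    let ?R = "\<lambda>p. W (Suc j) p - aJ p * p (U 0 (Suc (Suc (Suc j))))"
    have "dfun ?R" by (intro dfun_diff dfun_mult dfun_W dfun_aJ dfun_coord)
    moreover have "dep (K (Suc (Suc j))) (\<lambda>p. P p * p (U 0 (Suc (Suc j))) + Q p)"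
      by (intro dep_add dep_mult dep_coord dep_K_mono[OF PQ(1)] dep_K_mono[OF PQ(2)])
        (auto simp: K_def)
    then have "dep (K (Suc (Suc j))) ?R"
      by (rule dep_cong[rotated]) (use PQ(3) in auto)
    ultimately show ?case by (intro exI[of _ ?R]) auto
  qed
  show "\<exists>P Q. dep (K (Suc j)) P \<and> dep (K (Suc j)) Q \<and> (\<forall>p\<in>D. W (Suc j) p =
      aJ p * p (U 0 (Suc (Suc (Suc j)))) + P p * p (U 0 (Suc (Suc j))) + Q p)"
    using R[of j] step by blast
qed

lemma dep_W: "dep (K (Suc (Suc j))) (W j)"
proof -
  obtain R where R: "dep (K (Suc j)) R" "\<forall>p\<in>D. W j p = aJ p * p (U 0 (Suc (Suc j))) + R p"
    using W_top(1) by blast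
  have "dep (K (Suc (Suc j))) (\<lambda>p. aJ p * p (U 0 (Suc (Suc j))) + R p)"
    by (intro dep_add dep_mult dep_aJ dep_coord dep_K_mono[OF R(1)]) (auto simp: K_def)
  then show ?thesis by (rule dep_cong[rotated]) (use R(2) in auto)
qed

lemma \<tau>_K:
  assumes "dep (K n) F" "p \<in> D"
  shows "\<tau> F p = partial Time F p + (\<Sum>k\<le>n. W k p * partial (U 0 k) F p)"
  by (simp add: der_eq[OF finite_K assms] sum_K evol_def)

lemma dep_\<tau>_K: assumes "dfun F" "dep (K n) F" shows "dep (K (Suc (Suc n))) (\<tau> F)"
proof (rule dep_der[OF assms K_mono])
  show "dep (K (Suc (Suc n))) (evol c)" if "c \<in> K n" for c
    using that dep_K_mono[OF dep_W, of _ "Suc (Suc n)"]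
    by (auto simp: K_def[of n] evol_def intro: dep_const)
qed simp

lemma \<tau>_top:
  assumes "dfun F" "dep (K (Suc m)) F"
  shows "\<exists>M N. dep (K (Suc m)) M \<and> dep (K (Suc m)) N \<and> (\<forall>p\<in>D. \<tau> F p =
    aJ p * p (U 0 (Suc (Suc (Suc m)))) * partial (U 0 (Suc m)) F p + M p * p (U 0 (Suc (Suc m))) + N p)"
proof -
  obtain R where R: "dep (K (Suc m)) R" "\<forall>p\<in>D. W m p = aJ p * p (U 0 (Suc (Suc m))) + R p"
    using W_top(1) by blast
  obtain P Q where PQ: "dep (K (Suc m)) P" "dep (K (Suc m)) Q" "\<forall>p\<in>D. W (Suc m) p =
      aJ p * p (U 0 (Suc (Suc (Suc m)))) + P p * p (U 0 (Suc (Suc m))) + Q p"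
    using W_top(2) by blast
  let ?M = "\<lambda>p. P p * partial (U 0 (Suc m)) F p + aJ p * partial (U 0 m) F p"
  let ?N = "\<lambda>p. partial Time F p + (\<Sum>k<m. W k p * partial (U 0 k) F p) +
      Q p * partial (U 0 (Suc m)) F p + R p * partial (U 0 m) F p"
  have "dep (K (Suc m)) ?M" by (intro dep_add dep_mult dep_partial assms PQ dep_aJ)
  moreover have "dep (K (Suc m)) ?N"
    by (intro dep_add dep_mult dep_sum dep_partial assms PQ R dep_K_mono[OF dep_W]) auto
  moreover have "\<tau> F p = aJ p * p (U 0 (Suc (Suc (Suc m)))) * partial (U 0 (Suc m)) F p +
      ?M p * p (U 0 (Suc (Suc m))) + ?N p" if p: "p \<in> D" for p
  proof -
    have "(\<Sum>k\<le>Suc m. W k p * partial (U 0 k) F p) = (\<Sum>k<m. W k p * partial (U 0 k) F p) +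
        W m p * partial (U 0 m) F p + W (Suc m) p * partial (U 0 (Suc m)) F p"
      by (simp only: lessThan_Suc_atMost[symmetric] sum.lessThan_Suc)
    then show ?thesis
      unfolding \<tau>_K[OF assms(2) p] using PQ(3) R(2) p by (simp add: algebra_simps del: funpow.simps)
  qed
  ultimately show ?thesis by blast
qed

text \<open>The values \<open>0\<close>, \<open>1\<close> and \<open>-1\<close> of the top variable
  suffice. The variable is at least \<open>u_x\<close> because, unlike \<open>u\<close>, it ranges
  over all reals.\<close>

lemma polynomial_coeffs_zero:
  assumes "dep (K n) \<alpha>" "dep (K n) \<beta>" "dep (K n) \<gamma>"
    and eq: "\<And>p. p \<in> D ==> \<alpha> p + \<beta> p * p (U 0 (Suc n)) + \<gamma> p * (p (U 0 (Suc n)))\<^sup>2 = 0"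
    and p: "p \<in> D"
  shows "\<alpha> p = 0" "\<beta> p = 0" "\<gamma> p = 0"
proof -
  have "\<alpha> p + \<beta> p * v + \<gamma> p * v\<^sup>2 = 0" for v
  proof -
    let ?q = "p(U 0 (Suc n) := v)"
    have q: "?q \<in> D" using p by (simp add: D_iff)
    have "\<alpha> ?q = \<alpha> p" "\<beta> ?q = \<beta> p" "\<gamma> ?q = \<gamma> p"
      by (rule dep_eq[OF assms(1) q p] dep_eq[OF assms(2) q p] dep_eq[OF assms(3) q p];
          auto simp: K_def)+
    then show ?thesis using eq[OF q] by simp
  qed
  from this[of 0] this[of 1] this[of "-1"] show "\<alpha> p = 0" "\<beta> p = 0" "\<gamma> p = 0" by simp_all
qed

text \<open>\<open>\<tau> F\<close> has order at most \<open>r + 2\<close>, so a flux of order above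
  \<open>r + 1\<close> would leave the top derivative in \<open>D_x G\<close> unmatched.\<close>

lemma flux_order:
  assumes F: "dfun F" "dep (K r) F" and G: "dfun G" "dep (K s) G"
    and eq: "\<And>p. p \<in> D ==> \<tau> F p + Dx G p = 0"
  shows "dep (K (Suc r)) G"
  using G(2)
proof (induction s)
  case 0
  then show ?case by (rule dep_K_mono) simp
next
  case (Suc s)
  show ?case
  proof (cases "Suc s \<le> Suc r")
    case True then show ?thesis using Suc.prems dep_K_mono by blast
  next
    case False
    obtain B where B: "dep (K (Suc s)) B"
      "\<forall>p\<in>D. Dx G p = B p + p (U 0 (Suc (Suc s))) * partial (U 0 (Suc s)) G p"
      using Dx_top[OF G(1) Suc.prems] by blast
    have "partial (U 0 (Suc s)) G p = 0" if p: "p \<in> D" for p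
    proof (rule polynomial_coeffs_zero(2)[OF _ _ dep_const[of _ 0] _ p])
      show "dep (K (Suc s)) (\<lambda>p. \<tau> F p + B p)"
        using False by (intro dep_add B dep_K_mono[OF dep_\<tau>_K[OF F]]) simp
      show "dep (K (Suc s)) (partial (U 0 (Suc s)) G)" by (rule dep_partial[OF Suc.prems])
      fix q assume "q \<in> D"
      then show "\<tau> F q + B q + partial (U 0 (Suc s)) G q * q (U 0 (Suc (Suc s))) +
          0 * (q (U 0 (Suc (Suc s))))\<^sup>2 = 0"
        using eq[of q] B(2) by (simp add: algebra_simps)
    qed
    then have "dep (K (Suc s) - {U 0 (Suc s)}) G"
      by (rule dep_diff[OF dfun_smooth[OF G(1)] Suc.prems])
    then show ?thesis using Suc.IH by (simp add: K_Suc)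
  qed
qed

lemma flux_top:
  assumes F: "dfun F" "dep (K r) F" and G: "dfun G" "dep (K (Suc r)) G"
    and eq: "\<And>p. p \<in> D ==> partial (U 0 (Suc r)) G p = - aJ p * partial (U 0 r) F p"
    and Fr: "dep (K r) (partial (U 0 r) F)"
  shows "\<exists>G0. dfun G0 \<and> dep (K r) G0 \<and>
    (\<forall>p\<in>D. G p = G0 p - aJ p * partial (U 0 r) F p * p (U 0 (Suc r)))"
proof -
  let ?a = "\<lambda>p. aJ p * partial (U 0 r) F p"
  let ?G0 = "\<lambda>p. G p + ?a p * p (U 0 (Suc r))"
  have a: "dfun ?a" "dep (K r) ?a" by (intro dfun_mult dfun_aJ dfun_partial F dep_mult dep_aJ Fr)+
  have dG0: "dfun ?G0" by (intro dfun_add G dfun_mult[of ?a] a dfun_coord)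
  have "partial (U 0 (Suc r)) ?G0 p = 0" if p: "p \<in> D" for p
  proof -
    have "partial (U 0 (Suc r)) ?a p = 0"
      by (rule partial_eq_0[OF a(2) _ p]) (simp add: K_mem)
    then show ?thesis
      using partial_add[OF dfun_smooth[OF G(1)] dfun_smooth[OF dfun_mult[OF a(1) dfun_coord]] p]
        partial_mult[OF dfun_smooth[OF a(1)] smooth_coord p] eq[OF p] partial_coord[OF p] by simp
  qed
  moreover have "dep (K (Suc r)) ?G0"
    by (intro dep_add G dep_mult[of _ ?a] dep_coord dep_K_mono[OF a(2)]) (auto simp: K_def)
  ultimately have "dep (K r) ?G0"
    using dep_diff[OF dfun_smooth[OF dG0], of "K (Suc r)" "U 0 (Suc r)"] by (simp add: K_Suc)
  then show ?thesis using dG0 by (intro exI[of _ ?G0]) auto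
qed

end

section \<open>Lowering the order of a density\<close>

context eqn
begin

lemma partial_diff:
  assumes "smooth F" "smooth G" "p \<in> D"
  shows "partial c (\<lambda>p. F p - G p) p = partial c F p - partial c G p"
proof (rule has_partial_imp_partial[OF _ assms(3)])
  show "has_partial c (\<lambda>p. F p - G p) (\<lambda>p. partial c F p - partial c G p)"
    using smooth_has_partial[OF assms(1), of c] smooth_has_partial[OF assms(2), of c]
    unfolding has_partial_def by (auto intro: DERIV_diff)
qed

text \<open>The coefficient of \<open>u_(r+2)\<close> determines the part of the flux that contains
  \<open>u_(r+1)\<close>, and this part is linear. Splitting it off leaves a flux \<open>G0\<close>
  of the order of the density and an identity free of \<open>u_(r+2)\<close>.\<close>

lemma flux_reduce:
  assumes F: "dfun F" "dep (K r) F" and G: "dfun G" "dep K_jet G"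
    and eq: "\<And>p. p \<in> D ==> \<tau> F p + Dx G p = 0"
    and T: "dep (K (Suc r)) T"
      "\<And>p. p \<in> D ==> \<tau> F p = aJ p * p (U 0 (Suc (Suc r))) * partial (U 0 r) F p + T p"
  shows "\<exists>G0. dfun G0 \<and> dep (K r) G0 \<and> (\<forall>p\<in>D. T p + Dx G0 p
    - Dx (\<lambda>p. aJ p * partial (U 0 r) F p) p * p (U 0 (Suc r)) = 0)"
proof -
  obtain s where "dep (K s) G" using dep_K_exists[OF G] by blast
  from flux_order[OF F G(1) this eq] have GK: "dep (K (Suc r)) G" .
  obtain B where B: "dep (K (Suc r)) B"
    "\<forall>p\<in>D. Dx G p = B p + p (U 0 (Suc (Suc r))) * partial (U 0 (Suc r)) G p"
    using Dx_top[OF G(1) GK] by blast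
  have Fr: "dep (K r) (partial (U 0 r) F)" by (rule dep_partial[OF F(2)])
  have "aJ p * partial (U 0 r) F p + partial (U 0 (Suc r)) G p = 0" if p: "p \<in> D" for p
  proof (rule polynomial_coeffs_zero(2)[OF _ _ dep_const[of _ 0] _ p])
    show "dep (K (Suc r)) (\<lambda>p. T p + B p)" by (intro dep_add T B)
    show "dep (K (Suc r)) (\<lambda>p. aJ p * partial (U 0 r) F p + partial (U 0 (Suc r)) G p)"
      by (intro dep_add dep_mult dep_aJ dep_partial GK dep_K_mono[OF Fr]) simp
    fix q assume q: "q \<in> D"
    show "T q + B q + (aJ q * partial (U 0 r) F q + partial (U 0 (Suc r)) G q) * q (U 0 (Suc (Suc r)))
        + 0 * (q (U 0 (Suc (Suc r))))\<^sup>2 = 0"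
      using eq[OF q] B(2) q T(2)[OF q] by (simp add: algebra_simps)
  qed
  then have "partial (U 0 (Suc r)) G p = - aJ p * partial (U 0 r) F p" if "p \<in> D" for p
    using that by (simp add: eq_neg_iff_add_eq_0 add.commute)
  from flux_top[OF F G(1) GK this Fr] obtain G0 where G0: "dfun G0" "dep (K r) G0"
    "\<forall>p\<in>D. G p = G0 p - aJ p * partial (U 0 r) F p * p (U 0 (Suc r))" by blast
  let ?a = "\<lambda>p. aJ p * partial (U 0 r) F p"
  have a: "dfun ?a" by (intro dfun_mult dfun_aJ dfun_partial F)
  have "T p + Dx G0 p - Dx ?a p * p (U 0 (Suc r)) = 0" if p: "p \<in> D" for p
  proof -
    have "Dx G p = Dx (\<lambda>p. G0 p - ?a p * p (U 0 (Suc r))) p"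
      by (rule der_cong[OF _ p]) (use G0 in auto)
    also have "\<dots> = Dx G0 p - (Dx ?a p * p (U 0 (Suc r)) + ?a p * p (U 0 (Suc (Suc r))))"
      by (simp add: der_diff[OF G0(1) dfun_mult[OF a dfun_coord] p] der_mult[OF a dfun_coord p]
          der_coord p)
    finally show ?thesis using eq[OF p] T(2)[OF p] by (simp add: algebra_simps)
  qed
  then show ?thesis using G0 by blast
qed

text \<open>Take the coefficient of the square of \<open>u_(m+2)\<close> in the identity of
  \<open>flux_reduce\<close>. Only \<open>D_x (aJ F')\<close> times \<open>u_(m+2)\<close>
  contributes, so \<open>aJ F'\<close> is free of \<open>u_(m+1)\<close>; the factor
  \<open>aJ\<close> is nonzero and free of it, hence \<open>F'\<close> is free of it too.\<close>

lemma density_affine: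
  assumes F: "dfun F" "dep (K (Suc m)) F" and G: "dfun G" "dep K_jet G"
    and eq: "\<And>p. p \<in> D ==> \<tau> F p + Dx G p = 0"
  shows "dep (K m) (partial (U 0 (Suc m)) F)"
proof -
  let ?F' = "partial (U 0 (Suc m)) F"
  let ?a = "\<lambda>p. aJ p * ?F' p"
  obtain M N where MN: "dep (K (Suc m)) M" "dep (K (Suc m)) N" "\<forall>p\<in>D. \<tau> F p =
      aJ p * p (U 0 (Suc (Suc (Suc m)))) * ?F' p + M p * p (U 0 (Suc (Suc m))) + N p"
    using \<tau>_top[OF F] by blast
  have F': "dfun ?F'" "dep (K (Suc m)) ?F'" using dfun_partial[OF F(1)] dep_partial[OF F(2)] .
  have a: "dfun ?a" "dep (K (Suc m)) ?a" by (intro dfun_mult dfun_aJ F' dep_mult dep_aJ)+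
  have T: "dep (K (Suc (Suc m))) (\<lambda>p. M p * p (U 0 (Suc (Suc m))) + N p)"
    by (intro dep_add dep_mult dep_coord dep_K_mono[OF MN(1)] dep_K_mono[OF MN(2)])
      (auto simp: K_def)
  obtain G0 where G0: "dfun G0" "dep (K (Suc m)) G0" "\<forall>p\<in>D. M p * p (U 0 (Suc (Suc m))) + N p +
      Dx G0 p - Dx ?a p * p (U 0 (Suc (Suc m))) = 0"
    using flux_reduce[OF F G eq T] MN(3) by force
  obtain B1 where B1: "dep (K (Suc m)) B1"
    "\<forall>p\<in>D. Dx ?a p = B1 p + p (U 0 (Suc (Suc m))) * partial (U 0 (Suc m)) ?a p"
    using Dx_top[OF a] by blast
  obtain B2 where B2: "dep (K (Suc m)) B2"
    "\<forall>p\<in>D. Dx G0 p = B2 p + p (U 0 (Suc (Suc m))) * partial (U 0 (Suc m)) G0 p"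
    using Dx_top[OF G0(1,2)] by blast
  have "partial (U 0 (Suc m)) ?F' p = 0" if p: "p \<in> D" for p
  proof -
    have "(-1) * partial (U 0 (Suc m)) ?a p = 0"
    proof (rule polynomial_coeffs_zero(3)[OF _ _ _ _ p])
      show "dep (K (Suc m)) (\<lambda>p. N p + B2 p)" by (intro dep_add MN B2)
      show "dep (K (Suc m)) (\<lambda>p. M p + partial (U 0 (Suc m)) G0 p + (-1) * B1 p)"
        by (intro dep_add dep_mult dep_const dep_partial MN G0 B1)
      show "dep (K (Suc m)) (\<lambda>p. (-1) * partial (U 0 (Suc m)) ?a p)"
        by (intro dep_mult dep_const dep_partial a)
      fix q assume q: "q \<in> D"
      show "N q + B2 q + (M q + partial (U 0 (Suc m)) G0 q + (-1) * B1 q) * q (U 0 (Suc (Suc m)))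
          + (-1) * partial (U 0 (Suc m)) ?a q * (q (U 0 (Suc (Suc m))))\<^sup>2 = 0"
        using G0(3) B1(2) B2(2) q by (simp add: algebra_simps power2_eq_square)
    qed
    moreover have "partial (U 0 (Suc m)) aJ p = 0"
      by (rule partial_eq_0[OF dep_aJ[of 0] _ p]) (simp add: K_mem)
    ultimately show ?thesis
      using partial_mult[OF dfun_smooth[OF dfun_aJ] dfun_smooth[OF F'(1)] p] aJ_nz[OF p] by simp
  qed
  then show ?thesis
    using dep_diff[OF dfun_smooth[OF F'(1)] F'(2), of "U 0 (Suc m)"] by (simp add: K_Suc)
qed

text \<open>The jet version of the equation for characteristics; \<open>char_data\<close> restates
  it with ordinary derivatives.\<close>

definition det_jet :: "(jet => real) => bool" where
  "det_jet L \<longleftrightarrow> dfun L \<and> dep {Time, Space} L \<and>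
    (\<forall>p\<in>D. cf E (p Space) * partial Time L p + cA E (p (U 0 0)) * partial Space (partial Space L) p
      - cB E (p (U 0 0)) * (deriv (ch E) (p Space) * L p + ch E (p Space) * partial Space L p) = 0)"

lemma partial_line:
  assumes "smooth_on_line (jet_sec E c) g" "p \<in> D"
  shows "partial c (\<lambda>p. g (p c)) p = deriv g (p c)"
  unfolding partial_def by simp

lemma partial_zero_line: "c \<noteq> d ==> p \<in> D ==> partial d (\<lambda>p. g (p c)) p = 0"
  by (rule partial_eq_0[of "{c}"]) (auto simp: dep_def)

lemma Dx_K0:
  assumes "dep (K 0) F" "p \<in> D"
  shows "Dx F p = partial Space F p + p (U 0 1) * partial (U 0 0) F p"
  by (simp add: der_eq[OF finite_K assms] sum_K)

lemma sec_point: obtains t x u where "t \<in> tdom E" "x \<in> xdom E" "u \<in> udom E"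
  using domains unfolding open_interval_def by blast

text \<open>The identity of \<open>flux_reduce\<close> is now quadratic in \<open>u_x\<close>. Its
  \<open>u_x^2\<close> part gives \<open>F_uu = 0\<close>; the other two parts give the
  \<open>x\<close>- and the \<open>u\<close>-derivative of \<open>G0\<close>, and equality of its
  mixed derivatives is the equation for \<open>L = F_u / f\<close>.\<close>

lemma reduce_base:
  assumes F: "dfun F" "dep (K 0) F" and G: "dfun G" "dep K_jet G"
    and eq: "\<And>p. p \<in> D ==> \<tau> F p + Dx G p = 0"
  shows "\<exists>L H. det_jet L \<and> dfun H \<and> dep K_jet H \<and>
    (\<forall>p\<in>D. F p = L p * cf E (p Space) * p (U 0 0) + Dx H p)"
proof -
  let ?Fu = "partial (U 0 0) F"
  let ?f = "\<lambda>p. cf E (p Space)" and ?A = "\<lambda>p. cA E (p (U 0 0))" and ?B = "\<lambda>p. cB E (p (U 0 0))"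
  let ?h = "\<lambda>p. ch E (p Space)" and ?A' = "\<lambda>p. deriv (cA E) (p (U 0 0))"
  let ?a = "\<lambda>p. aJ p * ?Fu p"
  have Fu: "dfun ?Fu" "dep (K 0) ?Fu" using dfun_partial[OF F(1)] dep_partial[OF F(2)] .
  have a: "dfun ?a" "dep (K 0) ?a" by (intro dfun_mult dfun_aJ Fu dep_mult dep_aJ)+
  \<comment> \<open>\<open>b\<close> and \<open>c\<close> are the coefficients of
    \<open>u_x^2\<close> and \<open>u_x\<close> in \<open>u_t\<close>.\<close>
  define b where "b = (\<lambda>p. ?A' p * inverse (?f p))"
  define c where "c = (\<lambda>p. ?h p * ?B p * inverse (?f p))"
  have bc: "dep (K 0) b" "dep (K 0) c" by (auto simp: dep_def b_def c_def K_def)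
  let ?T = "\<lambda>p. partial Time F p + (b p * (p (U 0 1) * p (U 0 1)) + c p * p (U 0 1)) * ?Fu p"
  have T: "dep (K (Suc 0)) ?T"
    by (intro dep_add dep_mult dep_partial dep_coord dep_K_mono[OF F(2)] dep_K_mono[OF bc(1)]
        dep_K_mono[OF bc(2)]) (auto simp: K_def)
  have "\<tau> F p = aJ p * p (U 0 (Suc (Suc 0))) * ?Fu p + ?T p" if p: "p \<in> D" for p
    by (simp add: \<tau>_K[OF F(2) p] rhs_def b_def c_def aJ_def numeral_2_eq_2 algebra_simps)
  from flux_reduce[OF F G eq T this] obtain G0 where G0: "dfun G0" "dep (K 0) G0"
    "\<forall>p\<in>D. ?T p + Dx G0 p - Dx ?a p * p (U 0 (Suc 0)) = 0" by auto
  have coeffs: "partial Time F p + partial Space G0 p = 0"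
    "c p * ?Fu p + partial (U 0 0) G0 p + (-1) * partial Space ?a p = 0"
    "b p * ?Fu p + (-1) * partial (U 0 0) ?a p = 0" if p: "p \<in> D" for p
  proof -
    have eqq: "partial Time F q + partial Space G0 q
        + (c q * ?Fu q + partial (U 0 0) G0 q + (-1) * partial Space ?a q) * q (U 0 (Suc 0))
        + (b q * ?Fu q + (-1) * partial (U 0 0) ?a q) * (q (U 0 (Suc 0)))\<^sup>2 = 0" if q: "q \<in> D" for q
      using bspec[OF G0(3) q] unfolding Dx_K0[OF G0(2) q] Dx_K0[OF a(2) q]
      by (simp add: algebra_simps power2_eq_square)
    have d: "dep (K 0) (\<lambda>p. partial Time F p + partial Space G0 p)"
      "dep (K 0) (\<lambda>p. c p * ?Fu p + partial (U 0 0) G0 p + (-1) * partial Space ?a p)"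
      "dep (K 0) (\<lambda>p. b p * ?Fu p + (-1) * partial (U 0 0) ?a p)"
      by (intro dep_add dep_mult dep_const dep_partial F G0 a bc)+
    show "partial Time F p + partial Space G0 p = 0"
      "c p * ?Fu p + partial (U 0 0) G0 p + (-1) * partial Space ?a p = 0"
      "b p * ?Fu p + (-1) * partial (U 0 0) ?a p = 0"
      using polynomial_coeffs_zero[OF d eqq p] by simp_all
  qed
  have "partial (U 0 0) ?Fu p = 0" if p: "p \<in> D" for p
  proof -
    have "partial (U 0 0) aJ p = b p"
      unfolding aJ_def[abs_def] b_def
      using partial_mult[OF dfun_smooth[OF dfun_coeffs(3)] dfun_smooth[OF dfun_inverse_f] p, of "U 0 0"]
        partial_line[of "U 0 0" "cA E", OF _ p] smooth_coeffs(3)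
        partial_zero_line[of Space "U 0 0" p "\<lambda>x. inverse (cf E x)"] p by simp
    then show ?thesis
      using coeffs(3)[OF p] partial_mult[OF dfun_smooth[OF dfun_aJ] dfun_smooth[OF Fu(1)] p, of "U 0 0"]
        aJ_nz[OF p] by simp
  qed
  then have Fu_dep: "dep {Time, Space} ?Fu"
    using dep_diff[OF dfun_smooth[OF Fu(1)] Fu(2), of "U 0 0"] by (simp add: K_def)
  define L where "L = (\<lambda>p. ?Fu p * inverse (?f p))"
  have L: "dfun L" "dep {Time, Space} L"
  proof -
    have "dep {Time, Space} (\<lambda>p. inverse (?f p))" by (simp add: dep_def)
    then show "dfun L" "dep {Time, Space} L"
      unfolding L_def by (intro dfun_mult Fu dfun_inverse_f dep_mult Fu_dep)+
  qed
  have Fu_eq: "?Fu p = L p * ?f p" if "p \<in> D" for p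
    using that f_nz[of "p Space"] by (simp add: L_def D_iff)
  have Lx: "dfun (partial Space L)" by (rule dfun_partial[OF L(1)])
  have det: "?f p * partial Time L p + ?A p * partial Space (partial Space L) p
      - ?B p * (deriv (ch E) (p Space) * L p + ?h p * partial Space L p) = 0" if p: "p \<in> D" for p
  proof -
    have "partial Space (partial (U 0 0) G0) p = partial Space (\<lambda>p. ?A p * partial Space L p
        - ?B p * (?h p * L p)) p"
    proof (rule partial_cong[OF _ p])
      fix q assume q: "q \<in> D"
      have "partial Space ?a q = partial Space (\<lambda>p. ?A p * L p) q"
        by (rule partial_cong[OF _ q]) (simp add: aJ_def L_def)
      also have "\<dots> = ?A q * partial Space L q"
        using partial_mult[OF dfun_smooth[OF dfun_coeffs(3)] dfun_smooth[OF L(1)] q, of Space]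
          partial_zero_line[of "U 0 0" Space q "cA E"] q by simp
      finally show "partial (U 0 0) G0 q = ?A q * partial Space L q - ?B q * (?h q * L q)"
        using coeffs(2)[OF q] by (simp add: c_def L_def algebra_simps)
    qed
    also have "\<dots> = ?A p * partial Space (partial Space L) p
        - ?B p * (deriv (ch E) (p Space) * L p + ?h p * partial Space L p)"
      using partial_zero_line[of "U 0 0" Space p "cA E"] partial_zero_line[of "U 0 0" Space p "cB E"] p
        partial_line[of Space "ch E", OF _ p] smooth_coeffs(2)
      by (simp add: partial_diff partial_mult dfun_smooth dfun_coeffs L Lx dfun_mult)
    finally have 1: "partial Space (partial (U 0 0) G0) p = ?A p * partial Space (partial Space L) p
        - ?B p * (deriv (ch E) (p Space) * L p + ?h p * partial Space L p)" .
    have "partial (U 0 0) (partial Space G0) p = partial (U 0 0) (\<lambda>p. (-1) * partial Time F p) p"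
      by (rule partial_cong[OF _ p]) (use coeffs(1) in \<open>auto simp: eq_neg_iff_add_eq_0 add.commute\<close>)
    also have "\<dots> = - partial (U 0 0) (partial Time F) p"
      using partial_mult[OF smooth_const dfun_smooth[OF dfun_partial[OF F(1)]] p, of "U 0 0" "-1" Time]
        partial_const[OF p] by simp
    also have "partial (U 0 0) (partial Time F) p = partial Time ?Fu p"
      by (rule partial_commute[OF dfun_smooth[OF F(1)] p])
    also have "\<dots> = partial Time (\<lambda>p. L p * ?f p) p"
      by (rule partial_cong[OF Fu_eq p])
    also have "\<dots> = partial Time L p * ?f p"
      using partial_mult[OF dfun_smooth[OF L(1)] dfun_smooth[OF dfun_coeffs(1)] p, of Time]
        partial_zero_line[of Space Time p "cf E"] p by simp
    finally show ?thesis
      using 1 partial_commute[OF dfun_smooth[OF G0(1)] p, of Space "U 0 0"] by (simp add: algebra_simps)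
  qed
  obtain x0 where x0: "x0 \<in> jet_sec E Space" using sec_nonempty by blast
  \<comment> \<open>What is left of \<open>F\<close> depends on \<open>t\<close> and
    \<open>x\<close> only, so it is the \<open>x\<close>-derivative of its own integral.\<close>
  let ?\<beta> = "\<lambda>p. F p - L p * ?f p * p (U 0 0)"
  have \<beta>: "dfun ?\<beta>" by (intro dfun_diff dfun_mult F L dfun_coeffs dfun_coord)
  have "partial (U 0 0) ?\<beta> p = 0" if p: "p \<in> D" for p
  proof -
    have "partial (U 0 0) ?\<beta> p = partial (U 0 0) (\<lambda>p. F p - ?Fu p * p (U 0 0)) p"
      by (rule partial_cong[OF _ p]) (simp add: Fu_eq)
    also have "\<dots> = 0"
      using \<open>\<And>p. p \<in> D ==> partial (U 0 0) ?Fu p = 0\<close> p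
      by (simp add: partial_diff partial_mult dfun_smooth F Fu dfun_mult dfun_coord partial_coord)
    finally show ?thesis .
  qed
  moreover have "dep (K 0) ?\<beta>"
  proof -
    have "dep (K 0) (\<lambda>p. F p + (-1) * (L p * ?f p * p (U 0 0)))"
      by (intro dep_add dep_mult dep_const F dep_mono[OF L(2)] dep_coord) (auto simp: dep_def K_def)
    then show ?thesis by simp
  qed
  ultimately have \<beta>d: "dep {Time, Space} ?\<beta>"
    using dep_diff[OF dfun_smooth[OF \<beta>], of "K 0" "U 0 0"] by (simp add: K_def)
  let ?H = "coord_integral Space x0 ?\<beta>"
  have H: "dfun ?H" "dep {Time, Space} ?H"
    using dfun_coord_integral[OF \<beta> x0] dep_coord_integral[OF \<beta>d x0] by (simp_all add: insert_commute)
  have "F p = L p * ?f p * p (U 0 0) + Dx ?H p" if p: "p \<in> D" for p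
  proof -
    have "Dx ?H p = partial Space ?H p"
      using der_eq[OF _ H(2) p, of shift_x] by simp
    also have "\<dots> = ?\<beta> p"
      by (rule has_partial_imp_partial[OF has_partial_coord_integral_same[OF dfun_smooth[OF \<beta>] x0] p])
    finally show ?thesis by simp
  qed
  moreover have "dep K_jet ?H" by (rule dep_mono[OF H(2)]) (auto simp: K_jet_def)
  ultimately show ?thesis
    using L det H(1) unfolding det_jet_def by blast
qed

text \<open>The density is affine in its top derivative \<open>u_(m+1)\<close>. If \<open>H\<close>
  is the integral of the coefficient with respect to \<open>u_m\<close>, then
  \<open>F - D_x H\<close> has order \<open>m\<close>, and \<open>G + \<tau> H\<close> is a matching
  flux because \<open>\<tau>\<close> and \<open>D_x\<close> commute.\<close>

lemma reduce:
  "dfun F ==> dep (K r) F ==> dfun G ==> dep K_jet G ==> (\<And>p. p \<in> D ==> \<tau> F p + Dx G p = 0) ==>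
    \<exists>L H. det_jet L \<and> dfun H \<and> dep K_jet H \<and>
      (\<forall>p\<in>D. F p = L p * cf E (p Space) * p (U 0 0) + Dx H p)"
proof (induction r arbitrary: F G)
  case 0
  then show ?case by (rule reduce_base)
next
  case (Suc m)
  note F = Suc.prems(1,2) and G = Suc.prems(3,4) and eq = Suc.prems(5)
  let ?F1 = "partial (U 0 (Suc m)) F"
  have F1: "dfun ?F1" "dep (K m) ?F1"
    using dfun_partial[OF F(1)] density_affine[OF F G eq] .
  obtain a where a: "a \<in> jet_sec E (U 0 m)" using sec_nonempty by blast
  let ?H = "coord_integral (U 0 m) a ?F1"
  have H: "dfun ?H" "dep (K m) ?H"
    using dfun_coord_integral[OF F1(1) a] dep_coord_integral[OF F1(2) a]
    by (simp_all add: K_mem insert_absorb)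
  have HJ: "dep K_jet ?H" by (rule dep_mono[OF H(2) K_subset])
  have Hm: "partial (U 0 m) ?H p = ?F1 p" if "p \<in> D" for p
    by (rule has_partial_imp_partial[OF has_partial_coord_integral_same[OF dfun_smooth[OF F1(1)] a] that])
  obtain B where B: "dep (K m) B" "\<forall>p\<in>D. Dx ?H p = B p + p (U 0 (Suc m)) * partial (U 0 m) ?H p"
    using Dx_top[OF H] by blast
  let ?\<Phi> = "\<lambda>p. F p - p (U 0 (Suc m)) * ?F1 p"
  have \<Phi>: "dfun ?\<Phi>" by (intro dfun_diff dfun_mult dfun_coord F F1)
  have "dep (K (Suc m)) (\<lambda>p. F p + (-1) * (p (U 0 (Suc m)) * ?F1 p))"
    by (intro dep_add dep_mult dep_const dep_coord F dep_K_mono[OF F1(2)]) (auto simp: K_def)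
  then have "dep (K (Suc m)) ?\<Phi>" by simp
  moreover have "partial (U 0 (Suc m)) ?\<Phi> p = 0" if p: "p \<in> D" for p
    using partial_eq_0[OF F1(2) _ p, of "U 0 (Suc m)"] p
    by (simp add: partial_diff partial_mult dfun_smooth F F1 dfun_mult dfun_coord partial_coord K_mem)
  ultimately have \<Phi>m: "dep (K m) ?\<Phi>"
    using dep_diff[OF dfun_smooth[OF \<Phi>], of "K (Suc m)" "U 0 (Suc m)"] by (simp add: K_Suc)
  let ?F' = "\<lambda>p. F p - Dx ?H p" and ?G' = "\<lambda>p. G p + \<tau> ?H p"
  have F': "dfun ?F'" by (intro dfun_diff F dfun_Dx H)
  have "dep (K m) (\<lambda>p. ?\<Phi> p + (-1) * B p)" by (intro dep_add dep_mult dep_const \<Phi>m B)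
  then have F'm: "dep (K m) ?F'"
    by (rule dep_cong[rotated]) (use B(2) Hm in auto)
  have G': "dfun ?G'" "dep K_jet ?G'"
    by (intro dfun_add G dfun_\<tau> H dep_add dep_\<tau> HJ)+
  have "\<tau> ?F' p + Dx ?G' p = 0" if p: "p \<in> D" for p
    using eq[OF p] \<tau>_Dx_commute[OF H(1) HJ p]
    by (simp add: der_diff der_add F G H dfun_Dx dfun_\<tau> p)
  from Suc.IH[OF F' F'm G' this] obtain L H' where L: "det_jet L" "dfun H'" "dep K_jet H'"
    "\<forall>p\<in>D. ?F' p = L p * cf E (p Space) * p (U 0 0) + Dx H' p" by blast
  have "\<forall>p\<in>D. F p = L p * cf E (p Space) * p (U 0 0) + Dx (\<lambda>p. H' p + ?H p) p"
    using L by (auto simp: der_add H algebra_simps)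
  moreover have "dfun (\<lambda>p. H' p + ?H p)" "dep K_jet (\<lambda>p. H' p + ?H p)"
    by (intro dfun_add dep_add L H HJ)+
  ultimately show ?case using L(1) by (intro exI[of _ L] exI[of _ "\<lambda>p. H' p + ?H p"]) auto
qed

text \<open>If some \<open>u_n\<close> occurred in \<open>H\<close>, then \<open>u_(n+1)\<close>
  would occur in \<open>D_x H\<close>; the coordinates are removed from the top down.\<close>

lemma Dx_dep:
  assumes H: "dfun H" "dep K_jet H" and DH: "dep (K 0) (Dx H)"
  shows "dep {Time, Space} H"
proof -
  obtain n where "dep (K n) H" using dep_K_exists[OF H] by blast
  then show ?thesis
  proof (induction n)
    case (Suc n)
    have "partial (U 0 (Suc n)) H p = 0" if p: "p \<in> D" for p
    proof -
      obtain B where B: "dep (K (Suc n)) B"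
        "\<forall>p\<in>D. Dx H p = B p + p (U 0 (Suc (Suc n))) * partial (U 0 (Suc n)) H p"
        using Dx_top[OF H(1) Suc.prems] by blast
      have "- partial (U 0 (Suc n)) H p = 0"
      proof (rule polynomial_coeffs_zero(2)[OF _ _ dep_const[of _ 0] _ p])
        have "dep (K (Suc n)) (\<lambda>p. Dx H p + (-1) * B p)"
          by (intro dep_add dep_mult dep_const B dep_K_mono[OF DH]) simp
        then show "dep (K (Suc n)) (\<lambda>p. Dx H p - B p)" by simp
        have "dep (K (Suc n)) (\<lambda>p. (-1) * partial (U 0 (Suc n)) H p)"
          by (intro dep_mult dep_const dep_partial Suc.prems)
        then show "dep (K (Suc n)) (\<lambda>p. - partial (U 0 (Suc n)) H p)" by simp
      qed (use B(2) in auto)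
      then show ?thesis by simp
    qed
    then have "dep (K n) H"
      using dep_diff[OF dfun_smooth[OF H(1)] Suc.prems, of "U 0 (Suc n)"] by (simp add: K_Suc)
    then show ?case by (rule Suc.IH)
  next
    case 0
    have "partial (U 0 0) H p = 0" if p: "p \<in> D" for p
    proof -
      have "- partial (U 0 0) H p = 0"
      proof (rule polynomial_coeffs_zero(2)[OF _ _ dep_const[of _ 0] _ p])
        have "dep (K 0) (\<lambda>p. Dx H p + (-1) * partial Space H p)"
          by (intro dep_add dep_mult dep_const dep_partial 0 DH)
        then show "dep (K 0) (\<lambda>p. Dx H p - partial Space H p)" by simp
        have "dep (K 0) (\<lambda>p. (-1) * partial (U 0 0) H p)"
          by (intro dep_mult dep_const dep_partial 0)
        then show "dep (K 0) (\<lambda>p. - partial (U 0 0) H p)" by simp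
      qed (use Dx_K0[OF 0] in auto)
      then show ?thesis by simp
    qed
    then show ?case
      using dep_diff[OF dfun_smooth[OF H(1)] 0, of "U 0 0"] by (simp add: K_def)
  qed
qed

end

section \<open>Characteristics of conserved vectors\<close>

text \<open>The determining equation for characteristics that depend on \<open>t\<close> and \<open>x\<close> only, required merely
  for sufficiently differentiable functions.\<close>

definition char_data :: "equation => (real => real => real) => (real => real => real) =>
    (real => real => real) => (real => real => real) => bool" where
  "char_data E l lt lx lxx \<longleftrightarrow>
     (\<forall>g\<in>{l, lt, lx, lxx}. continuous_on (tdom E \<times> xdom E) (\<lambda>z. g (fst z) (snd z))) \<and>
     (\<forall>t\<in>tdom E. \<forall>x\<in>xdom E.
        ((\<lambda>s. l s x) has_real_derivative lt t x) (at t) \<and>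
        (l t has_real_derivative lx t x) (at x) \<and> (lx t has_real_derivative lxx t x) (at x) \<and>
        (\<forall>u\<in>udom E. cf E x * lt t x + cA E u * lxx t x
           - cB E u * (deriv (ch E) x * l t x + ch E x * lx t x) = 0))"

definition char_solution :: "equation => (real => real => real) => bool" where
  "char_solution E l \<longleftrightarrow> (\<exists>lt lx lxx. char_data E l lt lx lxx)"

context eqn
begin

definition pt :: "real => real => real => jet" where
  "pt t x u c = (case c of Time => t | Space => x | U i j => u)"

lemma pt_simps [simp]: "pt t x u Time = t" "pt t x u Space = x" "pt t x u (U i j) = u"
  by (simp_all add: pt_def)

lemma pt_D: "t \<in> tdom E ==> x \<in> xdom E ==> u \<in> udom E ==> pt t x u \<in> D"
  by (simp add: D_iff)

lemma pt_upd: "(pt t x u)(Time := s) = pt s x u" "(pt t x u)(Space := y) = pt t y u"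
  by (auto simp: pt_def fun_eq_iff split: coord.splits)

abbreviation lift :: "(real => real => real) => jet => real" where
  "lift l \<equiv> (\<lambda>p. l (p Time) (p Space))"

lemma dep_lift: "dep {Time, Space} (lift l)"
  by (simp add: dep_def)

lemma lift_derivatives:
  assumes L: "dfun L" "dep {Time, Space} L" and lift: "\<And>p. p \<in> D ==> L p = lift l p"
  shows "\<exists>lt lx lxx.
     (\<forall>g\<in>{l, lt, lx, lxx}. continuous_on (tdom E \<times> xdom E) (\<lambda>z. g (fst z) (snd z))) \<and>
     (\<forall>t\<in>tdom E. \<forall>x\<in>xdom E.
        ((\<lambda>s. l s x) has_real_derivative lt t x) (at t) \<and>
        (l t has_real_derivative lx t x) (at x) \<and> (lx t has_real_derivative lxx t x) (at x)) \<and>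
     (\<forall>p\<in>D. partial Time L p = lift lt p \<and> partial Space L p = lift lx p \<and>
        partial Space (partial Space L) p = lift lxx p)"
proof -
  obtain u0 where u0: "u0 \<in> udom E" using sec_point by blast
  let ?r = "\<lambda>F t x. F (pt t x u0)"
  have rep: "F p = lift (?r F) p" if "dep {Time, Space} F" "p \<in> D" for F p
    by (rule dep_eq[OF that]) (use that(2) u0 in \<open>auto simp: D_iff\<close>)
  have cont: "continuous_on (tdom E \<times> xdom E) (\<lambda>z. ?r F (fst z) (snd z))" if "dfun F" for F
  proof (rule continuous_on_compose2[OF smooth_continuous[OF dfun_smooth[OF that]]])
    show "continuous_on (tdom E \<times> xdom E) (\<lambda>z. pt (fst z) (snd z) u0)"
    proof (rule continuous_on_coordinatewise_then_product)
      show "continuous_on (tdom E \<times> xdom E) (\<lambda>z. pt (fst z) (snd z) u0 c)" for c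
        by (cases c) (auto intro: continuous_intros)
    qed
    show "(\<lambda>z. pt (fst z) (snd z) u0) ` (tdom E \<times> xdom E) \<subseteq> D" using u0 by (auto simp: D_iff)
  qed
  have dt: "((\<lambda>s. ?r F s x) has_real_derivative ?r (partial Time F) t x) (at t)"
    and dx: "(?r F t has_real_derivative ?r (partial Space F) t x) (at x)"
    if "dfun F" "t \<in> tdom E" "x \<in> xdom E" for F t x
    using smooth_DERIV[OF dfun_smooth[OF that(1)] pt_D[OF that(2,3) u0], of Time]
      smooth_DERIV[OF dfun_smooth[OF that(1)] pt_D[OF that(2,3) u0], of Space]
    by (simp_all add: pt_upd)
  have l: "l t x = ?r L t x" if "t \<in> tdom E" "x \<in> xdom E" for t x
    using lift[OF pt_D[OF that u0]] by simp
  have "continuous_on (tdom E \<times> xdom E) (\<lambda>z. l (fst z) (snd z))"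
    by (rule continuous_on_eq[OF cont[OF L(1)]]) (auto simp: l)
  moreover have "((\<lambda>s. l s x) has_real_derivative ?r (partial Time L) t x) (at t)"
    "(l t has_real_derivative ?r (partial Space L) t x) (at x)"
    if t: "t \<in> tdom E" and x: "x \<in> xdom E" for t x
    by (rule has_field_derivative_transform_within_open[OF dt[OF L(1) t x] open_domains(1) t], simp add: l x,
        rule has_field_derivative_transform_within_open[OF dx[OF L(1) t x] open_domains(2) x], simp add: l t)
  ultimately show ?thesis
    using cont[OF dfun_partial[OF L(1)]] cont[OF dfun_partial[OF dfun_partial[OF L(1)]]]
      dx[OF dfun_partial[OF L(1)]] rep[OF dep_partial[OF L(2)]]
      rep[OF dep_partial[OF dep_partial[OF L(2)]]]
    by (intro exI[of _ "?r (partial Time L)"] exI[of _ "?r (partial Space L)"]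
        exI[of _ "?r (partial Space (partial Space L))"]) simp
qed

text \<open>Ties \<open>V\<close> to \<open>l\<close> through the density alone, on solutions and
  modulo total \<open>x\<close>-derivatives. The relation is linear in both, and for a conserved
  vector \<open>l = 0\<close> already forces triviality, flux included
  (\<open>zero_imp_trivial\<close>).\<close>

definition has_char :: "vec => (real => real => real) => bool" where
  "has_char V l \<longleftrightarrow> dfun (lift l) \<and> (\<exists>H. dfun H \<and> dep K_jet H \<and>
     (\<forall>p\<in>D. fst V (sol p) = lift l p * cf E (p Space) * p (U 0 0) + Dx H p))"

lemma conserved_dfun:
  assumes "conserved_vector E V" shows "dfun (fst V)" "dfun (snd V)"
  using assms by (simp_all add: conserved_vector_def D_eq)

lemma conserved_sol:
  assumes V: "conserved_vector E V" and p: "p \<in> D"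
  shows "\<tau> (\<lambda>p. fst V (sol p)) p + Dx (\<lambda>p. snd V (sol p)) p = 0"
proof -
  have "total_t (fst V) (sol p) + total_x (snd V) (sol p) = 0"
    using V sol_in_solution_jets[OF p] by (simp add: conserved_vector_def)
  then show ?thesis
    by (simp add: total_as_der conserved_dfun[OF V] sol_D[OF p] Dt_sol Dx_sol p)
qed

lemma conserved_has_char:
  assumes V: "conserved_vector E V"
  shows "\<exists>l. has_char V l \<and> char_solution E l"
proof -
  note d = conserved_dfun[OF V]
  obtain r where "dep (K r) (\<lambda>p. fst V (sol p))"
    using dep_K_exists[OF dfun_sol[OF d(1)] dep_sol[OF d(1)]] by blast
  from reduce[OF dfun_sol[OF d(1)] this dfun_sol[OF d(2)] dep_sol[OF d(2)] conserved_sol[OF V]]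
  obtain L H where L: "det_jet L" and H: "dfun H" "dep K_jet H"
    "\<forall>p\<in>D. fst V (sol p) = L p * cf E (p Space) * p (U 0 0) + Dx H p" by blast
  have Ld: "dfun L" "dep {Time, Space} L" using L by (simp_all add: det_jet_def)
  obtain u0 where u0: "u0 \<in> udom E" using sec_point by blast
  define l where "l t x = L (pt t x u0)" for t x
  have lift: "L p = lift l p" if "p \<in> D" for p
    unfolding l_def by (rule dep_eq[OF Ld(2) that]) (use that u0 in \<open>auto simp: D_iff\<close>)
  obtain lt lx lxx where
    cont: "\<forall>g\<in>{l, lt, lx, lxx}. continuous_on (tdom E \<times> xdom E) (\<lambda>z. g (fst z) (snd z))" and
    der: "\<forall>t\<in>tdom E. \<forall>x\<in>xdom E.
        ((\<lambda>s. l s x) has_real_derivative lt t x) (at t) \<and>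
        (l t has_real_derivative lx t x) (at x) \<and> (lx t has_real_derivative lxx t x) (at x)" and
    part: "\<forall>p\<in>D. partial Time L p = lift lt p \<and> partial Space L p = lift lx p \<and>
        partial Space (partial Space L) p = lift lxx p"
    using lift_derivatives[OF Ld lift] by blast
  have "cf E x * lt t x + cA E u * lxx t x
           - cB E u * (deriv (ch E) x * l t x + ch E x * lx t x) = 0"
    if "t \<in> tdom E" "x \<in> xdom E" "u \<in> udom E" for t x u
    using L part lift[OF pt_D[OF that]] pt_D[OF that] unfolding det_jet_def by force
  then have "char_solution E l"
    unfolding char_solution_def char_data_def using cont der by (intro exI[of _ lt] exI[of _ lx] exI[of _ lxx]) blast
  moreover have "dfun (lift l)" by (rule dfun_cong[OF lift Ld(1)])
  ultimately show ?thesis using H lift unfolding has_char_def by (intro exI[of _ l]) auto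
qed

lemma trivial_zero: "trivial_vector E (vec_diff V V)"
  unfolding trivial_vector_def vec_diff_def D_eq[symmetric]
  by (rule exI[of _ "\<lambda>p. 0"], rule exI[of _ "\<lambda>p. 0"], rule exI[of _ "\<lambda>p. 0"])
    (auto simp: dfun_const total_as_der der_const)

text \<open>For a trivial \<open>V\<close> the function \<open>l f u\<close> is \<open>D_x\<close>
  of some function, which by \<open>Dx_dep\<close> depends on \<open>t\<close> and \<open>x\<close>
  only. Then \<open>l f u\<close> would not change with \<open>u\<close>.\<close>

lemma trivial_imp_zero:
  assumes V: "conserved_vector E V" "has_char V l" and triv: "trivial_vector E V"
    and tx: "t \<in> tdom E" "x \<in> xdom E"
  shows "l t x = 0"
proof -
  obtain F' G' H where H: "dfun F'" "dfun H" "\<forall>p\<in>solution_jets E. F' p = 0"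
    "\<forall>p\<in>D. fst V p = F' p + total_x H p"
    using triv unfolding trivial_vector_def D_eq[symmetric] by blast
  obtain H' where H': "dfun H'" "dep K_jet H'"
    "\<forall>p\<in>D. fst V (sol p) = lift l p * cf E (p Space) * p (U 0 0) + Dx H' p"
    using V(2) unfolding has_char_def by blast
  have l: "dfun (lift l)" using V(2) by (simp add: has_char_def)
  let ?H = "\<lambda>p. H (sol p) - H' p"
  have Hd: "dfun ?H" by (intro dfun_diff dfun_sol H H')
  have "dep K_jet (\<lambda>p. H (sol p) + (-1) * H' p)"
    by (intro dep_add dep_mult dep_const dep_sol H H')
  then have Hdep: "dep K_jet ?H" by simp
  have eq: "Dx ?H p = lift l p * cf E (p Space) * p (U 0 0)" if p: "p \<in> D" for p
  proof -
    have "fst V (sol p) = F' (sol p) + total_x H (sol p)" using H(4) sol_D[OF p] by blast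
    also have "\<dots> = Dx (\<lambda>p. H (sol p)) p"
      using H(3) sol_in_solution_jets[OF p] by (simp add: total_as_der H sol_D[OF p] Dx_sol p)
    finally show ?thesis
      using H'(3) p by (simp add: der_diff dfun_sol H H')
  qed
  have "dep (K 0) (\<lambda>p. lift l p * cf E (p Space) * p (U 0 0))"
    by (auto simp: dep_def K_def)
  then have "dep (K 0) (Dx ?H)" by (rule dep_cong[rotated]) (simp add: eq)
  then have "dep {Time, Space} ?H" by (rule Dx_dep[OF Hd Hdep])
  then have dep: "dep {Time, Space} (Dx ?H)"
  proof (rule dep_der[OF Hd _ order_refl])
    show "dep {Time, Space} (shift_x c)" if "c \<in> {Time, Space}" for c
      using that by (auto simp: dep_def)
  qed
  obtain u0 where u0: "u0 \<in> udom E" using sec_point by blast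
  then obtain e where e: "e > 0" "ball u0 e \<subseteq> udom E"
    using open_domains(3) open_contains_ball by blast
  then have u1: "u0 + e / 2 \<in> udom E" by (auto simp: subset_eq dist_real_def)
  have "Dx ?H (pt t x u0) = Dx ?H (pt t x (u0 + e / 2))"
    by (rule dep_eq[OF dep]) (use tx u0 u1 in \<open>auto simp: D_iff\<close>)
  then have "l t x * cf E x * u0 = l t x * cf E x * (u0 + e / 2)"
    using tx u0 u1 by (simp add: eq D_iff)
  then show ?thesis using f_nz[OF tx(2)] e by (simp add: algebra_simps)
qed

text \<open>On solutions the density is \<open>D_x H\<close>, so the flux plus
  \<open>\<tau> H\<close> has zero \<open>x\<close>-derivative and is a function of
  \<open>t\<close>. Subtracting its \<open>t\<close>-integral from \<open>H\<close> gives the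
  potential; the remainders vanish on solution jets because these are fixed by
  \<open>sol\<close>.\<close>

lemma zero_imp_trivial:
  assumes V: "conserved_vector E V" "has_char V l"
    and zero: "\<And>t x. t \<in> tdom E ==> x \<in> xdom E ==> l t x = 0"
  shows "trivial_vector E V"
proof -
  note d = conserved_dfun[OF V(1)]
  obtain H where H: "dfun H" "dep K_jet H"
    "\<forall>p\<in>D. fst V (sol p) = lift l p * cf E (p Space) * p (U 0 0) + Dx H p"
    using V(2) unfolding has_char_def by blast
  then have F: "fst V (sol p) = Dx H p" if "p \<in> D" for p
    using zero that by (simp add: D_iff)
  let ?g = "\<lambda>p. snd V (sol p) + \<tau> H p"
  have g: "dfun ?g" "dep K_jet ?g"
    by (intro dfun_add dfun_sol dfun_\<tau> H d dep_add dep_sol dep_\<tau>)+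
  have Dg: "Dx ?g p = 0" if p: "p \<in> D" for p
  proof -
    have "\<tau> (\<lambda>p. fst V (sol p)) p = \<tau> (Dx H) p" by (rule der_cong[OF F p])
    then show ?thesis
      using conserved_sol[OF V(1) p] \<tau>_Dx_commute[OF H(1,2) p]
      by (simp add: der_add dfun_sol dfun_\<tau> H d p)
  qed
  then have "dep (K 0) (Dx ?g)" by (simp add: dep_def)
  from Dx_dep[OF g this] have gd: "dep {Time, Space} ?g" .
  have "partial Space ?g p = 0" if p: "p \<in> D" for p
    using der_eq[OF _ gd p, of shift_x] Dg[OF p] by simp
  from dep_diff[OF dfun_smooth[OF g(1)] gd this] have gt: "dep {Time} ?g"
    by (rule dep_mono) auto
  obtain t0 where t0: "t0 \<in> jet_sec E Time" using sec_nonempty by blast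
  let ?I = "coord_integral Time t0 ?g"
  have I: "dfun ?I" "dep {Time} ?I"
    using dfun_coord_integral[OF g(1) t0] dep_coord_integral[OF gt t0] by simp_all
  have IK: "dep K_jet ?I" by (rule dep_mono[OF I(2)]) (simp add: K_jet_def)
  let ?H = "\<lambda>p. H p - ?I p"
  have H': "dfun ?H" by (intro dfun_diff H I)
  have "dep K_jet (\<lambda>p. H p + (-1) * ?I p)" by (intro dep_add dep_mult dep_const H IK)
  then have H'd: "dep K_jet ?H" by simp
  have DxH': "Dx ?H p = fst V (sol p)" if p: "p \<in> D" for p
    using der_eq[OF _ I(2) p, of shift_x] F[OF p] by (simp add: der_diff H I p)
  have \<tau>H': "\<tau> ?H p = - snd V (sol p)" if p: "p \<in> D" for p
  proof -
    have "\<tau> ?I p = partial Time ?I p"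
      using der_eq[OF _ I(2) p, of evol] by (simp add: evol_def)
    also have "\<dots> = ?g p"
      by (rule has_partial_imp_partial[OF has_partial_coord_integral_same[OF dfun_smooth[OF g(1)] t0] p])
    finally show ?thesis by (simp add: der_diff H I p)
  qed
  let ?F' = "\<lambda>p. fst V p - Dx ?H p" and ?G' = "\<lambda>p. snd V p + Dt ?H p"
  have "dfun ?F'" "dfun ?G'" by (intro dfun_diff dfun_add d dfun_Dx dfun_Dt H')+
  moreover have "?F' q = 0 \<and> ?G' q = 0" if q: "q \<in> solution_jets E" for q
  proof -
    have qD: "q \<in> D" and qs: "sol q = q"
      using q solution_jets_sol by (simp_all add: solution_jets_iff)
    have "Dt ?H q = \<tau> (\<lambda>p. ?H (sol p)) q" using Dt_sol[OF H' qD] qs by simp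
    also have "\<dots> = \<tau> ?H q" by (rule der_cong[OF sol_dep[OF H'd] qD])
    finally show ?thesis using DxH'[OF qD] \<tau>H'[OF qD] qs by simp
  qed
  ultimately show ?thesis
    unfolding trivial_vector_def D_eq[symmetric]
    by (intro exI[of _ ?F'] exI[of _ ?G'] exI[of _ ?H]) (simp add: H' total_as_der)
qed

section \<open>Linear combinations of conserved vectors, and vectors with a given
  characteristic\<close>

lemma der_lin_comb:
  assumes "\<And>k. k < (n :: nat) ==> dfun (F k)" "p \<in> D"
  shows "der \<xi> (\<lambda>p. \<Sum>k<n. c k * F k p) p = (\<Sum>k<n. c k * der \<xi> (F k) p)"
  by (subst der_sum) (auto simp: assms dfun_mult dfun_const der_cmult)

lemma conserved_vec_diff:
  assumes "conserved_vector E V" "conserved_vector E Z" shows "conserved_vector E (vec_diff V Z)"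
proof -
  note d = conserved_dfun[OF assms(1)] conserved_dfun[OF assms(2)]
  have "total_t (\<lambda>p. fst V p - fst Z p) p + total_x (\<lambda>p. snd V p - snd Z p) p = 0"
    if p: "p \<in> solution_jets E" for p
  proof -
    have pD: "p \<in> D" using p by (simp add: solution_jets_iff)
    have "total_t (\<lambda>p. fst V p - fst Z p) p + total_x (\<lambda>p. snd V p - snd Z p) p =
        (total_t (fst V) p + total_x (snd V) p) - (total_t (fst Z) p + total_x (snd Z) p)"
      by (simp add: total_as_der d dfun_diff der_diff pD)
    then show ?thesis using assms p by (simp add: conserved_vector_def)
  qed
  then show ?thesis
    using d unfolding conserved_vector_def D_eq[symmetric] vec_diff_def by (simp add: dfun_diff)
qed

lemma conserved_lin_comb:
  assumes "\<And>k. k < length Vs ==> conserved_vector E (Vs ! k)"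
  shows "conserved_vector E (lin_comb c Vs)"
proof -
  note d = conserved_dfun[OF assms]
  have z: "Dt (fst (Vs ! k)) p + Dx (snd (Vs ! k)) p = 0"
    if "p \<in> solution_jets E" "k < length Vs" for p k
    using assms[OF that(2)] that d[OF that(2)]
    by (simp add: conserved_vector_def total_as_der solution_jets_iff)
  have F: "dfun (\<lambda>p. \<Sum>k<length Vs. c k * fst (Vs ! k) p)"
    "dfun (\<lambda>p. \<Sum>k<length Vs. c k * snd (Vs ! k) p)"
    by (intro dfun_sum dfun_mult dfun_const d; simp)+
  have "total_t (\<lambda>p. \<Sum>k<length Vs. c k * fst (Vs ! k) p) p +
      total_x (\<lambda>p. \<Sum>k<length Vs. c k * snd (Vs ! k) p) p = 0" if p: "p \<in> solution_jets E" for p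
  proof -
    have pD: "p \<in> D" using p by (simp add: solution_jets_iff)
    have "total_t (\<lambda>p. \<Sum>k<length Vs. c k * fst (Vs ! k) p) p +
      total_x (\<lambda>p. \<Sum>k<length Vs. c k * snd (Vs ! k) p) p =
      (\<Sum>k<length Vs. c k * (Dt (fst (Vs ! k)) p + Dx (snd (Vs ! k)) p))"
      by (simp add: total_as_der F pD der_lin_comb d sum.distrib distrib_left)
    then show ?thesis using z[OF p] by simp
  qed
  then show ?thesis
    using F unfolding conserved_vector_def lin_comb_def by (simp add: D_eq)
qed

lemma has_char_vec_diff:
  assumes "has_char V l" "has_char Z m" shows "has_char (vec_diff V Z) (\<lambda>t x. l t x - m t x)"
proof -
  obtain H I where H: "dfun H" "dep K_jet H"
    "\<forall>p\<in>D. fst V (sol p) = lift l p * cf E (p Space) * p (U 0 0) + Dx H p"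
    "dfun I" "dep K_jet I"
    "\<forall>p\<in>D. fst Z (sol p) = lift m p * cf E (p Space) * p (U 0 0) + Dx I p"
    using assms unfolding has_char_def by blast
  have "dep K_jet (\<lambda>p. H p + (-1) * I p)" by (intro dep_add dep_mult dep_const H)
  then show ?thesis
    using assms H unfolding has_char_def vec_diff_def
    by (intro conjI exI[of _ "\<lambda>p. H p - I p"]) (auto simp: dfun_diff der_diff algebra_simps)
qed

lemma has_char_lin_comb:
  assumes "length ls = length Vs" "\<And>k. k < length Vs ==> has_char (Vs ! k) (ls ! k)"
  shows "has_char (lin_comb c Vs) (\<lambda>t x. \<Sum>k<length Vs. c k * (ls ! k) t x)"
proof -
  have "\<forall>k. \<exists>H. k < length Vs \<longrightarrow> dfun H \<and> dep K_jet H \<and> (\<forall>p\<in>D. fst (Vs ! k) (sol p) =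
      lift (ls ! k) p * cf E (p Space) * p (U 0 0) + Dx H p)"
    using assms(2) unfolding has_char_def by blast
  then obtain H where H: "\<And>k. k < length Vs ==> dfun (H k)" "\<And>k. k < length Vs ==> dep K_jet (H k)"
    "\<And>k p. k < length Vs ==> p \<in> D ==> fst (Vs ! k) (sol p) =
      lift (ls ! k) p * cf E (p Space) * p (U 0 0) + Dx (H k) p" by metis
  let ?H = "\<lambda>p. \<Sum>k<length Vs. c k * H k p"
  have l: "\<And>k. k < length Vs ==> dfun (lift (ls ! k))" using assms(2) by (simp add: has_char_def)
  have "dfun (lift (\<lambda>t x. \<Sum>k<length Vs. c k * (ls ! k) t x))"
    by (intro dfun_sum dfun_mult dfun_const l) auto
  moreover have "dfun ?H" by (intro dfun_sum dfun_mult dfun_const H) auto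
  moreover have "dep K_jet ?H" by (intro dep_sum dep_mult dep_const H) auto
  moreover have "fst (lin_comb c Vs) (sol p) = lift (\<lambda>t x. \<Sum>k<length Vs. c k * (ls ! k) t x) p *
      cf E (p Space) * p (U 0 0) + Dx ?H p" if p: "p \<in> D" for p
  proof -
    have "Dx ?H p = (\<Sum>k<length Vs. c k * Dx (H k) p)"
      by (rule der_lin_comb[OF H(1) p])
    then show ?thesis
      by (simp add: lin_comb_def H(3) p distrib_left sum.distrib sum_distrib_right mult.assoc)
  qed
  ultimately show ?thesis unfolding has_char_def by blast
qed

lemma nontrivial_imp_char_solution:
  assumes "has_nontrivial_cl E"
  shows "\<exists>l. char_solution E l \<and> (\<exists>t\<in>tdom E. \<exists>x\<in>xdom E. l t x \<noteq> 0)"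
proof -
  obtain V where V: "conserved_vector E V" "\<not> trivial_vector E V"
    using assms by (auto simp: has_nontrivial_cl_def)
  obtain l where "has_char V l" "char_solution E l" using conserved_has_char[OF V(1)] by blast
  then show ?thesis using zero_imp_trivial[OF V(1)] V(2) by blast
qed

text \<open>The last equation required of \<open>l\<close> is the one for characteristics integrated
  over \<open>u\<close>; it is sensitive to the integration constants in \<open>IA\<close> and
  \<open>IB\<close>. In the applications \<open>l_xx\<close> vanishes or \<open>IA\<close> is
  \<open>u\<close>, and \<open>(h l)_x\<close> vanishes or \<open>IB\<close> is \<open>u\<close> or
  \<open>0\<close>.\<close>

lemma vector_of_char:
  assumes l: "dfun (lift l)"
    and dt: "\<And>t x. t \<in> tdom E ==> x \<in> xdom E ==> ((\<lambda>s. l s x) has_real_derivative lt t x) (at t)"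
    and dx: "\<And>t x. t \<in> tdom E ==> x \<in> xdom E ==> (l t has_real_derivative lx t x) (at x)"
    and dxx: "\<And>t x. t \<in> tdom E ==> x \<in> xdom E ==> (lx t has_real_derivative lxx t x) (at x)"
    and IA: "antiderivative (udom E) (cA E) IA" and IB: "antiderivative (udom E) (cB E) IB"
    and det: "\<And>t x u. t \<in> tdom E ==> x \<in> xdom E ==> u \<in> udom E ==>
      cf E x * lt t x * u + lxx t x * IA u - (deriv (ch E) x * l t x + ch E x * lx t x) * IB u = 0"
    and F: "\<And>t x u v. t \<in> tdom E ==> x \<in> xdom E ==> u \<in> udom E ==> F t x u v = l t x * cf E x * u"
    and G: "\<And>t x u v. t \<in> tdom E ==> x \<in> xdom E ==> u \<in> udom E ==>
      G t x u v = lx t x * IA u - l t x * cA E u * v - l t x * ch E x * IB u"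
  shows "characteristic E (on_jet F, on_jet G) (on_jet (\<lambda>t x u v. l t x))"
    "has_char (on_jet F, on_jet G) l"
proof -
  obtain lt' lx' lxx' where d': "\<forall>t\<in>tdom E. \<forall>x\<in>xdom E.
        ((\<lambda>s. l s x) has_real_derivative lt' t x) (at t) \<and>
        (l t has_real_derivative lx' t x) (at x) \<and> (lx' t has_real_derivative lxx' t x) (at x)"
    "\<forall>p\<in>D. partial Time (lift l) p = lift lt' p \<and> partial Space (lift l) p = lift lx' p \<and>
        partial Space (partial Space (lift l)) p = lift lxx' p"
    using lift_derivatives[OF l dep_lift refl] by blast
  let ?L = "lift l" and ?LX = "partial Space (lift l)"
  have LX: "dfun ?LX" "dep {Time, Space} ?LX" using dfun_partial[OF l] dep_partial[OF dep_lift] .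
  have lt: "lt' t x = lt t x" and lx: "lx' t x = lx t x" if "t \<in> tdom E" "x \<in> xdom E" for t x
    using DERIV_unique d'(1) dt dx that by blast+
  have lxx: "lxx' t x = lxx t x" if tx: "t \<in> tdom E" "x \<in> xdom E" for t x
    by (rule DERIV_unique_open[OF open_domains(2) tx(2) lx[OF tx(1)]
          conjunct2[OF conjunct2[OF bspec[OF bspec[OF d'(1) tx(1)] tx(2)]]] dxx[OF tx]])
  have part: "partial Time ?L p = lift lt p" "?LX p = lift lx p" "partial Space ?LX p = lift lxx p"
    if "p \<in> D" for p
    using d'(2) that lt lx lxx by (simp_all add: D_iff)
  have sIA: "smooth_on_line (udom E) IA" "smooth_on_line (udom E) IB"
    using smooth_on_line_antiderivative[OF IA] smooth_on_line_antiderivative[OF IB]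
      smooth_coeffs open_domains by auto
  have dI: "deriv IA u = cA E u" "deriv IB u = cB E u" if "u \<in> udom E" for u
    using that IA IB by (auto simp: antiderivative_def intro!: DERIV_imp_deriv)
  let ?F = "\<lambda>p. ?L p * cf E (p Space) * p (U 0 0)"
  let ?G = "\<lambda>p. ?LX p * IA (p (U 0 0)) - ?L p * cA E (p (U 0 0)) * p (U 0 1)
      - ?L p * ch E (p Space) * IB (p (U 0 0))"
  have dF: "dfun ?F" by (intro dfun_mult l dfun_coeffs dfun_coord)
  have dG: "dfun ?G" by (intro dfun_mult dfun_diff l LX dfun_coeffs dfun_coord dfun_u sIA)
  have FG: "on_jet F p = ?F p" "on_jet G p = ?G p" if "p \<in> D" for p
    using that F G part by (simp_all add: on_jet_def D_iff)
  have FG': "dfun (on_jet F)" "dfun (on_jet G)"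
    using dfun_cong[OF _ dF, of "on_jet F"] dfun_cong[OF _ dG, of "on_jet G"] FG by auto
  have Dt_l: "Dt ?L p = lift lt p" and Dx_l: "Dx ?L p = lift lx p" and Dx_lx: "Dx ?LX p = lift lxx p"
    if "p \<in> D" for p
    using der_eq[OF _ dep_lift that] der_eq[OF _ LX(2) that] part[OF that] by simp_all
  have ident: "total_t (on_jet F) p + total_x (on_jet G) p = lift l p * pde E p" if p: "p \<in> D" for p
  proof -
    have pd: "p Time \<in> tdom E" "p Space \<in> xdom E" "p (U 0 0) \<in> udom E" using p by (simp_all add: D_iff)
    have t: "total_t (on_jet F) p = lift lt p * cf E (p Space) * p (U 0 0) + ?L p * cf E (p Space) * p (U 1 0)"
    proof -
      have "total_t (on_jet F) p = Dt ?F p" using total_as_der(1)[OF FG'(1) p] der_cong[OF FG(1) p] by simp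
      then show ?thesis
        using der_line[of Space "cf E" p shift_t] smooth_coeffs(1)
        by (simp add: der_mult l dfun_mult dfun_coeffs dfun_coord p Dt_l der_coord algebra_simps)
    qed
    have "total_x (on_jet G) p = Dx ?G p" using total_as_der(2)[OF FG'(2) p] der_cong[OF FG(2) p] by simp
    also have "\<dots> = lift lxx p * IA (p (U 0 0)) + lift lx p * (p (U 0 1) * cA E (p (U 0 0)))
        - ((lift lx p * cA E (p (U 0 0)) + ?L p * (p (U 0 1) * deriv (cA E) (p (U 0 0)))) * p (U 0 1)
           + ?L p * cA E (p (U 0 0)) * p (U 0 2))
        - ((lift lx p * ch E (p Space) + ?L p * deriv (ch E) (p Space)) * IB (p (U 0 0))
           + ?L p * ch E (p Space) * (p (U 0 1) * cB E (p (U 0 0))))"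
      using der_line[of Space "ch E" p shift_x] der_line[of "U 0 0" "cA E" p shift_x]
        der_line[of "U 0 0" IA p shift_x] der_line[of "U 0 0" IB p shift_x] smooth_coeffs sIA
      by (simp add: der_mult der_diff l LX dfun_mult dfun_diff dfun_coeffs dfun_coord p Dx_l Dx_lx dfun_u
          der_coord dI pd part numeral_2_eq_2)
    finally have X: "total_x (on_jet G) p = \<dots>" .
    have pe: "pde E p = cf E (p Space) * p (U 1 0) - (cA E (p (U 0 0)) * p (U 0 2)
        + deriv (cA E) (p (U 0 0)) * p (U 0 1) * p (U 0 1)
        + ch E (p Space) * cB E (p (U 0 0)) * p (U 0 1))"
      using f_nz[OF pd(2)] unfolding pde_eq[OF p] rhs_def by (simp add: field_simps)
    have "total_t (on_jet F) p + total_x (on_jet G) p = lift l p * pde E p +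
        (cf E (p Space) * lift lt p * p (U 0 0) + lift lxx p * IA (p (U 0 0))
         - (deriv (ch E) (p Space) * lift l p + ch E (p Space) * lift lx p) * IB (p (U 0 0)))"
      unfolding t X pe by (simp add: algebra_simps)
    then show ?thesis using det[OF pd] by simp
  qed
  have cons: "conserved_vector E (on_jet F, on_jet G)"
  proof -
    have "pde E p = 0" if "p \<in> solution_jets E" for p
      using that unfolding solution_jets_iff by (metis funpow_0)
    then show ?thesis
      using FG' ident unfolding conserved_vector_def D_eq[symmetric] by (simp add: solution_jets_iff)
  qed
  have onl: "on_jet (\<lambda>t x u v. l t x) = lift l" by (simp add: on_jet_def fun_eq_iff)
  show "characteristic E (on_jet F, on_jet G) (on_jet (\<lambda>t x u v. l t x))"
    unfolding characteristic_def onl D_eq[symmetric]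
    using cons l ident trivial_zero by (intro conjI exI[of _ "(on_jet F, on_jet G)"]) auto
  have "fst (on_jet F, on_jet G) (sol p) = lift l p * cf E (p Space) * p (U 0 0) + Dx (\<lambda>p. 0) p"
    if "p \<in> D" for p
    using FG(1)[OF sol_D[OF that]] that by (simp add: der_const)
  then show "has_char (on_jet F, on_jet G) l"
    unfolding has_char_def using l dfun_const dep_const by blast
qed

end

section \<open>Transformations\<close>

lemma smooth_on_line_cmult:
  "smooth_on_line S g ==> open S ==> smooth_on_line S (\<lambda>x. k * g x)"
  by (rule smooth_on_line_mult[OF smooth_on_line_const])

lemma smooth_on_line_exp_comp:
  "smooth_on_line S g ==> open S ==> smooth_on_line S (\<lambda>x. exp (g x))"
  by (rule smooth_on_line_comp[OF smooth_on_line_exp]) auto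

lemma open_interval_constant:
  assumes "open_interval S" "\<And>x. x \<in> S ==> (g has_real_derivative 0) (at x)"
  shows "\<exists>k. \<forall>x\<in>S. g x = k"
proof -
  have "convex S" using assms(1) by (simp add: open_interval_def is_interval_convex)
  then show ?thesis
    using has_field_derivative_zero_constant[of S g] assms(2) has_field_derivative_at_within by blast
qed

text \<open>The \<open>x\<close>-part of a group element. Its derivative \<open>d5 * w\<close> has
  no zeros, so \<open>\<phi>\<close> is injective, and invariance of domain makes its image an open
  interval.\<close>

locale x_change =
  fixes E :: equation and d5 d6 d8 :: real and H K :: "real => real"
  assumes E: "is_equation E" and d5: "d5 \<noteq> 0"
    and H: "antiderivative (xdom E) (ch E) H"
    and K: "antiderivative (xdom E) (\<lambda>x. exp (d8 * H x)) K"
begin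

sublocale eqn E by unfold_locales (rule E)

definition \<phi> :: "real => real" where "\<phi> x = d5 * K x + d6"
definition \<psi> :: "real => real" where "\<psi> = inv_into (xdom E) \<phi>"
definition w :: "real => real" where "w x = exp (d8 * H x)"

lemma w_pos: "w x > 0" "w x \<noteq> 0"
  by (simp_all add: w_def)

lemma DERIV_\<phi>: "x \<in> xdom E ==> (\<phi> has_real_derivative d5 * w x) (at x)"
  using K unfolding antiderivative_def \<phi>_def[abs_def] w_def by (auto intro!: derivative_eq_intros)

lemma DERIV_H: "x \<in> xdom E ==> (H has_real_derivative ch E x) (at x)"
  using H by (simp add: antiderivative_def)

lemma smooth_H: "smooth_on_line (xdom E) H"
  by (rule smooth_on_line_antiderivative[OF H smooth_coeffs(2) open_domains(2)])

lemma smooth_w: "smooth_on_line (xdom E) w"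
  unfolding w_def[abs_def]
  by (intro smooth_on_line_exp_comp smooth_on_line_cmult smooth_H open_domains)

lemma DERIV_w: "x \<in> xdom E ==> (w has_real_derivative d8 * ch E x * w x) (at x)"
  unfolding w_def[abs_def] by (auto intro!: derivative_eq_intros DERIV_H)

lemma inj_\<phi>: "inj_on \<phi> (xdom E)"
proof -
  have *: False if "a \<in> xdom E" "b \<in> xdom E" "a < b" "\<phi> a = \<phi> b" for a b
  proof -
    have sub: "{a..b} \<subseteq> xdom E"
      using domains(2) that mem_is_interval_1_I[of "xdom E" a b] by (auto simp: open_interval_def)
    have "\<exists>z. a < z \<and> z < b \<and> \<phi> b - \<phi> a = (b - a) * (d5 * w z)"
      by (rule MVT2[OF that(3)]) (use sub DERIV_\<phi> in auto)
    then show False using that d5 w_pos by auto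
  qed
  show ?thesis
    by (rule inj_onI) (metis * linorder_neqE_linordered_idom)
qed

lemma \<psi>_\<phi>: "x \<in> xdom E ==> \<psi> (\<phi> x) = x"
  unfolding \<psi>_def by (rule inv_into_f_f[OF inj_\<phi>])

lemma \<psi>_mem: "y \<in> \<phi> ` xdom E ==> \<psi> y \<in> xdom E" and \<phi>_\<psi>: "y \<in> \<phi> ` xdom E ==> \<phi> (\<psi> y) = y"
  unfolding \<psi>_def by (auto intro: inv_into_into f_inv_into_f)

lemma continuous_\<phi>: "continuous_on (xdom E) \<phi>"
  by (rule DERIV_continuous_on[where D="\<lambda>x. d5 * w x"])
    (auto intro: has_field_derivative_at_within DERIV_\<phi>)

lemma open_interval_image: "open_interval (\<phi> ` xdom E)"
  unfolding open_interval_def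
proof (intro conjI)
  show "open (\<phi> ` xdom E)"
    by (rule invariance_of_domain[OF continuous_\<phi> open_domains(2) inj_\<phi>])
  show "is_interval (\<phi> ` xdom E)"
    using connected_continuous_image[OF continuous_\<phi>] domains(2)
    by (simp add: is_interval_connected_1 open_interval_def)
  show "\<phi> ` xdom E \<noteq> {}" using domains(2) by (simp add: open_interval_def)
qed

lemma open_image: "open (\<phi> ` xdom E)"
  using open_interval_image by (simp add: open_interval_def)

lemma DERIV_\<psi>: "y \<in> \<phi> ` xdom E ==> (\<psi> has_real_derivative inverse (d5 * w (\<psi> y))) (at y)"
  unfolding has_field_derivative_def
proof (rule has_derivative_inverse_strong_x[OF open_domains(2) \<psi>_mem continuous_\<phi> \<psi>_\<phi>])
  assume y: "y \<in> \<phi> ` xdom E"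
  show "(\<phi> has_derivative (*) (d5 * w (\<psi> y))) (at (\<psi> y))"
    using DERIV_\<phi>[OF \<psi>_mem[OF y]] by (simp add: has_field_derivative_def)
  show "(*) (d5 * w (\<psi> y)) \<circ> (*) (inverse (d5 * w (\<psi> y))) = id"
    using d5 w_pos(2)[of "\<psi> y"] by (simp add: fun_eq_iff field_simps)
qed (use \<phi>_\<psi> in auto)

lemma DERIV_comp_\<psi>:
  assumes "(g has_real_derivative g') (at (\<psi> y))" "y \<in> \<phi> ` xdom E"
  shows "((\<lambda>y. g (\<psi> y)) has_real_derivative g' * inverse (d5 * w (\<psi> y))) (at y)"
  using DERIV_chain2[OF assms(1) DERIV_\<psi>[OF assms(2)]] .

lemma continuous_\<psi>: "continuous_on (\<phi> ` xdom E) \<psi>"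
  by (rule DERIV_continuous_on[OF has_field_derivative_at_within[OF DERIV_\<psi>]])

text \<open>The derivative of \<open>g (\<psi> y)\<close> is a function of the same form, with
  \<open>deriv g\<close> divided by \<open>d5 * w\<close> in place of \<open>g\<close>.\<close>

lemma smooth_comp_\<psi>:
  assumes "smooth_on_line (xdom E) g" shows "smooth_on_line (\<phi> ` xdom E) (\<lambda>y. g (\<psi> y))"
proof (rule smooth_on_line_coinduct[where C="(\<lambda>g y. g (\<psi> y)) ` {g. smooth_on_line (xdom E) g}"])
  fix G assume "G \<in> (\<lambda>g y. g (\<psi> y)) ` {g. smooth_on_line (xdom E) g}"
  then obtain g where g: "smooth_on_line (xdom E) g" and G: "G = (\<lambda>y. g (\<psi> y))" by blast
  have "smooth_on_line (xdom E) (\<lambda>x. deriv g x * inverse (d5 * w x))"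
    using w_pos d5 by (intro smooth_on_line_mult smooth_on_line_deriv g open_domains
        smooth_on_line_inverse smooth_on_line_cmult smooth_w) auto
  moreover have "(G has_real_derivative deriv g (\<psi> y) * inverse (d5 * w (\<psi> y))) (at y)"
    if "y \<in> \<phi> ` xdom E" for y
    unfolding G by (rule DERIV_comp_\<psi>[OF smooth_on_line_DERIV[OF g \<psi>_mem[OF that]] that])
  ultimately show "\<exists>g'\<in>(\<lambda>g y. g (\<psi> y)) ` {g. smooth_on_line (xdom E) g}.
      \<forall>y\<in>\<phi> ` xdom E. (G has_real_derivative g' y) (at y)"
    by (intro bexI[of _ "\<lambda>y. deriv g (\<psi> y) * inverse (d5 * w (\<psi> y))"] ballI)
      (auto intro: rev_image_eqI)
qed (use assms open_image in auto)

end

lemma affine_image_open_interval: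
  assumes "open_interval S" "(a :: real) \<noteq> 0"
  shows "open_interval ((\<lambda>t. a * t + b) ` S)"
  unfolding open_interval_def
proof (intro conjI)
  have "continuous_on S (\<lambda>t. a * t + b)" by (auto intro!: continuous_intros)
  moreover have "inj_on (\<lambda>t. a * t + b) S" using assms(2) by (auto simp: inj_on_def)
  ultimately show "open ((\<lambda>t. a * t + b) ` S)" "is_interval ((\<lambda>t. a * t + b) ` S)"
    using assms(1) invariance_of_domain[of S "\<lambda>t. a * t + b"] connected_continuous_image
    by (auto simp: is_interval_connected_1 open_interval_def)
  show "(\<lambda>t. a * t + b) ` S \<noteq> {}" using assms(1) by (simp add: open_interval_def)
qed

lemma smooth_on_line_affine:
  assumes "smooth_on_line S g" "(a :: real) \<noteq> 0" "open_interval S"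
  shows "smooth_on_line ((\<lambda>t. a * t + b) ` S) (\<lambda>y. g ((y - b) / a))"
proof (rule smooth_on_line_comp[OF assms(1)])
  have op: "open ((\<lambda>t. a * t + b) ` S)"
    using affine_image_open_interval[OF assms(3,2)] by (simp add: open_interval_def)
  then show "open ((\<lambda>t. a * t + b) ` S)" .
  have "smooth_on_line ((\<lambda>t. a * t + b) ` S) (\<lambda>y. inverse a * y + - b / a)"
    by (intro smooth_on_line_add smooth_on_line_cmult smooth_on_line_ident smooth_on_line_const op)
  then show "smooth_on_line ((\<lambda>t. a * t + b) ` S) (\<lambda>y. (y - b) / a)"
    by (simp add: divide_inverse_commute right_diff_distrib)
qed (use assms(2) in auto)

text \<open>The body of \<open>maps_to\<close> with the constants and antiderivatives as arguments,
  so that composition and inversion can compute with them.\<close>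

definition maps_via :: "real => real => real => real => real => real => real => real => real =>
    (real => real) => (real => real) => equation => equation => bool" where
  "maps_via d1 d2 d3 d4 d5 d6 d7 d8 d9 H K E E' \<longleftrightarrow>
        d1 * d3 * d5 * d7 * d9 \<noteq> 0 \<and>
        antiderivative (xdom E) (ch E) H \<and>
        antiderivative (xdom E) (\<lambda>x. exp (d8 * H x)) K \<and>
        tdom E' = (\<lambda>t. d1 * t + d2) ` tdom E \<and>
        xdom E' = (\<lambda>x. d5 * K x + d6) ` xdom E \<and>
        udom E' = (\<lambda>u. d3 * u + d4) ` udom E \<and>
        (\<forall>x\<in>xdom E.
           cf E' (d5 * K x + d6) = d1 / d5 * d9 * cf E x * exp (- 2 * d8 * H x) \<and>
           ch E' (d5 * K x + d6) = d9 / d7 * ch E x * exp (- d8 * H x)) \<and>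
        (\<forall>u\<in>udom E.
           cA E' (d3 * u + d4) = d5 * d9 * cA E u \<and>
           cB E' (d3 * u + d4) = d7 * (cB E u + d8 * cA E u))"

lemma maps_to_iff: "maps_to E E' \<longleftrightarrow>
    (\<exists>d1 d2 d3 d4 d5 d6 d7 d8 d9 H K. maps_via d1 d2 d3 d4 d5 d6 d7 d8 d9 H K E E')"
  unfolding maps_to_def maps_via_def by blast

lemma maps_via_exists:
  assumes E: "is_equation E" and nz: "d1 * d3 * d5 * d7 * d9 \<noteq> 0"
    and H: "antiderivative (xdom E) (ch E) H"
    and K: "antiderivative (xdom E) (\<lambda>x. exp (d8 * H x)) K"
  shows "\<exists>E'. is_equation E' \<and> maps_via d1 d2 d3 d4 d5 d6 d7 d8 d9 H K E E'"
proof -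
  have d: "d1 \<noteq> 0" "d3 \<noteq> 0" "d5 \<noteq> 0" "d7 \<noteq> 0" "d9 \<noteq> 0" using nz by auto
  interpret x_change E d5 d6 d8 H K by unfold_locales (fact E d H K)+
  let ?X = "\<phi> ` xdom E" and ?T = "(\<lambda>t. d1 * t + d2) ` tdom E" and ?U = "(\<lambda>u. d3 * u + d4) ` udom E"
  define E' where "E' = \<lparr>tdom = ?T, xdom = ?X, udom = ?U,
    cf = (\<lambda>y. d1 / d5 * d9 * cf E (\<psi> y) * exp (- 2 * d8 * H (\<psi> y))),
    ch = (\<lambda>y. d9 / d7 * ch E (\<psi> y) * exp (- d8 * H (\<psi> y))),
    cA = (\<lambda>v. d5 * d9 * cA E ((v - d4) / d3)),
    cB = (\<lambda>v. d7 * (cB E ((v - d4) / d3) + d8 * cA E ((v - d4) / d3)))\<rparr>"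
  have U: "open_interval ?U" by (rule affine_image_open_interval[OF domains(3) d(2)])
  have oU: "open ?U" using U by (simp add: open_interval_def)
  have "smooth_on_line (xdom E) (\<lambda>x. d1 / d5 * d9 * cf E x * exp (- 2 * d8 * H x))"
    "smooth_on_line (xdom E) (\<lambda>x. d9 / d7 * ch E x * exp (- d8 * H x))"
    by (intro smooth_on_line_mult smooth_on_line_const smooth_on_line_exp_comp
        smooth_on_line_cmult smooth_coeffs smooth_H open_domains)+
  note fh = this[THEN smooth_comp_\<psi>]
  have A: "smooth_on_line ?U (\<lambda>v. cA E ((v - d4) / d3))" "smooth_on_line ?U (\<lambda>v. cB E ((v - d4) / d3))"
    by (intro smooth_on_line_affine smooth_coeffs d domains)+
  have "smooth_on_line ?U (\<lambda>v. d5 * d9 * cA E ((v - d4) / d3))"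
    "smooth_on_line ?U (\<lambda>v. d7 * (cB E ((v - d4) / d3) + d8 * cA E ((v - d4) / d3)))"
    by (intro smooth_on_line_cmult smooth_on_line_add A oU)+
  then have "is_equation E'"
    using fh U d f_nz A_nz \<psi>_mem affine_image_open_interval[OF domains(1) d(1)] open_interval_image
    unfolding is_equation_def E'_def by auto
  moreover have "maps_via d1 d2 d3 d4 d5 d6 d7 d8 d9 H K E E'"
  proof -
    have "xdom E' = (\<lambda>x. d5 * K x + d6) ` xdom E" by (simp add: E'_def \<phi>_def)
    moreover have "\<psi> (d5 * K x + d6) = x" if "x \<in> xdom E" for x
      using \<psi>_\<phi>[OF that] by (simp add: \<phi>_def)
    ultimately show ?thesis
      unfolding maps_via_def using nz H K d by (simp add: E'_def)
  qed
  ultimately show ?thesis by blast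
qed

lemma maps_via_compose:
  assumes E: "is_equation E" and m1: "maps_via d1 d2 d3 d4 d5 d6 d7 d8 d9 H K E E'"
    and m2: "maps_via e1 e2 e3 e4 e5 e6 e7 e8 e9 H' K' E' E''"
  shows "maps_to E E''"
proof -
  have d: "d1 \<noteq> 0" "d3 \<noteq> 0" "d5 \<noteq> 0" "d7 \<noteq> 0" "d9 \<noteq> 0" using m1 by (auto simp: maps_via_def)
  have e: "e1 \<noteq> 0" "e3 \<noteq> 0" "e5 \<noteq> 0" "e7 \<noteq> 0" "e9 \<noteq> 0" using m2 by (auto simp: maps_via_def)
  interpret x_change E d5 d6 d8 H K
    by unfold_locales (use E d m1 in \<open>auto simp: maps_via_def\<close>)
  \<comment> \<open>The chain rule turns \<open>h'\<close> along \<open>\<phi>\<close> into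
    \<open>k h\<close>, so the antiderivatives correspond by
    \<open>H' (\<phi> x) = k * H x + c\<close>.\<close>
  define k where "k = d9 * d5 / d7"
  have X': "xdom E' = \<phi> ` xdom E" using m1 by (simp add: maps_via_def \<phi>_def)
  have "\<exists>c. \<forall>x\<in>xdom E. H' (\<phi> x) - k * H x = c"
  proof (rule open_interval_constant[OF domains(2)])
    fix x assume x: "x \<in> xdom E"
    have "(H' has_real_derivative ch E' (\<phi> x)) (at (\<phi> x))"
      using m2 x by (auto simp: maps_via_def antiderivative_def X')
    from DERIV_chain2[OF this DERIV_\<phi>[OF x]]
    have "((\<lambda>x. H' (\<phi> x)) has_real_derivative ch E' (\<phi> x) * (d5 * w x)) (at x)" .
    moreover have "ch E' (\<phi> x) * (d5 * w x) = k * ch E x"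
      using m1 x d w_pos unfolding maps_via_def \<phi>_def k_def w_def
      by (simp add: exp_minus field_simps)
    ultimately show "((\<lambda>x. H' (\<phi> x) - k * H x) has_real_derivative 0) (at x)"
      by (auto intro!: derivative_eq_intros DERIV_H x)
  qed
  then obtain c where c: "\<And>x. x \<in> xdom E ==> H' (\<phi> x) = k * H x + c" by (auto simp: algebra_simps)
  \<comment> \<open>The integration constant \<open>c\<close> produces the factor \<open>g\<close>,
    absorbed in the fifth and ninth parameters of the composition.\<close>
  define g where "g = exp (e8 * c)"
  have g: "g \<noteq> 0" by (simp add: g_def)
  define K'' where "K'' = (\<lambda>x. K' (\<phi> x) / (d5 * g))"
  have "antiderivative (xdom E) (\<lambda>x. exp ((d8 + k * e8) * H x)) K''"
    unfolding antiderivative_def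
  proof
    fix x assume x: "x \<in> xdom E"
    have "(K' has_real_derivative exp (e8 * H' (\<phi> x))) (at (\<phi> x))"
      using m2 x by (auto simp: maps_via_def antiderivative_def X')
    from DERIV_chain2[OF this DERIV_\<phi>[OF x]]
    have "(K'' has_real_derivative exp (e8 * H' (\<phi> x)) * (d5 * w x) / (d5 * g)) (at x)"
      unfolding K''_def by (rule DERIV_cdivide)
    moreover have "exp (e8 * H' (\<phi> x)) * (d5 * w x) / (d5 * g) = exp ((d8 + k * e8) * H x)"
      using d g by (simp add: c[OF x] w_def g_def field_simps exp_add[symmetric])
    ultimately show "(K'' has_real_derivative exp ((d8 + k * e8) * H x)) (at x)" by simp
  qed
  moreover have K'': "e5 * d5 * g * K'' x + e6 = e5 * K' (\<phi> x) + e6" for x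
    using d g by (simp add: K''_def)
  ultimately have "maps_via (e1 * d1) (e1 * d2 + e2) (e3 * d3) (e3 * d4 + e4) (e5 * d5 * g) e6
      (e7 * d7) (d8 + k * e8) (e9 * d9 / g) H K'' E E''"
    unfolding maps_via_def K''
  proof (intro conjI ballI)
    show "e1 * d1 * (e3 * d3) * (e5 * d5 * g) * (e7 * d7) * (e9 * d9 / g) \<noteq> 0" using d e g by simp
    show "antiderivative (xdom E) (ch E) H" by (rule H)
    show "tdom E'' = (\<lambda>t. e1 * d1 * t + (e1 * d2 + e2)) ` tdom E"
      "udom E'' = (\<lambda>t. e3 * d3 * t + (e3 * d4 + e4)) ` udom E"
      using m1 m2 by (auto simp: maps_via_def image_image algebra_simps)
    show "xdom E'' = (\<lambda>x. e5 * K' (\<phi> x) + e6) ` xdom E"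
      using m1 m2 by (auto simp: maps_via_def image_image \<phi>_def)
    fix x assume x: "x \<in> xdom E"
    then have x': "\<phi> x \<in> xdom E'" by (simp add: X')
    have f1: "cf E' (\<phi> x) = d1 / d5 * d9 * cf E x * exp (- 2 * d8 * H x)"
      "ch E' (\<phi> x) = d9 / d7 * ch E x * exp (- d8 * H x)"
      using m1 x by (simp_all add: maps_via_def \<phi>_def)
    have f2: "cf E'' (e5 * K' (\<phi> x) + e6) = e1 / e5 * e9 * cf E' (\<phi> x) * exp (- 2 * e8 * H' (\<phi> x))"
      "ch E'' (e5 * K' (\<phi> x) + e6) = e9 / e7 * ch E' (\<phi> x) * exp (- e8 * H' (\<phi> x))"
      using m2 x' by (simp_all add: maps_via_def)
    have "exp (- 2 * d8 * H x) * exp (- 2 * e8 * H' (\<phi> x)) = exp (- 2 * (d8 + k * e8) * H x) / g / g"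
      by (simp add: c[OF x] g_def exp_add[symmetric] exp_diff[symmetric] algebra_simps)
    then show "cf E'' (e5 * K' (\<phi> x) + e6) = e1 * d1 / (e5 * d5 * g) * (e9 * d9 / g) * cf E x *
        exp (- 2 * (d8 + k * e8) * H x)"
      unfolding f2 f1 using d e g by (simp add: field_simps)
    have "exp (- d8 * H x) * exp (- e8 * H' (\<phi> x)) = exp (- (d8 + k * e8) * H x) / g"
      by (simp add: c[OF x] g_def exp_add[symmetric] exp_diff[symmetric] algebra_simps)
    then show "ch E'' (e5 * K' (\<phi> x) + e6) = e9 * d9 / g / (e7 * d7) * ch E x * exp (- (d8 + k * e8) * H x)"
      unfolding f2 f1 using d e g by (simp add: field_simps)
  next
    fix u assume u: "u \<in> udom E"
    then have u': "d3 * u + d4 \<in> udom E'" using m1 by (auto simp: maps_via_def)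
    have u2: "e3 * d3 * u + (e3 * d4 + e4) = e3 * (d3 * u + d4) + e4" by (simp add: algebra_simps)
    show "cA E'' (e3 * d3 * u + (e3 * d4 + e4)) = e5 * d5 * g * (e9 * d9 / g) * cA E u"
      "cB E'' (e3 * d3 * u + (e3 * d4 + e4)) = e7 * d7 * (cB E u + (d8 + k * e8) * cA E u)"
    proof -
      have "cA E' (d3 * u + d4) = d5 * d9 * cA E u" "cB E' (d3 * u + d4) = d7 * (cB E u + d8 * cA E u)"
        using m1 u by (simp_all add: maps_via_def)
      moreover have "cA E'' (e3 * (d3 * u + d4) + e4) = e5 * e9 * cA E' (d3 * u + d4)"
        "cB E'' (e3 * (d3 * u + d4) + e4) = e7 * (cB E' (d3 * u + d4) + e8 * cA E' (d3 * u + d4))"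
        using m2 u' by (simp_all add: maps_via_def)
      ultimately show "cA E'' (e3 * d3 * u + (e3 * d4 + e4)) = e5 * d5 * g * (e9 * d9 / g) * cA E u"
        "cB E'' (e3 * d3 * u + (e3 * d4 + e4)) = e7 * d7 * (cB E u + (d8 + k * e8) * cA E u)"
        unfolding u2 using d g by (simp_all add: k_def field_simps)
    qed
  qed
  then show ?thesis unfolding maps_to_iff by blast
qed

text \<open>\<open>k * H (\<psi> y)\<close> is an antiderivative of the new \<open>h\<close>, and
  with the parameter \<open>- (d8 / k)\<close> its weight becomes the reciprocal of
  \<open>w\<close>.\<close>

lemma maps_via_inverse:
  assumes E: "is_equation E" and m: "maps_via d1 d2 d3 d4 d5 d6 d7 d8 d9 H K E E'"
  shows "maps_to E' E"
proof -
  have d: "d1 \<noteq> 0" "d3 \<noteq> 0" "d5 \<noteq> 0" "d7 \<noteq> 0" "d9 \<noteq> 0" using m by (auto simp: maps_via_def)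
  interpret x_change E d5 d6 d8 H K
    by unfold_locales (use E d m in \<open>auto simp: maps_via_def\<close>)
  define k where "k = d9 * d5 / d7"
  have k: "k \<noteq> 0" using d by (simp add: k_def)
  have X': "xdom E' = \<phi> ` xdom E" using m by (simp add: maps_via_def \<phi>_def)
  have h': "ch E' (\<phi> x) = d9 / d7 * ch E x * inverse (w x)"
    "cf E' (\<phi> x) = d1 / d5 * d9 * cf E x * inverse (w x) * inverse (w x)" if "x \<in> xdom E" for x
    using m that by (simp_all add: maps_via_def \<phi>_def w_def exp_minus[symmetric] exp_add[symmetric])
  have H': "antiderivative (xdom E') (ch E') (\<lambda>y. k * H (\<psi> y))"
    unfolding antiderivative_def X'
  proof
    fix y assume y: "y \<in> \<phi> ` xdom E"
    have "((\<lambda>y. k * H (\<psi> y)) has_real_derivative k * (ch E (\<psi> y) * inverse (d5 * w (\<psi> y)))) (at y)"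
      by (intro DERIV_cmult DERIV_comp_\<psi> DERIV_H \<psi>_mem y)
    moreover have "k * (ch E (\<psi> y) * inverse (d5 * w (\<psi> y))) = ch E' y"
      using h'(1)[OF \<psi>_mem[OF y]] \<phi>_\<psi>[OF y] d by (simp add: k_def)
    ultimately show "((\<lambda>y. k * H (\<psi> y)) has_real_derivative ch E' y) (at y)" by simp
  qed
  have K': "antiderivative (xdom E') (\<lambda>y. exp (- (d8 / k) * (k * H (\<psi> y)))) (\<lambda>y. d5 * \<psi> y)"
    unfolding antiderivative_def X'
  proof
    fix y assume y: "y \<in> \<phi> ` xdom E"
    have "((\<lambda>y. d5 * \<psi> y) has_real_derivative d5 * inverse (d5 * w (\<psi> y))) (at y)"
      by (intro DERIV_cmult DERIV_\<psi> y)
    then show "((\<lambda>y. d5 * \<psi> y) has_real_derivative exp (- (d8 / k) * (k * H (\<psi> y)))) (at y)"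
      using d k by (simp add: w_def exp_minus mult.assoc[symmetric])
  qed
  have "maps_via (inverse d1) (- d2 / d1) (inverse d3) (- d4 / d3) (inverse d5) 0 (inverse d7)
      (- (d8 / k)) (inverse d9) (\<lambda>y. k * H (\<psi> y)) (\<lambda>y. d5 * \<psi> y) E' E"
    unfolding maps_via_def
  proof (intro conjI ballI H' K')
    show "inverse d1 * inverse d3 * inverse d5 * inverse d7 * inverse d9 \<noteq> 0" using d by simp
    have "(\<lambda>t. inverse d1 * t + - d2 / d1) ` (\<lambda>t. d1 * t + d2) ` tdom E = tdom E"
      "(\<lambda>t. inverse d3 * t + - d4 / d3) ` (\<lambda>t. d3 * t + d4) ` udom E = udom E"
      using d by (simp_all add: image_image field_simps)
    then show "tdom E = (\<lambda>t. inverse d1 * t + - d2 / d1) ` tdom E'"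
      "udom E = (\<lambda>t. inverse d3 * t + - d4 / d3) ` udom E'"
      using m by (simp_all add: maps_via_def)
    have "(\<lambda>x. inverse d5 * (d5 * \<psi> x) + 0) ` \<phi> ` xdom E = xdom E"
      using d \<psi>_\<phi> by (simp add: image_image mult.assoc[symmetric])
    then show "xdom E = (\<lambda>x. inverse d5 * (d5 * \<psi> x) + 0) ` xdom E'" by (simp add: X')
  next
    fix y assume "y \<in> xdom E'"
    then obtain x where x: "x \<in> xdom E" "y = \<phi> x" by (auto simp: X')
    then have *: "inverse d5 * (d5 * \<psi> y) + 0 = x" using \<psi>_\<phi> d by simp
    have w: "exp (- 2 * - (d8 / k) * (k * H (\<psi> y))) = w x * w x"
      "exp (- (- (d8 / k)) * (k * H (\<psi> y))) = w x"
      using k x \<psi>_\<phi> by (simp_all add: w_def exp_add[symmetric])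
    show "cf E (inverse d5 * (d5 * \<psi> y) + 0) =
        inverse d1 / inverse d5 * inverse d9 * cf E' y * exp (- 2 * - (d8 / k) * (k * H (\<psi> y)))"
      "ch E (inverse d5 * (d5 * \<psi> y) + 0) =
        inverse d9 / inverse d7 * ch E' y * exp (- (- (d8 / k)) * (k * H (\<psi> y)))"
      unfolding * w unfolding x(2) h'[OF x(1)] using d w_pos by (simp_all add: field_simps)
  next
    fix v assume "v \<in> udom E'"
    then obtain u where u: "u \<in> udom E" "v = d3 * u + d4" using m by (auto simp: maps_via_def)
    then have *: "inverse d3 * v + - d4 / d3 = u" using d by (simp add: field_simps)
    have "cA E' v = d5 * d9 * cA E u" "cB E' v = d7 * (cB E u + d8 * cA E u)"
      using m u by (simp_all add: maps_via_def)
    then show "cA E (inverse d3 * v + - d4 / d3) = inverse d5 * inverse d9 * cA E' v"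
      "cB E (inverse d3 * v + - d4 / d3) = inverse d7 * (cB E' v + - (d8 / k) * cA E' v)"
      unfolding * using d by (simp_all add: k_def field_simps)
  qed
  then show ?thesis unfolding maps_to_iff by blast
qed

lemma same_equation_sym: "same_equation E E' ==> same_equation E' E"
  unfolding same_equation_def by auto

lemma equivalent_sym: "equivalent E E' ==> equivalent E' E"
  unfolding equivalent_def using same_equation_sym maps_via_inverse maps_to_iff by metis

lemma same_equation_refl: "same_equation E E"
  unfolding same_equation_def by auto

lemma eqnI: "is_equation E ==> eqn E"
  by (rule eqn.intro)

section \<open>Action of transformations on characteristics\<close>

lemma char_dataD:
  assumes "char_data E l lt lx lxx"
  shows "g \<in> {l, lt, lx, lxx} ==> continuous_on (tdom E \<times> xdom E) (\<lambda>z. g (fst z) (snd z))"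
    "t \<in> tdom E ==> x \<in> xdom E ==> ((\<lambda>s. l s x) has_real_derivative lt t x) (at t)"
    "t \<in> tdom E ==> x \<in> xdom E ==> (l t has_real_derivative lx t x) (at x)"
    "t \<in> tdom E ==> x \<in> xdom E ==> (lx t has_real_derivative lxx t x) (at x)"
    "t \<in> tdom E ==> x \<in> xdom E ==> u \<in> udom E ==> cf E x * lt t x + cA E u * lxx t x
           - cB E u * (deriv (ch E) x * l t x + ch E x * lx t x) = 0"
  using assms unfolding char_data_def by blast+

lemma char_solutionI:
  assumes "\<And>g. g \<in> {l, lt, lx, lxx} ==> continuous_on (tdom E \<times> xdom E) (\<lambda>z. g (fst z) (snd z))"
    "\<And>t x. t \<in> tdom E ==> x \<in> xdom E ==> ((\<lambda>s. l s x) has_real_derivative lt t x) (at t)"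
    "\<And>t x. t \<in> tdom E ==> x \<in> xdom E ==> (l t has_real_derivative lx t x) (at x)"
    "\<And>t x. t \<in> tdom E ==> x \<in> xdom E ==> (lx t has_real_derivative lxx t x) (at x)"
    "\<And>t x u. t \<in> tdom E ==> x \<in> xdom E ==> u \<in> udom E ==> cf E x * lt t x + cA E u * lxx t x
           - cB E u * (deriv (ch E) x * l t x + ch E x * lx t x) = 0"
  shows "char_solution E l"
  unfolding char_solution_def char_data_def
  by (intro exI[of _ lt] exI[of _ lx] exI[of _ lxx] conjI ballI assms)

text \<open>Keeps of an equivalence only its effect on characteristics: \<open>t\<close> changes
  affinely and the values are multiplied by a weight depending on \<open>x\<close>. This is enough
  to carry over linear independence.\<close>

definition transfers :: "real => real => (real => real) => (real => real) => equation => equation => bool" where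
  "transfers d1 d2 \<phi> w E E' \<longleftrightarrow> d1 \<noteq> 0 \<and> (\<forall>x. w x \<noteq> 0) \<and>
    tdom E' = (\<lambda>t. d1 * t + d2) ` tdom E \<and> xdom E' = \<phi> ` xdom E \<and>
    (\<forall>l. char_solution E l \<longrightarrow> (\<exists>l'. char_solution E' l' \<and>
       (\<forall>t\<in>tdom E. \<forall>x\<in>xdom E. l' (d1 * t + d2) (\<phi> x) = w x * l t x)))"

lemma transfersD:
  assumes "transfers d1 d2 \<phi> w E E'"
  shows "d1 \<noteq> 0" "w x \<noteq> 0" "tdom E' = (\<lambda>t. d1 * t + d2) ` tdom E" "xdom E' = \<phi> ` xdom E"
    "char_solution E l ==> \<exists>l'. char_solution E' l' \<and>
       (\<forall>t\<in>tdom E. \<forall>x\<in>xdom E. l' (d1 * t + d2) (\<phi> x) = w x * l t x)"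
  using assms unfolding transfers_def by blast+

text \<open>The two equations share \<open>h B\<close>, hence also its \<open>x\<close>-derivative
  \<open>h_x B\<close>, and these are the combinations in which \<open>B\<close> enters the equation
  for \<open>l\<close>.\<close>

lemma char_solution_same:
  assumes E: "is_equation E" "is_equation E'" and same: "same_equation E E'" and l: "char_solution E l"
  shows "char_solution E' l"
proof -
  interpret E: eqn E by (rule eqnI[OF E(1)])
  interpret E': eqn E' by (rule eqnI[OF E(2)])
  have dom: "tdom E' = tdom E" "xdom E' = xdom E" "udom E' = udom E"
    using same by (simp_all add: same_equation_def)
  have h: "ch E' x * cB E' u = ch E x * cB E u" if "x \<in> xdom E" "u \<in> udom E" for x u
    using same that by (simp add: same_equation_def)
  have h': "deriv (ch E') x * cB E' u = deriv (ch E) x * cB E u" if x: "x \<in> xdom E" and u: "u \<in> udom E" for x u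
  proof -
    have d: "((\<lambda>x. ch E x * cB E u) has_real_derivative deriv (ch E) x * cB E u) (at x)"
      using smooth_on_line_DERIV[OF E.smooth_coeffs(2) x] by (auto intro!: derivative_eq_intros)
    have d': "((\<lambda>x. ch E' x * cB E' u) has_real_derivative deriv (ch E') x * cB E' u) (at x)"
      using smooth_on_line_DERIV[OF E'.smooth_coeffs(2), of x] x dom by (auto intro!: derivative_eq_intros)
    show ?thesis by (rule DERIV_unique_open[OF E.open_domains(2) x _ d' d]) (rule h[OF _ u])
  qed
  have "cf E' x = cf E x" "cA E' u = cA E u" if "x \<in> xdom E" "u \<in> udom E" for x u
    using same that by (simp_all add: same_equation_def)
  moreover have "cB E' u * (deriv (ch E') x * a + ch E' x * b) = cB E u * (deriv (ch E) x * a + ch E x * b)"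
    if "x \<in> xdom E" "u \<in> udom E" for x u a b
  proof -
    have "cB E' u * (deriv (ch E') x * a + ch E' x * b) =
        (deriv (ch E') x * cB E' u) * a + (ch E' x * cB E' u) * b" by (simp add: algebra_simps)
    then show ?thesis using h[OF that] h'[OF that] by (simp add: algebra_simps)
  qed
  ultimately show ?thesis
    using l unfolding char_solution_def char_data_def dom by simp
qed

text \<open>The new characteristic is \<open>w l\<close>. Since \<open>h' l'\<close> is
  \<open>d9 / d7\<close> times \<open>h l\<close>, the term \<open>d8 A\<close> added to
  \<open>B\<close> contributes a multiple of \<open>A (h l)_x\<close>, exactly what the weight adds
  to the second derivative of \<open>l\<close>.\<close>

lemma char_solution_maps:
  assumes E: "is_equation E" and m: "maps_via d1 d2 d3 d4 d5 d6 d7 d8 d9 H K E E'"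
    and l: "char_solution E l"
  shows "\<exists>l'. char_solution E' l' \<and>
    (\<forall>t\<in>tdom E. \<forall>x\<in>xdom E. l' (d1 * t + d2) (d5 * K x + d6) = exp (d8 * H x) * l t x)"
proof -
  have d: "d1 \<noteq> 0" "d3 \<noteq> 0" "d5 \<noteq> 0" "d7 \<noteq> 0" "d9 \<noteq> 0" using m by (auto simp: maps_via_def)
  interpret x_change E d5 d6 d8 H K
    by unfold_locales (use E d m in \<open>auto simp: maps_via_def\<close>)
  obtain lt lx lxx where data: "char_data E l lt lx lxx" using l unfolding char_solution_def by blast
  note cont = char_dataD(1)[OF data] and der = char_dataD(2-4)[OF data] and det = char_dataD(5)[OF data]
  define \<theta> where "\<theta> s = (s - d2) / d1" for s
  have \<theta>: "\<theta> (d1 * t + d2) = t" for t using d by (simp add: \<theta>_def)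
  have T': "tdom E' = (\<lambda>t. d1 * t + d2) ` tdom E" and X': "xdom E' = \<phi> ` xdom E"
    and U': "udom E' = (\<lambda>u. d3 * u + d4) ` udom E"
    using m by (simp_all add: maps_via_def \<phi>_def)
  have \<theta>_mem: "\<theta> s \<in> tdom E" if "s \<in> tdom E'" for s using that \<theta> by (auto simp: T')
  define hl where "hl t x = deriv (ch E) x * l t x + ch E x * lx t x" for t x
  define l' where "l' s y = w (\<psi> y) * l (\<theta> s) (\<psi> y)" for s y
  define lt' where "lt' s y = w (\<psi> y) * lt (\<theta> s) (\<psi> y) / d1" for s y
  define lx' where "lx' s y = (d8 * ch E (\<psi> y) * l (\<theta> s) (\<psi> y) + lx (\<theta> s) (\<psi> y)) / d5" for s y
  define lxx' where "lxx' s y = (d8 * hl (\<theta> s) (\<psi> y) + lxx (\<theta> s) (\<psi> y)) / (d5 * d5 * w (\<psi> y))" for s y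
  have c\<theta>: "continuous_on (tdom E' \<times> xdom E') (\<lambda>z. (\<theta> (fst z), \<psi> (snd z)))"
    unfolding X' \<theta>_def using d
    by (auto intro!: continuous_intros continuous_on_compose2[OF continuous_\<psi>])
  have c: "continuous_on (tdom E' \<times> xdom E') (\<lambda>z. g (\<theta> (fst z)) (\<psi> (snd z)))"
    if "g \<in> {l, lt, lx, lxx}" for g
    using continuous_on_compose2[OF cont[OF that] c\<theta>] \<theta>_mem \<psi>_mem X' by force
  have cx: "continuous_on (tdom E' \<times> xdom E') (\<lambda>z. g (\<psi> (snd z)))" if "smooth_on_line (xdom E) g" for g
    by (rule continuous_on_compose2[OF smooth_on_line_continuous[OF smooth_comp_\<psi>[OF that]]])
      (auto simp: X' intro: continuous_intros)
  note cx' = cx[OF smooth_w] cx[OF smooth_coeffs(2)] cx[OF smooth_on_line_deriv[OF smooth_coeffs(2)]]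
  have c': "continuous_on (tdom E' \<times> xdom E') (\<lambda>z. g (fst z) (snd z))" if "g \<in> {l', lt', lx', lxx'}" for g
    using that unfolding l'_def[abs_def] lt'_def[abs_def] lx'_def[abs_def] lxx'_def[abs_def] hl_def
    using c[of l] c[of lt] c[of lx] c[of lxx] cx' d w_pos
    by (auto intro!: continuous_intros)
  have der': "((\<lambda>s. l' s y) has_real_derivative lt' s y) (at s)"
    "(l' s has_real_derivative lx' s y) (at y)" "(lx' s has_real_derivative lxx' s y) (at y)"
    if s: "s \<in> tdom E'" and y: "y \<in> xdom E'" for s y
  proof -
    have y': "y \<in> \<phi> ` xdom E" and x: "\<psi> y \<in> xdom E" using y \<psi>_mem by (simp_all add: X')
    have t: "\<theta> s \<in> tdom E" by (rule \<theta>_mem[OF s])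
    have "(\<theta> has_real_derivative inverse d1) (at s)"
      unfolding \<theta>_def[abs_def] using d by (auto intro!: derivative_eq_intros simp: field_simps)
    from DERIV_cmult[OF DERIV_chain2[OF der(1)[OF t x] this], of "w (\<psi> y)"]
    show "((\<lambda>s. l' s y) has_real_derivative lt' s y) (at s)"
      unfolding l'_def lt'_def by (simp add: divide_inverse mult.assoc)
    have "((\<lambda>x. w x * l (\<theta> s) x) has_real_derivative
        w (\<psi> y) * lx (\<theta> s) (\<psi> y) + d8 * ch E (\<psi> y) * w (\<psi> y) * l (\<theta> s) (\<psi> y)) (at (\<psi> y))"
      by (rule DERIV_mult'[OF DERIV_w[OF x] der(2)[OF t x]])
    from DERIV_comp_\<psi>[OF this y'] show "(l' s has_real_derivative lx' s y) (at y)"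
      unfolding l'_def[abs_def] lx'_def
      by (rule DERIV_cong) (use d w_pos(2)[of "\<psi> y"] in \<open>simp add: field_simps\<close>)
    have "((\<lambda>x. (d8 * (ch E x * l (\<theta> s) x) + lx (\<theta> s) x) / d5) has_real_derivative
        (d8 * (ch E (\<psi> y) * lx (\<theta> s) (\<psi> y) + deriv (ch E) (\<psi> y) * l (\<theta> s) (\<psi> y)) + lxx (\<theta> s) (\<psi> y)) / d5) (at (\<psi> y))"
      by (intro DERIV_cdivide DERIV_add DERIV_cmult DERIV_mult' der[OF t x]
          smooth_on_line_DERIV[OF smooth_coeffs(2) x])
    from DERIV_comp_\<psi>[OF this y'] show "(lx' s has_real_derivative lxx' s y) (at y)"
      unfolding lx'_def[abs_def] lxx'_def hl_def mult.assoc[of d8]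
      by (rule DERIV_cong) (use d w_pos(2)[of "\<psi> y"] in \<open>simp add: field_simps\<close>)
  qed
  have det': "cf E' y * lt' s y + cA E' v * lxx' s y
      - cB E' v * (deriv (ch E') y * l' s y + ch E' y * lx' s y) = 0"
    if s: "s \<in> tdom E'" and y: "y \<in> xdom E'" and v: "v \<in> udom E'" for s y v
  proof -
    define t where "t = \<theta> s"
    define x where "x = \<psi> y"
    have y': "y \<in> \<phi> ` xdom E" and x: "x \<in> xdom E" using y \<psi>_mem by (simp_all add: X' x_def)
    have t: "t \<in> tdom E" unfolding t_def by (rule \<theta>_mem[OF s])
    obtain u where u: "u \<in> udom E" "v = d3 * u + d4" using v by (auto simp: U')
    have yx: "\<phi> (\<psi> y) = y" by (rule \<phi>_\<psi>[OF y'])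
    have f: "cf E' y = d1 / d5 * d9 * cf E x / w x / w x" and h: "ch E' y = d9 / d7 * ch E x / w x"
      using m x yx unfolding maps_via_def \<phi>_def[symmetric] x_def w_def
      by (auto simp: exp_minus exp_double[symmetric] field_simps exp_add[symmetric])
    have AB: "cA E' v = d5 * d9 * cA E u" "cB E' v = d7 * (cB E u + d8 * cA E u)"
      using m u by (auto simp: maps_via_def)
    have h': "deriv (ch E') y = d9 / d7 * (deriv (ch E) x - d8 * ch E x * ch E x) / (d5 * w x * w x)"
    proof (rule DERIV_imp_deriv)
      have "((\<lambda>x. d9 / d7 * (ch E x / w x)) has_real_derivative
          d9 / d7 * ((deriv (ch E) x * w x - ch E x * (d8 * ch E x * w x)) / (w x * w x))) (at x)"
        by (intro DERIV_cmult DERIV_divide smooth_on_line_DERIV[OF smooth_coeffs(2) x] DERIV_w x w_pos)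
      from DERIV_comp_\<psi>[OF this[unfolded x_def] y']
      have "((\<lambda>y. d9 / d7 * (ch E (\<psi> y) / w (\<psi> y))) has_real_derivative
          d9 / d7 * (deriv (ch E) x - d8 * ch E x * ch E x) / (d5 * w x * w x)) (at y)"
        by (rule DERIV_cong) (use d w_pos(2)[of x] in \<open>simp add: x_def field_simps\<close>)
      moreover have "\<forall>\<^sub>F z in nhds y. ch E' z = d9 / d7 * (ch E (\<psi> z) / w (\<psi> z))"
        using eventually_nhds_in_open[OF open_image y']
      proof eventually_elim
        case (elim z)
        then have "ch E' (\<phi> (\<psi> z)) = d9 / d7 * ch E (\<psi> z) * exp (- d8 * H (\<psi> z))"
          using m \<psi>_mem[OF elim] unfolding maps_via_def \<phi>_def by blast
        then show ?case by (simp add: \<phi>_\<psi>[OF elim] w_def exp_minus divide_inverse)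
      qed
      ultimately show "(ch E' has_real_derivative
          d9 / d7 * (deriv (ch E) x - d8 * ch E x * ch E x) / (d5 * w x * w x)) (at y)"
        by (rule DERIV_cong_ev[THEN iffD2, OF refl _ refl, rotated])
    qed
    have l'x: "deriv (ch E') y * l' s y + ch E' y * lx' s y = d9 / (d7 * d5 * w x) * hl t x"
      unfolding h h' l'_def lx'_def hl_def x_def[symmetric] t_def[symmetric]
      using d w_pos(2)[of x] by (simp add: field_simps)
    have "cf E' y * lt' s y + cA E' v * lxx' s y - cB E' v * (d9 / (d7 * d5 * w x) * hl t x) =
        d9 / (d5 * w x) * (cf E x * lt t x + cA E u * lxx t x - cB E u * hl t x)"
      unfolding f AB lt'_def lxx'_def x_def[symmetric] t_def[symmetric]
      using d w_pos(2)[of x] by (simp add: field_simps)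
    then show ?thesis using det[OF t x u(1)] by (simp add: l'x hl_def)
  qed
  from char_solutionI[of l' lt' lx' lxx', OF c' der' det'] have "char_solution E' l'" by blast
  moreover have "l' (d1 * t + d2) (d5 * K x + d6) = exp (d8 * H x) * l t x"
    if "x \<in> xdom E" for t x
    using \<psi>_\<phi>[OF that] \<theta> by (simp add: l'_def w_def \<phi>_def)
  ultimately show ?thesis by blast
qed

lemma char_solution_equivalent:
  assumes E: "is_equation E" "is_equation E'" and eq: "equivalent E E'"
  shows "\<exists>d1 d2 \<phi> w. transfers d1 d2 \<phi> w E E'"
proof -
  obtain E1 E2 where e: "is_equation E1" "is_equation E2" "same_equation E E1" "maps_to E1 E2"
    "same_equation E2 E'" using eq unfolding equivalent_def by blast
  obtain d1 d2 d3 d4 d5 d6 d7 d8 d9 H K where m: "maps_via d1 d2 d3 d4 d5 d6 d7 d8 d9 H K E1 E2"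
    using e(4) unfolding maps_to_iff by blast
  have dom: "tdom E1 = tdom E" "xdom E1 = xdom E" "tdom E' = tdom E2" "xdom E' = xdom E2"
    using e(3,5) by (simp_all add: same_equation_def)
  have "\<exists>l'. char_solution E' l' \<and> (\<forall>t\<in>tdom E. \<forall>x\<in>xdom E.
      l' (d1 * t + d2) (d5 * K x + d6) = exp (d8 * H x) * l t x)" if "char_solution E l" for l
    using char_solution_maps[OF e(1) m char_solution_same[OF E(1) e(1,3) that]]
      char_solution_same[OF e(2) E(2) e(5)] unfolding dom by blast
  then show ?thesis
    using m dom unfolding maps_via_def transfers_def
    by (intro exI[of _ d1] exI[of _ d2] exI[of _ "\<lambda>x. d5 * K x + d6"] exI[of _ "\<lambda>x. exp (d8 * H x)"]) auto
qed

text \<open>The invariant that tells the items of grade one from those of grade two.\<close>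

definition two_char_solutions :: "equation => bool" where
  "two_char_solutions E \<longleftrightarrow> (\<exists>l m. char_solution E l \<and> char_solution E m \<and>
     (\<forall>a b. (\<forall>t\<in>tdom E. \<forall>x\<in>xdom E. a * l t x + b * m t x = 0) \<longrightarrow> a = 0 \<and> b = 0))"

lemma two_char_solutions_equivalent:
  assumes "is_equation E" "is_equation E'" "equivalent E E'" "two_char_solutions E"
  shows "two_char_solutions E'"
proof -
  obtain l m where lm: "char_solution E l" "char_solution E m"
    "\<And>a b. (\<forall>t\<in>tdom E. \<forall>x\<in>xdom E. a * l t x + b * m t x = 0) ==> a = 0 \<and> b = 0"
    using assms(4) unfolding two_char_solutions_def by blast
  obtain d1 d2 \<phi> w where T: "transfers d1 d2 \<phi> w E E'"
    using char_solution_equivalent[OF assms(1-3)] by blast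
  note tr = transfersD(2-5)[OF T]
  obtain l' m' where l': "char_solution E' l'" "char_solution E' m'"
    "\<forall>t\<in>tdom E. \<forall>x\<in>xdom E. l' (d1 * t + d2) (\<phi> x) = w x * l t x"
    "\<forall>t\<in>tdom E. \<forall>x\<in>xdom E. m' (d1 * t + d2) (\<phi> x) = w x * m t x"
    using tr(4)[OF lm(1)] tr(4)[OF lm(2)] by blast
  have "a = 0 \<and> b = 0" if z: "\<forall>t\<in>tdom E'. \<forall>x\<in>xdom E'. a * l' t x + b * m' t x = 0" for a b
  proof (rule lm(3), intro ballI)
    fix t x assume tx: "t \<in> tdom E" "x \<in> xdom E"
    then have "a * l' (d1 * t + d2) (\<phi> x) + b * m' (d1 * t + d2) (\<phi> x) = 0" using z tr(2,3) by auto
    moreover have "l' (d1 * t + d2) (\<phi> x) = w x * l t x" "m' (d1 * t + d2) (\<phi> x) = w x * m t x"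
      using l' tx by blast+
    ultimately have "w x * (a * l t x + b * m t x) = 0" by (simp add: algebra_simps)
    then show "a * l t x + b * m t x = 0" using tr(1) by simp
  qed
  then show ?thesis unfolding two_char_solutions_def using l' by blast
qed

section \<open>Invariants of equivalence\<close>

lemma equivalent_invariant:
  assumes eq: "equivalent E E'" and P: "P E"
    and same: "\<And>E E'. same_equation E E' ==> P E ==> P E'"
    and maps: "\<And>d1 d2 d3 d4 d5 d6 d7 d8 d9 H K E E'. maps_via d1 d2 d3 d4 d5 d6 d7 d8 d9 H K E E' ==> P E ==> P E'"
  shows "P E'"
proof -
  obtain E1 E2 where s: "same_equation E E1" "maps_to E1 E2" "same_equation E2 E'"
    using eq unfolding equivalent_def by blast
  obtain d1 d2 d3 d4 d5 d6 d7 d8 d9 H K where "maps_via d1 d2 d3 d4 d5 d6 d7 d8 d9 H K E1 E2"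
    using s(2) unfolding maps_to_iff by blast
  then show ?thesis using same[OF s(1) P] maps same[OF s(3)] by blast
qed

definition constant_A :: "equation => bool" where
  "constant_A E \<longleftrightarrow> (\<exists>a. \<forall>u\<in>udom E. cA E u = a)"

lemma constant_A_equivalent:
  assumes "equivalent E E'" "constant_A E" shows "constant_A E'"
proof (rule equivalent_invariant[where P=constant_A, OF assms])
  show "constant_A E'" if "same_equation E E'" "constant_A E" for E E'
    using that unfolding constant_A_def same_equation_def by auto
next
  fix d1 d2 d3 d4 d5 d6 d7 d8 d9 H K E E'
  assume m: "maps_via d1 d2 d3 d4 d5 d6 d7 d8 d9 H K E E'" and "constant_A E"
  then obtain a where "\<And>u. u \<in> udom E ==> cA E u = a" by (auto simp: constant_A_def)
  then have "\<And>u. u \<in> udom E' ==> cA E' u = d5 * d9 * a" using m by (auto simp: maps_via_def)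
  then show "constant_A E'" by (auto simp: constant_A_def)
qed

text \<open>The term \<open>h B u\<^sub>x\<close> can be removed by a change of variables iff \<open>h B\<close> is a multiple \<open>k(x) A\<close>.\<close>

definition degenerate :: "equation => bool" where
  "degenerate E \<longleftrightarrow> (\<exists>k. \<forall>x\<in>xdom E. \<forall>u\<in>udom E. ch E x * cB E u = k x * cA E u)"

lemma degenerate_same: "same_equation E E' ==> degenerate E ==> degenerate E'"
  unfolding degenerate_def same_equation_def by force

text \<open>Up to factors depending on \<open>x\<close>, a transformation adds \<open>d8 h A\<close>
  to \<open>h B\<close>, so a multiple of \<open>A\<close> remains one.\<close>

lemma degenerate_maps:
  assumes m: "maps_via d1 d2 d3 d4 d5 d6 d7 d8 d9 H K E E'" and "degenerate E"
  shows "degenerate E'"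
proof -
  obtain k where k: "\<And>x u. x \<in> xdom E ==> u \<in> udom E ==> ch E x * cB E u = k x * cA E u"
    using assms(2) unfolding degenerate_def by blast
  have d: "d5 \<noteq> 0" "d7 \<noteq> 0" "d9 \<noteq> 0" using m by (auto simp: maps_via_def)
  have "\<exists>c. \<forall>u\<in>udom E'. ch E' y * cB E' u = c * cA E' u" if y: "y \<in> xdom E'" for y
  proof -
    obtain x where x: "x \<in> xdom E" "y = d5 * K x + d6" using m y by (auto simp: maps_via_def)
    let ?e = "exp (- d8 * H x)"
    have "ch E' y * cB E' u' = ?e * (k x + d8 * ch E x) / d5 * cA E' u'" if "u' \<in> udom E'" for u'
    proof -
      obtain u where u: "u \<in> udom E" "u' = d3 * u + d4" using m \<open>u' \<in> udom E'\<close> by (auto simp: maps_via_def)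
      have e: "ch E' y = d9 / d7 * ch E x * ?e" "cB E' u' = d7 * (cB E u + d8 * cA E u)" "cA E' u' = d5 * d9 * cA E u"
        using m x u by (auto simp: maps_via_def)
      have "ch E' y * cB E' u' = d9 * ?e * (ch E x * cB E u + d8 * ch E x * cA E u)"
        unfolding e using d by (simp add: field_simps)
      also have "\<dots> = ?e * (k x + d8 * ch E x) / d5 * (d5 * d9 * cA E u)"
        unfolding k[OF x(1) u(1)] using d by (simp add: field_simps)
      finally show ?thesis unfolding e .
    qed
    then show ?thesis by blast
  qed
  then show ?thesis unfolding degenerate_def by metis
qed

lemma degenerate_equivalent: assumes "equivalent E E'" "degenerate E" shows "degenerate E'"
  by (rule equivalent_invariant[where P=degenerate, OF assms]) (erule degenerate_same, assumption, erule degenerate_maps, assumption)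

text \<open>Describes the equations equivalent to \<open>Item9\<close> by conditions that every
  transformation preserves.\<close>

definition linearizable :: "equation => bool" where
  "linearizable E \<longleftrightarrow> constant_A E \<and> degenerate E"

lemma linearizable_equivalent:
  assumes "equivalent E E'" "linearizable E" shows "linearizable E'"
  using assms constant_A_equivalent degenerate_equivalent unfolding linearizable_def by blast

section \<open>Unique continuation\<close>

text \<open>\<open>bump k r i j\<close> is the \<open>k\<close>-th derivative of \<open>(r - s)\<^sup>i (r + s)\<^sup>j\<close>.\<close>

primrec bump :: "nat => real => nat => nat => real => real" where
  "bump 0 r i j s = (r - s) ^ i * (r + s) ^ j"
| "bump (Suc k) r i j s = - real i * bump k r (i - 1) j s + real j * bump k r i (j - 1) s"

lemma DERIV_bump: "(bump k r i j has_real_derivative bump (Suc k) r i j s) (at s)"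
proof (induction k arbitrary: i j)
  case 0
  have "bump 0 r i j = (\<lambda>s. (r - s) ^ i * (r + s) ^ j)" by (rule ext) simp
  moreover have "((\<lambda>s. (r - s) ^ i * (r + s) ^ j) has_real_derivative
      (r - s) ^ i * (real j * (1 * (r + s) ^ (j - Suc 0))) + real i * ((0 - 1) * (r - s) ^ (i - Suc 0)) * (r + s) ^ j) (at s)"
    by (intro DERIV_mult' DERIV_power) (auto intro!: derivative_eq_intros)
  ultimately show ?case by (simp add: algebra_simps)
next
  case (Suc k)
  have "((\<lambda>s. - real i * bump k r (i - 1) j s + real j * bump k r i (j - 1) s) has_real_derivative
      - real i * bump (Suc k) r (i - 1) j s + real j * bump (Suc k) r i (j - 1) s) (at s)"
    by (intro DERIV_add DERIV_cmult Suc.IH)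
  moreover have "bump (Suc k) r i j = (\<lambda>s. - real i * bump k r (i - 1) j s + real j * bump k r i (j - 1) s)"
    by (rule ext) simp
  moreover have "bump (Suc (Suc k)) r i j s =
      - real i * bump (Suc k) r (i - 1) j s + real j * bump (Suc k) r i (j - 1) s"
    by (rule bump.simps(2))
  ultimately show ?case by metis
qed

lemma continuous_bump: "continuous_on A (bump k r i j)"
  by (rule DERIV_continuous_on[OF has_field_derivative_at_within[OF DERIV_bump]])

lemma bump_boundary: "k < i ==> bump k r i j r = 0" "k < j ==> bump k r i j (- r) = 0"
  by (induction k arbitrary: i j) auto

text \<open>A differentiation produces terms of the same kind with one factor fewer and coefficients
  of total size at most \<open>i + j \<le> 2 * n\<close>, and every factor is bounded by
  \<open>R\<close>.\<close>

lemma bump_bound: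
  assumes "\<bar>s\<bar> \<le> r" "i \<le> n" "j \<le> n" "R \<ge> 1" "2 * r \<le> R"
  shows "\<bar>bump k r i j s\<bar> \<le> (2 * real n) ^ k * R ^ (i + j)"
  using assms(2,3)
proof (induction k arbitrary: i j)
  case 0
  have "\<bar>r - s\<bar> ^ i * \<bar>r + s\<bar> ^ j \<le> R ^ i * R ^ j"
    by (intro mult_mono power_mono) (use assms in auto)
  then show ?case by (simp add: abs_mult power_abs power_add)
next
  case (Suc k)
  have "\<bar>- real i * bump k r (i - 1) j s\<bar> \<le> real n * ((2 * real n) ^ k * R ^ (i + j))"
  proof -
    have "\<bar>bump k r (i - 1) j s\<bar> \<le> (2 * real n) ^ k * R ^ (i - 1 + j)" using Suc by simp
    also have "\<dots> \<le> (2 * real n) ^ k * R ^ (i + j)"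
      using assms(4) by (intro mult_left_mono power_increasing) auto
    finally show ?thesis using Suc.prems by (simp add: abs_mult mult_mono)
  qed
  moreover have "\<bar>real j * bump k r i (j - 1) s\<bar> \<le> real n * ((2 * real n) ^ k * R ^ (i + j))"
  proof -
    have "\<bar>bump k r i (j - 1) s\<bar> \<le> (2 * real n) ^ k * R ^ (i + (j - 1))" using Suc by simp
    also have "\<dots> \<le> (2 * real n) ^ k * R ^ (i + j)"
      using assms(4) by (intro mult_left_mono power_increasing) auto
    finally show ?thesis using Suc.prems by (simp add: abs_mult mult_mono)
  qed
  ultimately show ?case by (simp add: abs_le_iff algebra_simps)
qed

text \<open>The sum and the difference of the claimed bound and \<open>g\<close> both have
  nonnegative derivative and start from \<open>0\<close>.\<close>

lemma growth_bound:
  assumes "\<And>x. x \<in> {a..b} ==> (g has_real_derivative g' x) (at x)" "g a = 0"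
    and "\<And>x. x \<in> {a..b} ==> \<bar>g' x\<bar> \<le> c * (x - a) ^ n" "x \<in> {a..b}"
  shows "\<bar>g x\<bar> \<le> c / real (Suc n) * (x - a) ^ Suc n"
proof -
  let ?p = "\<lambda>x. c / real (Suc n) * (x - a) ^ Suc n"
  have p: "(?p has_real_derivative c * (x - a) ^ n) (at x)" for x
  proof -
    have "(?p has_real_derivative c / real (Suc n) * (real (Suc n) * ((1 - 0) * (x - a) ^ (Suc n - Suc 0)))) (at x)"
      by (intro DERIV_cmult DERIV_power DERIV_diff DERIV_ident DERIV_const)
    then show ?thesis by simp
  qed
  have "\<exists>y. ((\<lambda>x. ?p x + s * g x) has_real_derivative y) (at z) \<and> 0 \<le> y" if "z \<in> {a..x}" "s = 1 \<or> s = -1" for z s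
    using DERIV_add[OF p DERIV_cmult[OF assms(1)], of z s] assms(3)[of z] assms(4) that
    by (intro exI[of _ "c * (z - a) ^ n + s * g' z"]) (auto simp: abs_le_iff)
  then have "?p a + s * g a \<le> ?p x + s * g x" if "s = 1 \<or> s = -1" for s
    using assms(4) that by (intro DERIV_nonneg_imp_nondecreasing[of a x "\<lambda>x. ?p x + s * g x"]) auto
  from this[of 1] this[of "-1"] show ?thesis using assms(2) by (simp add: abs_le_iff)
qed

lemma growth_bound2:
  assumes g: "\<And>x. x \<in> {a..b} ==> (g has_real_derivative g' x) (at x)" "g a = 0"
    and g': "\<And>x. x \<in> {a..b} ==> (g' has_real_derivative g'' x) (at x)" "g' a = 0"
    and "\<And>x. x \<in> {a..b} ==> \<bar>g'' x\<bar> \<le> c * (x - a) ^ n" "x \<in> {a..b}"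
  shows "\<bar>g x\<bar> \<le> c / (real (Suc n) * real (Suc (Suc n))) * (x - a) ^ Suc (Suc n)"
proof -
  have step: "\<bar>g' x\<bar> \<le> c / real (Suc n) * (x - a) ^ Suc n" if "x \<in> {a..b}" for x
    by (rule growth_bound[OF g' assms(5) that])
  show ?thesis using growth_bound[OF g step assms(6)] by simp
qed

text \<open>The kernels \<open>(r^2 - s^2)^n\<close> peak at \<open>0\<close>. If \<open>g 0\<close>
  were nonzero, their integrals against \<open>g\<close> would be at least a multiple of
  \<open>a^n\<close> up to an error of order \<open>b^n\<close> with \<open>b < a\<close>, which
  contradicts decay like \<open>Q^n / n!\<close>.\<close>

lemma bump_concentration:
  assumes r: "r > 0" and cont: "continuous_on {-r..r} g"
    and bound: "\<And>n. \<bar>integral {-r..r} (\<lambda>s. g s * bump 0 r n n s)\<bar> \<le> A * (inverse (fact n) * Q ^ n)"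
  shows "g 0 = 0"
proof (rule ccontr)
  assume "g 0 \<noteq> 0"
  define \<sigma> where "\<sigma> = sgn (g 0)"
  define k where "k s = \<sigma> * g s" for s
  have \<sigma>: "\<bar>\<sigma>\<bar> = 1" and k0: "k 0 > 0" using \<open>g 0 \<noteq> 0\<close> by (auto simp: \<sigma>_def k_def sgn_if)
  have ck: "continuous_on {-r..r} k" unfolding k_def[abs_def] by (intro continuous_intros cont)
  have q: "bump 0 r n n s = (r\<^sup>2 - s\<^sup>2) ^ n" for n s
    by (simp add: power_mult_distrib[symmetric] power2_eq_square algebra_simps)
  obtain d where d: "d > 0" "\<And>s. s \<in> {-r..r} ==> \<bar>s\<bar> < d ==> \<bar>k s - k 0\<bar> < k 0 / 2"
    using ck k0 r unfolding continuous_on_iff dist_real_def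
    by (metis atLeastAtMost_iff diff_zero half_gt_zero less_eq_real_def neg_le_0_iff_le)
  define \<delta> where "\<delta> = min d r / 2"
  have \<delta>: "\<delta> > 0" "\<delta> < r" "\<delta> < d" using d r by (auto simp: \<delta>_def)
  obtain M where "\<forall>x\<in>k ` {-r..r}. norm x \<le> M"
    using compact_imp_bounded[OF compact_continuous_image[OF ck compact_Icc]]
    unfolding bounded_iff by blast
  then have M: "\<bar>k s\<bar> \<le> M" if "s \<in> {-r..r}" for s using that by auto
  have M0: "M \<ge> 0" using M[of 0] r by auto
  \<comment> \<open>\<open>a\<close> is a lower bound of \<open>r^2 - s^2\<close> on the interval of
    radius \<open>\<delta> / 2\<close>, and \<open>b\<close> an upper bound outside the one of
    radius \<open>\<delta>\<close>.\<close>
  define a where "a = r\<^sup>2 - (\<delta> / 2)\<^sup>2"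
  define b where "b = r\<^sup>2 - \<delta>\<^sup>2"
  have "(\<delta> / 2)\<^sup>2 < \<delta>\<^sup>2" "\<delta>\<^sup>2 < r\<^sup>2" using \<delta> by (auto simp: power_strict_mono intro: power_strict_mono)
  then have ab: "0 < b" "b < a" by (auto simp: a_def b_def)
  have low: "\<delta> * (k 0 / 2) * a ^ n \<le> A * (inverse (fact n) * Q ^ n) + 2 * r * M * b ^ n" for n
  proof -
    \<comment> \<open>Adding \<open>M * b ^ n\<close> makes the integrand nonnegative on the whole
      interval, so its integral over the inner interval is a lower bound for the total.\<close>
    let ?I = "\<lambda>s. k s * bump 0 r n n s + M * b ^ n"
    have cI: "continuous_on {-r..r} ?I" by (intro continuous_intros ck continuous_bump)
    have pos: "?I s \<ge> 0" if s: "s \<in> {-r..r}" for s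
    proof (cases "\<bar>s\<bar> \<le> \<delta>")
      case True
      then have "\<bar>s\<bar> < d" using \<delta> by linarith
      then have "k s \<ge> 0" using d(2)[OF s] k0 by linarith
      moreover have "\<bar>s\<bar> \<le> \<bar>r\<bar>" using s by auto
      then have "s\<^sup>2 \<le> r\<^sup>2" by (simp add: abs_le_square_iff)
      ultimately show ?thesis unfolding q using M0 ab by simp
    next
      case False
      then have "\<bar>\<delta>\<bar> \<le> \<bar>s\<bar>" "\<bar>s\<bar> \<le> \<bar>r\<bar>" using s \<delta> by auto
      then have "\<delta>\<^sup>2 \<le> s\<^sup>2" "s\<^sup>2 \<le> r\<^sup>2" by (simp_all add: abs_le_square_iff)
      then have "(r\<^sup>2 - s\<^sup>2) ^ n \<le> b ^ n" "0 \<le> (r\<^sup>2 - s\<^sup>2) ^ n" by (auto simp: b_def intro: power_mono)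
      then have "\<bar>k s * (r\<^sup>2 - s\<^sup>2) ^ n\<bar> \<le> M * b ^ n"
        using M[OF s] M0 by (auto simp: abs_mult intro!: mult_mono)
      then show ?thesis unfolding q by (simp add: abs_le_iff)
    qed
    have sub: "{-(\<delta>/2)..\<delta>/2} \<subseteq> {-r..r}" using \<delta> by auto
    have iI: "?I integrable_on {-r..r}" "?I integrable_on {-(\<delta>/2)..\<delta>/2}"
      using integrable_continuous_real[OF cI] integrable_continuous_real[OF continuous_on_subset[OF cI sub]]
      by auto
    have "integral {-(\<delta>/2)..\<delta>/2} (\<lambda>s. k 0 / 2 * a ^ n) \<le> integral {-(\<delta>/2)..\<delta>/2} ?I"
    proof (rule integral_le)
      fix s assume s: "s \<in> {-(\<delta>/2)..\<delta>/2}"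
      then have sr: "s \<in> {-r..r}" and "\<bar>s\<bar> < d" using sub \<delta> by (auto simp: abs_less_iff)
      then have ks: "k s \<ge> k 0 / 2" using d(2)[OF sr] by linarith
      have "s\<^sup>2 \<le> (\<delta> / 2)\<^sup>2" using s \<delta> by (subst abs_le_square_iff[symmetric]) auto
      then have "a ^ n \<le> (r\<^sup>2 - s\<^sup>2) ^ n" using ab by (intro power_mono) (auto simp: a_def)
      then have "k 0 / 2 * a ^ n \<le> k s * (r\<^sup>2 - s\<^sup>2) ^ n"
        using ks k0 ab by (intro mult_mono) auto
      then show "k 0 / 2 * a ^ n \<le> ?I s" unfolding q using M0 ab by (simp add: add_increasing2)
    qed (use iI in auto)
    also have "\<dots> \<le> integral {-r..r} ?I"
      by (rule integral_subset_le[OF sub iI(2,1)]) (use pos in auto)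
    also have "\<dots> = integral {-r..r} (\<lambda>s. k s * bump 0 r n n s) + integral {-r..r} (\<lambda>s. M * b ^ n)"
      by (intro integral_add integrable_continuous_real continuous_intros ck continuous_bump)
    also have "integral {-r..r} (\<lambda>s. k s * bump 0 r n n s) = \<sigma> * integral {-r..r} (\<lambda>s. g s * bump 0 r n n s)"
      unfolding k_def by (simp add: mult.assoc)
    also have "\<dots> \<le> \<bar>integral {-r..r} (\<lambda>s. g s * bump 0 r n n s)\<bar>"
      using abs_ge_self[of "\<sigma> * integral {-r..r} (\<lambda>s. g s * bump 0 r n n s)"] \<sigma> by (simp add: abs_mult)
    also have "\<dots> \<le> A * (inverse (fact n) * Q ^ n)" by (rule bound)
    finally show ?thesis using r \<delta> by (simp add: algebra_simps)
  qed
  have "\<delta> * (k 0 / 2) \<le> A * (inverse (fact n) * (Q / a) ^ n) + 2 * r * M * (b / a) ^ n" for n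
  proof -
    have "\<delta> * (k 0 / 2) = \<delta> * (k 0 / 2) * a ^ n / a ^ n" using ab by simp
    also have "\<dots> \<le> (A * (inverse (fact n) * Q ^ n) + 2 * r * M * b ^ n) / a ^ n"
      by (rule divide_right_mono[OF low]) (use ab in auto)
    finally show ?thesis by (simp add: add_divide_distrib power_divide)
  qed
  moreover have "(\<lambda>n. A * (inverse (fact n) * (Q / a) ^ n) + 2 * r * M * (b / a) ^ n) \<longlonglongrightarrow> A * 0 + 2 * r * M * 0"
    by (intro tendsto_intros summable_LIMSEQ_zero[OF summable_exp] LIMSEQ_realpow_zero) (use ab in auto)
  ultimately have "\<delta> * (k 0 / 2) \<le> A * 0 + 2 * r * M * 0" by (intro LIMSEQ_le_const) auto
  then show False using \<delta> k0 by (simp add: mult_le_0_iff)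
qed

text \<open>Pairing a solution with the functions \<open>bump k\<close> in \<open>t\<close> gives \<open>J\<^sub>k'' = f J\<^bsub>k+1\<^esub>\<close>. As the
  \<open>n\<close>-th derivative of \<open>(r\<^sup>2 - s\<^sup>2)\<^sup>n\<close> is bounded by \<open>C\<^sup>n n\<^sup>n\<close>, zero Cauchy data give
  \<open>\<bar>J\<^sub>0\<bar> \<le> C\<^sup>n n\<^sup>n / (2n)!\<close>.\<close>

lemma unique_continuation_right:
  fixes f :: "real => real" and l lt lx lxx :: "real => real => real"
  assumes T: "open_interval T" and X: "open_interval X" and f: "continuous_on X f"
    and cont: "\<And>g. g \<in> {l, lt, lx, lxx} ==> continuous_on (T \<times> X) (\<lambda>z. g (fst z) (snd z))"
    and dt: "\<And>t x. t \<in> T ==> x \<in> X ==> ((\<lambda>s. l s x) has_real_derivative lt t x) (at t)"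
    and dx: "\<And>t x. t \<in> T ==> x \<in> X ==> (l t has_real_derivative lx t x) (at x)"
    and dxx: "\<And>t x. t \<in> T ==> x \<in> X ==> (lx t has_real_derivative lxx t x) (at x)"
    and eq: "\<And>t x. t \<in> T ==> x \<in> X ==> f x * lt t x + lxx t x = 0"
    and x0: "x0 \<in> X" "\<And>t. t \<in> T ==> l t x0 = 0" "\<And>t. t \<in> T ==> lx t x0 = 0"
    and y: "y \<in> X" "x0 \<le> y" and t0: "t0 \<in> T"
  shows "l t0 y = 0"
proof -
  have oX: "open X" "convex X" and oT: "open T"
    using X T by (auto simp: open_interval_def is_interval_convex)
  obtain r where r: "r > 0" "cball t0 r \<subseteq> T" using oT t0 open_contains_cball by blast
  have tT: "t0 + s \<in> T" if "s \<in> {-r..r}" for s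
    using r that by (auto simp: subset_eq dist_real_def)
  have sub: "{x0..y} \<subseteq> X" using X x0(1) y(1) mem_is_interval_1_I[of X x0 y] by (auto simp: open_interval_def)
  have cont2: "continuous_on (X \<times> {-r..r}) (\<lambda>z. g (t0 + snd z) (fst z))" if "g \<in> {l, lt, lx, lxx}" for g
    using continuous_on_compose2[OF cont[OF that], of "X \<times> {-r..r}" "\<lambda>z. (t0 + snd z, fst z)"] tT
    by (force intro!: continuous_intros)
  have cont1: "continuous_on {-r..r} (\<lambda>s. g (t0 + s) x)" if "g \<in> {l, lt, lx, lxx}" "x \<in> X" for g x
    using continuous_on_compose2[OF cont[OF that(1)], of "{-r..r}" "\<lambda>s. (t0 + s, x)"] tT that(2)
    by (force intro!: continuous_intros)
  define J where "J g n k x = integral {-r..r} (\<lambda>s. g (t0 + s) x * bump k r n n s)"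
    for g :: "real => real => real" and n k x
  have int: "(\<lambda>s. g (t0 + s) x * bump k r n n s) integrable_on {-r..r}"
    if "g \<in> {l, lt, lx, lxx}" "x \<in> X" for g n k x
    by (intro integrable_continuous_real continuous_on_mult cont1 that continuous_bump)
  have DJ: "(J g n k has_real_derivative J g' n k x) (at x)"
    if g: "g \<in> {l, lx}" "g' \<in> {lx, lxx}" and x: "x \<in> X"
      and D: "\<And>t x. t \<in> T ==> x \<in> X ==> (g t has_real_derivative g' t x) (at x)" for g g' n k x
  proof -
    have "((\<lambda>x. integral (cbox (-r) r) (\<lambda>s. g (t0 + s) x * bump k r n n s)) has_real_derivative
        integral (cbox (-r) r) (\<lambda>s. g' (t0 + s) x * bump k r n n s)) (at x within X)"
    proof (rule leibniz_rule_field_derivative)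
      show "((\<lambda>x. g (t0 + s) x * bump k r n n s) has_real_derivative g' (t0 + s) x * bump k r n n s) (at x within X)"
        if "x \<in> X" "s \<in> cbox (-r) r" for x s
        using DERIV_cmult_right[OF D[OF tT that(1)], of s "bump k r n n s"] that(2)
        by (auto intro: has_field_derivative_at_within)
      show "(\<lambda>s. g (t0 + s) x * bump k r n n s) integrable_on cbox (-r) r" if "x \<in> X" for x
        using int[of g x] g that by auto
      have "continuous_on (X \<times> {-r..r}) (\<lambda>z. g' (t0 + snd z) (fst z) * bump k r n n (snd z))"
        using g by (intro continuous_on_mult cont2 continuous_on_compose2[OF continuous_bump[of UNIV]]
            continuous_on_snd continuous_on_id) auto
      then show "continuous_on (X \<times> cbox (-r) r) (\<lambda>(x, s). g' (t0 + s) x * bump k r n n s)"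
        by (simp add: case_prod_beta)
    qed (use x oX in auto)
    then show ?thesis unfolding J_def at_within_open[OF x oX(1)] by simp
  qed
  \<comment> \<open>Integration by parts in \<open>t\<close>. The boundary terms vanish since fewer
    than \<open>n\<close> differentiations leave a zero of the kernel at both ends, and
    \<open>f\<close>, a function of \<open>x\<close>, can be taken out of the integral.\<close>
  have Jxx: "J lxx n k x = f x * J l n (Suc k) x" if k: "k < n" and x: "x \<in> X" for n k x
  proof -
    have "((\<lambda>s. l (t0 + s) x * bump (Suc k) r n n s + lt (t0 + s) x * bump k r n n s) has_integral
        l (t0 + r) x * bump k r n n r - l (t0 + - r) x * bump k r n n (- r)) {-r..r}"
    proof (rule fundamental_theorem_of_calculus)
      fix s assume s: "s \<in> {-r..r}"
      have "((\<lambda>s. l (t0 + s) x) has_real_derivative lt (t0 + s) x * 1) (at s)"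
        by (rule DERIV_chain2[where f="\<lambda>t. l t x" and g="\<lambda>s. t0 + s", OF dt[OF tT[OF s] x]])
          (auto intro!: derivative_eq_intros)
      then have "((\<lambda>s. l (t0 + s) x * bump k r n n s) has_real_derivative
          l (t0 + s) x * bump (Suc k) r n n s + lt (t0 + s) x * bump k r n n s) (at s)"
        by (intro DERIV_mult' DERIV_bump) simp
      then show "((\<lambda>s. l (t0 + s) x * bump k r n n s) has_vector_derivative
          l (t0 + s) x * bump (Suc k) r n n s + lt (t0 + s) x * bump k r n n s) (at s within {-r..r})"
        by (simp add: has_real_derivative_iff_has_vector_derivative[symmetric] has_field_derivative_at_within
            del: bump.simps)
    qed (use r in auto)
    then have "integral {-r..r} (\<lambda>s. l (t0 + s) x * bump (Suc k) r n n s + lt (t0 + s) x * bump k r n n s) = 0"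
      using bump_boundary[OF k] by (simp add: integral_unique del: bump.simps)
    then have parts: "J l n (Suc k) x + J lt n k x = 0"
      unfolding J_def using integral_add[OF int[of l x] int[of lt x], of "Suc k" n k n] x
      by (simp del: bump.simps)
    have "J lxx n k x = integral {-r..r} (\<lambda>s. - f x * (lt (t0 + s) x * bump k r n n s))"
      unfolding J_def
    proof (rule integral_cong)
      fix s assume s: "s \<in> {-r..r}"
      have "lxx (t0 + s) x = - f x * lt (t0 + s) x" using eq[OF tT[OF s] x] by simp
      then show "lxx (t0 + s) x * bump k r n n s = - f x * (lt (t0 + s) x * bump k r n n s)" by simp
    qed
    also have "\<dots> = - f x * J lt n k x" unfolding J_def by (rule integral_mult_right)
    finally show ?thesis using parts by (simp add: eq_neg_iff_add_eq_0[symmetric] minus_equation_iff)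
  qed
  have zero: "J g n k x0 = 0" if "g \<in> {l, lx}" for g n k
  proof -
    have "J g n k x0 = integral {-r..r} (\<lambda>s. 0)"
      unfolding J_def by (rule integral_cong) (use that x0(2,3) tT in auto)
    then show ?thesis by simp
  qed
  have comp: "compact ({-r..r} \<times> {x0..y})" by (intro compact_Times compact_Icc)
  have "continuous_on ({-r..r} \<times> {x0..y}) (\<lambda>z. l (t0 + fst z) (snd z))"
    using continuous_on_compose2[OF cont[of l], of "{-r..r} \<times> {x0..y}" "\<lambda>z. (t0 + fst z, snd z)"] tT sub
    by (force intro!: continuous_intros)
  from compact_imp_bounded[OF compact_continuous_image[OF this comp]]
  obtain M where "\<forall>v\<in>(\<lambda>z. l (t0 + fst z) (snd z)) ` ({-r..r} \<times> {x0..y}). norm v \<le> M"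
    unfolding bounded_iff by blast
  then have M: "\<bar>l (t0 + s) x\<bar> \<le> M" if "s \<in> {-r..r}" "x \<in> {x0..y}" for s x
    using that by force
  have M0: "M \<ge> 0" using M[of 0 x0] r y by auto
  from compact_imp_bounded[OF compact_continuous_image[OF continuous_on_subset[OF f sub] compact_Icc]]
  obtain C where "\<forall>v\<in>f ` {x0..y}. norm v \<le> C" unfolding bounded_iff by blast
  then have C: "\<bar>f x\<bar> \<le> C" if "x \<in> {x0..y}" for x using that by auto
  have C0: "C \<ge> 0" using C[of x0] y by auto
  define R where "R = max 1 (2 * r)"
  define Z where "Z n = 2 * r * (M * ((2 * real n) ^ n * R ^ (n + n)))" for n
  have JK: "\<bar>J l n n x\<bar> \<le> Z n" if x: "x \<in> {x0..y}" for n x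
  proof -
    have "norm (integral {-r..r} (\<lambda>s. l (t0 + s) x * bump n r n n s)) \<le>
        integral {-r..r} (\<lambda>s. M * ((2 * real n) ^ n * R ^ (n + n)))"
    proof (rule integral_norm_bound_integral)
      show "(\<lambda>s. l (t0 + s) x * bump n r n n s) integrable_on {-r..r}"
        by (rule int) (use x sub in auto)
      fix s assume s: "s \<in> {-r..r}"
      have "\<bar>l (t0 + s) x\<bar> * \<bar>bump n r n n s\<bar> \<le> M * ((2 * real n) ^ n * R ^ (n + n))"
        by (intro mult_mono M x s bump_bound) (use s M0 in \<open>auto simp: R_def abs_le_iff\<close>)
      then show "norm (l (t0 + s) x * bump n r n n s) \<le> M * ((2 * real n) ^ n * R ^ (n + n))"
        by (simp add: abs_mult)
    qed auto
    moreover have "integral {-r..r} (\<lambda>s. c) = 2 * r * c" for c :: real using r by simp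
    ultimately show ?thesis unfolding J_def Z_def real_norm_def by metis
  qed
  \<comment> \<open>The crude estimate is available for \<open>k = n\<close>. Each step down
    integrates twice from zero data, which gains two powers of \<open>x - x0\<close> and the next
    two factors of the factorial.\<close>
  have bound: "\<forall>x\<in>{x0..y}. \<bar>J l n (n - j) x\<bar> \<le> C ^ j * Z n / fact (2 * j) * (x - x0) ^ (2 * j)" if "j \<le> n" for n j
    using that
  proof (induction j)
    case 0
    then show ?case using JK by simp
  next
    case (Suc j)
    define k where "k = n - Suc j"
    have k: "k < n" "Suc k = n - j" using Suc.prems by (auto simp: k_def)
    have "\<bar>J l n k x\<bar> \<le> C ^ Suc j * Z n / fact (2 * j) / (real (Suc (2 * j)) * real (Suc (Suc (2 * j))))
        * (x - x0) ^ Suc (Suc (2 * j))" if x: "x \<in> {x0..y}" for x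
    proof (rule growth_bound2[where b=y and g'="J lx n k" and g''="J lxx n k"])
      show "(J l n k has_real_derivative J lx n k x) (at x)" if "x \<in> {x0..y}" for x
        by (rule DJ) (use that sub dx in auto)
      show "(J lx n k has_real_derivative J lxx n k x) (at x)" if "x \<in> {x0..y}" for x
        by (rule DJ) (use that sub dxx in auto)
      show "J l n k x0 = 0" "J lx n k x0 = 0" using zero by auto
      fix x assume x: "x \<in> {x0..y}"
      have "\<bar>J lxx n k x\<bar> = \<bar>f x\<bar> * \<bar>J l n (n - j) x\<bar>"
        using Jxx[OF k(1)] x sub k(2) by (auto simp: abs_mult)
      also have "\<dots> \<le> C * (C ^ j * Z n / fact (2 * j) * (x - x0) ^ (2 * j))"
        using Suc x C C0 by (intro mult_mono) auto
      finally show "\<bar>J lxx n k x\<bar> \<le> C ^ Suc j * Z n / fact (2 * j) * (x - x0) ^ (2 * j)" by simp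
    qed (rule x)
    then show ?case by (simp add: k_def mult_ac)
  qed
  \<comment> \<open>Sets the growth \<open>n^n\<close> of the kernel derivatives against
    \<open>(2 * n)!\<close>; what remains is the decay \<open>1 / n!\<close> that
    \<open>bump_concentration\<close> asks for.\<close>
  have fact_ge: "fact n * real n ^ n \<le> fact (2 * n)" for n
  proof -
    have "fact n * n ^ m \<le> (fact (n + m) :: nat)" for m
    proof (induction m)
      case (Suc m)
      have "fact n * n ^ Suc m = n * (fact n * n ^ m)" by simp
      also have "\<dots> \<le> Suc (n + m) * fact (n + m)" by (intro mult_le_mono Suc) simp
      finally show ?case by simp
    qed simp
    from this[of n] have "real (fact n * n ^ n) \<le> real (fact (n + n))" by (simp only: of_nat_le_iff)
    then show ?thesis by (simp add: mult_2)
  qed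
  have "\<bar>J l n 0 y\<bar> \<le> 2 * r * M * (inverse (fact n) * (2 * C * R\<^sup>2 * (y - x0)\<^sup>2) ^ n)" for n
  proof -
    define Y where "Y = y - x0"
    have "\<bar>J l n 0 y\<bar> \<le> C ^ n * Z n / fact (2 * n) * Y ^ (2 * n)"
      using bound[of n n] y by (auto simp: Y_def)
    also have "\<dots> = 2 * r * M * ((2 * C * R\<^sup>2 * Y\<^sup>2) ^ n * (real n ^ n / fact (2 * n)))"
      by (simp add: Z_def power_mult_distrib power_mult power_add power2_eq_square mult_ac)
    also have "\<dots> \<le> 2 * r * M * ((2 * C * R\<^sup>2 * Y\<^sup>2) ^ n * inverse (fact n))"
    proof (intro mult_left_mono)
      show "real n ^ n / fact (2 * n) \<le> inverse (fact n)"
        using fact_ge[of n] by (simp add: field_simps)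
    qed (use r M0 C0 in auto)
    finally show ?thesis by (simp add: mult_ac Y_def)
  qed
  then have "l (t0 + 0) y = 0"
    unfolding J_def by (intro bump_concentration[OF r(1) cont1[of l y]]) (use y in auto)
  then show ?thesis by simp
qed

text \<open>Points to the left of \<open>x0\<close> are reached by reflecting \<open>x\<close>,
  under which the equation keeps its form.\<close>

lemma unique_continuation:
  fixes f :: "real => real" and l lt lx lxx :: "real => real => real"
  assumes T: "open_interval T" and X: "open_interval X" and f: "continuous_on X f"
    and cont: "\<And>g. g \<in> {l, lt, lx, lxx} ==> continuous_on (T \<times> X) (\<lambda>z. g (fst z) (snd z))"
    and dt: "\<And>t x. t \<in> T ==> x \<in> X ==> ((\<lambda>s. l s x) has_real_derivative lt t x) (at t)"
    and dx: "\<And>t x. t \<in> T ==> x \<in> X ==> (l t has_real_derivative lx t x) (at x)"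
    and dxx: "\<And>t x. t \<in> T ==> x \<in> X ==> (lx t has_real_derivative lxx t x) (at x)"
    and eq: "\<And>t x. t \<in> T ==> x \<in> X ==> f x * lt t x + lxx t x = 0"
    and x0: "x0 \<in> X" "\<And>t. t \<in> T ==> l t x0 = 0" "\<And>t. t \<in> T ==> lx t x0 = 0"
    and y: "y \<in> X" and t0: "t0 \<in> T"
  shows "l t0 y = 0"
proof (cases "x0 \<le> y")
  case True
  show ?thesis by (rule unique_continuation_right[OF T X f cont dt dx dxx eq x0 y True t0])
next
  case False
  let ?X = "(\<lambda>x. (-1) * x + 0) ` X"
  have X': "open_interval ?X" by (rule affine_image_open_interval[OF X]) simp
  have mem: "- x \<in> X" if "x \<in> ?X" for x using that by auto
  have "(\<lambda>t x. l t (- x)) t0 (- y) = 0"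
  proof (rule unique_continuation_right[OF T X', where f="\<lambda>x. f (- x)" and lt="\<lambda>t x. lt t (- x)"
        and lx="\<lambda>t x. - lx t (- x)" and lxx="\<lambda>t x. lxx t (- x)" and ?x0.0="- x0"
        and l="\<lambda>t x. l t (- x)" and y="- y"])
    show "continuous_on ?X (\<lambda>x. f (- x))"
      by (rule continuous_on_compose2[OF f]) (auto intro: continuous_intros)
    have c: "continuous_on (T \<times> ?X) (\<lambda>z. g (fst z) (- snd z))" if "g \<in> {l, lt, lx, lxx}" for g
      using continuous_on_compose2[OF cont[OF that], of "T \<times> ?X" "\<lambda>z. (fst z, - snd z)"] mem
      by (force intro!: continuous_intros)
    show "continuous_on (T \<times> ?X) (\<lambda>z. g (fst z) (snd z))"
      if "g \<in> {\<lambda>t x. l t (- x), \<lambda>t x. lt t (- x), \<lambda>t x. - lx t (- x), \<lambda>t x. lxx t (- x)}" for g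
      using that c[of l] c[of lt] c[of lx] c[of lxx] by (auto intro: continuous_on_minus)
    fix t x assume t: "t \<in> T" and x: "x \<in> ?X"
    have m: "((\<lambda>x. - x) has_real_derivative -1) (at x)" by (auto intro!: derivative_eq_intros)
    show "((\<lambda>s. l s (- x)) has_real_derivative lt t (- x)) (at t)" by (rule dt[OF t mem[OF x]])
    show "((\<lambda>x. l t (- x)) has_real_derivative - lx t (- x)) (at x)"
      using DERIV_chain2[where f="l t" and g="\<lambda>x. - x" and Db="-1", OF dx[OF t mem[OF x]] m] by simp
    show "((\<lambda>x. - lx t (- x)) has_real_derivative lxx t (- x)) (at x)"
      using DERIV_minus[OF DERIV_chain2[where f="lx t" and g="\<lambda>x. - x" and Db="-1", OF dxx[OF t mem[OF x]] m]]
      by simp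
    show "f (- x) * lt t (- x) + lxx t (- x) = 0" by (rule eq[OF t mem[OF x]])
  qed (use x0 y False t0 in auto)
  then show ?thesis by simp
qed

section \<open>Normal forms\<close>

lemma antiderivatives_exist:
  assumes "is_equation E"
  obtains H K where "antiderivative (xdom E) (ch E) H" "antiderivative (xdom E) (\<lambda>x. exp (d8 * H x)) K"
proof -
  interpret eqn E by (rule eqnI[OF assms])
  obtain H where H: "antiderivative (xdom E) (ch E) H"
    using open_interval_antiderivative[OF domains(2) smooth_on_line_continuous[OF smooth_coeffs(2)]] by blast
  have "smooth_on_line (xdom E) (\<lambda>x. exp (d8 * H x))"
    by (intro smooth_on_line_exp_comp smooth_on_line_cmult open_domains
        smooth_on_line_antiderivative[OF H] smooth_coeffs)
  from open_interval_antiderivative[OF domains(2) smooth_on_line_continuous[OF this]]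
  obtain K where "antiderivative (xdom E) (\<lambda>x. exp (d8 * H x)) K" by blast
  then show ?thesis using that H by blast
qed

lemma equivalentI: "is_equation E ==> is_equation E' ==> maps_to E E' ==> equivalent E E'"
  unfolding equivalent_def using same_equation_refl by blast

text \<open>The transformations with \<open>d8 = 0\<close>, where the identity can serve as
  \<open>K\<close> and the change of \<open>x\<close> is affine; \<open>u\<close> and the origin of
  \<open>t\<close> are left alone.\<close>

definition affine_image :: "real => real => real => real => real => equation => equation => bool" where
  "affine_image d1 d5 d6 d7 d9 E E' \<longleftrightarrow> is_equation E' \<and> maps_to E E' \<and>
    tdom E' = (\<lambda>t. d1 * t) ` tdom E \<and> xdom E' = (\<lambda>x. d5 * x + d6) ` xdom E \<and> udom E' = udom E \<and>
    (\<forall>x\<in>xdom E. cf E' (d5 * x + d6) = d1 / d5 * d9 * cf E x \<and> ch E' (d5 * x + d6) = d9 / d7 * ch E x) \<and>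
    (\<forall>u\<in>udom E. cA E' u = d5 * d9 * cA E u \<and> cB E' u = d7 * cB E u)"

lemma deriv_affine:
  assumes E: "is_equation E" "is_equation E'" and X: "xdom E' = (\<lambda>x. d5 * x + d6) ` xdom E"
    and h: "\<And>x. x \<in> xdom E ==> ch E' (d5 * x + d6) = k * ch E x" and x: "x \<in> xdom E"
  shows "deriv (ch E') (d5 * x + d6) * d5 = k * deriv (ch E) x"
proof -
  interpret eqn E by (rule eqnI[OF E(1)])
  interpret E': eqn E' by (rule eqnI[OF E(2)])
  have y: "d5 * x + d6 \<in> xdom E'" using X x by blast
  have "((\<lambda>x. ch E' (d5 * x + d6)) has_real_derivative deriv (ch E') (d5 * x + d6) * d5) (at x)"
    by (rule DERIV_chain2[where g="\<lambda>x. d5 * x + d6", OF smooth_on_line_DERIV[OF E'.smooth_coeffs(2) y]])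
      (auto intro!: derivative_eq_intros)
  moreover have "((\<lambda>x. k * ch E x) has_real_derivative k * deriv (ch E) x) (at x)"
    by (intro DERIV_cmult smooth_on_line_DERIV[OF smooth_coeffs(2) x])
  ultimately show ?thesis by (rule DERIV_unique_open[OF open_domains(2) x, rotated]) (rule h)
qed

lemma affine_imageD:
  assumes "affine_image d1 d5 d6 d7 d9 E E'"
  shows "is_equation E'" "maps_to E E'" "tdom E' = (\<lambda>t. d1 * t) ` tdom E"
    "xdom E' = (\<lambda>x. d5 * x + d6) ` xdom E" "udom E' = udom E"
    "x \<in> xdom E ==> cf E' (d5 * x + d6) = d1 / d5 * d9 * cf E x"
    "x \<in> xdom E ==> ch E' (d5 * x + d6) = d9 / d7 * ch E x"
    "u \<in> udom E ==> cA E' u = d5 * d9 * cA E u" "u \<in> udom E ==> cB E' u = d7 * cB E u"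
  using assms unfolding affine_image_def by blast+

lemma affine_change:
  assumes E: "is_equation E" and d: "d1 \<noteq> 0" "d5 \<noteq> 0" "d7 \<noteq> 0" "d9 \<noteq> 0"
  shows "\<exists>E'. affine_image d1 d5 d6 d7 d9 E E'"
proof -
  obtain H K where H: "antiderivative (xdom E) (ch E) H" using antiderivatives_exist[OF E] by blast
  have "antiderivative (xdom E) (\<lambda>x. exp (0 * H x)) (\<lambda>x. x)" by (simp add: antiderivative_def)
  moreover have "d1 * 1 * d5 * d7 * d9 \<noteq> 0" using d by simp
  ultimately obtain E' where E': "is_equation E'" "maps_via d1 0 1 0 d5 d6 d7 0 d9 H (\<lambda>x. x) E E'"
    using maps_via_exists[OF E _ H] by blast
  then have "maps_to E E'" unfolding maps_to_iff by blast
  then show ?thesis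
    using E' unfolding affine_image_def by (intro exI[of _ E']) (simp add: maps_via_def)
qed

lemma maps_to_trans:
  assumes "is_equation E" "maps_to E E'" "maps_to E' E''" shows "maps_to E E''"
proof -
  obtain d1 d2 d3 d4 d5 d6 d7 d8 d9 H K where m1: "maps_via d1 d2 d3 d4 d5 d6 d7 d8 d9 H K E E'"
    using assms(2) unfolding maps_to_iff by blast
  obtain e1 e2 e3 e4 e5 e6 e7 e8 e9 H' K' where m2: "maps_via e1 e2 e3 e4 e5 e6 e7 e8 e9 H' K' E' E''"
    using assms(3) unfolding maps_to_iff by blast
  show ?thesis by (rule maps_via_compose[OF assms(1) m1 m2])
qed

text \<open>The transformation with trivial parameters yields an equation that is only known to
  agree with \<open>E\<close> on the domains; going there and back returns to \<open>E\<close>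
  itself.\<close>

lemma maps_to_refl:
  assumes "is_equation E" shows "maps_to E E"
proof -
  obtain E' where "affine_image 1 1 0 1 1 E E'"
    using affine_change[OF assms, of 1 1 1 1 0] by auto
  then have E': "maps_to E E'" by (rule affine_imageD)
  obtain d1 d2 d3 d4 d5 d6 d7 d8 d9 H K where m: "maps_via d1 d2 d3 d4 d5 d6 d7 d8 d9 H K E E'"
    using E' unfolding maps_to_iff by blast
  show ?thesis by (rule maps_to_trans[OF assms E' maps_via_inverse[OF assms m]])
qed

lemma continuous_nonzero_sign:
  assumes "open_interval S" "continuous_on S (g :: real => real)" "\<And>x. x \<in> S ==> g x \<noteq> 0"
  shows "\<exists>s\<in>{1, -1}. \<forall>x\<in>S. s * g x > 0"
proof -
  have "connected (g ` S)"
    using assms(1,2) by (intro connected_continuous_image) (auto simp: open_interval_def is_interval_connected_1)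
  then have conn: "is_interval (g ` S)" by (simp add: is_interval_connected_1)
  have "(\<forall>x\<in>S. g x > 0) \<or> (\<forall>x\<in>S. g x < 0)"
  proof (rule ccontr)
    assume "\<not> ((\<forall>x\<in>S. g x > 0) \<or> (\<forall>x\<in>S. g x < 0))"
    then obtain x y where xy: "x \<in> S" "y \<in> S" "\<not> g x > 0" "\<not> g y < 0" by blast
    then have "0 \<in> g ` S" using mem_is_interval_1_I[OF conn, of "g x" "g y" 0] by auto
    then show False using assms(3) by auto
  qed
  then show ?thesis by auto
qed

text \<open>If \<open>h = c / (p x + q)\<close>, the flow of \<open>d8\<close> turns \<open>h\<close> into a constant.\<close>

lemma to_item1:
  assumes E: "is_equation E" and c: "c \<noteq> 0"
    and l: "\<And>x. x \<in> xdom E ==> p * x + q \<noteq> 0" and h: "\<And>x. x \<in> xdom E ==> ch E x = c / (p * x + q)"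
  shows "\<exists>E'. listed_equation Item1 E' \<and> maps_to E E'"
proof (cases "p = 0")
  case True
  interpret eqn E by (rule eqnI[OF E])
  obtain x where "x \<in> xdom E" using sec_point by blast
  then have q: "q \<noteq> 0" using l True by auto
  obtain E' where "affine_image 1 1 0 (c / q) 1 E E'"
    using affine_change[OF E, of 1 1 "c / q" 1 0] c q by auto
  note E' = affine_imageD[OF this]
  have "ch E' x = 1" if "x \<in> xdom E'" for x
    using that E'(7)[of x] E'(4) h c q True by auto
  then show ?thesis using E'(1,2) by (intro exI[of _ E']) (auto simp: listed_equation_def)
next
  case False
  interpret eqn E by (rule eqnI[OF E])
  have "continuous_on (xdom E) (\<lambda>x. p * x + q)" by (intro continuous_intros)
  from continuous_nonzero_sign[OF domains(2) this l]
  obtain s where s: "s = 1 \<or> s = -1" "\<And>x. x \<in> xdom E ==> s * (p * x + q) > 0" by blast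
  \<comment> \<open>With \<open>d8 = - p / c\<close> the weight is the reciprocal of
    \<open>s * (p * x + q)\<close>, so dividing \<open>h\<close> by it cancels the denominator of
    \<open>h\<close>. The sign \<open>s\<close> makes the logarithm meaningful.\<close>
  define H where "H x = c / p * ln (s * (p * x + q))" for x
  have H: "antiderivative (xdom E) (ch E) H"
    unfolding antiderivative_def
  proof
    fix x assume x: "x \<in> xdom E"
    have "(H has_real_derivative c / p * (inverse (s * (p * x + q)) * (s * p))) (at x)"
      unfolding H_def by (rule DERIV_cmult, rule DERIV_chain2[OF DERIV_ln])
        (use s(2)[OF x] in \<open>auto intro!: derivative_eq_intros\<close>)
    moreover have "c / p * (inverse (s * (p * x + q)) * (s * p)) = ch E x"
      using False s(1) l[OF x] by (auto simp: h[OF x] field_simps)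
    ultimately show "(H has_real_derivative ch E x) (at x)" by simp
  qed
  have "smooth_on_line (xdom E) (\<lambda>x. exp (- p / c * H x))"
    by (intro smooth_on_line_exp_comp smooth_on_line_cmult open_domains
        smooth_on_line_antiderivative[OF H] smooth_coeffs)
  from open_interval_antiderivative[OF domains(2) smooth_on_line_continuous[OF this]]
  obtain K where K: "antiderivative (xdom E) (\<lambda>x. exp (- p / c * H x)) K" by blast
  have "1 * 1 * 1 * (c * s) * 1 \<noteq> 0" using c s by auto
  from maps_via_exists[OF E this H K, of 0 0 0]
  obtain E' where E': "is_equation E'" and m: "maps_via 1 0 1 0 1 0 (c * s) (- p / c) 1 H K E E'" by blast
  have "ch E' (1 * K x + 0) = 1" if x: "x \<in> xdom E" for x
  proof -
    have "exp (- (- p / c) * H x) = s * (p * x + q)"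
      using s(2)[OF x] c False by (simp add: H_def)
    then have "ch E' (1 * K x + 0) = 1 / (c * s) * (c / (p * x + q)) * (s * (p * x + q))"
      using m x h[OF x] unfolding maps_via_def by simp
    then show ?thesis using c s l[OF x] by auto
  qed
  moreover have "xdom E' = (\<lambda>x. 1 * K x + 0) ` xdom E" using m by (simp add: maps_via_def)
  ultimately have "listed_equation Item1 E'" using E' by (auto simp: listed_equation_def)
  then show ?thesis using m unfolding maps_to_iff by blast
qed

text \<open>For \<open>B = 1\<close> and non-constant \<open>A\<close>, a two-dimensional space of characteristics \<open>p(t) x + q(t)\<close>
  amounts to \<open>h\<close> and \<open>h\<^sub>x\<close> being the following multiples of \<open>f\<close>.\<close>

definition quadratic :: "equation => real => real => real => real => bool" where
  "quadratic E a b c n \<longleftrightarrow> is_equation E \<and> (\<forall>u\<in>udom E. cB E u = 1) \<and>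
     (\<forall>x\<in>xdom E. ch E x = cf E x * (a * x\<^sup>2 + b * x + c) \<and> deriv (ch E) x = cf E x * (n - a * x))"

text \<open>With \<open>d7 = d9 = 1\<close> the values of \<open>h\<close> are unchanged,
  \<open>h_x\<close> is divided by \<open>d5\<close> and \<open>f\<close> is multiplied by
  \<open>d1 / d5\<close>; the two polynomials have to compensate this.\<close>

lemma quadratic_affine:
  assumes E: "quadratic E a b c n" and d: "d1 \<noteq> 0" "d5 \<noteq> 0"
    and Q: "\<And>x. a' * (d5 * x + d6)\<^sup>2 + b' * (d5 * x + d6) + c' = d5 / d1 * (a * x\<^sup>2 + b * x + c)"
    and N: "\<And>x. n' - a' * (d5 * x + d6) = (n - a * x) / d1"
  shows "\<exists>E'. maps_to E E' \<and> xdom E' = (\<lambda>x. d5 * x + d6) ` xdom E \<and> quadratic E' a' b' c' n'"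
proof -
  have eqE: "is_equation E" using E by (simp add: quadratic_def)
  interpret eqn E by (rule eqnI[OF eqE])
  obtain E' where "affine_image d1 d5 d6 1 1 E E'"
    using affine_change[OF eqE d, of 1 1 d6] by auto
  note E' = affine_imageD[OF this]
  have "ch E' y = cf E' y * (a' * y\<^sup>2 + b' * y + c') \<and> deriv (ch E') y = cf E' y * (n' - a' * y)"
    if y: "y \<in> xdom E'" for y
  proof -
    obtain x where x: "x \<in> xdom E" "y = d5 * x + d6" using y E'(4) by auto
    have f: "cf E' y = d1 / d5 * cf E x" and h: "ch E' y = ch E x" using E'(6,7)[OF x(1)] x(2) by simp_all
    have h': "deriv (ch E) x = deriv (ch E') y * d5"
      using deriv_affine[OF eqE E'(1,4,7) x(1)] x(2) by simp
    have hx: "ch E x = cf E x * (a * x\<^sup>2 + b * x + c)" "deriv (ch E) x = cf E x * (n - a * x)"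
      using E x(1) by (simp_all add: quadratic_def)
    have "cf E' y * (a' * y\<^sup>2 + b' * y + c') = d1 / d5 * cf E x * (d5 / d1 * (a * x\<^sup>2 + b * x + c))"
      unfolding f unfolding x(2) Q ..
    then have "ch E' y = cf E' y * (a' * y\<^sup>2 + b' * y + c')" using d h hx by simp
    moreover have "cf E' y * (n' - a' * y) = d1 / d5 * cf E x * ((n - a * x) / d1)"
      unfolding f unfolding x(2) N ..
    then have "cf E' y * (n' - a' * y) = cf E x * (n - a * x) / d5" using d by simp
    then have "deriv (ch E') y = cf E' y * (n' - a' * y)" using d h' hx by simp
    ultimately show ?thesis by blast
  qed
  then show ?thesis
    using E'(1,2,4,5,9) E unfolding quadratic_def by (intro exI[of _ E']) auto
qed

lemma finite_quadratic_roots: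
  assumes "(a, b, c) \<noteq> (0, 0, 0 :: real)" shows "finite {x. a * x\<^sup>2 + b * x + c = 0}"
proof -
  have "[:c, b, a:] \<noteq> 0" using assms by auto
  moreover have "poly [:c, b, a:] x = a * x\<^sup>2 + b * x + c" for x
    by (simp add: algebra_simps power2_eq_square)
  ultimately show ?thesis using poly_roots_finite[of "[:c, b, a:]"] by presburger
qed

text \<open>Compare the derivative of \<open>h = f Q\<close> with the prescribed \<open>h_x\<close>.
  At a root of \<open>Q\<close> the left side vanishes, which restricts the parameters whenever the
  root lies in the domain.\<close>

lemma quadratic_f_ode:
  assumes E: "quadratic E a b c n" and x: "x \<in> xdom E"
  shows "(a * x\<^sup>2 + b * x + c) * deriv (cf E) x = cf E x * (n - b - 3 * a * x)"
proof -
  interpret eqn E using E by (intro eqnI) (simp add: quadratic_def)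
  have "((\<lambda>x. cf E x * (a * x\<^sup>2 + b * x + c)) has_real_derivative
      cf E x * (2 * a * x + b) + deriv (cf E) x * (a * x\<^sup>2 + b * x + c)) (at x)"
    by (intro DERIV_mult' smooth_on_line_DERIV[OF smooth_coeffs(1) x])
      (auto intro!: derivative_eq_intros)
  from DERIV_unique_open[OF open_domains(2) x _ smooth_on_line_DERIV[OF smooth_coeffs(2) x] this]
  have "deriv (ch E) x = cf E x * (2 * a * x + b) + deriv (cf E) x * (a * x\<^sup>2 + b * x + c)"
    using E unfolding quadratic_def by blast
  moreover have "deriv (ch E) x = cf E x * (n - a * x)" using E x by (simp add: quadratic_def)
  ultimately show ?thesis by (simp add: algebra_simps)
qed

text \<open>\<open>f\<close> and \<open>f0\<close> solve the same linear equation of first order, so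
  \<open>f / f0\<close> has zero derivative away from the roots of \<open>Q\<close>. Being
  continuous, the quotient is constant across the finitely many roots too, where the equation is
  singular. The parameter \<open>d9\<close> removes the constant.\<close>

lemma quadratic_finish:
  assumes E: "quadratic E a b c n" and nz: "(a, b, c) \<noteq> (0, 0, 0)"
    and f0: "\<And>x. x \<in> xdom E ==> (f0 has_real_derivative f0' x) (at x)" "\<And>x. x \<in> xdom E ==> f0 x \<noteq> 0"
    and ode: "\<And>x. x \<in> xdom E ==> (a * x\<^sup>2 + b * x + c) * f0' x = f0 x * (n - b - 3 * a * x)"
  shows "\<exists>E'. is_equation E' \<and> maps_to E E' \<and> xdom E' = xdom E \<and> (\<forall>u\<in>udom E'. cB E' u = 1) \<and>
    (\<forall>x\<in>xdom E'. cf E' x = f0 x \<and> ch E' x = f0 x * (a * x\<^sup>2 + b * x + c))"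
proof -
  have eqE: "is_equation E" using E by (simp add: quadratic_def)
  interpret eqn E by (rule eqnI[OF eqE])
  have conv: "convex (xdom E)" using domains(2) by (simp add: open_interval_def is_interval_convex)
  obtain x0 where x0: "x0 \<in> xdom E" using sec_point by blast
  let ?g = "\<lambda>x. cf E x / f0 x"
  have Dg: "(?g has_real_derivative (deriv (cf E) x * f0 x - cf E x * f0' x) / (f0 x * f0 x)) (at x)"
    if "x \<in> xdom E" for x
    by (intro DERIV_divide smooth_on_line_DERIV[OF smooth_coeffs(1)] f0 that)
  have C: "?g x = ?g x0" if x: "x \<in> xdom E" for x
  proof (rule has_derivative_zero_unique_strong_convex[OF conv finite_quadratic_roots[OF nz] _ x0 refl _ x])
    show "continuous_on (xdom E) ?g"
      by (rule DERIV_continuous_on[OF has_field_derivative_at_within[OF Dg]])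
    fix x assume x: "x \<in> xdom E - {x. a * x\<^sup>2 + b * x + c = 0}"
    then have o: "(a * x\<^sup>2 + b * x + c) * deriv (cf E) x = cf E x * (n - b - 3 * a * x)"
      "(a * x\<^sup>2 + b * x + c) * f0' x = f0 x * (n - b - 3 * a * x)"
      using quadratic_f_ode[OF E, of x] ode[of x] by simp_all
    have "(a * x\<^sup>2 + b * x + c) * (deriv (cf E) x * f0 x - cf E x * f0' x) =
        ((a * x\<^sup>2 + b * x + c) * deriv (cf E) x) * f0 x - cf E x * ((a * x\<^sup>2 + b * x + c) * f0' x)"
      by (simp add: algebra_simps)
    also have "\<dots> = 0" unfolding o by (simp add: algebra_simps)
    finally have "deriv (cf E) x * f0 x - cf E x * f0' x = 0" using x by simp
    then have "(?g has_real_derivative 0) (at x)" using Dg[of x] x by simp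
    then show "(?g has_derivative (\<lambda>h. 0)) (at x within xdom E)"
      unfolding has_field_derivative_def lambda_zero by (rule has_derivative_at_withinI)
  qed
  have g0: "?g x0 \<noteq> 0" using f_nz f0(2) x0 by simp
  have "1 / ?g x0 \<noteq> 0" using g0 by simp
  then obtain E' where "affine_image 1 1 0 1 (1 / ?g x0) E E'"
    using affine_change[OF eqE, of 1 1 1 "1 / ?g x0" 0] by auto
  note E' = affine_imageD[OF this]
  have "cf E' x = f0 x" if x: "x \<in> xdom E" for x
  proof -
    have "cf E x = ?g x0 * f0 x" using C[OF x] f0(2)[OF x] by (simp add: field_simps)
    moreover have "cf E' x = 1 / ?g x0 * cf E x" using E'(6)[OF x] by simp
    ultimately have "cf E' x = (1 / ?g x0 * ?g x0) * f0 x" by (simp only: mult.assoc)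
    then show ?thesis using g0 by simp
  qed
  moreover have "ch E' x = cf E' x * (a * x\<^sup>2 + b * x + c)" if x: "x \<in> xdom E" for x
    using E'(6,7)[OF x] E x by (simp add: quadratic_def)
  ultimately show ?thesis using E'(1,2,4,5,9) E by (intro exI[of _ E']) (auto simp: quadratic_def)
qed

section \<open>Explicit coefficients of the items\<close>

lemma rpow_simps [simp]: "rpow x 0 = 1" "rpow x 1 = x"
  by (simp_all add: rpow_def)

lemma rpow_zero_base: "rpow 0 a \<noteq> 0 ==> a = 0"
  unfolding rpow_def by (auto simp: power_int_0_left_if Ints_def split: if_splits)

lemma rpow_nonzero: "x > 0 \<or> (x \<noteq> 0 \<and> a \<in> \<int>) ==> rpow x a \<noteq> 0"
  by (auto simp: rpow_def)

lemma rpow_add_1: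
  assumes "x > 0 \<or> (x \<noteq> 0 \<and> a \<in> \<int>) \<or> a = 0" shows "rpow x (a + 1) = x * rpow x a"
proof (cases "a = 0")
  case False
  then have x: "x \<noteq> 0" "x > 0 \<or> a \<in> \<int>" using assms by auto
  show ?thesis
  proof (cases "a \<in> \<int>")
    case True
    then show ?thesis using x by (auto simp: rpow_def power_int_add elim!: Ints_cases)
  next
    case False
    then have "a + 1 \<notin> \<int>" using Ints_diff[of "a + 1" 1] by auto
    then show ?thesis using x False by (auto simp: rpow_def powr_add)
  qed
qed simp

lemma DERIV_rpow:
  assumes "x > 0 \<or> (x \<noteq> 0 \<and> a \<in> \<int>)"
  shows "((\<lambda>x. rpow x a) has_real_derivative rpow x a * (a / x)) (at x)"
proof (cases "a \<in> \<int>")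
  case True
  then obtain k where k: "a = of_int k" by (auto elim: Ints_cases)
  have x: "x \<noteq> 0" using assms by auto
  have "((\<lambda>x. x powi k) has_real_derivative of_int k * x powi (k - 1) * 1) (at x)"
    by (intro DERIV_power_int DERIV_ident disjI2 x)
  moreover have "of_int k * x powi (k - 1) * 1 = x powi k * (of_int k / x)"
    using x by (simp add: power_int_diff)
  ultimately show ?thesis by (simp add: rpow_def k)
next
  case False
  then have x: "x > 0" using assms by auto
  have "((\<lambda>x. x powr a) has_real_derivative a * x powr (a - 1)) (at x)"
    by (rule has_real_derivative_powr[OF x])
  moreover have "a * x powr (a - 1) = x powr a * (a / x)" using x by (simp add: powr_diff)
  ultimately show ?thesis using False by (simp add: rpow_def)
qed

lemma DERIV_rpow_abs:
  assumes "x \<noteq> c \<or> a = 0"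
  shows "((\<lambda>x. rpow \<bar>x - c\<bar> a) has_real_derivative rpow \<bar>x - c\<bar> a * (a / (x - c))) (at x)"
proof (cases "a = 0")
  case False
  then have x: "x - c \<noteq> 0" using assms by auto
  have "((\<lambda>x. \<bar>x - c\<bar>) has_real_derivative sgn (x - c)) (at x)"
  proof -
    have "open {y. sgn (x - c) * (y - c) > 0}" by (intro open_Collect_less continuous_intros)
    moreover have "sgn (x - c) * (x - c) > 0" using x by (auto simp: sgn_if)
    ultimately have "\<forall>\<^sub>F y in nhds x. y \<in> {y. sgn (x - c) * (y - c) > 0}"
      by (intro eventually_nhds_in_open) auto
    then have "\<forall>\<^sub>F y in nhds x. \<bar>y - c\<bar> = sgn (x - c) * (y - c)"
      by eventually_elim (auto simp: sgn_if split: if_splits)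
    moreover have "((\<lambda>y. sgn (x - c) * (y - c)) has_real_derivative sgn (x - c)) (at x)"
      by (auto intro!: derivative_eq_intros)
    ultimately show ?thesis by (rule DERIV_cong_ev[THEN iffD2, OF refl _ refl])
  qed
  moreover have "((\<lambda>x. rpow x a) has_real_derivative rpow \<bar>x - c\<bar> a * (a / \<bar>x - c\<bar>)) (at \<bar>x - c\<bar>)"
    by (rule DERIV_rpow) (use x in auto)
  ultimately have "((\<lambda>x. rpow \<bar>x - c\<bar> a) has_real_derivative rpow \<bar>x - c\<bar> a * (a / \<bar>x - c\<bar>) * sgn (x - c)) (at x)"
    by (intro DERIV_chain2[where f="\<lambda>x. rpow x a" and g="\<lambda>x. \<bar>x - c\<bar>"])
  moreover have "a / \<bar>x - c\<bar> * sgn (x - c) = a / (x - c)"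
    using x by (cases "x - c > 0") (auto simp: field_simps)
  ultimately show ?thesis by (simp only: mult.assoc)
qed simp

text \<open>\<open>qa\<close>, \<open>qb\<close>, \<open>qc\<close> and \<open>qn\<close> are the
  constants of \<open>quadratic\<close> for the items. The normal forms of the quadratic are
  \<open>1\<close>, \<open>x\<close>, \<open>x^2\<close>, \<open>x^2 - 1\<close> and
  \<open>x^2 + 1\<close>.\<close>

fun qa :: "item => real" where
  "qa (Item6 m) = 1" | "qa (Item7 m) = 1" | "qa (Item8 m) = 1" | "qa _ = 0"
fun qb :: "item => real" where
  "qb (Item5d m) = 1" | "qb _ = 0"
fun qc :: "item => real" where
  "qc Item5b = 1" | "qc Item5c = 1" | "qc (Item7 m) = -1" | "qc (Item8 m) = 1" | "qc _ = 0"
fun qn :: "item => real" where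
  "qn Item5c = 1" | "qn (Item5d m) = m" | "qn (Item6 m) = m" | "qn (Item7 m) = 2 * m"
| "qn (Item8 m) = m" | "qn _ = 0"

definition quadratic_item :: "item => bool" where
  "quadratic_item i \<longleftrightarrow> grade i = 2 \<and> i \<noteq> Item5a"

lemma quadratic_item_cases [consumes 1, case_names i5b i5c i5d i6 i7 i8]:
  assumes "quadratic_item i"
  obtains "i = Item5b" | "i = Item5c" | m where "i = Item5d m" | m where "i = Item6 m"
    | m where "i = Item7 m" | m where "i = Item8 m"
  using assms by (cases i) (auto simp: quadratic_item_def)

lemma q_nonzero: "quadratic_item i ==> (qa i, qb i, qc i) \<noteq> (0, 0, 0)"
  by (cases rule: quadratic_item_cases) auto

fun item_f :: "item => real => real" where
  "item_f Item5b x = 1" | "item_f Item5c x = exp x" | "item_f (Item5d m) x = rpow x (m - 1)"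
| "item_f (Item6 m) x = exp (- m / x) * x powi (- 3)"
| "item_f (Item7 m) x = rpow \<bar>x - 1\<bar> (m - 3/2) * rpow \<bar>x + 1\<bar> (- m - 3/2)"
| "item_f (Item8 m) x = exp (m * arctan x) * (x\<^sup>2 + 1) powr (- 3/2)"
| "item_f _ x = 0"

fun item_h :: "item => real => real" where
  "item_h Item5b x = 1" | "item_h Item5c x = exp x" | "item_h (Item5d m) x = rpow x m"
| "item_h (Item6 m) x = exp (- m / x) * x powi (- 1)"
| "item_h (Item7 m) x = sgn (x\<^sup>2 - 1) * rpow \<bar>x - 1\<bar> (m - 1/2) * rpow \<bar>x + 1\<bar> (- m - 1/2)"
| "item_h (Item8 m) x = exp (m * arctan x) * (x\<^sup>2 + 1) powr (- 1/2)"
| "item_h _ x = 0"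

text \<open>Points where the formula for \<open>f\<close> is differentiable and nonzero. A root of
  the quadratic qualifies only if the power of the factor vanishing there has exponent
  \<open>0\<close>.\<close>

fun regular_point :: "item => real => bool" where
  "regular_point (Item5d m) x \<longleftrightarrow> x > 0 \<or> (x \<noteq> 0 \<and> m \<in> \<int>) \<or> m = 1"
| "regular_point (Item6 m) x \<longleftrightarrow> x \<noteq> 0"
| "regular_point (Item7 m) x \<longleftrightarrow> (x \<noteq> 1 \<or> m = 3/2) \<and> (x \<noteq> -1 \<or> m = -3/2)"
| "regular_point _ x \<longleftrightarrow> True"

lemma item_f_ode:
  assumes "quadratic_item i" "regular_point i x"
  shows "\<exists>g. (item_f i has_real_derivative g) (at x) \<and> item_f i x \<noteq> 0 \<and>
    (qa i * x\<^sup>2 + qb i * x + qc i) * g = item_f i x * (qn i - qb i - 3 * qa i * x)"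
  using assms(1)
proof (cases rule: quadratic_item_cases)
  case i5b
  have "item_f Item5b = (\<lambda>x. 1)" by (rule ext) simp
  then have "(item_f Item5b has_real_derivative 0) (at x)" by simp
  then show ?thesis using i5b by auto
next
  case i5c
  have "item_f Item5c = exp" by (rule ext) simp
  then have "(item_f Item5c has_real_derivative exp x) (at x)" by (auto intro: DERIV_exp)
  then show ?thesis using i5c by auto
next
  case (i5d m)
  have e: "item_f (Item5d m) = (\<lambda>x. rpow x (m - 1))" by (rule ext) simp
  show ?thesis
  proof (cases "m = 1")
    case True
    then have "(item_f (Item5d m) has_real_derivative 0) (at x)" unfolding e by simp
    then show ?thesis using i5d True by auto
  next
    case False
    then have x: "x > 0 \<or> (x \<noteq> 0 \<and> m - 1 \<in> \<int>)" using assms(2) i5d by auto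
    show ?thesis
      using DERIV_rpow[OF x] rpow_nonzero[OF x] x unfolding i5d e
      by (intro exI[of _ "rpow x (m - 1) * ((m - 1) / x)"]) auto
  qed
next
  case (i6 m)
  have x: "x \<noteq> 0" using assms(2) i6 by simp
  have e: "item_f (Item6 m) = (\<lambda>x. exp (- m / x) * x powi (- 3))" by (rule ext) simp
  have "((\<lambda>x. exp (- m / x) * x powi (- 3)) has_real_derivative
      exp (- m / x) * (of_int (- 3) * x powi (- 3 - 1) * 1) + exp (- m / x) * (m / x\<^sup>2) * x powi (- 3)) (at x)"
    by (intro DERIV_mult' DERIV_power_int DERIV_ident disjI2 x)
      (use x in \<open>auto intro!: derivative_eq_intros simp: power2_eq_square\<close>)
  then show ?thesis
    unfolding i6 e using x
    by (intro exI conjI) (assumption, simp_all add: power_int_minus power_int_diff field_simps power2_eq_square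
        power3_eq_cube power4_eq_xxxx)
next
  case (i7 m)
  let ?\<alpha> = "m - 3/2" and ?\<beta> = "- m - 3/2"
  have s: "x \<noteq> 1 \<or> ?\<alpha> = 0" "x \<noteq> -1 \<or> ?\<beta> = 0" using assms(2) i7 by auto
  have e: "item_f (Item7 m) = (\<lambda>x. rpow \<bar>x - 1\<bar> ?\<alpha> * rpow \<bar>x - (-1)\<bar> ?\<beta>)" by (rule ext) simp
  let ?g = "item_f (Item7 m) x * (?\<beta> / (x - (-1)) + ?\<alpha> / (x - 1))"
  have "(item_f (Item7 m) has_real_derivative ?g) (at x)"
    unfolding e using DERIV_mult'[OF DERIV_rpow_abs[of x 1 ?\<alpha>] DERIV_rpow_abs[of x "-1" ?\<beta>]] s
    by (auto simp: algebra_simps)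
  moreover have "item_f (Item7 m) x \<noteq> 0"
  proof -
    have "rpow \<bar>x - 1\<bar> ?\<alpha> \<noteq> 0" using s(1) by (cases "?\<alpha> = 0") (simp_all only: rpow_simps, simp, intro rpow_nonzero, auto)
    moreover have "rpow \<bar>x - (-1)\<bar> ?\<beta> \<noteq> 0" using s(2) by (cases "?\<beta> = 0") (simp_all only: rpow_simps, simp, intro rpow_nonzero, auto)
    ultimately show ?thesis unfolding e by simp
  qed
  \<comment> \<open>At a root one quotient is \<open>0 / 0\<close>, which is \<open>0\<close>; the
    cancellation below still holds because the exponent in its numerator is \<open>0\<close>
    there.\<close>
  moreover have "(x\<^sup>2 - 1) * (?\<beta> / (x - (-1)) + ?\<alpha> / (x - 1)) = 2 * m - 3 * x"
  proof -
    have "x\<^sup>2 - 1 = (x - 1) * (x - (-1))" by (simp add: power2_eq_square algebra_simps)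
    then have "(x\<^sup>2 - 1) * (?\<beta> / (x - (-1)) + ?\<alpha> / (x - 1)) =
        (x - 1) * ((x - (-1)) * (?\<beta> / (x - (-1)))) + (x - (-1)) * ((x - 1) * (?\<alpha> / (x - 1)))"
      by (simp add: algebra_simps)
    also have "(x - (-1)) * (?\<beta> / (x - (-1))) = ?\<beta>" using s(2) by (cases "x = -1") auto
    also have "(x - 1) * (?\<alpha> / (x - 1)) = ?\<alpha>" using s(1) by (cases "x = 1") auto
    finally have "(x\<^sup>2 - 1) * (?\<beta> / (x - (-1)) + ?\<alpha> / (x - 1)) = (x - 1) * ?\<beta> + (x - (-1)) * ?\<alpha>" .
    also have "\<dots> = 2 * m - 3 * x" by (simp add: field_simps)
    finally show ?thesis .
  qed
  then have "(x\<^sup>2 - 1) * ?g = item_f (Item7 m) x * (2 * m - 3 * x)"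
    by (metis mult.left_commute)
  ultimately show ?thesis unfolding i7 by (intro exI[of _ ?g]) (simp del: item_f.simps)
next
  case (i8 m)
  have e: "item_f (Item8 m) = (\<lambda>x. exp (m * arctan x) * (x\<^sup>2 + 1) powr (- 3/2))" by (rule ext) simp
  have p: "x\<^sup>2 + 1 > 0" by (simp add: add_nonneg_pos)
  have "((\<lambda>x. (x\<^sup>2 + 1) powr (- 3/2)) has_real_derivative (- 3/2) * (x\<^sup>2 + 1) powr (- 3/2 - 1) * (2 * x)) (at x)"
    by (rule DERIV_chain2[where g="\<lambda>x. x\<^sup>2 + 1", OF has_real_derivative_powr[OF p]])
      (auto intro!: derivative_eq_intros)
  moreover have "(- 3/2) * (x\<^sup>2 + 1) powr (- 3/2 - 1) * (2 * x) = (x\<^sup>2 + 1) powr (- 3/2) * (- 3 * x / (x\<^sup>2 + 1))"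
  proof -
    have e: "(x\<^sup>2 + 1) powr (- 3/2 - 1) = (x\<^sup>2 + 1) powr (- 3/2) / (x\<^sup>2 + 1)"
      using p by (subst powr_diff) simp
    have g: "(- 3/2) * (P / q) * (2 * x) = P * (- 3 * x / q)" if "q > 0" for P q :: real
      using that by (simp add: field_simps)
    show ?thesis unfolding e by (rule g[OF p])
  qed
  ultimately have 1: "((\<lambda>x. (x\<^sup>2 + 1) powr (- 3/2)) has_real_derivative
      (x\<^sup>2 + 1) powr (- 3/2) * (- 3 * x / (x\<^sup>2 + 1))) (at x)" by simp
  have 2: "((\<lambda>x. exp (m * arctan x)) has_real_derivative exp (m * arctan x) * (m * inverse (1 + x\<^sup>2))) (at x)"
    by (auto intro!: derivative_eq_intros)
  have "(item_f (Item8 m) has_real_derivative item_f (Item8 m) x * ((m - 3 * x) / (x\<^sup>2 + 1))) (at x)"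
  proof -
    have eq: "a * (b * (- 3 * x / q)) + a * (m * inverse q) * b = a * b * ((m - 3 * x) / q)" for a b q
      by (simp add: divide_inverse algebra_simps)
    show ?thesis
      using DERIV_mult'[OF 2 1] unfolding add.commute[of 1 "x\<^sup>2"] eq unfolding e .
  qed
  moreover have "item_f (Item8 m) x \<noteq> 0" using p by simp
  ultimately show ?thesis unfolding i8 using p
    by (intro exI[of _ "item_f (Item8 m) x * ((m - 3 * x) / (x\<^sup>2 + 1))"]) (simp del: item_f.simps)
qed

lemma item_h_eq:
  assumes "quadratic_item i" "regular_point i x"
  shows "item_h i x = item_f i x * (qa i * x\<^sup>2 + qb i * x + qc i)"
  using assms(1)
proof (cases rule: quadratic_item_cases)
  case (i5d m)
  have "rpow x (m - 1 + 1) = x * rpow x (m - 1)"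
    using assms(2) i5d by (intro rpow_add_1) auto
  then show ?thesis using i5d by simp
next
  case (i6 m)
  have "x \<noteq> 0" using assms(2) i6 by simp
  then show ?thesis using i6 by (simp add: power_int_minus power3_eq_cube power2_eq_square field_simps)
next
  case (i7 m)
  have s: "x \<noteq> 1 \<or> m - 3/2 = 0" "x \<noteq> -1 \<or> - m - 3/2 = 0" using assms(2) i7 by auto
  have "rpow \<bar>x - 1\<bar> (m - 3/2 + 1) = \<bar>x - 1\<bar> * rpow \<bar>x - 1\<bar> (m - 3/2)"
    "rpow \<bar>x + 1\<bar> (- m - 3/2 + 1) = \<bar>x + 1\<bar> * rpow \<bar>x + 1\<bar> (- m - 3/2)"
    by (rule rpow_add_1; use s in auto)+
  moreover have "m - 3/2 + 1 = m - 1/2" "- m - 3/2 + 1 = - m - 1/2" by simp_all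
  ultimately have r: "rpow \<bar>x - 1\<bar> (m - 1/2) = \<bar>x - 1\<bar> * rpow \<bar>x - 1\<bar> (m - 3/2)"
    "rpow \<bar>x + 1\<bar> (- m - 1/2) = \<bar>x + 1\<bar> * rpow \<bar>x + 1\<bar> (- m - 3/2)" by (simp_all only:)
  have q: "sgn (x\<^sup>2 - 1) * (\<bar>x - 1\<bar> * \<bar>x + 1\<bar>) = x\<^sup>2 - 1"
  proof -
    have "x\<^sup>2 - 1 = (x - 1) * (x + 1)" by (simp add: power2_eq_square algebra_simps)
    then show ?thesis by (simp add: abs_mult[symmetric] mult_sgn_abs)
  qed
  have g: "s * (a * A) * (b * B) = (s * (a * b)) * (A * B)" for s a b A B :: real
    by (simp only: mult_ac)
  show ?thesis unfolding i7 item_h.simps r g q by simp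
next
  case (i8 m)
  have p: "x\<^sup>2 + 1 > 0" by (simp add: add_nonneg_pos)
  have "(x\<^sup>2 + 1) powr (- 1/2) = (x\<^sup>2 + 1) powr (- 3/2 + 1)" by simp
  also have "\<dots> = (x\<^sup>2 + 1) powr (- 3/2) * (x\<^sup>2 + 1)" using p by (subst powr_add) simp
  finally show ?thesis unfolding i8 by simp
qed auto

lemma in_item_iff:
  assumes "quadratic_item i"
  shows "in_item i E \<longleftrightarrow> (\<forall>u\<in>udom E. cB E u = 1) \<and> (\<forall>x\<in>xdom E. cf E x = item_f i x \<and> ch E x = item_h i x) \<and>
    (\<forall>m. i = Item5d m \<longrightarrow> xdom E \<subseteq> {0<..} \<or> m \<in> \<int>) \<and>
    (\<forall>m. i = Item6 m \<longrightarrow> m \<in> {0, 1} \<and> 0 \<notin> xdom E)"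
  using assms by (cases rule: quadratic_item_cases) auto

text \<open>As \<open>f\<close> has no zeros, a power with base \<open>0\<close> at a point of the
  domain must have exponent \<open>0\<close>.\<close>

lemma listed_regular:
  assumes i: "quadratic_item i" and E: "listed_equation i E" and x: "x \<in> xdom E"
  shows "regular_point i x"
proof -
  interpret eqn E using E by (intro eqnI) (simp add: listed_equation_def)
  have it: "in_item i E" using E by (simp add: listed_equation_def)
  have f: "item_f i x \<noteq> 0" using it f_nz[OF x] x unfolding in_item_iff[OF i] by force
  show ?thesis using i
  proof (cases rule: quadratic_item_cases)
    case (i5d m)
    have "xdom E \<subseteq> {0<..} \<or> m \<in> \<int>" using it i5d by simp
    moreover have "m = 1" if "x = 0" using f that i5d rpow_zero_base[of "m - 1"] by auto
    ultimately show ?thesis using x i5d by auto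
  next
    case (i6 m) then show ?thesis using it x by auto
  next
    case (i7 m)
    have "m - 3/2 = 0" if "x = 1" using f that i7 rpow_zero_base[of "m - 3/2"] by auto
    moreover have "- m - 3/2 = 0" if "x = -1" using f that i7 rpow_zero_base[of "- m - 3/2"] by auto
    ultimately show ?thesis using i7 by auto
  qed auto
qed

lemma listed_quadratic:
  assumes i: "quadratic_item i" and E: "listed_equation i E"
  shows "quadratic E (qa i) (qb i) (qc i) (qn i)"
proof -
  have eqE: "is_equation E" using E by (simp add: listed_equation_def)
  interpret eqn E by (rule eqnI[OF eqE])
  have it: "\<forall>u\<in>udom E. cB E u = 1" "\<And>x. x \<in> xdom E ==> cf E x = item_f i x"
    "\<And>x. x \<in> xdom E ==> ch E x = item_h i x"
    using E in_item_iff[OF i, of E] by (simp_all add: listed_equation_def)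
  let ?Q = "\<lambda>x. qa i * x\<^sup>2 + qb i * x + qc i"
  have h: "ch E x = item_f i x * ?Q x" if "x \<in> xdom E" for x
    using it(3)[OF that] item_h_eq[OF i listed_regular[OF i E that]] by simp
  have "deriv (ch E) x = cf E x * (qn i - qa i * x)" if x: "x \<in> xdom E" for x
  proof (rule DERIV_imp_deriv)
    obtain g where g: "(item_f i has_real_derivative g) (at x)"
      "?Q x * g = item_f i x * (qn i - qb i - 3 * qa i * x)"
      using item_f_ode[OF i listed_regular[OF i E x]] by blast
    have "(?Q has_real_derivative 2 * qa i * x + qb i) (at x)" by (auto intro!: derivative_eq_intros)
    from DERIV_mult'[OF g(1) this]
    have "((\<lambda>x. item_f i x * ?Q x) has_real_derivative item_f i x * (2 * qa i * x + qb i) + g * ?Q x) (at x)" .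
    moreover have "item_f i x * (2 * qa i * x + qb i) + g * ?Q x = cf E x * (qn i - qa i * x)"
      using g(2) by (simp add: it(2)[OF x] mult.commute[of g]) (simp add: algebra_simps)
    ultimately have "((\<lambda>x. item_f i x * ?Q x) has_real_derivative cf E x * (qn i - qa i * x)) (at x)" by simp
    then show "(ch E has_real_derivative cf E x * (qn i - qa i * x)) (at x)"
      by (rule has_field_derivative_transform_within_open[OF _ open_domains(2) x]) (simp add: h)
  qed
  then show ?thesis unfolding quadratic_def using eqE it h by simp
qed

lemma finish_item:
  assumes i: "quadratic_item i" and E: "quadratic E (qa i) (qb i) (qc i) (qn i)"
    and reg: "\<And>x. x \<in> xdom E ==> regular_point i x"
    and side: "\<And>m. i = Item5d m ==> xdom E \<subseteq> {0<..} \<or> m \<in> \<int>" "\<And>m. i = Item6 m ==> m \<in> {0, 1}"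
  shows "\<exists>E'. listed_equation i E' \<and> maps_to E E'"
proof -
  have "\<forall>x. \<exists>g. x \<in> xdom E \<longrightarrow> (item_f i has_real_derivative g) (at x) \<and> item_f i x \<noteq> 0 \<and>
    (qa i * x\<^sup>2 + qb i * x + qc i) * g = item_f i x * (qn i - qb i - 3 * qa i * x)"
    using item_f_ode[OF i reg] by blast
  then obtain g where g: "\<And>x. x \<in> xdom E ==> (item_f i has_real_derivative g x) (at x)"
    "\<And>x. x \<in> xdom E ==> item_f i x \<noteq> 0"
    "\<And>x. x \<in> xdom E ==> (qa i * x\<^sup>2 + qb i * x + qc i) * g x = item_f i x * (qn i - qb i - 3 * qa i * x)"
    by metis
  from quadratic_finish[OF E q_nonzero[OF i] g]
  obtain E' where E': "is_equation E'" "maps_to E E'" "xdom E' = xdom E" "\<forall>u\<in>udom E'. cB E' u = 1"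
    "\<forall>x\<in>xdom E'. cf E' x = item_f i x \<and> ch E' x = item_f i x * (qa i * x\<^sup>2 + qb i * x + qc i)" by blast
  have "in_item i E'"
    unfolding in_item_iff[OF i] E'(3)
    using E' item_h_eq[OF i reg] side reg[of 0] by auto
  then show ?thesis using E' by (auto simp: listed_equation_def)
qed

section \<open>Removing B\<close>

lemma equivalent_via:
  assumes "is_equation E1" "is_equation E2" "same_equation E E1" "maps_to E1 E2"
  shows "equivalent E E2"
  unfolding equivalent_def using assms same_equation_refl by blast

lemma same_equation_B_zero:
  assumes E: "is_equation E" and z: "\<And>x u. x \<in> xdom E ==> u \<in> udom E ==> ch E x * cB E u = 0"
  shows "\<exists>E1. is_equation E1 \<and> same_equation E E1 \<and> (\<forall>u. cB E1 u = 0) \<and> cA E1 = cA E \<and> udom E1 = udom E"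
proof -
  let ?E = "E\<lparr>cB := \<lambda>u. 0\<rparr>"
  interpret eqn E by (rule eqnI[OF E])
  have "is_equation ?E"
    using E smooth_on_line_const[OF open_domains(3), of 0] unfolding is_equation_def by simp
  moreover have "same_equation E ?E" using z by (simp add: same_equation_def)
  ultimately show ?thesis by (intro exI[of _ ?E]) simp
qed

text \<open>Mixing \<open>A\<close> into \<open>B\<close> is how \<open>B = 0\<close> or
  \<open>B = 1\<close> is reached. The accompanying change of \<open>x\<close> stays implicit,
  except for the fact that it does not annihilate \<open>h\<close>.\<close>

lemma mixing_change:
  assumes E: "is_equation E" and "d7 \<noteq> 0" "d9 \<noteq> 0"
  shows "\<exists>E'. is_equation E' \<and> maps_to E E' \<and> udom E' = udom E \<and>
    ((\<forall>x\<in>xdom E'. ch E' x = 0) \<longrightarrow> (\<forall>x\<in>xdom E. ch E x = 0)) \<and> (\<forall>u\<in>udom E. cA E' u = d9 * cA E u \<and> cB E' u = d7 * (cB E u + d8 * cA E u))"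
proof -
  obtain H K where "antiderivative (xdom E) (ch E) H" "antiderivative (xdom E) (\<lambda>x. exp (d8 * H x)) K"
    using antiderivatives_exist[OF E] by blast
  from maps_via_exists[OF E _ this, of 1 1 1 d7 d9 0 0 0] assms
  obtain E' where E': "is_equation E'" "maps_via 1 0 1 0 1 0 d7 d8 d9 H K E E'" by auto
  have "maps_to E E'" unfolding maps_to_iff using E'(2) by blast
  then show ?thesis using E' assms by (intro exI[of _ E']) (simp add: maps_via_def)
qed

text \<open>If \<open>h B\<close> vanishes identically, \<open>B\<close> is replaced by
  \<open>0\<close> without changing the equation. Otherwise a point with \<open>h \<noteq> 0\<close>
  shows that \<open>B\<close> is constant, and mixing in the constant \<open>A\<close> removes
  it.\<close>

lemma linearizable_to_item9:
  assumes E: "is_equation E" and l: "linearizable E"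
  shows "\<exists>E'. listed_equation Item9 E' \<and> equivalent E E'"
proof -
  interpret eqn E by (rule eqnI[OF E])
  obtain u0 where u0: "u0 \<in> udom E" using sec_point by blast
  obtain a where a: "\<And>u. u \<in> udom E ==> cA E u = a" using l by (auto simp: linearizable_def constant_A_def)
  have a0: "a \<noteq> 0" using A_nz[OF u0] a[OF u0] by simp
  show ?thesis
  proof (cases "\<forall>x\<in>xdom E. \<forall>u\<in>udom E. ch E x * cB E u = 0")
    case True
    then obtain E1 where E1: "is_equation E1" "same_equation E E1" "\<forall>u. cB E1 u = 0" "cA E1 = cA E" "udom E1 = udom E"
      using same_equation_B_zero[OF E] by blast
    obtain E2 where E2: "is_equation E2" "maps_to E1 E2" "udom E2 = udom E1"
      "\<forall>u\<in>udom E1. cA E2 u = 1 / a * cA E1 u \<and> cB E2 u = 1 * (cB E1 u + 0 * cA E1 u)"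
      using mixing_change[OF E1(1), of 1 "1 / a" 0] a0 by auto
    have "listed_equation Item9 E2" using E2 E1 a a0 by (simp add: listed_equation_def)
    then show ?thesis using equivalent_via[OF E1(1) E2(1) E1(2) E2(2)] by blast
  next
    case False
    then obtain x where x: "x \<in> xdom E" "ch E x \<noteq> 0" by auto
    obtain k where "\<And>u. u \<in> udom E ==> ch E x * cB E u = k x * cA E u"
      using l x(1) unfolding linearizable_def degenerate_def by blast
    then obtain b where "\<And>u. u \<in> udom E ==> ch E x * cB E u = b" using a by fastforce
    then have b: "\<And>u. u \<in> udom E ==> cB E u = b / ch E x" using x(2) by (simp add: field_simps)
    obtain E2 where E2: "is_equation E2" "maps_to E E2" "udom E2 = udom E"
      "\<forall>u\<in>udom E. cA E2 u = 1 / a * cA E u \<and> cB E2 u = 1 * (cB E u + - (b / ch E x) / a * cA E u)"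
      using mixing_change[OF E, of 1 "1 / a" "- (b / ch E x) / a"] a0 by auto
    have "listed_equation Item9 E2" using E2 a a0 b by (simp add: listed_equation_def)
    then show ?thesis using equivalentI[OF E E2(1,2)] by blast
  qed
qed

section \<open>Reaching the items with a quadratic\<close>

lemma continuous_zero_at:
  fixes g :: "real => real"
  assumes "open S" "continuous_on S g" "a \<in> S" "\<And>y. y \<in> S ==> y \<noteq> a ==> g y = 0"
  shows "g a = 0"
proof -
  have e: "\<forall>\<^sub>F y in at a. y \<in> S" using assms(1,3) by (auto simp: eventually_at_topological)
  have "\<forall>\<^sub>F y in at a. g y = 0"
    using e eventually_neq_at_within[of a a UNIV] by eventually_elim (rule assms(4))
  then have "(g \<longlongrightarrow> 0) (at a)" by (rule tendsto_eventually)
  moreover have "(g \<longlongrightarrow> g a) (at a)"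
    using assms(1-3) continuous_on_eq_continuous_at isCont_def by blast
  ultimately show ?thesis by (metis LIM_unique)
qed

text \<open>At a root of the quadratic the equation for \<open>f\<close> forces
  \<open>n - b - 3 a x = 0\<close>, which singles out the exponents that the normal form allows
  there.\<close>

lemma quadratic_regular:
  assumes i: "quadratic_item i" and E: "quadratic E (qa i) (qb i) (qc i) (qn i)"
    and side: "\<And>m. i = Item5d m ==> xdom E \<subseteq> {0<..} \<or> m \<in> \<int>"
    and x: "x \<in> xdom E"
  shows "regular_point i x"
proof -
  have eqE: "is_equation E" using E by (simp add: quadratic_def)
  interpret eqn E by (rule eqnI[OF eqE])
  have root: "qn i - qb i - 3 * qa i * x = 0" if "qa i * x\<^sup>2 + qb i * x + qc i = 0"
    using quadratic_f_ode[OF E x] that f_nz[OF x] by simp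
  show ?thesis using i
  proof (cases rule: quadratic_item_cases)
    case (i5d m) then show ?thesis using side[of m] x root by auto
  next
    case (i6 m)
    have False if x0: "x = 0"
    proof -
      \<comment> \<open>For \<open>m = 0\<close> the equation is consistent at \<open>0\<close>, but
        divided by \<open>y\<close> it becomes \<open>y f' + 3 f = 0\<close>, and continuity yields
        \<open>f 0 = 0\<close>.\<close>
      have m: "m = 0" using root x0 i6 by simp
      have "y * deriv (cf E) y + 3 * cf E y = 0" if y: "y \<in> xdom E" "y \<noteq> 0" for y
      proof -
        have "y * (y * deriv (cf E) y + 3 * cf E y) = 0"
          using quadratic_f_ode[OF E y(1)] i6 m by (simp add: algebra_simps power2_eq_square)
        then show ?thesis using y by simp
      qed
      moreover have "continuous_on (xdom E) (\<lambda>y. y * deriv (cf E) y + 3 * cf E y)"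
        by (intro continuous_intros smooth_on_line_continuous smooth_on_line_deriv smooth_coeffs)
      ultimately have "0 * deriv (cf E) 0 + 3 * cf E 0 = 0"
        using continuous_zero_at[OF open_domains(2), of "\<lambda>y. y * deriv (cf E) y + 3 * cf E y" 0] x x0 by blast
      then show False using f_nz[OF x] x0 by simp
    qed
    then show ?thesis using i6 by auto
  next
    case (i7 m)
    then have 1: "x\<^sup>2 - 1 = 0 ==> 2 * m - 3 * x = 0" using root by simp
    have "m = 3/2" if "x = 1" using 1 that by simp
    moreover have "m = - 3/2" if "x = - 1" using 1 that by simp
    ultimately show ?thesis unfolding i7 regular_point.simps by blast
  qed auto
qed

lemma quadratic_to_item:
  assumes i: "quadratic_item i" and E: "quadratic E a b c n" and d: "d1 \<noteq> 0" "d5 \<noteq> 0"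
    and Q: "\<And>x. qa i * (d5 * x + d6)\<^sup>2 + qb i * (d5 * x + d6) + qc i = d5 / d1 * (a * x\<^sup>2 + b * x + c)"
    and N: "\<And>x. qn i - qa i * (d5 * x + d6) = (n - a * x) / d1"
    and side: "\<And>m. i = Item5d m ==> (\<lambda>x. d5 * x + d6) ` xdom E \<subseteq> {0<..} \<or> m \<in> \<int>"
      "\<And>m. i = Item6 m ==> m \<in> {0, 1}"
  shows "\<exists>E'. listed_equation i E' \<and> maps_to E E'"
proof -
  obtain E1 where E1: "maps_to E E1" "xdom E1 = (\<lambda>x. d5 * x + d6) ` xdom E" "quadratic E1 (qa i) (qb i) (qc i) (qn i)"
    using quadratic_affine[OF E d Q N] by blast
  have s: "xdom E1 \<subseteq> {0<..} \<or> m \<in> \<int>" if "i = Item5d m" for m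
    unfolding E1(2) by (rule side(1)[OF that])
  obtain E2 where E2: "listed_equation i E2" "maps_to E1 E2"
    using finish_item[OF i E1(3) quadratic_regular[OF i E1(3) s] s side(2)] by blast
  have "is_equation E" using E by (simp add: quadratic_def)
  then show ?thesis using maps_to_trans[OF _ E1(1) E2(2)] E2(1) by blast
qed

lemma linear_to_item5d:
  assumes E: "quadratic E 0 1 0 m"
  shows "\<exists>E'. listed_equation (Item5d m) E' \<and> maps_to E E'"
proof -
  have i: "quadratic_item (Item5d m)" by (simp add: quadratic_item_def)
  have eqE: "is_equation E" using E by (simp add: quadratic_def)
  interpret eqn E by (rule eqnI[OF eqE])
  show ?thesis
  proof (cases "0 \<in> xdom E")
    case True
    have "m = 1" using quadratic_f_ode[OF E True] f_nz[OF True] by simp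
    then show ?thesis by (intro quadratic_to_item[OF i E, of 1 1 0]) auto
  next
    case False
    then have "\<And>x. x \<in> xdom E ==> x \<noteq> 0" by blast
    from continuous_nonzero_sign[OF domains(2) continuous_on_id this]
    \<comment> \<open>Powers with a real exponent call for \<open>x > 0\<close>; a domain without
      \<open>0\<close> lies on one side of it, and \<open>s\<close> reflects it if
      necessary.\<close>
    obtain s :: real where s: "s \<in> {1, -1}" "\<And>x. x \<in> xdom E ==> s * x > 0" by blast
    then show ?thesis by (intro quadratic_to_item[OF i E, of 1 s 0]) auto
  qed
qed

text \<open>Polynomials of degree at most two are normalised by degree and, in degree two, by the
  sign of the discriminant. Scalings that are still free are spent on \<open>n\<close>; otherwise
  \<open>n\<close> supplies the parameter of the item.\<close>

lemma quadratic_to_listed: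
  assumes E: "quadratic E a b c n" and nz: "(a, b, c) \<noteq> (0, 0, 0)"
  shows "\<exists>i E'. grade i = 2 \<and> listed_equation i E' \<and> maps_to E E'"
proof -
  have *: ?thesis if "quadratic_item i" "\<exists>E'. listed_equation i E' \<and> maps_to E E'" for i
    using that by (auto simp: quadratic_item_def)
  have eqE: "is_equation E" using E by (simp add: quadratic_def)
  consider (const) "a = 0" "b = 0" "c \<noteq> 0" "n = 0" | (const') "a = 0" "b = 0" "c \<noteq> 0" "n \<noteq> 0"
    | (linear) "a = 0" "b \<noteq> 0" | (quadratic) "a \<noteq> 0"
    using nz by auto
  then show ?thesis
  proof cases
    case const
    show ?thesis
      by (rule *[of Item5b], simp add: quadratic_item_def, rule quadratic_to_item[OF _ E, of _ c 1 0])
        (use const in \<open>auto simp: quadratic_item_def\<close>)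
  next
    case const'
    show ?thesis
      by (rule *[of Item5c], simp add: quadratic_item_def, rule quadratic_to_item[OF _ E, of _ n "n / c" 0])
        (use const' in \<open>auto simp: quadratic_item_def\<close>)
  next
    case linear
    obtain E1 where E1: "maps_to E E1" "quadratic E1 0 1 0 (n / b)"
      using quadratic_affine[OF E, of b 1 0 "c / b" 1 0 "n / b"] linear by (auto simp: field_simps)
    obtain E2 where "listed_equation (Item5d (n / b)) E2" "maps_to E1 E2"
      using linear_to_item5d[OF E1(2)] by blast
    then show ?thesis using maps_to_trans[OF eqE E1(1)]
      by (intro *[of "Item5d (n / b)"]) (auto simp: quadratic_item_def)
  next
    case quadratic
    define r where "r = - b / (2 * a)"
    define e where "e = c / a - r\<^sup>2"
    have b: "b = - 2 * a * r" and c: "c = a * (r\<^sup>2 + e)" using quadratic by (simp_all add: r_def e_def)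
    have Q: "a * x\<^sup>2 + b * x + c = a * ((x - r)\<^sup>2 + e)" for x
      unfolding b c by (simp add: power2_eq_square algebra_simps)
    \<comment> \<open>Dividing \<open>x - r\<close> by \<open>s\<close> makes the constant term
      \<open>1\<close> or \<open>-1\<close>. The parameter of the item is then dictated by what
      becomes of \<open>n\<close>.\<close>
    have s2: "\<exists>i. quadratic_item i \<and> (\<forall>y. qa i * y\<^sup>2 + qb i * y + qc i = y\<^sup>2 + e / s\<^sup>2) \<and> qa i = 1 \<and>
        qn i = n / (a * s) - r / s \<and> (\<forall>m. i \<noteq> Item5d m) \<and> (\<forall>m. i \<noteq> Item6 m)"
      if "s > 0" "e = - s\<^sup>2 \<or> e = s\<^sup>2" for s
    proof (cases "e = s\<^sup>2")
      case True
      then show ?thesis using that by (intro exI[of _ "Item8 (n / (a * s) - r / s)"]) (simp add: quadratic_item_def)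
    next
      case False
      then have "e = - s\<^sup>2" using that by blast
      then show ?thesis using that(1) by (intro exI[of _ "Item7 ((n / (a * s) - r / s) / 2)"]) (simp add: quadratic_item_def mult.commute)
    qed
    show ?thesis
    proof (cases "e = 0")
      case False
      define s where "s = sqrt \<bar>e\<bar>"
      have s: "s > 0" "s\<^sup>2 = \<bar>e\<bar>" using False by (simp_all add: s_def)
      then have "e = - s\<^sup>2 \<or> e = s\<^sup>2" by auto
      from s2[OF s(1) this] obtain i where i: "quadratic_item i"
        "\<And>y. qa i * y\<^sup>2 + qb i * y + qc i = y\<^sup>2 + e / s\<^sup>2" "qa i = 1"
        "qn i = n / (a * s) - r / s" "\<And>m. i \<noteq> Item5d m" "\<And>m. i \<noteq> Item6 m" by blast
      show ?thesis
      proof (rule *[OF i(1)], rule quadratic_to_item[OF i(1) E, of "a * s" "1 / s" "- r / s"])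
        fix x
        have "1 / s * x + - r / s = (x - r) / s" by (simp add: diff_divide_distrib)
        then show "qa i * (1 / s * x + - r / s)\<^sup>2 + qb i * (1 / s * x + - r / s) + qc i =
            1 / s / (a * s) * (a * x\<^sup>2 + b * x + c)"
          unfolding i(2) Q using s(1) quadratic by (simp add: power_divide field_simps power2_eq_square)
        show "qn i - qa i * (1 / s * x + - r / s) = (n - a * x) / (a * s)"
          unfolding i(3,4) using s(1) quadratic by (simp add: field_simps)
      qed (use i s quadratic in auto)
    next
      case True
      \<comment> \<open>A double root leaves the scaling of \<open>x\<close> free, and it brings the
        remaining constant \<open>n - a * r\<close> to \<open>0\<close> or \<open>1\<close> after
        division by \<open>a\<close>.\<close>
      define m where "m = (if n = a * r then 0 else (1 :: real))"
      define d5 where "d5 = (if n = a * r then 1 else a / (n - a * r))"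
      have d5: "d5 \<noteq> 0" and m: "m = d5 * (n - a * r) / a"
        using quadratic by (auto simp: d5_def m_def)
      have i: "quadratic_item (Item6 m)" by (simp add: quadratic_item_def)
      show ?thesis
      proof (rule *[OF i], rule quadratic_to_item[OF i E, of "a / d5" d5 "- d5 * r"])
        fix x
        show "qa (Item6 m) * (d5 * x + - d5 * r)\<^sup>2 + qb (Item6 m) * (d5 * x + - d5 * r) + qc (Item6 m) =
            d5 / (a / d5) * (a * x\<^sup>2 + b * x + c)"
          unfolding Q True using d5 quadratic by (simp add: power2_eq_square algebra_simps)
        show "qn (Item6 m) - qa (Item6 m) * (d5 * x + - d5 * r) = (n - a * x) / (a / d5)"
          using d5 quadratic by (simp add: m field_simps)
      qed (use d5 quadratic in \<open>auto simp: m_def\<close>)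
    qed
  qed
qed

section \<open>Constancy and uniqueness on intervals\<close>

lemma open_interval_affine:
  assumes X: "open_interval X" and d: "\<And>x. x \<in> X ==> (g has_real_derivative g' x) (at x)"
    "\<And>x. x \<in> X ==> (g' has_real_derivative 0) (at x)"
  shows "\<exists>k m. \<forall>x\<in>X. g x = k * x + m \<and> g' x = k"
proof -
  obtain k where k: "\<And>x. x \<in> X ==> g' x = k" using open_interval_constant[OF X d(2)] by blast
  have "\<exists>m. \<forall>x\<in>X. g x - k * x = m"
    by (rule open_interval_constant[OF X]) (use d(1) k in \<open>auto intro!: derivative_eq_intros\<close>)
  then obtain m where "\<And>x. x \<in> X ==> g x - k * x = m" by blast
  then show ?thesis using k by (intro exI[of _ k] exI[of _ m]) (auto simp: algebra_simps)
qed

lemma open_interval_two_points: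
  assumes "open_interval S" obtains a b where "a \<in> S" "b \<in> S" "a \<noteq> b"
proof -
  obtain a where a: "a \<in> S" using assms unfolding open_interval_def by blast
  have "open S" using assms by (simp add: open_interval_def)
  then obtain e where "e > 0" "ball a e \<subseteq> S" using a open_contains_ball by blast
  then have "a + e / 2 \<in> S" "a \<noteq> a + e / 2" by (auto simp: dist_real_def)
  then show ?thesis using that a by blast
qed

lemma (in eqn) open_h_nonzero: "open {x \<in> xdom E. ch E x \<noteq> 0}"
  using continuous_open_preimage[OF smooth_on_line_continuous[OF smooth_coeffs(2)] open_domains(2), of "- {0}"]
  by (simp add: vimage_def Int_def open_Compl)

text \<open>Gronwall's argument for \<open>p^2 + q^2\<close>, whose derivative is bounded by
  \<open>C\<close> times itself; the factors \<open>exp (- C * t)\<close> and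
  \<open>exp (C * t)\<close> serve the two directions of time.\<close>

lemma linear_ode_zero:
  fixes p q :: "real => real"
  assumes T: "open_interval T"
    and p: "\<And>t. t \<in> T ==> (p has_real_derivative m1 * p t + m3 * q t) (at t)"
    and q: "\<And>t. t \<in> T ==> (q has_real_derivative m2 * p t + m4 * q t) (at t)"
    and t0: "t0 \<in> T" "p t0 = 0" "q t0 = 0" and t: "t \<in> T"
  shows "p t = 0 \<and> q t = 0"
proof -
  define C where "C = 2 * (\<bar>m1\<bar> + \<bar>m2\<bar> + \<bar>m3\<bar> + \<bar>m4\<bar>)"
  define N where "N s = p s * p s + q s * q s" for s
  define N' where "N' s = 2 * (p s * (m1 * p s + m3 * q s) + q s * (m2 * p s + m4 * q s))" for s
  have DN: "(N has_real_derivative N' s) (at s)" if "s \<in> T" for s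
    using DERIV_add[OF DERIV_mult'[OF p p] DERIV_mult'[OF q q], OF that that that that]
    unfolding N_def[abs_def] N'_def by (simp add: algebra_simps)
  have N': "\<bar>N' s\<bar> \<le> C * N s" for s
  proof -
    have b: "\<bar>p s * p s\<bar> \<le> N s" "\<bar>q s * q s\<bar> \<le> N s" "\<bar>p s * q s\<bar> \<le> N s"
    proof -
      have "2 * \<bar>p s * q s\<bar> \<le> N s"
        using sum_squares_bound[of "\<bar>p s\<bar>" "\<bar>q s\<bar>"] by (simp add: N_def abs_mult power2_eq_square)
      then show "\<bar>p s * q s\<bar> \<le> N s" by simp
    qed (simp_all add: N_def)
    have "N' s = 2 * (m1 * (p s * p s) + m3 * (p s * q s) + (m2 * (p s * q s) + m4 * (q s * q s)))"
      by (simp add: N'_def algebra_simps)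
    also have "\<bar>\<dots>\<bar> \<le> 2 * (\<bar>m1 * (p s * p s)\<bar> + \<bar>m3 * (p s * q s)\<bar> + (\<bar>m2 * (p s * q s)\<bar> + \<bar>m4 * (q s * q s)\<bar>))"
      by simp
    also have "\<dots> \<le> 2 * (\<bar>m1\<bar> * N s + \<bar>m3\<bar> * N s + (\<bar>m2\<bar> * N s + \<bar>m4\<bar> * N s))"
      using b by (intro mult_left_mono[of _ _ 2] add_mono) (simp_all add: abs_mult mult_left_mono)
    also have "\<dots> = C * N s" by (simp add: C_def algebra_simps)
    finally show ?thesis .
  qed
  have mem: "s \<in> T" if "a \<in> T" "b \<in> T" "a \<le> s" "s \<le> b" for a b s
    using T that unfolding open_interval_def is_interval_1 by blast
  have N0: "N t0 = 0" using t0 by (simp add: N_def)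
  have "N t \<le> 0"
  proof (cases "t0 \<le> t")
    case True
    have "N t * exp (- C * t) \<le> N t0 * exp (- C * t0)"
    proof (rule DERIV_nonpos_imp_nonincreasing[OF True])
      fix s assume "t0 \<le> s" "s \<le> t"
      then have s: "s \<in> T" using mem t0 t by blast
      have "((\<lambda>s. N s * exp (- C * s)) has_real_derivative (N' s - C * N s) * exp (- C * s)) (at s)"
        by (auto intro!: derivative_eq_intros DN s simp: algebra_simps)
      moreover have "(N' s - C * N s) * exp (- C * s) \<le> 0"
        using N'[of s] by (intro mult_nonpos_nonneg) auto
      ultimately show "\<exists>y. ((\<lambda>s. N s * exp (- C * s)) has_real_derivative y) (at s) \<and> y \<le> 0" by blast
    qed
    then show ?thesis unfolding N0 by (simp add: mult_le_0_iff)
  next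
    case False
    then have le: "t \<le> t0" by simp
    have "N t * exp (C * t) \<le> N t0 * exp (C * t0)"
    proof (rule DERIV_nonneg_imp_nondecreasing[OF le])
      fix s assume "t \<le> s" "s \<le> t0"
      then have s: "s \<in> T" using mem t0 t by blast
      have "((\<lambda>s. N s * exp (C * s)) has_real_derivative (N' s + C * N s) * exp (C * s)) (at s)"
        by (auto intro!: derivative_eq_intros DN s simp: algebra_simps)
      moreover have "(N' s + C * N s) * exp (C * s) \<ge> 0"
        using N'[of s] by (intro mult_nonneg_nonneg) auto
      ultimately show "\<exists>y. ((\<lambda>s. N s * exp (C * s)) has_real_derivative y) (at s) \<and> y \<ge> 0" by blast
    qed
    then show ?thesis unfolding N0 by (simp add: mult_le_0_iff)
  qed
  then show ?thesis using sum_squares_le_zero_iff[of "p t" "q t"] by (simp add: N_def)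
qed

lemma linear_ode_zero1:
  fixes r :: "real => real"
  assumes T: "open_interval T" and r: "\<And>t. t \<in> T ==> (r has_real_derivative m * r t) (at t)"
    and t0: "t0 \<in> T" "r t0 = 0" and t: "t \<in> T"
  shows "r t = 0"
proof -
  have "r t = 0 \<and> (0 :: real) = 0"
    by (rule linear_ode_zero[where p=r and q="\<lambda>t. 0" and T=T and t=t and ?m1.0=m and ?m2.0=0 and ?m3.0=0 and ?m4.0=0])
      (use assms in auto)
  then show ?thesis by blast
qed

lemma affine_image_deriv:
  assumes E: "is_equation E" and m: "affine_image d1 d5 d6 d7 d9 E E'" and x: "x \<in> xdom E"
  shows "deriv (ch E') (d5 * x + d6) * d5 = d9 / d7 * deriv (ch E) x"
  using deriv_affine[OF E affine_imageD(1,4,7)[OF m] x] .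

section \<open>Equations with characteristics proportional to the inverse of h\<close>

text \<open>Around \<open>x0\<close> the factor \<open>h\<close> is nonzero, so \<open>l\<close>
  vanishes there at all times and has zero Cauchy data at \<open>x0\<close>. Unique continuation
  carries this to the whole domain, past any zeros of \<open>h\<close>.\<close>

lemma hl_zero:
  assumes E: "is_equation E" and data: "char_data E l lt lx lxx" and a: "a \<noteq> 0"
    and eq: "\<And>t x. t \<in> tdom E ==> x \<in> xdom E ==> cf E x * lt t x + a * lxx t x = 0"
    and hl: "\<And>t x. t \<in> tdom E ==> x \<in> xdom E ==> ch E x * l t x = 0"
    and x0: "x0 \<in> xdom E" "ch E x0 \<noteq> 0" and t: "t \<in> tdom E" and y: "y \<in> xdom E"
  shows "l t y = 0"
proof -
  interpret eqn E by (rule eqnI[OF E])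
  note D = char_dataD[OF data]
  let ?S = "{x \<in> xdom E. ch E x \<noteq> 0}"
  have lz: "l s x = 0" if "s \<in> tdom E" "x \<in> ?S" for s x using hl[of s x] that by simp
  have "lx s x0 = 0" if s: "s \<in> tdom E" for s
    using DERIV_unique_open[OF open_h_nonzero, of x0 "l s" "\<lambda>x. 0" "lx s x0" 0] x0 lz[OF s] D(3)[OF s x0(1)] by simp
  moreover have "continuous_on (xdom E) (\<lambda>x. cf E x / a)"
    by (intro continuous_on_divide smooth_on_line_continuous smooth_coeffs continuous_on_const) (simp add: a)
  moreover have "cf E x / a * lt s x + lxx s x = 0" if "s \<in> tdom E" "x \<in> xdom E" for s x
    using eq[OF that] a by (simp add: field_simps)
  ultimately show ?thesis
    using unique_continuation[OF domains(1,2) _ D(1-4), of "\<lambda>x. cf E x / a" x0 y t] x0 lz t y by auto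
qed

text \<open>The equation for characteristics has split in two. From \<open>(h l)_x = 0\<close> one
  gets \<open>l = c(t) K\<close> with \<open>K = 1 / h\<close>, and separating variables in the
  other part makes \<open>c' / c\<close> a constant \<open>m\<close>. If \<open>m = 0\<close>, then
  \<open>K\<close> is affine and \<open>Item1\<close> is reached; otherwise \<open>alt\<close> makes
  \<open>A\<close> constant, and scaling \<open>t\<close> by \<open>m\<close> leads to
  \<open>Item2\<close>. The number \<open>a\<close> is the value of \<open>A\<close> or, if
  \<open>l_t\<close> vanishes for all characteristics, a dummy.\<close>

lemma hl_case:
  assumes E: "is_equation E" and a: "a \<noteq> 0"
    and eq: "\<And>l lt lx lxx t x. char_data E l lt lx lxx ==> t \<in> tdom E ==> x \<in> xdom E ==>
      cf E x * lt t x + a * lxx t x = 0 \<and> deriv (ch E) x * l t x + ch E x * lx t x = 0"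
    and alt: "(\<forall>u\<in>udom E. cA E u = a) \<or>
      (\<forall>l lt lx lxx. char_data E l lt lx lxx \<longrightarrow> (\<forall>t\<in>tdom E. \<forall>x\<in>xdom E. lt t x = 0))"
    and B: "\<nexists>b. \<forall>u\<in>udom E. cB E u = b"
    and h: "x1 \<in> xdom E" "ch E x1 \<noteq> 0"
    and l: "char_solution E l" and nz: "t0 \<in> tdom E" "x0 \<in> xdom E" "l t0 x0 \<noteq> 0"
  shows "\<not> two_char_solutions E \<and> (\<exists>i E'. grade i = 1 \<and> listed_equation i E' \<and> maps_to E E')"
proof -
  interpret eqn E by (rule eqnI[OF E])
  have hl: "ch E x * g t x = ch E x1 * g t x1"
    if g: "char_data E g gt gx gxx" and t: "t \<in> tdom E" and x: "x \<in> xdom E" for g gt gx gxx t x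
  proof -
    have "\<exists>k. \<forall>x\<in>xdom E. ch E x * g t x = k"
    proof (rule open_interval_constant[OF domains(2)])
      fix x assume x: "x \<in> xdom E"
      show "((\<lambda>x. ch E x * g t x) has_real_derivative 0) (at x)"
        by (rule DERIV_cong[OF DERIV_mult'[OF smooth_on_line_DERIV[OF smooth_coeffs(2) x] char_dataD(3)[OF g t x]]])
          (use eq[OF g t x] in \<open>simp add: algebra_simps\<close>)
    qed
    then show ?thesis using x h(1) by force
  qed
  obtain lt lx lxx where data: "char_data E l lt lx lxx" using l unfolding char_solution_def by blast
  \<comment> \<open>By unique continuation \<open>h l\<close> is nonzero at some time; as it does
    not vary with \<open>x\<close>, it follows that \<open>h\<close> has no zeros.\<close>
  have "\<exists>t\<in>tdom E. ch E x1 * l t x1 \<noteq> 0"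
  proof (rule ccontr)
    assume "\<not> ?thesis"
    then have "ch E x * l t x = 0" if "t \<in> tdom E" "x \<in> xdom E" for t x
      using hl[OF data that] that by auto
    from hl_zero[OF E data a _ this h nz(1,2)] eq[OF data] nz(3) show False by blast
  qed
  then obtain t1 where t1: "t1 \<in> tdom E" "ch E x1 * l t1 x1 \<noteq> 0" by blast
  have hnz: "ch E x \<noteq> 0" if "x \<in> xdom E" for x using hl[OF data t1(1) that] t1(2) by auto
  define K where "K x = inverse (ch E x)" for x
  have smK: "smooth_on_line (xdom E) K"
    unfolding K_def[abs_def] by (rule smooth_on_line_inverse[OF smooth_coeffs(2) open_domains(2) hnz])
  note DK = smooth_on_line_DERIV[OF smK] smooth_on_line_DERIV[OF smooth_on_line_deriv[OF smK]]
  have hK: "ch E x * K x = 1" if "x \<in> xdom E" for x using hnz[OF that] by (simp add: K_def)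
  have gK: "g t x = ch E x1 * g t x1 * K x"
    if g: "char_data E g gt gx gxx" and t: "t \<in> tdom E" and x: "x \<in> xdom E" for g gt gx gxx t x
    using hl[OF g t x] hnz[OF x] by (simp add: K_def field_simps)
  have ode: "cf E x * (ch E x1 * gt t x1) * K x + a * (ch E x1 * g t x1) * deriv (deriv K) x = 0"
    if g: "char_data E g gt gx gxx" and t: "t \<in> tdom E" and x: "x \<in> xdom E" for g gt gx gxx t x
  proof -
    have "gt t x = ch E x1 * gt t x1 * K x"
      by (rule DERIV_unique_open[OF open_domains(1) t gK[OF g _ x]  char_dataD(2)[OF g t x]])
        (auto intro!: DERIV_cmult_right DERIV_cmult char_dataD(2)[OF g t h(1)])
    moreover have gx: "gx t x = ch E x1 * g t x1 * deriv K x" if x: "x \<in> xdom E" for x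
      by (rule DERIV_unique_open[OF open_domains(2) x gK[OF g t] char_dataD(3)[OF g t x]])
        (auto intro!: DERIV_cmult DK x)
    moreover have "gxx t x = ch E x1 * g t x1 * deriv (deriv K) x"
      by (rule DERIV_unique_open[OF open_domains(2) x gx char_dataD(4)[OF g t x]])
        (auto intro!: DERIV_cmult DK x)
    ultimately show ?thesis using eq[OF g t x] by (simp add: mult.assoc)
  qed
  \<comment> \<open>The quotient \<open>c' / c\<close> at the time \<open>t1\<close>, where
    \<open>c\<close> is \<open>h l\<close> taken at \<open>x1\<close>.\<close>
  define m where "m = (ch E x1 * lt t1 x1) / (ch E x1 * l t1 x1)"
  have K2: "deriv (deriv K) x = - (m / a) * cf E x * K x" if "x \<in> xdom E" for x
  proof -
    have e: "F * c' * k + a * c * k2 = 0 ==> c \<noteq> 0 ==> k2 = - (c' / c / a) * F * k" for F c' k c k2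
      using a by (simp add: field_simps add_eq_0_iff)
    show ?thesis unfolding m_def by (rule e[OF ode[OF data t1(1) that] t1(2)])
  qed
  have mc: "ch E x1 * gt t x1 = m * (ch E x1 * g t x1)"
    if g: "char_data E g gt gx gxx" and t: "t \<in> tdom E" for g gt gx gxx t
  proof -
    have "cf E x1 * K x1 * (ch E x1 * gt t x1 - m * (ch E x1 * g t x1)) = 0"
    proof -
      have e: "F * c' * k + a * c * (- (m / a) * F * k) = 0 ==> F * k * (c' - m * c) = 0" for F c' k c
        using a by (simp add: field_simps)
      show ?thesis by (rule e[OF ode[OF g t h(1), unfolded K2[OF h(1)]]])
    qed
    then show ?thesis using f_nz[OF h(1)] h(2) by (simp add: K_def)
  qed
  have "\<not> two_char_solutions E"
  proof
    assume "two_char_solutions E"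
    then obtain g1 g2 where g: "char_solution E g1" "char_solution E g2"
      "\<And>a b. (\<forall>t\<in>tdom E. \<forall>x\<in>xdom E. a * g1 t x + b * g2 t x = 0) ==> a = 0 \<and> b = 0"
      unfolding two_char_solutions_def by blast
    obtain g1t g1x g1xx g2t g2x g2xx where d: "char_data E g1 g1t g1x g1xx" "char_data E g2 g2t g2x g2xx"
      using g(1,2) unfolding char_solution_def by blast
    have z: "\<alpha> * g1 t x + \<beta> * g2 t x = 0"
      if "\<alpha> * g1 t1 x1 + \<beta> * g2 t1 x1 = 0" and t: "t \<in> tdom E" and x: "x \<in> xdom E" for \<alpha> \<beta> t x
    proof -
      let ?r = "\<lambda>t. \<alpha> * g1 t x1 + \<beta> * g2 t x1"
      have r: "?r t = 0"
      proof (rule linear_ode_zero1[where r="?r" and T="tdom E", OF domains(1) _ t1(1) that(1) t])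
        fix s assume s: "s \<in> tdom E"
        have e: "g1t s x1 = m * g1 s x1" "g2t s x1 = m * g2 s x1"
          using mc[OF d(1) s] mc[OF d(2) s] h(2) by simp_all
        have "(?r has_real_derivative \<alpha> * g1t s x1 + \<beta> * g2t s x1) (at s)"
          by (intro DERIV_add DERIV_cmult char_dataD(2)[OF d(1) s h(1)] char_dataD(2)[OF d(2) s h(1)])
        then show "(?r has_real_derivative m * ?r s) (at s)"
          unfolding e by (simp add: algebra_simps)
      qed
      have "\<alpha> * g1 t x + \<beta> * g2 t x = ch E x1 * K x * (\<alpha> * g1 t x1 + \<beta> * g2 t x1)"
        unfolding gK[OF d(1) t x] gK[OF d(2) t x] by (simp add: algebra_simps)
      then show ?thesis unfolding r by simp
    qed
    \<comment> \<open>The combination with these coefficients vanishes at \<open>(t1, x1)\<close>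
      and hence everywhere, by uniqueness for \<open>c' = m c\<close>. Independence then gives
      \<open>g1 t1 x1 = 0\<close>, and by the same uniqueness \<open>g1\<close> is zero, which is
      absurd.\<close>
    have "g2 t1 x1 = 0 \<and> - g1 t1 x1 = 0"
      using z[of "g2 t1 x1" "- g1 t1 x1"] by (intro g(3) ballI) (simp add: mult.commute)
    then have "(1::real) = 0 \<and> (0::real) = 0" using z[of 1 0] by (intro g(3) ballI) simp
    then show False by simp
  qed
  moreover have "\<exists>i E'. grade i = 1 \<and> listed_equation i E' \<and> maps_to E E'"
  proof (cases "m = 0")
    case True
    have "(deriv K has_real_derivative 0) (at x)" if "x \<in> xdom E" for x
      using DK(2)[OF that] K2[OF that] True by simp
    from open_interval_affine[OF domains(2) DK(1) this]
    obtain p q where q: "\<And>x. x \<in> xdom E ==> K x = p * x + q" by blast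
    have "p * x + q \<noteq> 0" "ch E x = 1 / (p * x + q)" if x: "x \<in> xdom E" for x
      using q[OF x] hnz[OF x] by (auto simp: K_def divide_inverse[of 1] inverse_eq_imp_eq
          dest: inverse_zero_imp_zero sym[of "inverse _" "p * _ + q"])
    from to_item1[OF E _ this] show ?thesis by (metis grade.simps(1) zero_neq_one)
  next
    case False
    have "lt t1 x1 \<noteq> 0" using False by (auto simp: m_def split: if_splits)
    then have A: "\<forall>u\<in>udom E. cA E u = a" using alt data t1(1) h(1) by blast
    have "1 / a \<noteq> 0" using a by simp
    \<comment> \<open>\<open>d1 = m\<close> turns \<open>exp (m t)\<close> into
      \<open>exp t\<close>, \<open>d9 = 1 / a\<close> turns \<open>A\<close> into \<open>1\<close>,
      and the equal value of \<open>d7\<close> leaves \<open>h\<close> unchanged.\<close>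
    then obtain E' where "affine_image m 1 0 (1 / a) (1 / a) E E'"
      using affine_change[OF E False, of 1 "1 / a" "1 / a" 0] by auto
    note E' = affine_imageD[OF this]
    interpret E': eqn E' by (rule eqnI[OF E'(1)])
    have h': "ch E' x = ch E x" "cf E' x = m / a * cf E x" if "x \<in> xdom E" for x
      using E'(6,7)[OF that] a by simp_all
    have X: "xdom E' = xdom E" using E'(4) by simp
    have "cf E' x = - ch E' x * deriv (deriv (\<lambda>y. inverse (ch E' y))) x" if x: "x \<in> xdom E" for x
    proof -
      have "((\<lambda>y. inverse (ch E' y)) has_real_derivative deriv K y) (at y)" if "y \<in> xdom E" for y
        by (rule has_field_derivative_transform_within_open[OF DK(1)[OF that] open_domains(2) that]) (simp add: h' K_def)
      then have "deriv (deriv (\<lambda>y. inverse (ch E' y))) x = deriv (deriv K) x"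
        by (rule deriv_deriv_open[OF open_domains(2) _ DK(2)[OF x] x])
      then show ?thesis using h'[OF x] hK[OF x] K2[OF x] by simp
    qed
    moreover have "\<exists>u\<in>udom E. deriv (cB E') u \<noteq> 0"
    proof (rule ccontr)
      assume "\<not> ?thesis"
      then have "(cB E' has_real_derivative 0) (at u)" if "u \<in> udom E'" for u
        using smooth_on_line_DERIV[OF E'.smooth_coeffs(4) that] that E'(5) by auto
      from open_interval_constant[OF E'.domains(3) this]
      obtain k where "\<And>u. u \<in> udom E ==> cB E' u = k" using E'(5) by auto
      then have "\<And>u. u \<in> udom E ==> cB E u = a * k" using E'(9) a by (simp add: field_simps)
      then show False using B by blast
    qed
    moreover have "cA E' u = 1" if "u \<in> udom E" for u using E'(8)[OF that] A a that by simp
    ultimately have "listed_equation Item2 E'"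
      using E'(1,5) h' hnz X by (simp add: listed_equation_def)
    then show ?thesis using E'(2) by (intro exI[of _ Item2]) auto
  qed
  ultimately show ?thesis by blast
qed

section \<open>Equations with B = 1\<close>

text \<open>If \<open>B = 1\<close> and \<open>A\<close> is not constant, then all characteristics are of the form \<open>p(t) x + q(t)\<close>.\<close>

definition affine_char :: "equation => (real => real) => (real => real) => (real => real) => (real => real) => bool" where
  "affine_char E p q p' q' \<longleftrightarrow> (\<forall>t\<in>tdom E.
     (p has_real_derivative p' t) (at t) \<and> (q has_real_derivative q' t) (at t) \<and>
     (\<forall>x\<in>xdom E. cf E x * (p' t * x + q' t) = deriv (ch E) x * (p t * x + q t) + ch E x * p t))"

lemma affine_charD:
  assumes "affine_char E p q p' q'" "t \<in> tdom E"
  shows "(p has_real_derivative p' t) (at t)" "(q has_real_derivative q' t) (at t)"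
    "x \<in> xdom E ==> cf E x * (p' t * x + q' t) = deriv (ch E) x * (p t * x + q t) + ch E x * p t"
  using assms unfolding affine_char_def by blast+

text \<open>The two points of \<open>udom\<close> witness that \<open>A\<close> is not constant; the
  two points of \<open>xdom\<close> serve to read off the coefficients of affine functions.\<close>

locale eqn1 = eqn +
  fixes u1 u2 x0 x1
  assumes B1: "\<And>u. u \<in> udom E ==> cB E u = 1"
    and u12: "u1 \<in> udom E" "u2 \<in> udom E" "cA E u1 \<noteq> cA E u2"
    and x01: "x0 \<in> xdom E" "x1 \<in> xdom E" "x0 \<noteq> x1"
begin

text \<open>Subtracting the equations for two different values of \<open>A\<close> leaves
  \<open>l_xx = 0\<close>.\<close>

lemma char_affine:
  assumes "char_solution E l"
  shows "\<exists>p q p' q'. affine_char E p q p' q' \<and> (\<forall>t\<in>tdom E. \<forall>x\<in>xdom E. l t x = p t * x + q t)"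
proof -
  obtain lt lx lxx where data: "char_data E l lt lx lxx" using assms unfolding char_solution_def by blast
  note D = char_dataD[OF data]
  have lxx: "lxx t x = 0" and e: "cf E x * lt t x = deriv (ch E) x * l t x + ch E x * lx t x"
    if t: "t \<in> tdom E" and x: "x \<in> xdom E" for t x
  proof -
    have e: "cf E x * lt t x + cA E u * lxx t x - (deriv (ch E) x * l t x + ch E x * lx t x) = 0"
      if "u \<in> udom E" for u
      using D(5)[OF t x that] B1[OF that] by simp
    have "cA E u1 * lxx t x = cA E u2 * lxx t x"
      using e[OF u12(1)] e[OF u12(2)] by linarith
    then show "lxx t x = 0" using u12(3) by simp
    then show "cf E x * lt t x = deriv (ch E) x * l t x + ch E x * lx t x" using e[OF u12(1)] by simp
  qed
  \<comment> \<open>Interpolation between \<open>x0\<close> and \<open>x1\<close> instead of the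
    \<open>x\<close>-derivative, so that \<open>p\<close> and \<open>q\<close> inherit
    differentiability in \<open>t\<close> from \<open>l\<close>.\<close>
  define p where "p t = (l t x1 - l t x0) / (x1 - x0)" for t
  define q where "q t = l t x0 - p t * x0" for t
  define p' where "p' t = (lt t x1 - lt t x0) / (x1 - x0)" for t
  define q' where "q' t = lt t x0 - p' t * x0" for t
  have p: "(p has_real_derivative p' t) (at t)" if "t \<in> tdom E" for t
    unfolding p_def[abs_def] p'_def by (intro DERIV_cdivide DERIV_diff D(2) that x01)
  have q: "(q has_real_derivative q' t) (at t)" if "t \<in> tdom E" for t
    unfolding q_def[abs_def] q'_def by (intro DERIV_diff D(2) that x01 DERIV_cmult_right p)
  have lpq: "l t x = p t * x + q t" and lxp: "lx t x = p t" if t: "t \<in> tdom E" and x: "x \<in> xdom E" for t x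
  proof -
    have "(lx t has_real_derivative 0) (at x)" if "x \<in> xdom E" for x using D(4)[OF t that] lxx[OF t that] by simp
    from open_interval_affine[OF domains(2) D(3)[OF t] this]
    obtain k m where m: "\<And>x. x \<in> xdom E ==> l t x = k * x + m" and k: "\<And>x. x \<in> xdom E ==> lx t x = k" by blast
    have "p t = k" using m[OF x01(1)] m[OF x01(2)] x01(3) by (simp add: p_def right_diff_distrib[symmetric])
    then show "lx t x = p t" "l t x = p t * x + q t"
      using k[OF x] m[OF x] m[OF x01(1)] by (simp_all add: q_def)
  qed
  have ltp: "lt t x = p' t * x + q' t" if t: "t \<in> tdom E" and x: "x \<in> xdom E" for t x
    by (rule DERIV_unique_open[OF open_domains(1) t lpq[OF _ x] D(2)[OF t x]])
      (auto intro!: DERIV_add DERIV_cmult_right p q t)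
  have "affine_char E p q p' q'"
    unfolding affine_char_def using p q e by (simp add: lpq lxp ltp)
  then show ?thesis using lpq by blast
qed

lemma affine_char_solution:
  assumes c: "affine_char E p q p' q'" and "continuous_on (tdom E) p'" "continuous_on (tdom E) q'"
  shows "char_solution E (\<lambda>t x. p t * x + q t)"
proof (rule char_solutionI)
  note D = affine_charD[OF c]
  have "continuous_on (tdom E) p" "continuous_on (tdom E) q"
    by (rule DERIV_continuous_on[OF has_field_derivative_at_within[OF D(1)]],
        assumption, rule DERIV_continuous_on[OF has_field_derivative_at_within[OF D(2)]])
  note cont = this assms(2,3)
  have c2: "continuous_on (tdom E \<times> xdom E) (\<lambda>z. g (fst z))" if "continuous_on (tdom E) g" for g :: "real => real"
    by (rule continuous_on_compose2[OF that]) (auto intro: continuous_intros)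
  show "continuous_on (tdom E \<times> xdom E) (\<lambda>z. g (fst z) (snd z))"
    if "g \<in> {\<lambda>t x. p t * x + q t, \<lambda>t x. p' t * x + q' t, \<lambda>t x. p t, \<lambda>t x. 0}" for g
    using that by (auto intro!: continuous_intros c2 cont)
  fix t x assume t: "t \<in> tdom E" and x: "x \<in> xdom E"
  show "((\<lambda>s. p s * x + q s) has_real_derivative p' t * x + q' t) (at t)"
    by (intro DERIV_add DERIV_cmult_right D t)
  show "((\<lambda>x. p t * x + q t) has_real_derivative p t) (at x)" by (auto intro!: derivative_eq_intros)
  show "((\<lambda>x. p t) has_real_derivative 0) (at x)" by simp
  show "cf E x * (p' t * x + q' t) + cA E u * 0 - cB E u * (deriv (ch E) x * (p t * x + q t) + ch E x * p t) = 0"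
    if "u \<in> udom E" for u
    using D(3)[OF t x] B1[OF that] by simp
qed

text \<open>Divided by \<open>f\<close>, the identity for characteristics reads
  \<open>p' x + q' = r(x) p + s(x) q\<close>, and its values at two points determine
  \<open>p'\<close> and \<open>q'\<close>. The coefficients belong to the equation and do not
  involve \<open>t\<close>, which yields both uniqueness and invariance under differentiation in
  \<open>t\<close>.\<close>

lemma affine_char_system:
  obtains m1 m2 m3 m4 where "\<And>p q p' q' t. affine_char E p q p' q' ==> t \<in> tdom E ==>
      p' t = m1 * p t + m3 * q t \<and> q' t = m2 * p t + m4 * q t"
proof -
  define r where "r x = (deriv (ch E) x * x + ch E x) / cf E x" for x
  define s where "s x = deriv (ch E) x / cf E x" for x
  define d where "d = x1 - x0"
  have d: "d \<noteq> 0" using x01 by (simp add: d_def)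
  show ?thesis
  proof (rule that[of "(r x1 - r x0) / d" "(s x1 - s x0) / d" "r x0 - x0 * ((r x1 - r x0) / d)"
        "s x0 - x0 * ((s x1 - s x0) / d)"])
    fix p q p' q' t assume c: "affine_char E p q p' q'" and t: "t \<in> tdom E"
    have e: "p' t * x + q' t = r x * p t + s x * q t" if "x \<in> xdom E" for x
    proof -
      have "p' t * x + q' t = (deriv (ch E) x * (p t * x + q t) + ch E x * p t) / cf E x"
        using affine_charD(3)[OF c t that] f_nz[OF that] by (simp add: field_simps)
      also have "\<dots> = r x * p t + s x * q t" using f_nz[OF that] by (simp add: r_def s_def field_simps)
      finally show ?thesis .
    qed
    have "p' t * d = (r x1 * p t + s x1 * q t) - (r x0 * p t + s x0 * q t)"
      using e[OF x01(1)] e[OF x01(2)] by (simp add: d_def algebra_simps)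
    then have "p' t = ((r x1 * p t + s x1 * q t) - (r x0 * p t + s x0 * q t)) / d"
      using d by (simp add: eq_divide_eq)
    then have P: "p' t = (r x1 - r x0) / d * p t + (s x1 - s x0) / d * q t"
      by (simp add: divide_inverse algebra_simps)
    have "q' t = r x0 * p t + s x0 * q t - p' t * x0" using e[OF x01(1)] by simp
    then have "q' t = (r x0 - x0 * ((r x1 - r x0) / d)) * p t + (s x0 - x0 * ((s x1 - s x0) / d)) * q t"
      unfolding P by (simp add: algebra_simps)
    then show "p' t = (r x1 - r x0) / d * p t + (s x1 - s x0) / d * q t \<and>
      q' t = (r x0 - x0 * ((r x1 - r x0) / d)) * p t + (s x0 - x0 * ((s x1 - s x0) / d)) * q t"
      using P by blast
  qed
qed

lemma affine_zero:
  assumes c: "affine_char E p q p' q'" and t0: "t0 \<in> tdom E" "p t0 = 0" "q t0 = 0" and t: "t \<in> tdom E"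
  shows "p t = 0 \<and> q t = 0"
proof -
  obtain m1 m2 m3 m4 where m: "\<And>p q p' q' t. affine_char E p q p' q' ==> t \<in> tdom E ==>
      p' t = m1 * p t + m3 * q t \<and> q' t = m2 * p t + m4 * q t" by (rule affine_char_system) blast
  show ?thesis
    by (rule linear_ode_zero[where p=p and q=q, OF domains(1) _ _ t0 t, where ?m1.0=m1 and ?m2.0=m2 and ?m3.0=m3 and ?m4.0=m4])
      (use affine_charD[OF c] m[OF c] in auto)
qed

lemma affine_char_lincomb:
  assumes "affine_char E p q p' q'" "affine_char E P Q P' Q'"
  shows "affine_char E (\<lambda>t. a * p t + b * P t) (\<lambda>t. a * q t + b * Q t)
    (\<lambda>t. a * p' t + b * P' t) (\<lambda>t. a * q' t + b * Q' t)"
  unfolding affine_char_def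
proof (intro ballI conjI)
  fix t assume t: "t \<in> tdom E"
  show "((\<lambda>t. a * p t + b * P t) has_real_derivative a * p' t + b * P' t) (at t)"
    "((\<lambda>t. a * q t + b * Q t) has_real_derivative a * q' t + b * Q' t) (at t)"
    by (intro DERIV_add DERIV_cmult affine_charD[OF assms(1) t] affine_charD[OF assms(2) t])+
  fix x assume x: "x \<in> xdom E"
  have "cf E x * ((a * p' t + b * P' t) * x + (a * q' t + b * Q' t)) =
      a * (cf E x * (p' t * x + q' t)) + b * (cf E x * (P' t * x + Q' t))" by (simp add: algebra_simps)
  then show "cf E x * ((a * p' t + b * P' t) * x + (a * q' t + b * Q' t)) =
      deriv (ch E) x * ((a * p t + b * P t) * x + (a * q t + b * Q t)) + ch E x * (a * p t + b * P t)"
    unfolding affine_charD(3)[OF assms(1) t x] affine_charD(3)[OF assms(2) t x] by (simp add: algebra_simps)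
qed

lemma affine_lincomb_zero:
  assumes "affine_char E p q p' q'" "affine_char E P Q P' Q'"
    and "t0 \<in> tdom E" "a * p t0 + b * P t0 = 0" "a * q t0 + b * Q t0 = 0" "t \<in> tdom E"
  shows "a * p t + b * P t = 0 \<and> a * q t + b * Q t = 0"
  by (rule affine_zero[OF affine_char_lincomb[OF assms(1,2)] assms(3-6)])

text \<open>A linear relation at one time propagates to all times by uniqueness for the system, so
  independent characteristics have independent pairs \<open>(p, q)\<close> at every time.\<close>

lemma det_nonzero:
  assumes c: "affine_char E p q p' q'" "affine_char E P Q P' Q'"
    and ind: "\<And>a b. (\<And>t x. t \<in> tdom E ==> x \<in> xdom E ==> a * (p t * x + q t) + b * (P t * x + Q t) = 0) ==> a = 0 \<and> b = 0"
    and t: "t0 \<in> tdom E"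
  shows "p t0 * Q t0 - P t0 * q t0 \<noteq> 0"
proof
  assume det: "p t0 * Q t0 - P t0 * q t0 = 0"
  have *: "a = 0 \<and> b = 0" if "a * p t0 + b * P t0 = 0" "a * q t0 + b * Q t0 = 0" for a b
  proof (rule ind)
    fix t x assume "t \<in> tdom E"
    from affine_lincomb_zero[OF c t that this]
    have "(a * p t + b * P t) * x + (a * q t + b * Q t) = 0" by simp
    then show "a * (p t * x + q t) + b * (P t * x + Q t) = 0" by (simp add: algebra_simps)
  qed
  have "P t0 = 0 \<and> - p t0 = 0" "Q t0 = 0 \<and> - q t0 = 0"
    by (rule *; use det in \<open>simp add: algebra_simps\<close>)+
  then have "(1::real) = 0 \<and> (1::real) = 0" by (intro *) auto
  then show False by simp
qed

text \<open>Cramer's rule produces the coefficients at one time, and uniqueness for the system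
  extends the relation to all times.\<close>

lemma char_span:
  assumes l: "char_solution E l1" "char_solution E l2" "char_solution E l"
    and ind: "\<And>a b. (\<And>t x. t \<in> tdom E ==> x \<in> xdom E ==> a * l1 t x + b * l2 t x = 0) ==> a = 0 \<and> b = 0"
  shows "\<exists>a b. \<forall>t\<in>tdom E. \<forall>x\<in>xdom E. l t x = a * l1 t x + b * l2 t x"
proof -
  obtain p q p' q' where 1: "affine_char E p q p' q'" "\<And>t x. t \<in> tdom E ==> x \<in> xdom E ==> l1 t x = p t * x + q t"
    using char_affine[OF l(1)] by blast
  obtain P Q P' Q' where 2: "affine_char E P Q P' Q'" "\<And>t x. t \<in> tdom E ==> x \<in> xdom E ==> l2 t x = P t * x + Q t"
    using char_affine[OF l(2)] by blast
  obtain r s r' s' where 3: "affine_char E r s r' s'" "\<And>t x. t \<in> tdom E ==> x \<in> xdom E ==> l t x = r t * x + s t"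
    using char_affine[OF l(3)] by blast
  obtain t0 where t0: "t0 \<in> tdom E" using sec_point by blast
  let ?d = "p t0 * Q t0 - P t0 * q t0"
  have d: "?d \<noteq> 0" by (rule det_nonzero[OF 1(1) 2(1) ind t0]) (simp add: 1(2) 2(2))
  define a where "a = (r t0 * Q t0 - P t0 * s t0) / ?d"
  define b where "b = (p t0 * s t0 - r t0 * q t0) / ?d"
  have ab: "?d * a = r t0 * Q t0 - P t0 * s t0" "?d * b = p t0 * s t0 - r t0 * q t0"
    using d by (simp_all add: a_def b_def)
  have "?d * (a * p t0 + b * P t0 - r t0) = (?d * a) * p t0 + (?d * b) * P t0 - ?d * r t0"
    "?d * (a * q t0 + b * Q t0 - s t0) = (?d * a) * q t0 + (?d * b) * Q t0 - ?d * s t0"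
    by (simp_all add: algebra_simps)
  then have "?d * (a * p t0 + b * P t0 - r t0) = 0" "?d * (a * q t0 + b * Q t0 - s t0) = 0"
    unfolding ab by (simp_all add: algebra_simps)
  then have z: "1 * (a * p t0 + b * P t0) + -1 * r t0 = 0" "1 * (a * q t0 + b * Q t0) + -1 * s t0 = 0"
    using d by simp_all
  have "l t x = a * l1 t x + b * l2 t x" if t: "t \<in> tdom E" and x: "x \<in> xdom E" for t x
  proof -
    have "1 * (a * p t + b * P t) + -1 * r t = 0 \<and> 1 * (a * q t + b * Q t) + -1 * s t = 0"
      by (rule affine_lincomb_zero[OF affine_char_lincomb[OF 1(1) 2(1)] 3(1) t0 z t])
    then have r: "r t = a * p t + b * P t" and s: "s t = a * q t + b * Q t" by auto
    show ?thesis unfolding 1(2)[OF t x] 2(2)[OF t x] 3(2)[OF t x] r s by (simp add: algebra_simps)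
  qed
  then show ?thesis by blast
qed

text \<open>The identity for characteristics is linear in \<open>(p, q)\<close>. Two independent
  pairs at one time make it hold coefficient by coefficient: \<open>h_x\<close> and
  \<open>(x h)_x\<close> are both \<open>f\<close> times polynomials of degree at most one.
  Eliminating \<open>h_x\<close> gives \<open>h\<close>.\<close>

lemma quadratic_of_two:
  assumes two: "two_char_solutions E" and h: "x \<in> xdom E" "ch E x \<noteq> 0"
  shows "\<exists>a b c n. quadratic E a b c n \<and> (a, b, c) \<noteq> (0, 0, 0)"
proof -
  obtain l1 l2 where l: "char_solution E l1" "char_solution E l2"
    "\<And>a b. (\<forall>t\<in>tdom E. \<forall>x\<in>xdom E. a * l1 t x + b * l2 t x = 0) ==> a = 0 \<and> b = 0"
    using two unfolding two_char_solutions_def by blast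
  obtain p q p' q' where 1: "affine_char E p q p' q'" "\<And>t x. t \<in> tdom E ==> x \<in> xdom E ==> l1 t x = p t * x + q t"
    using char_affine[OF l(1)] by blast
  obtain P Q P' Q' where 2: "affine_char E P Q P' Q'" "\<And>t x. t \<in> tdom E ==> x \<in> xdom E ==> l2 t x = P t * x + Q t"
    using char_affine[OF l(2)] by blast
  obtain t where t: "t \<in> tdom E" using sec_point by blast
  have d: "p t * Q t - P t * q t \<noteq> 0"
    by (rule det_nonzero[OF 1(1) 2(1) _ t], rule l(3)) (simp add: 1(2) 2(2))
  obtain m1 m2 m3 m4 where m: "\<And>p q p' q' t. affine_char E p q p' q' ==> t \<in> tdom E ==>
      p' t = m1 * p t + m3 * q t \<and> q' t = m2 * p t + m4 * q t" by (rule affine_char_system) blast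
  have hx: "deriv (ch E) x = cf E x * (m3 * x + m4) \<and> deriv (ch E) x * x + ch E x = cf E x * (m1 * x + m2)"
    if x: "x \<in> xdom E" for x
  proof -
    define X where "X = cf E x * (m1 * x + m2) - (deriv (ch E) x * x + ch E x)"
    define Y where "Y = cf E x * (m3 * x + m4) - deriv (ch E) x"
    have e: "X * p t + Y * q t = 0" if c: "affine_char E p q p' q'" for p q p' q'
      using affine_charD(3)[OF c t x] m[OF c t] unfolding X_def Y_def by (simp add: algebra_simps)
    have "X * (p t * Q t - P t * q t) = (X * p t + Y * q t) * Q t - (X * P t + Y * Q t) * q t"
      "Y * (p t * Q t - P t * q t) = (X * P t + Y * Q t) * p t - (X * p t + Y * q t) * P t"
      by (simp_all add: algebra_simps)
    then have "X * (p t * Q t - P t * q t) = 0" "Y * (p t * Q t - P t * q t) = 0"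
      unfolding e[OF 1(1)] e[OF 2(1)] by simp_all
    then have "X = 0" "Y = 0" using d by simp_all
    then show ?thesis by (simp add: X_def Y_def)
  qed
  have H: "ch E x = cf E x * (- m3 * x\<^sup>2 + (m1 - m4) * x + m2)" if "x \<in> xdom E" for x
  proof -
    have "ch E x = cf E x * (m1 * x + m2) - cf E x * (m3 * x + m4) * x"
      using conjunct2[OF hx[OF that]] unfolding conjunct1[OF hx[OF that]] by linarith
    then show ?thesis by (simp add: algebra_simps power2_eq_square)
  qed
  have "quadratic E (- m3) (m1 - m4) m2 m4"
    unfolding quadratic_def using is_eq B1 H hx by (simp add: algebra_simps)
  moreover have "(- m3, m1 - m4, m2) \<noteq> (0, 0, 0)" using H[OF h(1)] h(2) by auto
  ultimately show ?thesis by blast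
qed

text \<open>The equation for characteristics does not contain \<open>t\<close>, so it can be
  differentiated in \<open>t\<close>.\<close>

lemma affine_char_dt:
  assumes c: "affine_char E p q p' q'"
  shows "\<exists>p'' q''. affine_char E p' q' p'' q'' \<and> continuous_on (tdom E) p'' \<and> continuous_on (tdom E) q''"
proof -
  obtain m1 m2 m3 m4 where m: "\<And>p q p' q' t. affine_char E p q p' q' ==> t \<in> tdom E ==>
      p' t = m1 * p t + m3 * q t \<and> q' t = m2 * p t + m4 * q t" by (rule affine_char_system) blast
  note D = affine_charD[OF c]
  have p': "(p' has_real_derivative m1 * p' t + m3 * q' t) (at t)" if t: "t \<in> tdom E" for t
    by (rule has_field_derivative_transform_within_open[OF _ open_domains(1) t, of "\<lambda>t. m1 * p t + m3 * q t"])
      (use m[OF c] in \<open>auto intro!: DERIV_add DERIV_cmult D t\<close>)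
  have q': "(q' has_real_derivative m2 * p' t + m4 * q' t) (at t)" if t: "t \<in> tdom E" for t
    by (rule has_field_derivative_transform_within_open[OF _ open_domains(1) t, of "\<lambda>t. m2 * p t + m4 * q t"])
      (use m[OF c] in \<open>auto intro!: DERIV_add DERIV_cmult D t\<close>)
  have cont: "continuous_on (tdom E) p'" "continuous_on (tdom E) q'"
    by (rule DERIV_continuous_on[OF has_field_derivative_at_within[OF p']],
        assumption, rule DERIV_continuous_on[OF has_field_derivative_at_within[OF q']])
  have "cf E x * ((m1 * p' t + m3 * q' t) * x + (m2 * p' t + m4 * q' t)) =
      deriv (ch E) x * (p' t * x + q' t) + ch E x * p' t" if t: "t \<in> tdom E" and x: "x \<in> xdom E" for t x
    by (rule DERIV_unique_open[OF open_domains(1) t D(3)[OF _ x]])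
      (auto intro!: DERIV_add DERIV_cmult DERIV_cmult_right D t p' q')
  then have "affine_char E p' q' (\<lambda>t. m1 * p' t + m3 * q' t) (\<lambda>t. m2 * p' t + m4 * q' t)"
    unfolding affine_char_def using p' q' by blast
  then show ?thesis by (intro exI conjI) (assumption, auto intro!: continuous_intros cont)
qed

text \<open>As \<open>l_t\<close> is a characteristic too, it is a multiple \<open>m l\<close>, and
  \<open>l\<close> is proportional to \<open>exp (m t) (P x + Q)\<close>. For \<open>m = 0\<close>
  this leads to \<open>Item1\<close>; otherwise \<open>t\<close> is scaled by \<open>m\<close>, and
  the result is \<open>Item3\<close> if \<open>P = 0\<close> and \<open>Item4\<close> after shifting
  \<open>x\<close> by \<open>Q / P\<close> if not.\<close>

lemma one_char_solution:
  assumes l: "char_solution E l" and nz: "t0 \<in> tdom E" "y0 \<in> xdom E" "l t0 y0 \<noteq> 0"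
    and one: "\<not> two_char_solutions E" and h: "x \<in> xdom E" "ch E x \<noteq> 0"
  shows "\<exists>i E'. grade i = 1 \<and> listed_equation i E' \<and> maps_to E E'"
proof -
  obtain p q p' q' where 1: "affine_char E p q p' q'" "\<And>t x. t \<in> tdom E ==> x \<in> xdom E ==> l t x = p t * x + q t"
    using char_affine[OF l(1)] by blast
  obtain p'' q'' where 2: "affine_char E p' q' p'' q''" "continuous_on (tdom E) p''" "continuous_on (tdom E) q''"
    using affine_char_dt[OF 1(1)] by blast
  have l2: "char_solution E (\<lambda>t x. p' t * x + q' t)" by (rule affine_char_solution[OF 2])
  obtain a b where ab: "\<And>t x. t \<in> tdom E ==> x \<in> xdom E ==> a * l t x + b * (p' t * x + q' t) = 0" "a \<noteq> 0 \<or> b \<noteq> 0"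
    using one l l2 unfolding two_char_solutions_def by blast
  have b: "b \<noteq> 0" using ab(1)[OF nz(1,2)] ab(2) nz(3) by auto
  define m where "m = - a / b"
  define P where "P = p t0"
  define Q where "Q = q t0"
  have lt: "p' t0 * x + q' t0 = m * (P * x + Q)" if "x \<in> xdom E" for x
    using ab(1)[OF nz(1) that] 1(2)[OF nz(1) that] b unfolding m_def P_def Q_def by (simp add: field_simps add_eq_0_iff)
  have eq: "cf E x * (m * (P * x + Q)) = deriv (ch E) x * (P * x + Q) + ch E x * P" if "x \<in> xdom E" for x
    using affine_charD(3)[OF 1(1) nz(1) that] lt[OF that] by (simp add: P_def Q_def)
  have PQ: "P \<noteq> 0 \<or> Q \<noteq> 0" using 1(2)[OF nz(1,2)] nz(3) by (auto simp: P_def Q_def)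
  show ?thesis
  proof (cases "m = 0")
    case True
    have "\<exists>k. \<forall>x\<in>xdom E. ch E x * (P * x + Q) = k"
    proof (rule open_interval_constant[OF domains(2)])
      fix x assume x: "x \<in> xdom E"
      show "((\<lambda>x. ch E x * (P * x + Q)) has_real_derivative 0) (at x)"
        by (rule DERIV_cong[OF DERIV_mult'[OF smooth_on_line_DERIV[OF smooth_coeffs(2) x], of "\<lambda>x. P * x + Q" P]])
          (use eq[OF x] True in \<open>auto intro!: derivative_eq_intros simp: algebra_simps\<close>)
    qed
    then obtain k where k: "\<And>x. x \<in> xdom E ==> ch E x * (P * x + Q) = k" by blast
    \<comment> \<open>For \<open>k = 0\<close> the polynomial \<open>P x + Q\<close> would vanish on
      the nonempty open set where \<open>h\<close> does not.\<close>
    have k0: "k \<noteq> 0"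
    proof
      assume k0: "k = 0"
      have z: "P * y + Q = 0" if "y \<in> {x \<in> xdom E. ch E x \<noteq> 0}" for y using k[of y] that k0 by simp
      have "P = 0"
        by (rule DERIV_unique_open[where f="\<lambda>y. P * y + Q" and g="\<lambda>y. 0" and x=x, OF open_h_nonzero _ z]) (use h in \<open>auto intro!: derivative_eq_intros\<close>)
      then show False using z[of x] h PQ by simp
    qed
    have nz: "P * x + Q \<noteq> 0" if x: "x \<in> xdom E" for x using k[OF x] k0 by (metis mult_zero_right)
    have "ch E x = k / (P * x + Q)" if x: "x \<in> xdom E" for x
      using k[OF x] nz[OF x] by (simp add: eq_divide_eq)
    from to_item1[OF is_eq k0 nz this] show ?thesis by (metis grade.simps(1))
  next
    case False
    obtain E' where m: "affine_image m 1 (if P = 0 then 0 else Q / P) 1 1 E E'"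
      using affine_change[OF is_eq False, of 1 1 1] by auto
    note E' = affine_imageD[OF m]
    have f': "cf E' (x + (if P = 0 then 0 else Q / P)) = m * cf E x"
      "ch E' (x + (if P = 0 then 0 else Q / P)) = ch E x"
      "deriv (ch E') (x + (if P = 0 then 0 else Q / P)) = deriv (ch E) x" if "x \<in> xdom E" for x
      using E'(6,7)[OF that] affine_image_deriv[OF is_eq m that] by simp_all
    have X: "xdom E' = (\<lambda>x. x + (if P = 0 then 0 else Q / P)) ` xdom E" using E'(4) by simp
    show ?thesis
    proof (cases "P = 0")
      case True
      then have "m * cf E x = deriv (ch E) x" if "x \<in> xdom E" for x
        using eq[OF that] PQ by (simp add: mult.commute)
      then have "listed_equation Item3 E'"
        using E'(1,5,9) B1 f' X True by (auto simp: listed_equation_def)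
      then show ?thesis using E'(2) by (intro exI[of _ Item3]) auto
    next
      case False
      have "m * cf E x = deriv (ch E) x + ch E x / (x + Q / P)" if "x \<in> xdom E" "x + Q / P \<noteq> 0" for x
      proof -
        have "P * x + Q = P * (x + Q / P)" using False by (simp add: field_simps)
        with eq[OF that(1)] have "P * (cf E x * m * (x + Q / P)) = P * (deriv (ch E) x * (x + Q / P) + ch E x)"
          by (simp add: algebra_simps)
        then have "cf E x * m * (x + Q / P) = deriv (ch E) x * (x + Q / P) + ch E x" using False by simp
        then have "cf E x * m = (deriv (ch E) x * (x + Q / P) + ch E x) / (x + Q / P)"
          using that(2) by (simp add: eq_divide_eq)
        then show ?thesis using that(2) by (simp add: add_divide_distrib mult.commute)
      qed
      then have "listed_equation Item4 E'"
        using E'(1,5,9) B1 f' X False by (auto simp: listed_equation_def)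
      then show ?thesis using E'(2) by (intro exI[of _ Item4]) auto
    qed
  qed
qed

end

section \<open>Case distinction by the linear relations between 1, A and B\<close>

lemma eqn1I:
  assumes E: "is_equation E" and B: "\<And>u. u \<in> udom E ==> cB E u = 1" and A: "\<nexists>a. \<forall>u\<in>udom E. cA E u = a"
  shows "\<exists>u1 u2 x0 x1. eqn1 E u1 u2 x0 x1"
proof -
  interpret eqn E by (rule eqnI[OF E])
  obtain x0 x1 where x: "x0 \<in> xdom E" "x1 \<in> xdom E" "x0 \<noteq> x1" by (rule open_interval_two_points[OF domains(2)])
  obtain u1 u2 where "u1 \<in> udom E" "u2 \<in> udom E" "cA E u1 \<noteq> cA E u2" using A by blast
  then have "eqn1 E u1 u2 x0 x1" by unfold_locales (use E B x in auto)
  then show ?thesis by blast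
qed

text \<open>The second alternative records that there are no two independent characteristics; this
  later excludes an equivalence with an item of grade two.\<close>

definition covered :: "equation => bool" where
  "covered E \<longleftrightarrow> (\<exists>i E'. grade i = 2 \<and> listed_equation i E' \<and> equivalent E E') \<or>
     (\<not> two_char_solutions E \<and> (\<exists>i E'. grade i = 1 \<and> listed_equation i E' \<and> equivalent E E'))"

lemma covered_two: "listed_equation i E' ==> grade i = 2 ==> equivalent E E' ==> covered E"
  unfolding covered_def by blast

lemma covered_one:
  "listed_equation i E' ==> grade i = 1 ==> equivalent E E' ==> \<not> two_char_solutions E ==> covered E"
  unfolding covered_def by blast

text \<open>The equation for \<open>l\<close> is a relation between \<open>1\<close>,
  \<open>A\<close> and \<open>B\<close> as functions of \<open>u\<close>. If \<open>h B = 0\<close>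
  or \<open>B\<close> is a multiple of \<open>A\<close>, then \<open>B\<close> can be removed.
  Otherwise, constant \<open>A\<close> and \<open>1\<close> outside the span of \<open>A\<close> and
  \<open>B\<close> both lead to \<open>hl_case\<close>, and a relation
  \<open>\<alpha> A + \<beta> B = 1\<close> is transformed into \<open>B = 1\<close>.\<close>

lemma classification:
  assumes E: "is_equation E" and nl: "\<not> linearizable E"
    and l: "char_solution E l" and nz: "t0 \<in> tdom E" "x0 \<in> xdom E" "l t0 x0 \<noteq> 0"
  shows "covered E"
proof -
  interpret eqn E by (rule eqnI[OF E])
  obtain u0 where u0: "u0 \<in> udom E" using sec_point by blast
  consider (zero) "\<forall>x\<in>xdom E. \<forall>u\<in>udom E. ch E x * cB E u = 0"
    | (dependent) c where "\<And>u. u \<in> udom E ==> cB E u = c * cA E u"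
    | (general) x1 where "x1 \<in> xdom E" "ch E x1 \<noteq> 0" "\<And>c. \<exists>u\<in>udom E. cB E u \<noteq> c * cA E u"
    by force
  then show ?thesis
  proof cases
    case zero
    then obtain E1 where E1: "is_equation E1" "same_equation E E1" "\<forall>u. cB E1 u = 0"
      using same_equation_B_zero[OF E] by blast
    have "listed_equation Item5a E1" using E1 by (simp add: listed_equation_def)
    then show ?thesis
      by (rule covered_two) (simp, rule equivalent_via[OF E1(1) E1(1) E1(2) maps_to_refl[OF E1(1)]])
  next
    case dependent
    obtain E1 where E1: "is_equation E1" "maps_to E E1" "udom E1 = udom E"
      "\<forall>u\<in>udom E. cB E1 u = 1 * (cB E u + - c * cA E u)"
      using mixing_change[OF E, of 1 1 "- c"] by auto
    have "listed_equation Item5a E1" using E1 dependent by (simp add: listed_equation_def)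
    then show ?thesis by (rule covered_two) (simp, rule equivalentI[OF E E1(1,2)])
  next
    case general
    note x1 = general(1,2)
    note indep = general(3)
    have item: "covered E" if "\<not> two_char_solutions E \<and> (\<exists>i E'. grade i = 1 \<and> listed_equation i E' \<and> maps_to E E')"
      using that equivalentI[OF E] unfolding covered_def listed_equation_def by blast
    consider (const) a where "\<And>u. u \<in> udom E ==> cA E u = a"
      | (span) \<alpha> \<beta> where "\<nexists>a. \<forall>u\<in>udom E. cA E u = a" "\<And>u. u \<in> udom E ==> \<alpha> * cA E u + \<beta> * cB E u = 1"
      | (nospan) "\<And>\<alpha> \<beta>. \<exists>u\<in>udom E. \<alpha> * cA E u + \<beta> * cB E u \<noteq> 1"
      by force
    then show ?thesis
    proof cases
      case const
      have a: "a \<noteq> 0" using A_nz[OF u0] const[OF u0] by simp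
      have B: "\<nexists>b. \<forall>u\<in>udom E. cB E u = b"
      proof
        assume "\<exists>b. \<forall>u\<in>udom E. cB E u = b"
        then obtain b where "\<And>u. u \<in> udom E ==> cB E u = b" by blast
        then have "\<forall>u\<in>udom E. cB E u = b / a * cA E u" using const a by simp
        then show False using indep[of "b / a"] by blast
      qed
      obtain u' where u': "u' \<in> udom E" "cB E u0 \<noteq> cB E u'" using B by metis
      have *: "cf E x * lt t x + a * lxx t x = 0 \<and> deriv (ch E) x * l t x + ch E x * lx t x = 0"
        if d: "char_data E l lt lx lxx" and t: "t \<in> tdom E" and x: "x \<in> xdom E" for l lt lx lxx t x
      proof -
        let ?w = "deriv (ch E) x * l t x + ch E x * lx t x"
        have e: "cf E x * lt t x + a * lxx t x = cB E u * ?w" if "u \<in> udom E" for u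
          using char_dataD(5)[OF d t x that] const[OF that] by simp
        have "cB E u0 * ?w = cB E u' * ?w" using e[OF u0] e[OF u'(1)] by linarith
        then have "?w = 0" using u'(2) by simp
        then show ?thesis using e[OF u0] by simp
      qed
      show ?thesis
        by (rule item, rule hl_case[where a=a and l=l, OF E a _ _ B x1 l nz], erule *, assumption+)
          (use const in blast)
    next
      case nospan
      have B: "\<nexists>b. \<forall>u\<in>udom E. cB E u = b"
      proof
        assume "\<exists>b. \<forall>u\<in>udom E. cB E u = b"
        then obtain b where b: "\<And>u. u \<in> udom E ==> cB E u = b" by blast
        show False
        proof (cases "b = 0")
          case True then show False using indep[of 0] b by auto
        next
          case False then show False using nospan[of 0 "1 / b"] b by auto
        qed
      qed
      \<comment> \<open>With \<open>1\<close>, \<open>A\<close>, \<open>B\<close> linearly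
        independent, all three coefficients vanish. The resulting \<open>l_t = 0\<close> is the
        second form of \<open>alt\<close> in \<open>hl_case\<close>, used below with the dummy
        \<open>a = 1\<close>.\<close>
      have z: "lt t x = 0 \<and> lxx t x = 0 \<and> deriv (ch E) x * l t x + ch E x * lx t x = 0"
        if d: "char_data E l lt lx lxx" and t: "t \<in> tdom E" and x: "x \<in> xdom E" for l lt lx lxx t x
      proof -
        let ?w = "deriv (ch E) x * l t x + ch E x * lx t x"
        have e: "cf E x * lt t x + cA E u * lxx t x - cB E u * ?w = 0" if "u \<in> udom E" for u
          by (rule char_dataD(5)[OF d t x that])
        have "lt t x = 0"
        proof (rule ccontr)
          assume "lt t x \<noteq> 0"
          then have n: "cf E x * lt t x \<noteq> 0" using f_nz[OF x] by simp
          have "- lxx t x / (cf E x * lt t x) * cA E u + ?w / (cf E x * lt t x) * cB E u = 1" if "u \<in> udom E" for u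
          proof -
            have "- lxx t x * cA E u + ?w * cB E u = cf E x * lt t x" using e[OF that] by (simp add: mult.commute)
            then have "(- lxx t x * cA E u + ?w * cB E u) / (cf E x * lt t x) = 1" using n by simp
            then show ?thesis by (simp only: times_divide_eq_left add_divide_distrib[symmetric])
          qed
          then show False using nospan[of "- lxx t x / (cf E x * lt t x)" "?w / (cf E x * lt t x)"] by blast
        qed
        moreover have w: "?w = 0"
        proof (rule ccontr)
          assume w: "?w \<noteq> 0"
          have "cB E u = lxx t x / ?w * cA E u" if "u \<in> udom E" for u
          proof -
            have "cB E u * ?w = lxx t x * cA E u" using e[OF that] \<open>lt t x = 0\<close> by (simp add: mult.commute)
            then show ?thesis using w by (simp add: eq_divide_eq)
          qed
          then show False using indep[of "lxx t x / ?w"] by blast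
        qed
        ultimately have "lt t x = 0" "?w = 0" "cA E u0 * lxx t x = 0" using e[OF u0] by simp_all
        then show ?thesis using A_nz[OF u0] by simp
      qed
      have "\<forall>l lt lx lxx. char_data E l lt lx lxx \<longrightarrow> (\<forall>t\<in>tdom E. \<forall>x\<in>xdom E. lt t x = 0)"
        using z by blast
      moreover have "cf E x * lt t x + 1 * lxx t x = 0 \<and> deriv (ch E) x * l t x + ch E x * lx t x = 0"
        if "char_data E l lt lx lxx" "t \<in> tdom E" "x \<in> xdom E" for l lt lx lxx t x
        using z[OF that] by simp
      ultimately show ?thesis
        by (intro item hl_case[where a=1 and l=l, OF E one_neq_zero _ _ B x1 l nz]) blast+
    next
      case span
      have \<beta>: "\<beta> \<noteq> 0"
      proof
        assume \<beta>: "\<beta> = 0"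
        then have a: "\<alpha> * cA E u = 1" if "u \<in> udom E" for u using span(2)[OF that] by simp
        have "\<alpha> \<noteq> 0" using a[OF u0] by auto
        then have "\<forall>u\<in>udom E. cA E u = 1 / \<alpha>" using a by (simp add: field_simps)
        then show False using span(1) by blast
      qed
      \<comment> \<open>\<open>d7 = \<beta>\<close> and \<open>d8 = \<alpha> / \<beta>\<close> make
        the new \<open>B\<close> equal to \<open>\<alpha> A + \<beta> B\<close>, that is
        \<open>1\<close>.\<close>
      obtain E1 where E1: "is_equation E1" "maps_to E E1" "udom E1 = udom E"
        "(\<forall>x\<in>xdom E1. ch E1 x = 0) \<longrightarrow> (\<forall>x\<in>xdom E. ch E x = 0)"
        "\<forall>u\<in>udom E. cA E1 u = 1 * cA E u \<and> cB E1 u = \<beta> * (cB E u + \<alpha> / \<beta> * cA E u)"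
        using mixing_change[OF E \<beta>, of 1 "\<alpha> / \<beta>"] by auto
      have eqv: "equivalent E E1" by (rule equivalentI[OF E E1(1,2)])
      have B1: "cB E1 u = 1" if "u \<in> udom E1" for u
      proof -
        have "cB E1 u = \<beta> * (cB E u + \<alpha> / \<beta> * cA E u)" using E1(3,5) that by simp
        also have "\<dots> = \<alpha> * cA E u + \<beta> * cB E u" using \<beta> by (simp add: field_simps)
        finally show ?thesis using span(2) E1(3) that by simp
      qed
      have A1: "\<nexists>a. \<forall>u\<in>udom E1. cA E1 u = a" using span(1) E1(3,5) by simp
      obtain u1 u2 y0 y1 where "eqn1 E1 u1 u2 y0 y1" using eqn1I[OF E1(1) B1 A1] by blast
      then interpret E1: eqn1 E1 u1 u2 y0 y1 .
      obtain y where y: "y \<in> xdom E1" "ch E1 y \<noteq> 0" using E1(4) x1 by blast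
      show ?thesis
      proof (cases "two_char_solutions E1")
        case True
        obtain a b c n where q: "quadratic E1 a b c n" "(a, b, c) \<noteq> (0, 0, 0)"
          using E1.quadratic_of_two[OF True y] by blast
        obtain i E2 where E2: "grade i = 2" "listed_equation i E2" "maps_to E1 E2"
          using quadratic_to_listed[OF q] by blast
        show ?thesis
          by (rule covered_two[OF E2(2,1)], rule equivalentI[OF E _ maps_to_trans[OF E E1(2) E2(3)]])
            (use E2(2) in \<open>simp add: listed_equation_def\<close>)
      next
        case False
        obtain d1 d2 \<phi> w where tr: "transfers d1 d2 \<phi> w E E1"
          using char_solution_equivalent[OF E E1(1) eqv] by blast
        obtain l1 where l1: "char_solution E1 l1"
          "\<And>t x. t \<in> tdom E ==> x \<in> xdom E ==> l1 (d1 * t + d2) (\<phi> x) = w x * l t x"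
          using transfersD(5)[OF tr l] by blast
        have n: "d1 * t0 + d2 \<in> tdom E1" "\<phi> x0 \<in> xdom E1" "l1 (d1 * t0 + d2) (\<phi> x0) \<noteq> 0"
          using transfersD(2-4)[OF tr] nz l1(2)[OF nz(1,2)] by auto
        obtain i E2 where E2: "grade i = 1" "listed_equation i E2" "maps_to E1 E2"
          using E1.one_char_solution[OF l1(1) n False y] by blast
        have "\<not> two_char_solutions E" using False two_char_solutions_equivalent[OF E E1(1) eqv] by blast
        then show ?thesis
          by (intro covered_one[OF E2(2,1)] equivalentI[OF E _ maps_to_trans[OF E E1(2) E2(3)]])
            (use E2(2) in \<open>simp_all add: listed_equation_def\<close>)
      qed
    qed
  qed
qed

section \<open>The listed conservation laws\<close>

text \<open>Linear combinations of \<open>p\<close> and \<open>q\<close> form a class closed under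
  differentiation.\<close>

lemma linear_system_smooth:
  fixes p q :: "real => real"
  assumes "open S" and p: "\<And>t. t \<in> S ==> (p has_real_derivative m1 * p t + m3 * q t) (at t)"
    and q: "\<And>t. t \<in> S ==> (q has_real_derivative m2 * p t + m4 * q t) (at t)"
  shows "smooth_on_line S p" "smooth_on_line S q"
proof -
  let ?C = "{g. \<exists>\<alpha> \<beta>. g = (\<lambda>t. \<alpha> * p t + \<beta> * q t)}"
  have step: "\<exists>g'\<in>?C. \<forall>x\<in>S. (g has_real_derivative g' x) (at x)" if g: "g \<in> ?C" for g
  proof -
    obtain \<alpha> \<beta> where g: "g = (\<lambda>t. \<alpha> * p t + \<beta> * q t)" using g by blast
    have "(g has_real_derivative (\<alpha> * m1 + \<beta> * m2) * p t + (\<alpha> * m3 + \<beta> * m4) * q t) (at t)" if "t \<in> S" for t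
      unfolding g by (rule DERIV_cong[OF DERIV_add[OF DERIV_cmult[OF p[OF that]] DERIV_cmult[OF q[OF that]]]])
        (simp add: algebra_simps)
    then show ?thesis by (intro bexI[of _ "\<lambda>t. (\<alpha> * m1 + \<beta> * m2) * p t + (\<alpha> * m3 + \<beta> * m4) * q t"]) auto
  qed
  have "p = (\<lambda>t. 1 * p t + 0 * q t)" "q = (\<lambda>t. 0 * p t + 1 * q t)" by simp_all
  then have "p \<in> ?C" "q \<in> ?C" by blast+
  then show "smooth_on_line S p" "smooth_on_line S q"
    using smooth_on_line_coinduct[OF _ step assms(1)] by blast+
qed

text \<open>Insert \<open>h = f Q\<close> and \<open>h_x = f (n - a x)\<close> into the identity for
  characteristics: the terms in \<open>x^2\<close> cancel, and the coefficients of \<open>x\<close>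
  and \<open>1\<close> give this system.\<close>

lemma quadratic_affine_char:
  assumes Q: "quadratic E a b c n"
    and p: "\<And>t. (p has_real_derivative (n + b) * p t - a * q t) (at t)"
    and q: "\<And>t. (q has_real_derivative c * p t + n * q t) (at t)"
  shows "affine_char E p q (\<lambda>t. (n + b) * p t - a * q t) (\<lambda>t. c * p t + n * q t)"
    "open S ==> smooth_on_line S p" "open S ==> smooth_on_line S q"
proof -
  show "affine_char E p q (\<lambda>t. (n + b) * p t - a * q t) (\<lambda>t. c * p t + n * q t)"
    unfolding affine_char_def
  proof (intro ballI conjI p q)
    fix t x assume x: "x \<in> xdom E"
    have h: "ch E x = cf E x * (a * x\<^sup>2 + b * x + c)" "deriv (ch E) x = cf E x * (n - a * x)"
      using Q x by (simp_all add: quadratic_def)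
    show "cf E x * (((n + b) * p t - a * q t) * x + (c * p t + n * q t)) =
        deriv (ch E) x * (p t * x + q t) + ch E x * p t"
      unfolding h by (simp add: algebra_simps power2_eq_square)
  qed
  have "(p has_real_derivative (n + b) * p t + - a * q t) (at t)" for t using p[of t] by simp
  note sys = linear_system_smooth[OF _ this q]
  show "smooth_on_line S p" if "open S" by (rule sys(1)[OF that])
  show "smooth_on_line S q" if "open S" by (rule sys(2)[OF that])
qed

context eqn
begin

text \<open>The order reduction supplies some characteristic that solves the equation, and it
  coincides with \<open>l\<close> because the difference belongs to the trivial vector
  \<open>V - V\<close>.\<close>

lemma char_solution_of:
  assumes V: "conserved_vector E V" "has_char V l" shows "char_solution E l"
proof -
  obtain l' where l': "has_char V l'" "char_solution E l'" using conserved_has_char[OF V(1)] by blast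
  have eq: "l t x = l' t x" if "t \<in> tdom E" "x \<in> xdom E" for t x
    using trivial_imp_zero[OF conserved_vec_diff[OF V(1,1)] has_char_vec_diff[OF V(2) l'(1)] trivial_zero that] by simp
  obtain lt lx lxx where d: "char_data E l' lt lx lxx" using l'(2) unfolding char_solution_def by blast
  note D = char_dataD[OF d]
  show ?thesis
  proof (rule char_solutionI)
    show "continuous_on (tdom E \<times> xdom E) (\<lambda>z. g (fst z) (snd z))" if "g \<in> {l, lt, lx, lxx}" for g
    proof (cases "g = l")
      case True
      have "continuous_on (tdom E \<times> xdom E) (\<lambda>z. l' (fst z) (snd z))" by (rule D(1)) simp
      then show ?thesis unfolding True by (rule continuous_on_eq) (auto simp: eq)
    qed (use that D(1) in auto)
    fix t x assume t: "t \<in> tdom E" and x: "x \<in> xdom E"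
    show "((\<lambda>s. l s x) has_real_derivative lt t x) (at t)"
      by (rule has_field_derivative_transform_within_open[OF D(2)[OF t x] open_domains(1) t]) (simp add: eq x)
    show "(l t has_real_derivative lx t x) (at x)"
      by (rule has_field_derivative_transform_within_open[OF D(3)[OF t x] open_domains(2) x]) (simp add: eq t)
    show "(lx t has_real_derivative lxx t x) (at x)" by (rule D(4)[OF t x])
    show "cf E x * lt t x + cA E u * lxx t x - cB E u * (deriv (ch E) x * l t x + ch E x * lx t x) = 0"
      if "u \<in> udom E" for u
      unfolding eq[OF t x] by (rule D(5)[OF t x that])
  qed
qed

text \<open>The functions \<open>ls\<close> are the characteristics as functions of \<open>t\<close>
  and \<open>x\<close>. Their independence as functions is what independence modulo trivial vectors
  comes down to.\<close>

definition good_list :: "(vec \<times> (jet => real)) list => (real => real => real) list => bool" where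
  "good_list Vls ls \<longleftrightarrow> length ls = length Vls \<and>
     (\<forall>k<length Vls. characteristic E (fst (Vls ! k)) (snd (Vls ! k)) \<and> has_char (fst (Vls ! k)) (ls ! k)) \<and>
     (\<forall>c. (\<forall>t\<in>tdom E. \<forall>x\<in>xdom E. (\<Sum>k<length Vls. c k * (ls ! k) t x) = 0) \<longrightarrow> (\<forall>k<length Vls. c k = 0))"

lemma good_list1:
  assumes "characteristic E V l'" "has_char V l" "t \<in> tdom E" "x \<in> xdom E" "l t x \<noteq> 0"
  shows "good_list [(V, l')] [l]"
  unfolding good_list_def using assms by auto

lemma good_list2:
  assumes "characteristic E V l'" "has_char V l" "characteristic E Z m'" "has_char Z m"
    and "\<And>a b. (\<And>t x. t \<in> tdom E ==> x \<in> xdom E ==> a * l t x + b * m t x = 0) ==> a = 0 \<and> b = 0"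
  shows "good_list [(V, l'), (Z, m')] [l, m]"
proof -
  have "c 0 = 0 \<and> c 1 = 0" if "\<forall>t\<in>tdom E. \<forall>x\<in>xdom E. c 0 * l t x + c (Suc 0) * m t x = 0" for c
    by (rule assms(5)) (use that in simp)
  then show ?thesis unfolding good_list_def using assms(1-4) by (auto simp: less_Suc_eq)
qed

lemma good_list_independent2:
  assumes g: "good_list Vls ls" and n: "length Vls = 2"
    and z: "\<And>t x. t \<in> tdom E ==> x \<in> xdom E ==> a * (ls ! 0) t x + b * (ls ! 1) t x = 0"
  shows "a = 0 \<and> b = 0"
proof -
  define c where "c k = (if k = 0 then a else b)" for k :: nat
  have "(\<Sum>k<length Vls. c k * (ls ! k) t x) = a * (ls ! 0) t x + b * (ls ! 1) t x" for t x
    unfolding n by (simp add: numeral_2_eq_2 c_def)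
  then have "\<forall>k<length Vls. c k = 0" using g z unfolding good_list_def by simp
  then have "c 0 = 0" "c 1 = 0" using n by simp_all
  then show ?thesis by (simp add: c_def)
qed

text \<open>Two points of \<open>xdom\<close> separate the coefficients of \<open>x\<close> and
  \<open>1\<close>, so a nonzero determinant at one time is enough.\<close>

lemma affine_independent:
  assumes t: "t \<in> tdom E" and det: "p1 t * q2 t - p2 t * q1 t \<noteq> 0"
    and z: "\<And>t x. t \<in> tdom E ==> x \<in> xdom E ==> a * (p1 t * x + q1 t) + b * (p2 t * x + q2 t) = 0"
  shows "a = 0 \<and> b = 0"
proof -
  obtain x0 x1 where x: "x0 \<in> xdom E" "x1 \<in> xdom E" "x0 \<noteq> x1" by (rule open_interval_two_points[OF domains(2)])
  define X where "X = a * p1 t + b * p2 t"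
  define Y where "Y = a * q1 t + b * q2 t"
  have e: "X * x + Y = 0" if "x \<in> xdom E" for x
    using z[OF t that] by (simp add: X_def Y_def algebra_simps)
  have "X * (x0 - x1) = (X * x0 + Y) - (X * x1 + Y)" by (simp add: algebra_simps)
  then have X: "X = 0" using e x by simp
  then have Y: "Y = 0" using e[OF x(1)] by simp
  have "a * (p1 t * q2 t - p2 t * q1 t) = X * q2 t - Y * p2 t"
    "b * (p1 t * q2 t - p2 t * q1 t) = Y * p1 t - X * q1 t"
    by (simp_all add: X_def Y_def algebra_simps)
  then show ?thesis using X Y det by simp
qed

lemma affine_vector:
  assumes B1: "\<And>u. u \<in> udom E ==> cB E u = 1" and IA: "antiderivative (udom E) (cA E) IA"
    and c: "affine_char E p q p' q'" and sm: "smooth_on_line (tdom E) p" "smooth_on_line (tdom E) q"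
    and F: "\<And>t x u v. t \<in> tdom E ==> x \<in> xdom E ==> u \<in> udom E ==> F t x u v = (p t * x + q t) * cf E x * u"
    and G: "\<And>t x u v. t \<in> tdom E ==> x \<in> xdom E ==> u \<in> udom E ==>
      G t x u v = p t * IA u - (p t * x + q t) * cA E u * v - (p t * x + q t) * ch E x * u"
    and l: "l = (\<lambda>t x. p t * x + q t)"
  shows "characteristic E (fst (cl F G l)) (snd (cl F G l)) \<and> has_char (fst (cl F G l)) (\<lambda>t x. p t * x + q t)"
proof -
  let ?l = "\<lambda>t x. p t * x + q t"
  note D = affine_charD[OF c]
  have dl: "dfun (lift ?l)" by (intro dfun_add dfun_mult dfun_t sm dfun_coord)
  have IB: "antiderivative (udom E) (cB E) (\<lambda>u. u)" using B1 by (simp add: antiderivative_def)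
  have dt: "((\<lambda>s. ?l s x) has_real_derivative p' t * x + q' t) (at t)" if "t \<in> tdom E" for t x
    by (intro DERIV_add DERIV_cmult_right D that)
  have dx: "(?l t has_real_derivative p t) (at x)" for t x by (auto intro!: derivative_eq_intros)
  have dxx: "((\<lambda>x. p t) has_real_derivative 0) (at x)" for t x by simp
  have det: "cf E x * (p' t * x + q' t) * u + 0 * IA u - (deriv (ch E) x * ?l t x + ch E x * p t) * u = 0"
    if "t \<in> tdom E" "x \<in> xdom E" for t x u using D(3)[OF that] by simp
  show ?thesis
    using vector_of_char[OF dl dt dx dxx IA IB det F G] by (simp add: cl_def l)
qed

lemma quadratic_vectors:
  assumes Q: "quadratic E a b c n" and IA: "antiderivative (udom E) (cA E) IA"
    and p1: "\<And>t. (p1 has_real_derivative (n + b) * p1 t - a * q1 t) (at t)"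
    and q1: "\<And>t. (q1 has_real_derivative c * p1 t + n * q1 t) (at t)"
    and p2: "\<And>t. (p2 has_real_derivative (n + b) * p2 t - a * q2 t) (at t)"
    and q2: "\<And>t. (q2 has_real_derivative c * p2 t + n * q2 t) (at t)"
    and det: "\<And>t. p1 t * q2 t - p2 t * q1 t \<noteq> 0"
    and F1: "\<And>t x u v. t \<in> tdom E ==> x \<in> xdom E ==> u \<in> udom E ==> F1 t x u v = (p1 t * x + q1 t) * cf E x * u"
    and G1: "\<And>t x u v. t \<in> tdom E ==> x \<in> xdom E ==> u \<in> udom E ==>
      G1 t x u v = p1 t * IA u - (p1 t * x + q1 t) * cA E u * v - (p1 t * x + q1 t) * ch E x * u"
    and l1: "l1 = (\<lambda>t x. p1 t * x + q1 t)"
    and F2: "\<And>t x u v. t \<in> tdom E ==> x \<in> xdom E ==> u \<in> udom E ==> F2 t x u v = (p2 t * x + q2 t) * cf E x * u"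
    and G2: "\<And>t x u v. t \<in> tdom E ==> x \<in> xdom E ==> u \<in> udom E ==>
      G2 t x u v = p2 t * IA u - (p2 t * x + q2 t) * cA E u * v - (p2 t * x + q2 t) * ch E x * u"
    and l2: "l2 = (\<lambda>t x. p2 t * x + q2 t)"
  shows "\<exists>ls. good_list [cl F1 G1 l1, cl F2 G2 l2] ls"
proof -
  have B1: "cB E u = 1" if "u \<in> udom E" for u using Q that by (simp add: quadratic_def)
  have sm: "smooth_on_line (tdom E) p1" "smooth_on_line (tdom E) q1" "smooth_on_line (tdom E) p2" "smooth_on_line (tdom E) q2"
    by (rule quadratic_affine_char(2,3)[OF Q p1 q1 open_domains(1)] quadratic_affine_char(2,3)[OF Q p2 q2 open_domains(1)])+
  note v1 = affine_vector[OF B1 IA quadratic_affine_char(1)[OF Q p1 q1] sm(1,2) F1 G1 l1]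
  note v2 = affine_vector[OF B1 IA quadratic_affine_char(1)[OF Q p2 q2] sm(3,4) F2 G2 l2]
  obtain t where t: "t \<in> tdom E" using sec_point by blast
  have ind: "\<alpha> = 0 \<and> \<beta> = 0"
    if "\<And>t x. t \<in> tdom E ==> x \<in> xdom E ==> \<alpha> * (p1 t * x + q1 t) + \<beta> * (p2 t * x + q2 t) = 0" for \<alpha> \<beta>
    by (rule affine_independent[OF t det that])
  have "good_list [(fst (cl F1 G1 l1), snd (cl F1 G1 l1)), (fst (cl F2 G2 l2), snd (cl F2 G2 l2))]
      [\<lambda>t x. p1 t * x + q1 t, \<lambda>t x. p2 t * x + q2 t]"
    by (rule good_list2[OF conjunct1[OF v1] conjunct2[OF v1] conjunct1[OF v2] conjunct2[OF v2] ind])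
  then show ?thesis by auto
qed

text \<open>The two pairs \<open>(p, q)\<close> given in each case are a fundamental system for
  \<open>quadratic_affine_char\<close>; the listed characteristics are
  \<open>p x + q\<close>.\<close>

lemma quadratic_item_vectors:
  assumes i: "quadratic_item i" and it: "in_item i E" and IA: "antiderivative (udom E) (cA E) IA"
  shows "\<exists>ls. good_list (listed_cls i E IA IB) ls"
proof -
  have li: "listed_equation i E" using it is_eq by (simp add: listed_equation_def)
  have Q: "quadratic E (qa i) (qb i) (qc i) (qn i)" by (rule listed_quadratic[OF i li])
  have h: "ch E x = cf E x * (qa i * x\<^sup>2 + qb i * x + qc i)" if "x \<in> xdom E" for x
    using Q that by (simp add: quadratic_def)
  have d: "(g has_real_derivative D) (at t) ==> ((\<lambda>t. exp (g t)) has_real_derivative exp (g t) * D) (at t)" for g D and t :: real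
    by (rule DERIV_fun_exp)
  show ?thesis using i
  proof (cases rule: quadratic_item_cases)
    case i5b
    then have e: "cf E x = 1" "ch E x = 1" if "x \<in> xdom E" for x using it that by simp_all
    show ?thesis unfolding i5b listed_cls.simps
      by (rule quadratic_vectors[OF Q IA, of "\<lambda>t. 0" "\<lambda>t. 1" "\<lambda>t. 1" "\<lambda>t. t"])
        (use e in \<open>auto intro!: derivative_eq_intros simp: i5b fun_eq_iff algebra_simps\<close>)
  next
    case i5c
    then have e: "cf E x = exp x" "ch E x = exp x" if "x \<in> xdom E" for x using it that by simp_all
    show ?thesis unfolding i5c listed_cls.simps
      by (rule quadratic_vectors[OF Q IA, of "\<lambda>t. 0" exp exp "\<lambda>t. t * exp t"])
        (use e in \<open>auto intro!: derivative_eq_intros simp: i5c fun_eq_iff algebra_simps exp_add\<close>)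
  next
    case (i5d m)
    then have e: "cf E x = rpow x (m - 1)" "ch E x = rpow x m" if "x \<in> xdom E" for x using it that by simp_all
    have r: "rpow x m = x * rpow x (m - 1)" if "x \<in> xdom E" for x
      using h[OF that] e[OF that] i5d by simp
    have r': "rpow x (m + 1) = x * rpow x m" if x: "x \<in> xdom E" for x
    proof (cases "m = 1")
      case True
      have "(2 :: real) \<in> \<int>" by simp
      then have "rpow x 2 = x powi 2" unfolding rpow_def by simp
      then show ?thesis using True by (simp add: power2_eq_square)
    next
      case False
      then show ?thesis using listed_regular[OF i li x] i5d by (intro rpow_add_1) auto
    qed
    show ?thesis unfolding i5d listed_cls.simps
      by (rule quadratic_vectors[OF Q IA, of "\<lambda>t. 0" "\<lambda>t. exp (m * t)" "\<lambda>t. exp ((m + 1) * t)" "\<lambda>t. 0"])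
        (use e r r' in \<open>auto intro!: derivative_eq_intros simp: i5d fun_eq_iff algebra_simps\<close>)
  next
    case (i6 m)
    show ?thesis unfolding i6 listed_cls.simps
      by (rule quadratic_vectors[OF Q IA, of "\<lambda>t. exp (m * t)" "\<lambda>t. 0" "\<lambda>t. t * exp (m * t)" "\<lambda>t. - exp (m * t)"])
        (auto intro!: derivative_eq_intros simp: i6 fun_eq_iff algebra_simps)
  next
    case (i7 m)
    show ?thesis unfolding i7 listed_cls.simps
      by (rule quadratic_vectors[OF Q IA, of "\<lambda>t. exp ((2 * m + 1) * t)" "\<lambda>t. - exp ((2 * m + 1) * t)"
            "\<lambda>t. exp ((2 * m - 1) * t)" "\<lambda>t. exp ((2 * m - 1) * t)"])
        (auto intro!: derivative_eq_intros simp: i7 fun_eq_iff algebra_simps)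
  next
    case (i8 m)
    \<comment> \<open>The determinant equals \<open>- exp (2 m t)\<close>.\<close>
    have det: "exp (m * t) * cos t * - (exp (m * t) * cos t) - exp (m * t) * sin t * (exp (m * t) * sin t) \<noteq> 0" for t
    proof -
      have "e * c * - (e * c) - e * s * (e * s) = - (e * e) * (s\<^sup>2 + c\<^sup>2)" for e c s :: real
        by (simp add: power2_eq_square algebra_simps)
      then show ?thesis by (simp only: sin_cos_squared_add) simp
    qed
    show ?thesis unfolding i8 listed_cls.simps
      by (rule quadratic_vectors[OF Q IA, of "\<lambda>t. exp (m * t) * cos t" "\<lambda>t. exp (m * t) * sin t"
            "\<lambda>t. exp (m * t) * sin t" "\<lambda>t. - (exp (m * t) * cos t)", OF _ _ _ _ det])
        (auto intro!: derivative_eq_intros simp: i8 fun_eq_iff algebra_simps)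
  qed
qed

lemma item1_vectors:
  assumes it: "in_item Item1 E" and IA: "antiderivative (udom E) (cA E) IA" and IB: "antiderivative (udom E) (cB E) IB"
  shows "good_list (listed_cls Item1 E IA IB) [\<lambda>t x. 1]"
proof -
  have h: "ch E x = 1" if "x \<in> xdom E" for x using it that by simp
  have h': "deriv (ch E) x = 0" if "x \<in> xdom E" for x
    by (rule DERIV_unique_open[OF open_domains(2) that h smooth_on_line_DERIV[OF smooth_coeffs(2) that]]) auto
  obtain t x where tx: "t \<in> tdom E" "x \<in> xdom E" using sec_point by blast
  have "dfun (lift (\<lambda>t x. 1))" by (rule dfun_const)
  note v = vector_of_char[OF this, of "\<lambda>t x. 0" "\<lambda>t x. 0" "\<lambda>t x. 0", OF _ _ _ IA IB]
  show ?thesis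
    unfolding listed_cls.simps cl_def
    by (rule good_list1[OF v tx]) (auto simp: h h')
qed

text \<open>For \<open>l = - exp t / h\<close> the product \<open>h l\<close> does not depend on
  \<open>x\<close>, and with \<open>A = 1\<close> the constraint on \<open>f\<close> is the
  remaining part \<open>f l_t + l_xx = 0\<close> of the equation.\<close>

lemma item2_vectors:
  assumes it: "in_item Item2 E" and IB: "antiderivative (udom E) (cB E) IB"
  shows "good_list (listed_cls Item2 E IA IB) [\<lambda>t x. - exp t * inverse (ch E x)]"
proof -
  define k where "k x = inverse (ch E x)" for x
  have h: "ch E x \<noteq> 0" "cf E x = - ch E x * deriv (deriv k) x" if "x \<in> xdom E" for x
    using it that unfolding k_def[abs_def] by simp_all
  have A: "cA E u = 1" if "u \<in> udom E" for u using it that by simp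
  have IA: "antiderivative (udom E) (cA E) (\<lambda>u. u)" using A by (simp add: antiderivative_def)
  have smk: "smooth_on_line (xdom E) k"
    unfolding k_def[abs_def] by (rule smooth_on_line_inverse[OF smooth_coeffs(2) open_domains(2) h(1)])
  note Dk = smooth_on_line_DERIV[OF smk] smooth_on_line_DERIV[OF smooth_on_line_deriv[OF smk]]
  have hk: "ch E x * k x = 1" if "x \<in> xdom E" for x using h(1)[OF that] by (simp add: k_def)
  have hk': "deriv (ch E) x * k x + ch E x * deriv k x = 0" if x: "x \<in> xdom E" for x
  proof (rule DERIV_unique_open[OF open_domains(2) x hk])
    show "((\<lambda>x. ch E x * k x) has_real_derivative deriv (ch E) x * k x + ch E x * deriv k x) (at x)"
      using DERIV_mult'[OF smooth_on_line_DERIV[OF smooth_coeffs(2) x] Dk(1)[OF x]] by (simp add: add.commute)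
  qed auto
  obtain t x where tx: "t \<in> tdom E" "x \<in> xdom E" using sec_point by blast
  have "smooth_on_line (tdom E) exp" using smooth_on_line_exp_comp[OF smooth_on_line_ident[OF open_domains(1)] open_domains(1)] by simp
  then have "dfun (\<lambda>p. (- 1) * exp (p Time) * k (p Space))"
    by (intro dfun_mult dfun_const dfun_x smk) (rule dfun_t)
  then have dl: "dfun (lift (\<lambda>t x. - exp t * k x))" by simp
  have dt: "((\<lambda>s. - exp s * k x) has_real_derivative - exp t * k x) (at t)" for t x
    by (auto intro!: derivative_eq_intros)
  have dx: "((\<lambda>x. - exp t * k x) has_real_derivative - exp t * deriv k x) (at x)"
    "((\<lambda>x. - exp t * deriv k x) has_real_derivative - exp t * deriv (deriv k) x) (at x)"
    if "x \<in> xdom E" for t x by (intro DERIV_cmult Dk that)+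
  have det: "cf E x * (- exp t * k x) * u + - exp t * deriv (deriv k) x * u -
      (deriv (ch E) x * (- exp t * k x) + ch E x * (- exp t * deriv k x)) * IB u = 0" if x: "x \<in> xdom E" for t x u
  proof -
    have "cf E x * (- exp t * k x) * u = exp t * deriv (deriv k) x * u * (ch E x * k x)"
      unfolding h(2)[OF x] by simp
    moreover have "deriv (ch E) x * (- exp t * k x) + ch E x * (- exp t * deriv k x) =
        - exp t * (deriv (ch E) x * k x + ch E x * deriv k x)" by (simp add: algebra_simps)
    ultimately show ?thesis unfolding hk[OF x] hk'[OF x] by simp
  qed
  have F: "exp t * deriv (deriv k) x * u = - exp t * k x * cf E x * u" if x: "x \<in> xdom E" for t x u
  proof -
    have "- exp t * k x * cf E x * u = exp t * deriv (deriv k) x * u * (ch E x * k x)"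
      unfolding h(2)[OF x] by simp
    then show ?thesis unfolding hk[OF x] by simp
  qed
  have G: "exp t * (k x * v - deriv k x * u + IB u) =
      - exp t * deriv k x * u - - exp t * k x * cA E u * v - - exp t * k x * ch E x * IB u"
    if x: "x \<in> xdom E" and u: "u \<in> udom E" for t x u v
  proof -
    have "- exp t * k x * ch E x * IB u = - exp t * IB u * (ch E x * k x)" by simp
    then show ?thesis unfolding hk[OF x] A[OF u] by (simp add: algebra_simps)
  qed
  note v = vector_of_char[OF dl dt dx(1) dx(2) IA IB det F G]
  have "good_list [((on_jet (\<lambda>t x u v. exp t * deriv (deriv k) x * u),
      on_jet (\<lambda>t x u v. exp t * (k x * v - deriv k x * u + IB u))), on_jet (\<lambda>t x u v. - exp t * k x))]
      [\<lambda>t x. - exp t * k x]"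
    by (rule good_list1[OF v tx]) (use hk[OF tx(2)] in auto)
  then show ?thesis unfolding listed_cls.simps cl_def Let_def k_def[abs_def] .
qed

lemma item3_vectors:
  assumes it: "in_item Item3 E" and IA: "antiderivative (udom E) (cA E) IA"
  shows "good_list (listed_cls Item3 E IA IB) [\<lambda>t x. 0 * x + exp t]"
proof -
  have e: "cB E u = 1" "x \<in> xdom E ==> cf E x = deriv (ch E) x" if "u \<in> udom E" for u x using it that by simp_all
  obtain t x u where tx: "t \<in> tdom E" "x \<in> xdom E" and u: "u \<in> udom E" using sec_point by blast
  have c: "affine_char E (\<lambda>t. 0) exp (\<lambda>t. 0) exp" unfolding affine_char_def using e(2)[OF u] by (auto intro: DERIV_exp)
  have sm: "smooth_on_line (tdom E) (\<lambda>t. 0)" "smooth_on_line (tdom E) exp"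
    using smooth_on_line_const smooth_on_line_exp_comp[OF smooth_on_line_ident] open_domains(1) by blast+
  let ?V = "hd (listed_cls Item3 E IA IB)"
  have v: "characteristic E (fst ?V) (snd ?V) \<and> has_char (fst ?V) (\<lambda>t x. 0 * x + exp t)"
    unfolding listed_cls.simps list.sel
    by (rule affine_vector[OF e(1) IA c sm]) (auto simp: fun_eq_iff algebra_simps)
  have "good_list [(fst ?V, snd ?V)] [\<lambda>t x. 0 * x + exp t]"
    by (rule good_list1[OF conjunct1[OF v] conjunct2[OF v] tx]) simp
  then show ?thesis by simp
qed

lemma item4_vectors:
  assumes it: "in_item Item4 E" and IA: "antiderivative (udom E) (cA E) IA"
  shows "good_list (listed_cls Item4 E IA IB) [\<lambda>t x. exp t * x + 0]"
proof -
  have e: "cB E u = 1" if "u \<in> udom E" for u using it that by simp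
  have f: "cf E x * x - (deriv (ch E) x * x + ch E x) = 0" if x: "x \<in> xdom E" for x
  proof (cases "x = 0")
    case False
    then have "cf E x = deriv (ch E) x + ch E x / x" using it x by simp
    then show ?thesis using False by (simp add: algebra_simps)
  next
    case True
    \<comment> \<open>The constraint is stated away from \<open>0\<close>; multiplied by
      \<open>x\<close> it extends to \<open>0\<close> by continuity.\<close>
    have nz: "cf E y * y - (deriv (ch E) y * y + ch E y) = 0" if "y \<in> xdom E" "y \<noteq> 0" for y
      using it that by (simp add: algebra_simps)
    have "continuous_on (xdom E) (\<lambda>y. cf E y * y - (deriv (ch E) y * y + ch E y))"
      by (intro continuous_intros smooth_on_line_continuous[OF smooth_coeffs(1)]
          smooth_on_line_continuous[OF smooth_coeffs(2)] smooth_on_line_continuous[OF smooth_on_line_deriv[OF smooth_coeffs(2)]])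
    moreover have "0 \<in> xdom E" using x True by simp
    ultimately show ?thesis
      unfolding True by (rule continuous_zero_at[where a=0, OF open_domains(2) _ _ nz])
  qed
  obtain x where x: "x \<in> xdom E" "x \<noteq> 0" by (metis open_interval_two_points[OF domains(2)])
  obtain t where tx: "t \<in> tdom E" using sec_point by blast
  have c: "affine_char E exp (\<lambda>t. 0) exp (\<lambda>t. 0)"
    unfolding affine_char_def
  proof (intro ballI conjI)
    fix t x assume "x \<in> xdom E"
    then have "exp t * (cf E x * x - (deriv (ch E) x * x + ch E x)) = 0" using f by simp
    then show "cf E x * (exp t * x + 0) = deriv (ch E) x * (exp t * x + 0) + ch E x * exp t"
      by (simp add: algebra_simps)
  qed (auto intro: DERIV_exp)
  have sm: "smooth_on_line (tdom E) exp" "smooth_on_line (tdom E) (\<lambda>t. 0)"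
    using smooth_on_line_const smooth_on_line_exp_comp[OF smooth_on_line_ident] open_domains(1) by blast+
  let ?V = "hd (listed_cls Item4 E IA IB)"
  have v: "characteristic E (fst ?V) (snd ?V) \<and> has_char (fst ?V) (\<lambda>t x. exp t * x + 0)"
    unfolding listed_cls.simps list.sel
    by (rule affine_vector[OF e IA c sm]) (auto simp: fun_eq_iff algebra_simps)
  have "good_list [(fst ?V, snd ?V)] [\<lambda>t x. exp t * x + 0]"
    by (rule good_list1[OF conjunct1[OF v] conjunct2[OF v] tx x(1)]) (use x in simp)
  then show ?thesis by simp
qed

lemma item5a_vectors:
  assumes it: "in_item Item5a E" and IA: "antiderivative (udom E) (cA E) IA"
  shows "good_list (listed_cls Item5a E IA IB) [\<lambda>t x. 1, \<lambda>t x. x]"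
proof -
  have IB: "antiderivative (udom E) (cB E) (\<lambda>u. 0)" using it by (simp add: antiderivative_def)
  have l: "dfun (lift (\<lambda>t x. 1))" "dfun (lift (\<lambda>t x. x))" by (rule dfun_const, rule dfun_coord)
  note v = vector_of_char[OF l(1), of "\<lambda>t x. 0" "\<lambda>t x. 0" "\<lambda>t x. 0", OF _ _ _ IA IB]
  note w = vector_of_char[OF l(2), of "\<lambda>t x. 0" "\<lambda>t x. 1" "\<lambda>t x. 0", OF _ _ _ IA IB]
  obtain t where t: "t \<in> tdom E" using sec_point by blast
  have ind: "a = 0 \<and> b = 0" if "\<And>t x. t \<in> tdom E ==> x \<in> xdom E ==> a * 1 + b * x = 0" for a b
    using affine_independent[OF t, of "\<lambda>t. 0" "\<lambda>t. 0" "\<lambda>t. 1" "\<lambda>t. 1" a b] that by simp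
  show ?thesis
    unfolding listed_cls.simps cl_def
    by (rule good_list2[OF v w ind]) auto
qed

lemma listed_vectors:
  assumes it: "in_item i E" "i \<noteq> Item9"
    and IA: "antiderivative (udom E) (cA E) IA" and IB: "antiderivative (udom E) (cB E) IB"
  shows "\<exists>ls. good_list (listed_cls i E IA IB) ls"
proof (cases "quadratic_item i")
  case True then show ?thesis by (rule quadratic_item_vectors[OF _ it(1) IA])
next
  case False
  then consider "i = Item1" | "i = Item2" | "i = Item3" | "i = Item4" | "i = Item5a"
    using it(2) by (cases i) (auto simp: quadratic_item_def)
  then show ?thesis
    using it(1) item1_vectors[OF _ IA IB] item2_vectors[OF _ IB] item3_vectors[OF _ IA]
      item4_vectors[OF _ IA] item5a_vectors[OF _ IA] by cases blast+
qed

end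

section \<open>Independence and bases of conservation laws\<close>

context eqn
begin

lemma good_listD:
  assumes "good_list Vls ls"
  shows "length ls = length (map fst Vls)"
    "\<And>k. k < length (map fst Vls) ==> conserved_vector E (map fst Vls ! k)"
    "\<And>k. k < length (map fst Vls) ==> has_char (map fst Vls ! k) (ls ! k)"
  using assms by (simp_all add: good_list_def characteristic_def)

lemma good_list_independent:
  assumes g: "good_list Vls ls" shows "cl_independent E (map fst Vls)"
  unfolding cl_independent_def
proof (intro conjI allI impI)
  show "\<forall>V\<in>set (map fst Vls). conserved_vector E V" using good_listD(2)[OF g] by (metis in_set_conv_nth)
  fix c k assume triv: "trivial_vector E (lin_comb c (map fst Vls))" and k: "k < length (map fst Vls)"
  have "(\<Sum>k<length (map fst Vls). c k * (ls ! k) t x) = 0" if "t \<in> tdom E" "x \<in> xdom E" for t x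
    by (rule trivial_imp_zero[OF conserved_lin_comb[OF good_listD(2)[OF g]]
          has_char_lin_comb[OF good_listD(1,3)[OF g]] triv that])
  then show "c k = 0" using g k unfolding good_list_def by simp
qed

text \<open>A conserved vector has a characteristic. Subtracting the combination of listed vectors
  with the same characteristic leaves one with characteristic zero, which is trivial.\<close>

lemma good_list_basis:
  assumes g: "good_list Vls ls"
    and span: "\<And>l. char_solution E l ==>
      \<exists>c. \<forall>t\<in>tdom E. \<forall>x\<in>xdom E. l t x = (\<Sum>k<length Vls. c k * (ls ! k) t x)"
  shows "cl_basis E (map fst Vls)"
  unfolding cl_basis_def
proof (intro conjI allI impI good_list_independent[OF g])
  fix V assume cV: "conserved_vector E V"
  obtain l where l: "has_char V l" "char_solution E l" using conserved_has_char[OF cV] by blast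
  obtain c where c: "\<forall>t\<in>tdom E. \<forall>x\<in>xdom E. l t x = (\<Sum>k<length Vls. c k * (ls ! k) t x)"
    using span[OF l(2)] by blast
  have "trivial_vector E (vec_diff V (lin_comb c (map fst Vls)))"
    by (rule zero_imp_trivial[OF conserved_vec_diff[OF cV conserved_lin_comb[OF good_listD(2)[OF g]]]
          has_char_vec_diff[OF l(1) has_char_lin_comb[OF good_listD(1,3)[OF g]]]]) (use c in auto)
  then show "\<exists>c. trivial_vector E (vec_diff V (lin_comb c (map fst Vls)))" by blast
qed

lemma good_list_nontrivial:
  assumes g: "good_list Vls ls" and n: "Vls \<noteq> []" shows "has_nontrivial_cl E"
proof -
  let ?V = "fst (Vls ! 0)"
  have V: "conserved_vector E ?V" "has_char ?V (ls ! 0)"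
    using g n by (simp_all add: good_list_def characteristic_def)
  have "\<not> trivial_vector E ?V"
  proof
    assume "trivial_vector E ?V"
    then have z: "(ls ! 0) t x = 0" if "t \<in> tdom E" "x \<in> xdom E" for t x
      using trivial_imp_zero[OF V _ that] by blast
    define c :: "nat => real" where "c k = (if k = 0 then 1 else 0)" for k
    have "(\<Sum>k<length Vls. c k * (ls ! k) t x) = 0" if "t \<in> tdom E" "x \<in> xdom E" for t x
      by (rule sum.neutral) (use z[OF that] in \<open>auto simp: c_def\<close>)
    then have "\<forall>k<length Vls. c k = 0" using g unfolding good_list_def by blast
    then show False using n by (auto simp: c_def)
  qed
  then show ?thesis using V unfolding has_nontrivial_cl_def by blast
qed

lemma antiderivatives_u:
  obtains IA IB where "antiderivative (udom E) (cA E) IA" "antiderivative (udom E) (cB E) IB"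
  using open_interval_antiderivative[OF domains(3) smooth_on_line_continuous[OF smooth_coeffs(3)]]
    open_interval_antiderivative[OF domains(3) smooth_on_line_continuous[OF smooth_coeffs(4)]] by blast

lemma length_listed_cls: "i \<noteq> Item9 ==> length (listed_cls i E IA IB) = grade i"
  by (cases i) (simp_all add: Let_def)

lemma good_list_solution:
  assumes "good_list Vls ls" "k < length Vls" shows "char_solution E (ls ! k)"
  using assms char_solution_of unfolding good_list_def characteristic_def by blast

lemma good_list_two:
  assumes g: "good_list Vls ls" and n: "length Vls = 2" shows "two_char_solutions E"
  unfolding two_char_solutions_def
proof (rule exI[of _ "ls ! 0"], rule exI[of _ "ls ! 1"], intro conjI allI impI)
  show "char_solution E (ls ! 0)" "char_solution E (ls ! 1)" by (rule good_list_solution[OF g], simp add: n)+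
  fix a b assume "\<forall>t\<in>tdom E. \<forall>x\<in>xdom E. a * (ls ! 0) t x + b * (ls ! 1) t x = 0"
  then have "a = 0 \<and> b = 0" by (intro good_list_independent2[OF g n]) blast
  then show "a = 0" "b = 0" by blast+
qed

lemma basis_one:
  assumes g: "good_list Vls ls" and n: "length Vls = 1" and one: "\<not> two_char_solutions E"
  shows "cl_basis E (map fst Vls)"
proof (rule good_list_basis[OF g])
  fix l assume l: "char_solution E l"
  have l0: "char_solution E (ls ! 0)" by (rule good_list_solution[OF g]) (simp add: n)
  obtain a b where ab: "\<And>t x. t \<in> tdom E ==> x \<in> xdom E ==> a * (ls ! 0) t x + b * l t x = 0" "a \<noteq> 0 \<or> b \<noteq> 0"
    using one l l0 unfolding two_char_solutions_def by blast
  have b: "b \<noteq> 0"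
  proof
    assume b: "b = 0"
    then have "\<forall>t\<in>tdom E. \<forall>x\<in>xdom E. (\<Sum>k<length Vls. a * (ls ! k) t x) = 0"
      using ab(1) n by simp
    then have "\<forall>k<length Vls. a = 0" using g unfolding good_list_def by (elim conjE allE[of _ "\<lambda>k. a"]) blast
    then show False using n b ab(2) by auto
  qed
  have "l t x = (\<Sum>k<length Vls. (- a / b) * (ls ! k) t x)" if "t \<in> tdom E" "x \<in> xdom E" for t x
    using ab(1)[OF that] b n by (simp add: field_simps add_eq_0_iff)
  then show "\<exists>c. \<forall>t\<in>tdom E. \<forall>x\<in>xdom E. l t x = (\<Sum>k<length Vls. c k * (ls ! k) t x)"
    by (intro exI[of _ "\<lambda>k. - a / b"]) blast
qed

lemma basis_two:
  assumes g: "good_list Vls ls" and n: "length Vls = 2"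
    and span: "\<And>l. char_solution E l ==>
      \<exists>a b. \<forall>t\<in>tdom E. \<forall>x\<in>xdom E. l t x = a * (ls ! 0) t x + b * (ls ! 1) t x"
  shows "cl_basis E (map fst Vls)"
proof (rule good_list_basis[OF g])
  fix l assume "char_solution E l"
  then obtain a b where ab: "\<And>t x. t \<in> tdom E ==> x \<in> xdom E ==> l t x = a * (ls ! 0) t x + b * (ls ! 1) t x"
    using span by blast
  define c where "c k = (if k = 0 then a else b)" for k :: nat
  have "(\<Sum>k<length Vls. c k * (ls ! k) t x) = a * (ls ! 0) t x + b * (ls ! 1) t x" for t x
    unfolding n by (simp add: numeral_2_eq_2 c_def)
  then show "\<exists>c. \<forall>t\<in>tdom E. \<forall>x\<in>xdom E. l t x = (\<Sum>k<length Vls. c k * (ls ! k) t x)"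
    using ab by (intro exI[of _ c]) simp
qed

text \<open>For \<open>B = 0\<close>, two different values of \<open>A\<close> force
  \<open>l_xx = 0\<close> and then \<open>l_t = 0\<close>.\<close>

lemma span_item5a:
  assumes B: "\<And>u. u \<in> udom E ==> cB E u = 0" and A: "\<nexists>a. \<forall>u\<in>udom E. cA E u = a"
    and l: "char_solution E l"
  shows "\<exists>a b. \<forall>t\<in>tdom E. \<forall>x\<in>xdom E. l t x = a * 1 + b * x"
proof -
  obtain u1 u2 where u: "u1 \<in> udom E" "u2 \<in> udom E" "cA E u1 \<noteq> cA E u2" using A by blast
  obtain lt lx lxx where d: "char_data E l lt lx lxx" using l unfolding char_solution_def by blast
  note D = char_dataD[OF d]
  have z: "lt t x = 0 \<and> lxx t x = 0" if t: "t \<in> tdom E" and x: "x \<in> xdom E" for t x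
  proof -
    have e: "cf E x * lt t x + cA E u * lxx t x = 0" if "u \<in> udom E" for u
      using D(5)[OF t x that] B[OF that] by simp
    have "cA E u1 * lxx t x = cA E u2 * lxx t x" using e[OF u(1)] e[OF u(2)] by linarith
    then show ?thesis using u(3) e[OF u(1)] f_nz[OF x] by simp
  qed
  obtain t0 where t0: "t0 \<in> tdom E" using sec_point by blast
  have "(lx t0 has_real_derivative 0) (at x)" if "x \<in> xdom E" for x using D(4)[OF t0 that] z[OF t0 that] by simp
  from open_interval_affine[OF domains(2) D(3)[OF t0] this]
  obtain k m where m: "\<And>x. x \<in> xdom E ==> l t0 x = k * x + m" by blast
  have "l t x = m * 1 + k * x" if t: "t \<in> tdom E" and x: "x \<in> xdom E" for t x
  proof -
    have "\<exists>c. \<forall>t\<in>tdom E. l t x = c"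
      by (rule open_interval_constant[OF domains(1)]) (use D(2)[OF _ x] z[OF _ x] in simp)
    then show ?thesis using m[OF x] t t0 by force
  qed
  then show ?thesis by blast
qed

lemma linear_vector:
  assumes it: "in_item Item9 E" and a: "adjoint_solution E a"
  shows "characteristic E (fst (linear_cl E a)) (snd (linear_cl E a)) \<and> has_char (fst (linear_cl E a)) a"
proof -
  have AB: "cA E u = 1" "cB E u = 0" if "u \<in> udom E" for u using it that by auto
  have da: "dfun (lift a)"
    using a unfolding adjoint_solution_def D_eq[symmetric] by (simp add: on_jet_def[abs_def])
  obtain lt lx lxx where d: "\<And>t x. t \<in> tdom E ==> x \<in> xdom E ==>
        ((\<lambda>s. a s x) has_real_derivative lt t x) (at t) \<and>
        (a t has_real_derivative lx t x) (at x) \<and> (lx t has_real_derivative lxx t x) (at x)"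
    using lift_derivatives[OF da dep_lift refl] by blast
  have dt: "((\<lambda>s. a s x) has_real_derivative lt t x) (at t)" and dx: "(a t has_real_derivative lx t x) (at x)"
    and dxx: "(lx t has_real_derivative lxx t x) (at x)" if "t \<in> tdom E" "x \<in> xdom E" for t x
    using d[OF that] by blast+
  have lx: "deriv (a t) x = lx t x" if "t \<in> tdom E" "x \<in> xdom E" for t x
    by (rule DERIV_imp_deriv[OF dx[OF that]])
  have eq: "cf E x * lt t x + lxx t x = 0" if t: "t \<in> tdom E" and x: "x \<in> xdom E" for t x
  proof -
    have "deriv (deriv (a t)) x = lxx t x" by (rule deriv_deriv_open[OF open_domains(2) dx[OF t] dxx[OF t x] x])
    moreover have "deriv (\<lambda>s. a s x) t = lt t x" by (rule DERIV_imp_deriv[OF dt[OF t x]])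
    ultimately show ?thesis
      using conjunct2[OF a[unfolded adjoint_solution_def], THEN bspec, OF t, THEN bspec, OF x] by simp
  qed
  have I: "antiderivative (udom E) (cA E) (\<lambda>u. u)" "antiderivative (udom E) (cB E) (\<lambda>u. 0)"
    using AB by (simp_all add: antiderivative_def)
  have det: "cf E x * lt t x * u + lxx t x * u - (deriv (ch E) x * a t x + ch E x * lx t x) * 0 = 0"
    if "t \<in> tdom E" "x \<in> xdom E" for t x u
    using eq[OF that] by (simp add: distrib_right[symmetric])
  have G: "- a t x * v + deriv (\<lambda>y. a t y) x * u = lx t x * u - a t x * cA E u * v - a t x * ch E x * 0"
    if "t \<in> tdom E" "x \<in> xdom E" "u \<in> udom E" for t x u v
    using lx[OF that(1,2)] AB(1)[OF that(3)] by simp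
  note v = vector_of_char[OF da dt dx dxx I det refl G]
  show ?thesis unfolding linear_cl_def cl_def fst_conv snd_conv using v by blast
qed

lemma linear_independent:
  assumes it: "in_item Item9 E" and a: "adjoint_solution E a" and tr: "trivial_vector E (fst (linear_cl E a))"
    and "t \<in> tdom E" "x \<in> xdom E"
  shows "a t x = 0"
  using linear_vector[OF it a] trivial_imp_zero[OF _ _ tr assms(4,5)] unfolding characteristic_def by blast

text \<open>The characteristic delivered by the order reduction is itself the required solution of
  the linear equation.\<close>

lemma linear_span:
  assumes it: "in_item Item9 E" and V: "conserved_vector E V"
  shows "\<exists>a. adjoint_solution E a \<and> trivial_vector E (vec_diff V (fst (linear_cl E a)))"
proof -
  have AB: "cA E u = 1" "cB E u = 0" if "u \<in> udom E" for u using it that by auto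
  obtain l where l: "has_char V l" "char_solution E l" using conserved_has_char[OF V] by blast
  obtain lt lx lxx where d: "char_data E l lt lx lxx" using l(2) unfolding char_solution_def by blast
  note D = char_dataD[OF d]
  obtain u0 where u0: "u0 \<in> udom E" using sec_point by blast
  have "dfun (lift l)" using l(1) by (simp add: has_char_def)
  moreover have "cf E x * deriv (\<lambda>s. l s x) t + deriv (deriv (l t)) x = 0"
    if t: "t \<in> tdom E" and x: "x \<in> xdom E" for t x
  proof -
    have "deriv (deriv (l t)) x = lxx t x" by (rule deriv_deriv_open[OF open_domains(2) D(3)[OF t] D(4)[OF t x] x])
    moreover have "deriv (\<lambda>s. l s x) t = lt t x" by (rule DERIV_imp_deriv[OF D(2)[OF t x]])
    ultimately show ?thesis using D(5)[OF t x u0] AB[OF u0] by simp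
  qed
  ultimately have a: "adjoint_solution E l"
    unfolding adjoint_solution_def D_eq[symmetric] by (simp add: on_jet_def[abs_def])
  note v = linear_vector[OF it a]
  have "conserved_vector E (fst (linear_cl E l))" using v by (simp add: characteristic_def)
  then have "trivial_vector E (vec_diff V (fst (linear_cl E l)))"
    by (intro zero_imp_trivial[OF conserved_vec_diff[OF V] has_char_vec_diff[OF l(1) conjunct2[OF v]]]) simp_all
  then show ?thesis using a by blast
qed

lemma listed_nontrivial:
  assumes "in_item i E" shows "has_nontrivial_cl E"
proof (cases "i = Item9")
  case False
  obtain IA IB where I: "antiderivative (udom E) (cA E) IA" "antiderivative (udom E) (cB E) IB"
    by (rule antiderivatives_u)
  obtain ls where "good_list (listed_cls i E IA IB) ls" using listed_vectors[OF assms False I] by blast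
  moreover have "grade i \<noteq> 0" by (cases i) auto
  then have "listed_cls i E IA IB \<noteq> []" using length_listed_cls[OF False, of IA IB] by auto
  ultimately show ?thesis by (rule good_list_nontrivial)
next
  case True
  obtain t x where tx: "t \<in> tdom E" "x \<in> xdom E" using sec_point by blast
  \<comment> \<open>The constant \<open>1\<close> solves the equation for every
    \<open>f\<close>.\<close>
  have "adjoint_solution E (\<lambda>t x. 1)"
    unfolding adjoint_solution_def D_eq[symmetric] by (simp add: on_jet_def[abs_def] dfun_const)
  from linear_vector[OF _ this] have "good_list [linear_cl E (\<lambda>t x. 1)] [\<lambda>t x. 1]"
    using good_list1[of "fst (linear_cl E (\<lambda>t x. 1))" "snd (linear_cl E (\<lambda>t x. 1))" "\<lambda>t x. 1", OF _ _ tx] assms True by simp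
  then show ?thesis by (rule good_list_nontrivial) simp
qed

lemma listed_two:
  assumes "in_item i E" "grade i = 2" shows "two_char_solutions E"
proof -
  have i: "i \<noteq> Item9" using assms(2) by auto
  obtain IA IB where I: "antiderivative (udom E) (cA E) IA" "antiderivative (udom E) (cB E) IB"
    by (rule antiderivatives_u)
  obtain ls where "good_list (listed_cls i E IA IB) ls" using listed_vectors[OF assms(1) i I] by blast
  then show ?thesis by (rule good_list_two) (simp add: length_listed_cls[OF i] assms(2))
qed

end

section \<open>Distinct items\<close>

text \<open>Only the product \<open>h B\<close> is fixed. Where \<open>h\<close> has a nonzero
  value, another representation can merely move a nonzero constant between the two factors.\<close>

lemma B1_same:
  assumes s: "same_equation E E1" and B: "\<And>u. u \<in> udom E ==> cB E u = 1"
    and h: "x0 \<in> xdom E" "ch E x0 \<noteq> 0" and ne: "udom E \<noteq> {}"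
  shows "\<exists>\<beta>. \<beta> \<noteq> 0 \<and> (\<forall>u\<in>udom E. cB E1 u = \<beta>) \<and> (\<forall>x\<in>xdom E. ch E x = ch E1 x * \<beta>)"
proof -
  obtain u0 where u0: "u0 \<in> udom E" using ne by blast
  have e: "ch E1 x * cB E1 u = ch E x" if "x \<in> xdom E" "u \<in> udom E" for x u
    using s that B[OF that(2)] by (simp add: same_equation_def)
  have h1: "ch E1 x0 \<noteq> 0" using e[OF h(1) u0] h(2) by auto
  have \<beta>: "cB E1 u = ch E x0 / ch E1 x0" if "u \<in> udom E" for u
    using e[OF h(1) that] h1 by (simp add: field_simps)
  have "ch E x = ch E1 x * (ch E x0 / ch E1 x0)" if "x \<in> xdom E" for x
    using e[OF that u0] unfolding \<beta>[OF u0] by (rule sym)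
  moreover have "ch E x0 / ch E1 x0 \<noteq> 0" using h h1 by simp
  ultimately show ?thesis using \<beta> by blast
qed

text \<open>With \<open>B\<close> constant on both sides, \<open>d8 A\<close> has to be constant, so
  \<open>d8 = 0\<close> for nonconstant \<open>A\<close>. Then \<open>K\<close> differs from
  \<open>x\<close> by a constant, and the change of \<open>x\<close> is affine.\<close>

lemma B1_equivalent_affine:
  assumes E: "is_equation E" "is_equation E'" and eq: "equivalent E E'"
    and B: "\<And>u. u \<in> udom E ==> cB E u = 1" and B': "\<And>u. u \<in> udom E' ==> cB E' u = 1"
    and A: "\<nexists>a. \<forall>u\<in>udom E. cA E u = a" and h: "x0 \<in> xdom E" "ch E x0 \<noteq> 0" and h': "y0 \<in> xdom E'" "ch E' y0 \<noteq> 0"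
  shows "\<exists>d1 d5 d6 d9. d1 \<noteq> 0 \<and> d5 \<noteq> 0 \<and> d9 \<noteq> 0 \<and> xdom E' = (\<lambda>x. d5 * x + d6) ` xdom E \<and>
    (\<forall>x\<in>xdom E. cf E' (d5 * x + d6) = d1 / d5 * d9 * cf E x \<and> ch E' (d5 * x + d6) = d9 * ch E x \<and>
       deriv (ch E') (d5 * x + d6) * d5 = d9 * deriv (ch E) x)"
proof -
  obtain E1 E2 where s: "same_equation E E1" "maps_to E1 E2" "same_equation E2 E'"
    using eq unfolding equivalent_def by blast
  obtain d1 d2 d3 d4 d5 d6 d7 d8 d9 H K where m: "maps_via d1 d2 d3 d4 d5 d6 d7 d8 d9 H K E1 E2"
    using s(2) unfolding maps_to_iff by blast
  have d: "d1 \<noteq> 0" "d5 \<noteq> 0" "d7 \<noteq> 0" "d9 \<noteq> 0" using m by (auto simp: maps_via_def)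
  have dom: "xdom E1 = xdom E" "udom E1 = udom E" "xdom E' = xdom E2" "udom E' = udom E2"
    using s by (simp_all add: same_equation_def)
  have ne: "udom E \<noteq> {}" "udom E' \<noteq> {}" using E unfolding is_equation_def open_interval_def by auto
  obtain \<beta> where \<beta>: "\<beta> \<noteq> 0" "\<And>u. u \<in> udom E ==> cB E1 u = \<beta>" "\<And>x. x \<in> xdom E ==> ch E x = ch E1 x * \<beta>"
    using B1_same[OF s(1) B h ne(1)] by blast
  have s3: "same_equation E' E2" using s(3) by (simp add: same_equation_def)
  obtain \<gamma> where \<gamma>: "\<gamma> \<noteq> 0" "\<And>u. u \<in> udom E' ==> cB E2 u = \<gamma>" "\<And>x. x \<in> xdom E' ==> ch E' x = ch E2 x * \<gamma>"
    using B1_same[OF s3 B' h' ne(2)] by blast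
  have AB: "\<gamma> = d7 * (\<beta> + d8 * cA E u)" if u: "u \<in> udom E" for u
  proof -
    have u1: "u \<in> udom E1" and u2: "d3 * u + d4 \<in> udom E'" using u m dom by (auto simp: maps_via_def)
    have "cB E2 (d3 * u + d4) = d7 * (cB E1 u + d8 * cA E1 u)" using m u1 by (simp add: maps_via_def)
    moreover have "cA E1 u = cA E u" using s(1) u by (simp add: same_equation_def)
    ultimately show ?thesis using \<beta>(2)[OF u] \<gamma>(2)[OF u2] by simp
  qed
  have d8: "d8 = 0"
  proof (rule ccontr)
    assume "d8 \<noteq> 0"
    then have "cA E u = (\<gamma> / d7 - \<beta>) / d8" if "u \<in> udom E" for u using AB[OF that] d by (simp add: field_simps)
    then show False using A by blast
  qed
  \<comment> \<open>The constants moved between \<open>h\<close> and \<open>B\<close> on the two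
    sides cancel against \<open>d7\<close>, so that \<open>h\<close> is scaled by \<open>d9\<close>
    alone.\<close>
  have \<gamma>\<beta>: "\<gamma> = d7 * \<beta>" using AB ne d8 by auto
  have "antiderivative (xdom E) (\<lambda>x. exp (d8 * H x)) K" using m dom by (simp add: maps_via_def)
  then have K: "(K has_real_derivative 1) (at x)" if "x \<in> xdom E" for x
    using that d8 by (auto simp: antiderivative_def)
  interpret eqn E by (rule eqnI[OF E(1)])
  have "\<exists>k. \<forall>x\<in>xdom E. K x - x = k"
    by (rule open_interval_constant[OF domains(2)]) (auto intro!: derivative_eq_intros K)
  then obtain k where k: "\<And>x. x \<in> xdom E ==> d5 * K x + d6 = d5 * x + (d5 * k + d6)" by (force simp: algebra_simps)
  have X: "xdom E' = (\<lambda>x. d5 * x + (d5 * k + d6)) ` xdom E"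
    unfolding dom using m dom by (auto simp: maps_via_def k intro!: image_cong)
  have fh: "cf E' (d5 * x + (d5 * k + d6)) = d1 / d5 * d9 * cf E x" "ch E' (d5 * x + (d5 * k + d6)) = d9 * ch E x"
    if x: "x \<in> xdom E" for x
  proof -
    have y: "d5 * x + (d5 * k + d6) \<in> xdom E'" using x X by blast
    have m': "cf E2 (d5 * x + (d5 * k + d6)) = d1 / d5 * d9 * cf E1 x"
      "ch E2 (d5 * x + (d5 * k + d6)) = d9 / d7 * ch E1 x"
    proof -
      have "cf E2 (d5 * K x + d6) = d1 / d5 * d9 * cf E1 x * exp (- 2 * d8 * H x)"
        "ch E2 (d5 * K x + d6) = d9 / d7 * ch E1 x * exp (- d8 * H x)"
        using m x dom by (simp_all add: maps_via_def)
      then show "cf E2 (d5 * x + (d5 * k + d6)) = d1 / d5 * d9 * cf E1 x"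
        "ch E2 (d5 * x + (d5 * k + d6)) = d9 / d7 * ch E1 x"
        unfolding k[OF x] d8 by simp_all
    qed
    show "cf E' (d5 * x + (d5 * k + d6)) = d1 / d5 * d9 * cf E x"
      using s(1,3) y x m'(1) dom by (simp add: same_equation_def)
    show "ch E' (d5 * x + (d5 * k + d6)) = d9 * ch E x"
      unfolding \<gamma>(3)[OF y] m'(2) \<beta>(3)[OF x] \<gamma>\<beta> using d by simp
  qed
  note deriv_affine[OF E X fh(2)]
  then show ?thesis using d X fh by blast
qed

section \<open>Separating properly listed items\<close>

lemma properD:
  assumes "properly_listed i E"
  shows "is_equation E" "in_item i E" "listed_equation i E"
    "listed_equation j E' ==> equivalent E E' ==> grade j \<le> grade i"
    "i \<noteq> Item9 ==> \<not> linearizable E"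
proof -
  show 1: "is_equation E" "in_item i E" "listed_equation i E"
    using assms by (simp_all add: properly_listed_def listed_equation_def)
  show 2: "listed_equation j E' ==> equivalent E E' ==> grade j \<le> grade i" for j E'
    using assms unfolding properly_listed_def by (meson not_le)
  show "\<not> linearizable E" if i: "i \<noteq> Item9"
  proof
    assume "linearizable E"
    then obtain E' where "listed_equation Item9 E'" "equivalent E E'" using linearizable_to_item9[OF 1(1)] by blast
    from 2[OF this] show False using i by (cases i) auto
  qed
qed

text \<open>Two independent characteristics would exclude the second alternative of
  \<open>covered\<close>, making \<open>E\<close> equivalent to an item of grade two.\<close>

lemma proper_grade1:
  assumes p: "properly_listed i E" and g: "grade i = 1" shows "\<not> two_char_solutions E"
proof
  assume two: "two_char_solutions E"
  have nl: "\<not> linearizable E" by (rule properD(5)[OF p]) (use g in auto)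
  obtain l m where l: "char_solution E l" and ind: "\<And>a b. (\<forall>t\<in>tdom E. \<forall>x\<in>xdom E. a * l t x + b * m t x = 0) ==> a = 0 \<and> b = 0"
    using two unfolding two_char_solutions_def by blast
  have "\<exists>t\<in>tdom E. \<exists>x\<in>xdom E. l t x \<noteq> 0"
  proof (rule ccontr)
    assume "\<not> ?thesis"
    then have "(1::real) = 0 \<and> (0::real) = 0" by (intro ind) simp
    then show False by simp
  qed
  then have "covered E" using classification[OF properD(1)[OF p] nl l] by blast
  then obtain j E' where "grade j = 2" "listed_equation j E'" "equivalent E E'"
    using two unfolding covered_def by blast
  then show False using properD(4)[OF p, of j E'] g by simp
qed

text \<open>\<open>B = 1\<close> together with constant \<open>A\<close> is linearizable, and such
  an equation is properly listed under \<open>Item9\<close> only.\<close>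

lemma proper_B1_nonconst:
  assumes p: "properly_listed i E" and i: "i \<noteq> Item9" and B: "\<And>u. u \<in> udom E ==> cB E u = 1"
  shows "\<nexists>a. \<forall>u\<in>udom E. cA E u = a"
proof
  assume A: "\<exists>a. \<forall>u\<in>udom E. cA E u = a"
  then obtain a where a: "\<And>u. u \<in> udom E ==> cA E u = a" by blast
  interpret eqn E by (rule eqnI[OF properD(1)[OF p]])
  obtain u0 where u0: "u0 \<in> udom E" using sec_point by blast
  have "degenerate E"
    unfolding degenerate_def using a B A_nz[OF u0] u0 by (intro exI[of _ "\<lambda>x. ch E x / a"]) simp
  then show False using properD(5)[OF p i] A unfolding linearizable_def constant_A_def by blast
qed

lemma item34_h:
  assumes E: "is_equation E" and it: "in_item i E" "i = Item3 \<or> i = Item4"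
  shows "\<exists>x\<in>xdom E. ch E x \<noteq> 0"
proof (rule ccontr)
  assume "\<not> ?thesis"
  then have z: "ch E x = 0" if "x \<in> xdom E" for x using that by blast
  interpret eqn E by (rule eqnI[OF E])
  obtain x where x: "x \<in> xdom E" "x \<noteq> 0" by (metis open_interval_two_points[OF domains(2)])
  have "deriv (ch E) x = 0"
    by (rule DERIV_unique_open[OF open_domains(2) x(1) z smooth_on_line_DERIV[OF smooth_coeffs(2) x(1)]]) auto
  then have "cf E x = 0" using it x z by auto
  then show False using f_nz[OF x(1)] by simp
qed

lemma quadratic_h:
  assumes "quadratic E a b c n" "(a, b, c) \<noteq> (0, 0, 0)" shows "\<exists>x\<in>xdom E. ch E x \<noteq> 0"
proof (rule ccontr)
  assume n: "\<not> ?thesis"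
  have eqE: "is_equation E" using assms(1) by (simp add: quadratic_def)
  interpret eqn E by (rule eqnI[OF eqE])
  have "xdom E \<subseteq> {x. a * x\<^sup>2 + b * x + c = 0}"
  proof
    fix x assume x: "x \<in> xdom E"
    then show "x \<in> {x. a * x\<^sup>2 + b * x + c = 0}" using n assms(1) f_nz[OF x] by (auto simp: quadratic_def)
  qed
  then have "finite (xdom E)" using finite_quadratic_roots[OF assms(2)] by (rule finite_subset)
  moreover have "infinite (xdom E)"
    using domains(2) open_domains(2) finite_imp_not_open unfolding open_interval_def by blast
  ultimately show False by simp
qed

lemma exp_char:
  assumes E: "is_equation E" and it: "in_item i E" "i = Item2 \<or> i = Item3 \<or> i = Item4"
  shows "\<exists>\<kappa>. char_solution E (\<lambda>t x. exp t * \<kappa> x) \<and> (\<exists>x\<in>xdom E. \<kappa> x \<noteq> 0)"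
proof -
  interpret eqn E by (rule eqnI[OF E])
  obtain IA IB where I: "antiderivative (udom E) (cA E) IA" "antiderivative (udom E) (cB E) IB"
    by (rule antiderivatives_u)
  obtain x where x: "x \<in> xdom E" "x \<noteq> 0" by (metis open_interval_two_points[OF domains(2)])
  have s: "char_solution E l" if "good_list (listed_cls i E IA IB) [l]" for l
  proof -
    have "length (listed_cls i E IA IB) = 1" using that by (simp add: good_list_def)
    then show ?thesis using good_list_solution[OF that, of 0] by simp
  qed
  have *: ?thesis if "good_list (listed_cls i E IA IB) [\<lambda>t x. exp t * \<kappa> x]" "\<kappa> x \<noteq> 0" for \<kappa>
    using s[OF that(1)] that(2) x(1) by blast
  consider "i = Item2" | "i = Item3" | "i = Item4" using it(2) by blast
  then show ?thesis
  proof cases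
    case 1
    then show ?thesis using it item2_vectors[OF _ I(2), of IA] x by (intro *[of "\<lambda>x. - inverse (ch E x)"]) auto
  next
    case 2
    then show ?thesis using it item3_vectors[OF _ I(1), of IB] x by (intro *[of "\<lambda>x. 1"]) auto
  next
    case 3
    then show ?thesis using it item4_vectors[OF _ I(1), of IB] x by (intro *[of "\<lambda>x. x"]) auto
  qed
qed

text \<open>The characteristic \<open>1\<close> is carried to one that does not vary with
  \<open>t\<close> at fixed \<open>x\<close>, while the other item has one with the time factor
  \<open>exp t\<close>. The two are independent.\<close>

lemma item1_vs_exp:
  assumes E: "is_equation E" "is_equation E'" and eq: "equivalent E E'"
    and it: "in_item Item1 E" "in_item j E'" "j = Item2 \<or> j = Item3 \<or> j = Item4"
  shows "two_char_solutions E'"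
proof -
  interpret eqn E by (rule eqnI[OF E(1)])
  interpret E': eqn E' by (rule eqnI[OF E(2)])
  obtain IA IB where I: "antiderivative (udom E) (cA E) IA" "antiderivative (udom E) (cB E) IB"
    by (rule antiderivatives_u)
  have "char_solution E (\<lambda>t x. 1)"
    using good_list_solution[OF item1_vectors[OF it(1) I], of 0] by simp
  moreover obtain d1 d2 \<phi> w where tr: "transfers d1 d2 \<phi> w E E'"
    using char_solution_equivalent[OF E eq] by blast
  ultimately obtain l' where l': "char_solution E' l'"
    "\<And>t x. t \<in> tdom E ==> x \<in> xdom E ==> l' (d1 * t + d2) (\<phi> x) = w x * 1"
    using transfersD(5)[OF tr] by blast
  note tr = transfersD(1-4)[OF tr]
  obtain \<kappa> y where k: "char_solution E' (\<lambda>t x. exp t * \<kappa> x)" "y \<in> xdom E'" "\<kappa> y \<noteq> 0"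
    using exp_char[OF E(2) it(2,3)] by blast
  obtain x where x: "x \<in> xdom E" "y = \<phi> x" using k(2) tr(4) by auto
  obtain t1 t2 where t1: "t1 \<in> tdom E" and t2: "t2 \<in> tdom E" "t1 \<noteq> t2"
    by (rule open_interval_two_points[OF domains(1)])
  have "a = 0 \<and> b = 0" if z: "\<forall>t\<in>tdom E'. \<forall>x\<in>xdom E'. a * l' t x + b * (exp t * \<kappa> x) = 0" for a b
  proof -
    have z': "a * w x + b * (exp (d1 * t + d2) * \<kappa> y) = 0" if t: "t \<in> tdom E" for t
    proof -
      have "d1 * t + d2 \<in> tdom E'" using tr(3) t by blast
      then have "a * l' (d1 * t + d2) y + b * (exp (d1 * t + d2) * \<kappa> y) = 0" using z k(2) by blast
      then show ?thesis using l'(2)[OF t x(1)] x(2) by simp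
    qed
    have "b * (exp (d1 * t1 + d2) * \<kappa> y) = b * (exp (d1 * t2 + d2) * \<kappa> y)"
      using z'[OF t1] z'[OF t2(1)] by linarith
    then have b: "b = 0" using k(3) t2(2) tr(1) by auto
    then show ?thesis using z'[OF t1] tr(2) by simp
  qed
  then show ?thesis unfolding two_char_solutions_def using l'(1) k(1) by blast
qed

text \<open>The equivalence is affine in \<open>x\<close>, so \<open>f = h_x\<close> becomes
  \<open>f = d1 h_x\<close>, and \<open>exp (t / d1)\<close> is a characteristic besides
  \<open>exp t * x\<close>; this exceeds grade one.\<close>

lemma item3_vs_item4:
  assumes p: "properly_listed Item3 E" "properly_listed Item4 E'" and eq: "equivalent E E'"
  shows False
proof -
  note E = properD(1)[OF p(1)] properD(1)[OF p(2)]
  have B: "cB E u = 1" if "u \<in> udom E" for u using properD(2)[OF p(1)] that by simp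
  have B': "cB E' u = 1" if "u \<in> udom E'" for u using properD(2)[OF p(2)] that by simp
  have A: "\<nexists>a. \<forall>u\<in>udom E. cA E u = a" by (rule proper_B1_nonconst[OF p(1) _ B]) simp
  have A': "\<nexists>a. \<forall>u\<in>udom E'. cA E' u = a" by (rule proper_B1_nonconst[OF p(2) _ B']) simp
  obtain x0 where h: "x0 \<in> xdom E" "ch E x0 \<noteq> 0" using item34_h[OF E(1) properD(2)[OF p(1)]] by blast
  obtain y0 where h': "y0 \<in> xdom E'" "ch E' y0 \<noteq> 0" using item34_h[OF E(2) properD(2)[OF p(2)]] by blast
  obtain d1 d5 d6 d9 where d: "d1 \<noteq> 0" "d5 \<noteq> 0" "d9 \<noteq> 0" and X: "xdom E' = (\<lambda>x. d5 * x + d6) ` xdom E"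
    and rel: "\<And>x. x \<in> xdom E ==> cf E' (d5 * x + d6) = d1 / d5 * d9 * cf E x"
      "\<And>x. x \<in> xdom E ==> deriv (ch E') (d5 * x + d6) * d5 = d9 * deriv (ch E) x"
    using B1_equivalent_affine[OF E eq B B' A h h'] by blast
  obtain u1 u2 y1 y2 where "eqn1 E' u1 u2 y1 y2" using eqn1I[OF E(2) B' A'] by blast
  then interpret E': eqn1 E' u1 u2 y1 y2 .
  have dh: "cf E' y * (1 / d1) = deriv (ch E') y" if "y \<in> xdom E'" for y
  proof -
    obtain x where x: "x \<in> xdom E" "y = d5 * x + d6" using \<open>y \<in> xdom E'\<close> X by auto
    have "cf E x = deriv (ch E) x" using properD(2)[OF p(1)] x(1) by simp
    moreover have "deriv (ch E') y = d9 * deriv (ch E) x / d5" using rel(2)[OF x(1)] x(2) d by (simp add: field_simps)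
    ultimately show ?thesis using rel(1)[OF x(1)] x(2) d by simp
  qed
  have "affine_char E' (\<lambda>t. 0) (\<lambda>t. exp (t / d1)) (\<lambda>t. 0) (\<lambda>t. exp (t / d1) * (1 / d1))"
    unfolding affine_char_def
  proof (intro ballI conjI)
    show "((\<lambda>t. exp (t / d1)) has_real_derivative exp (t / d1) * (1 / d1)) (at t)" for t
      using d by (auto intro!: derivative_eq_intros)
    fix t x assume "x \<in> xdom E'"
    from dh[OF this] have "exp (t / d1) * (cf E' x * (1 / d1)) = exp (t / d1) * deriv (ch E') x" by simp
    then show "cf E' x * (0 * x + exp (t / d1) * (1 / d1)) = deriv (ch E') x * (0 * x + exp (t / d1)) + ch E' x * 0"
      by (simp add: mult.commute mult.left_commute)
  qed simp
  then have l1: "char_solution E' (\<lambda>t x. 0 * x + exp (t / d1))"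
    by (rule E'.affine_char_solution) (auto intro!: continuous_intros simp: d)
  obtain IA IB where I: "antiderivative (udom E') (cA E') IA" "antiderivative (udom E') (cB E') IB"
    by (rule E'.antiderivatives_u)
  have l2: "char_solution E' (\<lambda>t x. exp t * x + 0)"
    using E'.good_list_solution[OF E'.item4_vectors[OF properD(2)[OF p(2)] I(1), of IB], of 0] by simp
  obtain t where t: "t \<in> tdom E'" using E'.sec_point by blast
  have "a = 0 \<and> b = 0" if "\<forall>t\<in>tdom E'. \<forall>x\<in>xdom E'. a * (0 * x + exp (t / d1)) + b * (exp t * x + 0) = 0" for a b
    by (rule E'.affine_independent[OF t, of "\<lambda>t. 0" "\<lambda>t. 0" exp "\<lambda>t. exp (t / d1)"]) (use that in auto)
  then have "two_char_solutions E'" unfolding two_char_solutions_def using l1 l2 by blast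
  then show False using proper_grade1[OF p(2)] by simp
qed

text \<open>Constancy of \<open>A\<close> is invariant, whereas proper listing forbids it for
  \<open>B = 1\<close>.\<close>

lemma item2_vs_B1:
  assumes p: "properly_listed Item2 E" "properly_listed j E'" and j: "j = Item3 \<or> j = Item4" and eq: "equivalent E E'"
  shows False
proof -
  have "constant_A E" using properD(2)[OF p(1)] by (auto simp: constant_A_def)
  then have "\<exists>a. \<forall>u\<in>udom E'. cA E' u = a"
    unfolding constant_A_def[symmetric] by (rule constant_A_equivalent[OF eq])
  moreover have "cB E' u = 1" if "u \<in> udom E'" for u using properD(2)[OF p(2)] j that by auto
  then have "\<nexists>a. \<forall>u\<in>udom E'. cA E' u = a" using j by (intro proper_B1_nonconst[OF p(2)]) auto
  ultimately show False by blast
qed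

text \<open>\<open>h B = 0\<close> is degenerate, and degeneracy with \<open>B = 1\<close> at a
  point where \<open>h \<noteq> 0\<close> would make \<open>A\<close> constant.\<close>

lemma item5a_vs_quadratic:
  assumes p: "properly_listed Item5a E" "properly_listed j E'" and j: "quadratic_item j" and eq: "equivalent E E'"
  shows False
proof -
  have Q: "quadratic E' (qa j) (qb j) (qc j) (qn j)" by (rule listed_quadratic[OF j properD(3)[OF p(2)]])
  obtain x where x: "x \<in> xdom E'" "ch E' x \<noteq> 0" using quadratic_h[OF Q q_nonzero[OF j]] by blast
  have "degenerate E" unfolding degenerate_def using properD(2)[OF p(1)] by (intro exI[of _ "\<lambda>x. 0"]) simp
  then have "degenerate E'" by (rule degenerate_equivalent[OF eq])
  then obtain k where k: "\<And>u. u \<in> udom E' ==> ch E' x = k * cA E' u"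
    using Q x(1) unfolding degenerate_def quadratic_def by force
  interpret eqn E' by (rule eqnI[OF properD(1)[OF p(2)]])
  obtain u0 where u0: "u0 \<in> udom E'" using sec_point by blast
  have "k \<noteq> 0" using k[OF u0] x(2) by auto
  then have "\<forall>u\<in>udom E'. cA E' u = ch E' x / k" using k by (simp add: field_simps)
  moreover have "\<nexists>a. \<forall>u\<in>udom E'. cA E' u = a"
    using Q j by (intro proper_B1_nonconst[OF p(2)]) (auto simp: quadratic_def quadratic_item_def)
  ultimately show False by blast
qed

lemma quadratic_poly_zero:
  assumes "infinite S" "\<And>x. x \<in> S ==> a * x\<^sup>2 + b * x + c = (0::real)"
  shows "a = 0 \<and> b = 0 \<and> c = 0"
proof (rule ccontr)
  assume "\<not> ?thesis"
  then have "(a, b, c) \<noteq> (0, 0, 0)" by auto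
  then have "finite S" using finite_subset[OF _ finite_quadratic_roots] assms(2) by blast
  then show False using assms(1) by simp
qed

text \<open>The coefficients are compared under an affine change. If \<open>a = a' = 1\<close>, one
  finds \<open>d1 d5 = 1\<close>, \<open>d6 = 0\<close> and \<open>d5 c = d1 c'\<close>. For
  \<open>c\<close> and \<open>c'\<close> of opposite sign this would mean \<open>d1^2 = -1\<close>;
  for the same nonzero sign \<open>d1\<close> is \<open>1\<close> or \<open>-1\<close>, and the
  latter exchanges \<open>m\<close> and \<open>- m\<close>.\<close>

lemma quadratic_vs_quadratic:
  assumes p: "properly_listed i E" "properly_listed j E'" and i: "quadratic_item i" and j: "quadratic_item j"
    and eq: "equivalent E E'"
  shows "same_entry i j"
proof -
  note E = properD(1)[OF p(1)] properD(1)[OF p(2)]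
  have Q: "quadratic E (qa i) (qb i) (qc i) (qn i)" by (rule listed_quadratic[OF i properD(3)[OF p(1)]])
  have Q': "quadratic E' (qa j) (qb j) (qc j) (qn j)" by (rule listed_quadratic[OF j properD(3)[OF p(2)]])
  obtain x0 where h: "x0 \<in> xdom E" "ch E x0 \<noteq> 0" using quadratic_h[OF Q q_nonzero[OF i]] by blast
  obtain y0 where h': "y0 \<in> xdom E'" "ch E' y0 \<noteq> 0" using quadratic_h[OF Q' q_nonzero[OF j]] by blast
  have B: "cB E u = 1" if "u \<in> udom E" for u using Q that by (simp add: quadratic_def)
  have B': "cB E' u = 1" if "u \<in> udom E'" for u using Q' that by (simp add: quadratic_def)
  have A: "\<nexists>a. \<forall>u\<in>udom E. cA E u = a" using i by (intro proper_B1_nonconst[OF p(1) _ B]) (auto simp: quadratic_item_def)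
  obtain d1 d5 d6 d9 where d: "d1 \<noteq> 0" "d5 \<noteq> 0" "d9 \<noteq> 0" and X: "xdom E' = (\<lambda>x. d5 * x + d6) ` xdom E"
    and rel: "\<And>x. x \<in> xdom E ==> cf E' (d5 * x + d6) = d1 / d5 * d9 * cf E x"
      "\<And>x. x \<in> xdom E ==> ch E' (d5 * x + d6) = d9 * ch E x"
      "\<And>x. x \<in> xdom E ==> deriv (ch E') (d5 * x + d6) * d5 = d9 * deriv (ch E) x"
    using B1_equivalent_affine[OF E eq B B' A h h'] by blast
  interpret eqn E by (rule eqnI[OF E(1)])
  have inf: "infinite (xdom E)"
    using domains(2) open_domains(2) finite_imp_not_open unfolding open_interval_def by blast
  let ?a = "qa i" and ?b = "qb i" and ?c = "qc i" and ?n = "qn i"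
  let ?a' = "qa j" and ?b' = "qb j" and ?c' = "qc j" and ?n' = "qn j"
  have q: "d1 * (?a' * (d5 * x + d6)\<^sup>2 + ?b' * (d5 * x + d6) + ?c') = d5 * (?a * x\<^sup>2 + ?b * x + ?c) \<and>
      d1 * (?n' - ?a' * (d5 * x + d6)) = ?n - ?a * x" if x: "x \<in> xdom E" for x
  proof -
    have y: "d5 * x + d6 \<in> xdom E'" using x X by blast
    have e1: "ch E' (d5 * x + d6) = cf E' (d5 * x + d6) * (?a' * (d5 * x + d6)\<^sup>2 + ?b' * (d5 * x + d6) + ?c')"
      "deriv (ch E') (d5 * x + d6) = cf E' (d5 * x + d6) * (?n' - ?a' * (d5 * x + d6))"
      using Q' y by (simp_all add: quadratic_def)
    have e2: "ch E x = cf E x * (?a * x\<^sup>2 + ?b * x + ?c)" "deriv (ch E) x = cf E x * (?n - ?a * x)"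
      using Q x by (simp_all add: quadratic_def)
    have g: "d1 / d5 * d9 * F * q' = d9 * (F * q0) ==> F \<noteq> 0 ==> d1 * q' = d5 * q0" for F q0 q'
      using d by (simp add: field_simps)
    have g': "d1 / d5 * d9 * F * q' * d5 = d9 * (F * q0) ==> F \<noteq> 0 ==> d1 * q' = q0" for F q0 q'
      using d by (simp add: field_simps)
    show ?thesis
      using g[OF rel(2)[OF x, unfolded e1 e2 rel(1)[OF x]] f_nz[OF x]]
        g'[OF rel(3)[OF x, unfolded e1 e2 rel(1)[OF x]] f_nz[OF x]] by blast
  qed
  have P: "d1 * ?a' * d5\<^sup>2 - d5 * ?a = 0 \<and> d1 * (2 * ?a' * d5 * d6 + ?b' * d5) - d5 * ?b = 0 \<and>
      d1 * (?a' * d6\<^sup>2 + ?b' * d6 + ?c') - d5 * ?c = 0"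
    by (rule quadratic_poly_zero[OF inf]) (use q in \<open>simp add: algebra_simps power2_eq_square\<close>)
  have N: "0 = (0::real) \<and> ?a - d1 * ?a' * d5 = 0 \<and> d1 * (?n' - ?a' * d6) - ?n = 0"
    by (rule quadratic_poly_zero[OF inf]) (use q in \<open>simp add: algebra_simps power2_eq_square\<close>)
  have e: "?a = ?a' * (d1 * d5)" "?b = d1 * (2 * ?a' * d6 + ?b')" "d5 * ?c = d1 * (?a' * d6\<^sup>2 + ?b' * d6 + ?c')"
    "?n = d1 * (?n' - ?a' * d6)"
  proof -
    have "d5 * ?b = d5 * (d1 * (2 * ?a' * d6 + ?b'))" using P by (simp add: algebra_simps)
    then show "?b = d1 * (2 * ?a' * d6 + ?b')" using d by simp
  qed (use P N in \<open>simp_all add: algebra_simps\<close>)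
  have it6: "i = Item6 m ==> m \<in> {0, 1}" "j = Item6 m ==> m \<in> {0, 1}" for m
    using properD(2)[OF p(1)] properD(2)[OF p(2)] by auto
  have sq: "d1 = d5 \<or> d1 = - d5" if "d1 * d5 = 1" "d5 * d5 = 1"
  proof -
    have "d1 = d5" using that d by (metis mult_right_cancel)
    then show ?thesis by simp
  qed
  have pm: "d1 = 1 \<or> d1 = -1" if "d1 * d5 = 1" "d5 = d1 \<or> - d5 = - d1"
    using that square_eq_1_iff[of d1] by auto
  have neg: False if "d1 * d5 = 1" "d5 = - d1 \<or> - d5 = d1"
  proof -
    have "d1 * d1 = -1" using that by (auto simp: minus_equation_iff)
    then show False using zero_le_square[of d1] by simp
  qed
  show ?thesis
    using i j
  proof (cases rule: quadratic_item_cases[case_product quadratic_item_cases])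
    case (i6_i6 m m')
    then show ?thesis using e d it6 by (auto simp: same_entry_def)
  next
    case (i7_i7 m m')
    then have "d1 * d5 = 1" "d6 = 0" "d5 = d1" "m = d1 * m'" using e d by auto
    then show ?thesis using i7_i7 pm by (auto simp: same_entry_def)
  next
    case (i8_i8 m m')
    then have "d1 * d5 = 1" "d6 = 0" "d5 = d1" "m = d1 * m'" using e d by auto
    then show ?thesis using i8_i8 pm by (auto simp: same_entry_def)
  next
    case (i7_i8 m m')
    then have "d1 * d5 = 1" "d6 = 0" "- d5 = d1" using e d by auto
    then show ?thesis using neg by blast
  next
    case (i8_i7 m m')
    then have "d1 * d5 = 1" "d6 = 0" "d5 = - d1" using e d by auto
    then show ?thesis using neg by blast
  qed (use e d in \<open>auto simp: same_entry_def\<close>)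
qed

lemma item_grade_cases:
  obtains "i = Item9" | "i = Item1" | "i = Item2" | "i = Item3" | "i = Item4" | "i = Item5a" | "quadratic_item i"
  by (cases i) (auto simp: quadratic_item_def)

text \<open>Equivalence is symmetric, so proper listing on both sides makes the grades equal, and
  only items of the same grade have to be separated.\<close>

lemma proper_distinct:
  assumes p: "properly_listed i E" "properly_listed j E'" and eq: "equivalent E E'"
  shows "same_entry i j"
proof -
  note eq' = equivalent_sym[OF eq]
  note E = properD(1)[OF p(1)] properD(1)[OF p(2)]
  note it = properD(2)[OF p(1)] properD(2)[OF p(2)]
  have g: "grade i = grade j"
    using properD(4)[OF p(1) properD(3)[OF p(2)] eq] properD(4)[OF p(2) properD(3)[OF p(1)] eq'] by simp
  have gq: "quadratic_item k ==> grade k = 2" for k by (simp add: quadratic_item_def)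
  have refl: "same_entry k k" for k by (simp add: same_entry_def)
  have n1: False if "i = Item1" "j = Item2 \<or> j = Item3 \<or> j = Item4"
    using item1_vs_exp[OF E eq _ it(2) that(2)] it(1) proper_grade1[OF p(2)] that by auto
  have n1': False if "j = Item1" "i = Item2 \<or> i = Item3 \<or> i = Item4"
    using item1_vs_exp[OF E(2,1) eq' _ it(1) that(2)] it(2) proper_grade1[OF p(1)] that by auto
  show ?thesis
  proof (cases i rule: item_grade_cases)
    case 1 then show ?thesis using g by (cases j rule: item_grade_cases) (auto simp: refl dest: gq)
  next
    case 2 then show ?thesis using g n1 by (cases j rule: item_grade_cases) (auto simp: refl dest: gq)
  next
    case 3 then show ?thesis using g n1' item2_vs_B1[OF _ p(2) _ eq] p(1)
      by (cases j rule: item_grade_cases) (auto simp: refl dest: gq)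
  next
    case 4 then show ?thesis using g n1' item2_vs_B1[OF _ p(1) _ eq'] item3_vs_item4[OF _ _ eq] p
      by (cases j rule: item_grade_cases) (auto simp: refl dest: gq)
  next
    case 5 then show ?thesis using g n1' item2_vs_B1[OF _ p(1) _ eq'] item3_vs_item4[OF _ _ eq'] p
      by (cases j rule: item_grade_cases) (auto simp: refl dest: gq)
  next
    case 6 then show ?thesis using g item5a_vs_quadratic[OF _ p(2) _ eq] p(1)
      by (cases j rule: item_grade_cases) (auto simp: refl dest: gq)
  next
    case 7 then show ?thesis using g gq item5a_vs_quadratic[OF _ p(1) _ eq'] p quadratic_vs_quadratic[OF p _ _ eq]
      by (cases j rule: item_grade_cases) (auto simp: refl)
  qed
qed

section \<open>The classification\<close>

text \<open>The listed equation found by \<open>classification\<close> already has the largest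
  possible grade: grade three is ruled out by the invariance of \<open>linearizable\<close>, and
  grade two in the second alternative of \<open>covered\<close> by the invariance of
  \<open>two_char_solutions\<close>.\<close>

lemma nontrivial_equivalent_proper:
  assumes E: "is_equation E" and n: "has_nontrivial_cl E"
  shows "\<exists>i E'. properly_listed i E' \<and> equivalent E E'"
proof (cases "linearizable E")
  case True
  then obtain E' where E': "listed_equation Item9 E'" "equivalent E E'" using linearizable_to_item9[OF E] by blast
  have "grade j \<le> 3" for j by (cases j) auto
  then have "properly_listed Item9 E'" using E'(1) unfolding properly_listed_def by (auto simp: not_less)
  then show ?thesis using E'(2) by blast
next
  case False
  interpret eqn E by (rule eqnI[OF E])
  obtain l where l: "char_solution E l" "\<exists>t\<in>tdom E. \<exists>x\<in>xdom E. l t x \<noteq> 0"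
    using nontrivial_imp_char_solution[OF n] by blast
  have cov: "covered E" using classification[OF E False l(1)] l(2) by blast
  have no9: "j \<noteq> Item9" if "listed_equation j E''" "equivalent E' E''" "equivalent E E'" for j E' E''
  proof
    assume "j = Item9"
    then have "linearizable E''" using that(1) by (auto simp: listed_equation_def linearizable_def constant_A_def degenerate_def)
    then have "linearizable E'" by (rule linearizable_equivalent[OF equivalent_sym[OF that(2)]])
    then have "linearizable E" by (rule linearizable_equivalent[OF equivalent_sym[OF that(3)]])
    then show False using False by simp
  qed
  have g3: "grade j = 3 ==> j = Item9" "grade j \<le> 3" for j by (cases j; simp)+
  from cov consider i E' where "grade i = 2" "listed_equation i E'" "equivalent E E'"
    | i E' where "\<not> two_char_solutions E" "grade i = 1" "listed_equation i E'" "equivalent E E'"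
    unfolding covered_def by blast
  then show ?thesis
  proof cases
    case 1
    have "grade j \<le> grade i" if "listed_equation j E''" "equivalent E' E''" for j E''
      using no9[OF that 1(3)] g3[of j] 1(1) by linarith
    then have "properly_listed i E'" unfolding properly_listed_def using 1(2) by (meson not_le)
    then show ?thesis using 1(3) by blast
  next
    case 2
    have "grade j \<le> grade i" if j: "listed_equation j E''" "equivalent E' E''" for j E''
    proof -
      have eqs: "is_equation E'" "is_equation E''" using j(1) 2(3) by (simp_all add: listed_equation_def)
      have "grade j \<noteq> 2"
      proof
        assume g: "grade j = 2"
        interpret E'': eqn E'' by (rule eqnI[OF eqs(2)])
        have "two_char_solutions E''" using E''.listed_two[OF _ g] j(1) by (simp add: listed_equation_def)
        then have "two_char_solutions E'" by (rule two_char_solutions_equivalent[OF eqs(2,1) equivalent_sym[OF j(2)]])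
        then have "two_char_solutions E" by (rule two_char_solutions_equivalent[OF eqs(1) E equivalent_sym[OF 2(4)]])
        then show False using 2(1) by simp
      qed
      then show ?thesis using no9[OF j 2(4)] g3[of j] 2(2) by linarith
    qed
    then have "properly_listed i E'" unfolding properly_listed_def using 2(3) by (meson not_le)
    then show ?thesis using 2(4) by blast
  qed
qed

text \<open>Proper listing bounds the space of characteristics from above: it excludes a second
  characteristic in grade one and a constant \<open>A\<close> in grade two.\<close>

lemma proper_basis:
  assumes p: "properly_listed i E" and i: "i \<noteq> Item9"
    and I: "antiderivative (udom E) (cA E) IA" "antiderivative (udom E) (cB E) IB"
  shows "cl_basis E (map fst (listed_cls i E IA IB))"
proof -
  note E = properD(1)[OF p]
  note it = properD(2)[OF p]
  interpret eqn E by (rule eqnI[OF E])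
  obtain ls where ls: "good_list (listed_cls i E IA IB) ls" using listed_vectors[OF it i I] by blast
  consider "grade i = 1" | "i = Item5a" | "quadratic_item i" using i by (cases i) (auto simp: quadratic_item_def)
  then show ?thesis
  proof cases
    case 1
    then show ?thesis using basis_one[OF ls _ proper_grade1[OF p 1]] length_listed_cls[OF i] by simp
  next
    case 2
    have B: "cB E u = 0" if "u \<in> udom E" for u using it that 2 by simp
    have A: "\<nexists>a. \<forall>u\<in>udom E. cA E u = a" using properD(5)[OF p i] B
      unfolding linearizable_def constant_A_def degenerate_def by auto
    show ?thesis unfolding 2
    proof (rule basis_two[OF item5a_vectors[OF it[unfolded 2] I(1)]])
      fix l assume "char_solution E l"
      from span_item5a[OF B A this]
      show "\<exists>a b. \<forall>t\<in>tdom E. \<forall>x\<in>xdom E. l t x = a * ([\<lambda>t x. 1, \<lambda>t x. x] ! 0) t x + b * ([\<lambda>t x. 1, \<lambda>t x. x] ! 1) t x"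
        by simp
    qed simp
  next
    case 3
    have n: "length (listed_cls i E IA IB) = 2" using length_listed_cls[OF i] 3 by (simp add: quadratic_item_def)
    have B: "cB E u = 1" if "u \<in> udom E" for u
      using listed_quadratic[OF 3 properD(3)[OF p]] that by (simp add: quadratic_def)
    obtain u1 u2 x0 x1 where "eqn1 E u1 u2 x0 x1" using eqn1I[OF E B proper_B1_nonconst[OF p i B]] by blast
    then interpret eqn1 E u1 u2 x0 x1 .
    show ?thesis
      by (rule basis_two[OF ls n], rule char_span[OF good_list_solution[OF ls] good_list_solution[OF ls] _
            good_list_independent2[OF ls n]]) (simp_all add: n)
  qed
qed

theorem theorem3:
  shows
    "(\<forall>E. is_equation E \<and> has_nontrivial_cl E \<longrightarrow>
        (\<exists>i E'. properly_listed i E' \<and> equivalent E E')) \<and>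
     (\<forall>i E. listed_equation i E \<longrightarrow> has_nontrivial_cl E) \<and>
     (\<forall>i j E E'. properly_listed i E \<and> properly_listed j E' \<and> equivalent E E' \<longrightarrow>
        same_entry i j) \<and>
     (\<forall>i E IA IB. i \<noteq> Item9 \<and> listed_equation i E \<and>
        antiderivative (udom E) (cA E) IA \<and> antiderivative (udom E) (cB E) IB \<longrightarrow>
        (\<forall>(V, l)\<in>set (listed_cls i E IA IB). characteristic E V l) \<and>
        cl_independent E (map fst (listed_cls i E IA IB)) \<and>
        (properly_listed i E \<longrightarrow> cl_basis E (map fst (listed_cls i E IA IB)))) \<and>
     (\<forall>E. listed_equation Item9 E \<longrightarrow>
        (\<forall>a. adjoint_solution E a \<longrightarrow>
           characteristic E (fst (linear_cl E a)) (snd (linear_cl E a)) \<and>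
           (trivial_vector E (fst (linear_cl E a)) \<longrightarrow>
              (\<forall>t\<in>tdom E. \<forall>x\<in>xdom E. a t x = 0))) \<and>
        (\<forall>V. conserved_vector E V \<longrightarrow>
           (\<exists>a. adjoint_solution E a \<and>
              trivial_vector E (vec_diff V (fst (linear_cl E a))))))"
proof (intro conjI allI impI)
  show "\<exists>i E'. properly_listed i E' \<and> equivalent E E'" if "is_equation E \<and> has_nontrivial_cl E" for E
    using that nontrivial_equivalent_proper by blast
  show "has_nontrivial_cl E" if "listed_equation i E" for i E
  proof -
    interpret eqn E using that by (intro eqnI) (simp add: listed_equation_def)
    show ?thesis using that listed_nontrivial by (auto simp: listed_equation_def)
  qed
  show "same_entry i j" if "properly_listed i E \<and> properly_listed j E' \<and> equivalent E E'" for i j E E'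
    using that proper_distinct by blast
next
  fix i E IA IB
  assume a: "i \<noteq> Item9 \<and> listed_equation i E \<and>
    antiderivative (udom E) (cA E) IA \<and> antiderivative (udom E) (cB E) IB"
  interpret eqn E using a by (intro eqnI) (simp add: listed_equation_def)
  obtain ls where ls: "good_list (listed_cls i E IA IB) ls"
    using a listed_vectors[of i IA IB] by (auto simp: listed_equation_def)
  have "characteristic E (fst z) (snd z)" if z: "z \<in> set (listed_cls i E IA IB)" for z
  proof -
    obtain k where "k < length (listed_cls i E IA IB)" "z = listed_cls i E IA IB ! k"
      using z by (auto simp: in_set_conv_nth)
    then show ?thesis using ls by (simp add: good_list_def)
  qed
  then show "\<forall>(V, l)\<in>set (listed_cls i E IA IB). characteristic E V l" by auto
  show "cl_independent E (map fst (listed_cls i E IA IB))" by (rule good_list_independent[OF ls])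
  show "cl_basis E (map fst (listed_cls i E IA IB))" if "properly_listed i E"
    using proper_basis[OF that] a by blast
next
  fix E a assume E: "listed_equation Item9 E" and a: "adjoint_solution E a"
  interpret eqn E using E by (intro eqnI) (simp add: listed_equation_def)
  have it: "in_item Item9 E" using E by (simp add: listed_equation_def)
  show "characteristic E (fst (linear_cl E a)) (snd (linear_cl E a))" using linear_vector[OF it a] by blast
  show "\<forall>t\<in>tdom E. \<forall>x\<in>xdom E. a t x = 0" if "trivial_vector E (fst (linear_cl E a))"
    using linear_independent[OF it a that] by blast
next
  fix E V assume E: "listed_equation Item9 E" and V: "conserved_vector E V"
  interpret eqn E using E by (intro eqnI) (simp add: listed_equation_def)
  show "\<exists>a. adjoint_solution E a \<and> trivial_vector E (vec_diff V (fst (linear_cl E a)))"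
    using linear_span[OF _ V] E by (simp add: listed_equation_def)
qed

end
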